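(* The parameterized problem pw-3Coloring$^{\log n}$ is complete for the class $\mathrm{paraNTiSp}[f\cdot\mathrm{poly}\text{ time},\ f\cdot\log\text{ space}]$ under pl-reductions.
   Context: pw-3Coloring$^{\log n}$: the input is a graph $G$ together with a path decomposition of $G$ (a sequence of vertex subsets, called bags, such that every vertex and every edge is contained in some bag and the bags containing any fixed vertex form a contiguous interval) of width (maximum bag size minus one) at most $k\cdot \lg n$, where $n$ is the input size; the parameter is $k$; the question is whether $G$ is properly 3-colorable. $\mathrm{paraNTiSp}[f\cdot\mathrm{poly},f\cdot\log]$ is the class of parameterized problems decidable by a nondeterministic Turing machine in time $f(k)\cdot\mathrm{poly}(n)$ and space $f(k)\cdot\log n$ for some computable function $f$, where $k$ is the parameter and $n$ the input size. A pl-reduction from one parameterized problem to another is an algorithm that maps an instance with parameter $k$ to an equivalent instance with parameter $k'\le f(k)$, using space $f(k)+O(\log n)$, for some computable $f$. Completeness: the problem is in the class and every problem of the class pl-reduces to it. *)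

theory Defs
  imports "HOL-Computational_Algebra.Polynomial" "Graph_Theory.Pair_Digraph"
begin

section \<open>Turing machines\<close>

text \<open>
  Machines have a two-way read-only input tape over the binary alphabet, any fixed number of
  one-way infinite work tapes, and a write-only output tape, which deciders ignore.
  Work-tape symbols and states are natural numbers; since a machine has finitely many
  instructions, only finitely many of either occur. The blank is 0.
\<close>

datatype direction = Left | Stay | Right

text \<open>The input word is delimited by two end markers.\<close>

datatype insym = Start_Mark | Bit bool | End_Mark

record instr =
  src :: nat
  in_read :: insym
  wk_read :: "nat list"
  dst :: nat
  in_dir :: direction
  wk_act :: "(nat \<times> direction) list"
  emit :: "bool list"

record tm =
  n_tapes :: nat
  instrs :: "instr set"
  start :: nat
  accepting :: "nat set"

definition well_formed :: "tm \<Rightarrow> bool" where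
  "well_formed M \<longleftrightarrow> finite (instrs M) \<and>
     (\<forall>i\<in>instrs M. length (wk_read i) = n_tapes M \<and> length (wk_act i) = n_tapes M)"

definition deterministic :: "tm \<Rightarrow> bool" where
  "deterministic M \<longleftrightarrow> (\<forall>i\<in>instrs M. \<forall>j\<in>instrs M.
     src i = src j \<and> in_read i = in_read j \<and> wk_read i = wk_read j \<longrightarrow> i = j)"

type_synonym work_tape = "(nat \<Rightarrow> nat) \<times> nat"  \<comment> \<open>contents and head position\<close>

record config =
  state :: nat
  in_pos :: nat
  work :: "work_tape list"
  out_word :: "bool list"

definition init :: "tm \<Rightarrow> config" where
  "init M = \<lparr>state = start M, in_pos = 0, work = replicate (n_tapes M) (\<lambda>_. 0, 0), out_word = []\<rparr>"

definition scan_input :: "bool list \<Rightarrow> nat \<Rightarrow> insym" where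
  "scan_input w p =
     (if p = 0 then Start_Mark else if p \<le> length w then Bit (w ! (p - 1)) else End_Mark)"

text \<open>A head that is told to move left at position 0 stays there.\<close>

fun move :: "direction \<Rightarrow> nat \<Rightarrow> nat" where
  "move Left p = p - 1"
| "move Stay p = p"
| "move Right p = p + 1"

fun act :: "nat \<times> direction \<Rightarrow> work_tape \<Rightarrow> work_tape" where
  "act (a, d) (t, h) = (t(h := a), move d h)"

definition applicable :: "tm \<Rightarrow> bool list \<Rightarrow> config \<Rightarrow> instr \<Rightarrow> bool" where
  "applicable M w c i \<longleftrightarrow> i \<in> instrs M \<and> src i = state c \<and>
     in_read i = scan_input w (in_pos c) \<and> wk_read i = map (\<lambda>(t, h). t h) (work c)"

text \<open>The input head never leaves the two end markers, at positions 0 and \<open>length w + 1\<close>.\<close>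

definition execute :: "bool list \<Rightarrow> instr \<Rightarrow> config \<Rightarrow> config" where
  "execute w i c =
     \<lparr>state = dst i,
      in_pos = min (move (in_dir i) (in_pos c)) (length w + 1),
      work = map2 act (wk_act i) (work c),
      out_word = out_word c @ emit i\<rparr>"

definition step :: "tm \<Rightarrow> bool list \<Rightarrow> config \<Rightarrow> config \<Rightarrow> bool" where
  "step M w c c' \<longleftrightarrow> (\<exists>i. applicable M w c i \<and> c' = execute w i c)"

definition halted :: "tm \<Rightarrow> bool list \<Rightarrow> config \<Rightarrow> bool" where
  "halted M w c \<longleftrightarrow> (\<nexists>c'. step M w c c')"

definition reachable :: "tm \<Rightarrow> bool list \<Rightarrow> config \<Rightarrow> bool" where
  "reachable M w c \<longleftrightarrow> (step M w)\<^sup>*\<^sup>* (init M) c"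

definition accepts :: "tm \<Rightarrow> bool list \<Rightarrow> bool" where
  "accepts M w \<longleftrightarrow> (\<exists>c. reachable M w c \<and> halted M w c \<and> state c \<in> accepting M)"

text \<open>
  Resource bounds refer to all computation paths. In particular a machine with a time bound
  halts on every path.
\<close>

definition runs_in_time :: "tm \<Rightarrow> bool list \<Rightarrow> real \<Rightarrow> bool" where
  "runs_in_time M w b \<longleftrightarrow> (\<forall>m c. (step M w ^^ m) (init M) c \<longrightarrow> real m \<le> b)"

text \<open>Only work-tape cells are counted; head position \<open>h\<close> means that \<open>h + 1\<close> cells are in use.\<close>

definition runs_in_space :: "tm \<Rightarrow> bool list \<Rightarrow> real \<Rightarrow> bool" where
  "runs_in_space M w b \<longleftrightarrow>
     (\<forall>c. reachable M w c \<longrightarrow> (\<forall>(t, h)\<in>set (work c). real (h + 1) \<le> b))"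

definition outputs :: "tm \<Rightarrow> bool list \<Rightarrow> bool list \<Rightarrow> bool" where
  "outputs M w v \<longleftrightarrow> (\<exists>c. reachable M w c \<and> halted M w c \<and> out_word c = v)"

definition computable :: "(nat \<Rightarrow> nat) \<Rightarrow> bool" where
  "computable f \<longleftrightarrow> (\<exists>M. well_formed M \<and> deterministic M \<and>
     (\<forall>k. outputs M (replicate k True) (replicate (f k) True)))"


section \<open>Parameterized problems\<close>

text \<open>An instance is a pair of a binary word, whose length is the input size, and a parameter.\<close>

type_synonym instance_pair = "bool list \<times> nat"
type_synonym problem = "instance_pair set"

text \<open>
  A machine receives \<open>(x, k)\<close> as the word \<open>1\<^sup>k 0 x\<close>. Writing \<open>k\<close> in unary is harmless because
  all resource bounds allow an arbitrary computable dependence on \<open>k\<close>.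
\<close>

fun tape_word :: "instance_pair \<Rightarrow> bool list" where
  "tape_word (x, k) = replicate k True @ False # x"

text \<open>The shift by 2 keeps the space bounds positive for words of length 0 and 1.\<close>

definition lg_size :: "bool list \<Rightarrow> real" where
  "lg_size x = log 2 (real (length x + 2))"

definition paraNTiSp_fpoly_flog :: "problem set" where
  "paraNTiSp_fpoly_flog = {Q. \<exists>M f (p :: nat poly).
     well_formed M \<and> computable f \<and>
     (\<forall>x k. ((x, k) \<in> Q \<longleftrightarrow> accepts M (tape_word (x, k))) \<and>
        runs_in_time M (tape_word (x, k)) (real (f k * poly p (length x))) \<and>
        runs_in_space M (tape_word (x, k)) (real (f k) * lg_size x))}"

definition pl_reduces :: "problem \<Rightarrow> problem \<Rightarrow> bool" where
  "pl_reduces A B \<longleftrightarrow> (\<exists>M f (c :: nat) (g :: instance_pair \<Rightarrow> instance_pair).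
     well_formed M \<and> deterministic M \<and> computable f \<and>
     (\<forall>x k. outputs M (tape_word (x, k)) (tape_word (g (x, k))) \<and>
        ((x, k) \<in> A \<longleftrightarrow> g (x, k) \<in> B) \<and>
        snd (g (x, k)) \<le> f k \<and>
        runs_in_space M (tape_word (x, k)) (real (f k) + real c * lg_size x)))"

definition complete_under_pl_reductions :: "problem \<Rightarrow> problem set \<Rightarrow> bool" where
  "complete_under_pl_reductions Q C \<longleftrightarrow> Q \<in> C \<and> (\<forall>A\<in>C. pl_reduces A Q)"


section \<open>Path decompositions and 3-colorability\<close>

text \<open>
  Finite simple graphs are rendered by the locale \<open>pair_graph\<close>: finite loop-free digraphs
  with a symmetric arc relation, an edge being a pair of opposite arcs.
\<close>

definition path_decomposition :: "'a pair_pre_digraph \<Rightarrow> 'a set list \<Rightarrow> bool" where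
  "path_decomposition G P \<longleftrightarrow> P \<noteq> [] \<and>
     (\<forall>B\<in>set P. B \<subseteq> pverts G) \<and>
     (\<forall>v\<in>pverts G. \<exists>B\<in>set P. v \<in> B) \<and>
     (\<forall>(u, v)\<in>parcs G. \<exists>B\<in>set P. u \<in> B \<and> v \<in> B) \<and>
     (\<forall>i j l v. i \<le> j \<and> j \<le> l \<and> l < length P \<and> v \<in> P ! i \<and> v \<in> P ! l \<longrightarrow> v \<in> P ! j)"

definition pd_width :: "'a set list \<Rightarrow> int" where
  "pd_width P = int (Max (card ` set P)) - 1"

definition three_colorable :: "'a pair_pre_digraph \<Rightarrow> bool" where
  "three_colorable G \<longleftrightarrow> (\<exists>col :: 'a \<Rightarrow> nat.
     (\<forall>v\<in>pverts G. col v < 3) \<and> (\<forall>(u, v)\<in>parcs G. col u \<noteq> col v))"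

text \<open>
  Binary encoding. Each list element is announced by the bit 1 and the end of the list is
  marked by the bit 0, so that the code of a list is self-delimiting whenever the codes of its
  elements are; numbers are lists of binary digits, least significant digit first.
\<close>

fun enc_list :: "('a \<Rightarrow> bool list) \<Rightarrow> 'a list \<Rightarrow> bool list" where
  "enc_list e [] = [False]"
| "enc_list e (a # as) = True # e a @ enc_list e as"

fun binary :: "nat \<Rightarrow> bool list" where
  "binary n = (if n = 0 then [] else odd n # binary (n div 2))"

declare binary.simps [simp del]

definition enc_nat :: "nat \<Rightarrow> bool list" where
  "enc_nat n = enc_list (\<lambda>b. [b]) (binary n)"

definition enc_edge :: "nat \<times> nat \<Rightarrow> bool list" where
  "enc_edge = (\<lambda>(u, v). enc_nat u @ enc_nat v)"

text \<open>Number of vertices, list of edges, and list of bags, each bag being a list of vertices.\<close>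

definition enc_graph_pd :: "nat \<Rightarrow> (nat \<times> nat) list \<Rightarrow> nat list list \<Rightarrow> bool list" where
  "enc_graph_pd N es bs = enc_nat N @ enc_list enc_edge es @ enc_list (enc_list enc_nat) bs"

definition graph_of :: "nat \<Rightarrow> (nat \<times> nat) list \<Rightarrow> nat pair_pre_digraph" where
  "graph_of N es = \<lparr>pverts = {..<N}, parcs = {(u, v). (u, v) \<in> set es \<or> (v, u) \<in> set es}\<rparr>"

text \<open>Words that do not encode a graph with a path decomposition of the required width are
  no-instances.\<close>

definition pw_3Coloring_log :: problem where
  "pw_3Coloring_log = {(x, k). \<exists>N es bs.
     x = enc_graph_pd N es bs \<and>
     pair_graph (graph_of N es) \<and>
     path_decomposition (graph_of N es) (map set bs) \<and>
     real_of_int (pd_width (map set bs)) \<le> real k * log 2 (real (length x)) \<and>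
     three_colorable (graph_of N es)}"

text \<open>The encoding is unambiguous.\<close>

lemma enc_list_append_inject:
  assumes "\<And>a b r s. e a @ r = e b @ s \<Longrightarrow> a = b \<and> r = s"
    and "enc_list e as @ r = enc_list e bs @ s"
  shows "as = bs \<and> r = s"
  using assms(2)
proof (induction as arbitrary: bs)
  case Nil
  then show ?case by (cases bs) auto
next
  case (Cons a as)
  then obtain b bs' where bs: "bs = b # bs'"
    by (cases bs) auto
  with Cons.prems have "e a @ (enc_list e as @ r) = e b @ (enc_list e bs' @ s)"
    by simp
  from assms(1)[OF this] Cons.IH bs show ?case by blast
qed

lemma binary_inject: "binary m = binary n \<Longrightarrow> m = n"
proof (induction m arbitrary: n rule: less_induct)
  case (less m)
  show ?case
  proof (cases "m = 0 \<or> n = 0")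
    case True
    with less.prems show ?thesis
      by (auto simp: binary.simps[of m] binary.simps[of n] split: if_splits)
  next
    case False
    with less.prems have *: "odd m = odd n" "binary (m div 2) = binary (n div 2)"
      by (simp_all add: binary.simps[of m] binary.simps[of n])
    from False have "m div 2 < m" by simp
    from less.IH[OF this *(2)] *(1) show ?thesis
      by (metis div_mult_mod_eq odd_iff_mod_2_eq_one not_mod_2_eq_1_eq_0)
  qed
qed

lemma enc_nat_append_inject: "enc_nat m @ r = enc_nat n @ s \<Longrightarrow> m = n \<and> r = s"
  unfolding enc_nat_def
  using enc_list_append_inject[of "\<lambda>b. [b]" "binary m" r "binary n" s] binary_inject by auto

lemma enc_edge_append_inject: "enc_edge a @ r = enc_edge b @ s \<Longrightarrow> a = b \<and> r = s"
  by (cases a; cases b) (auto simp: enc_edge_def dest!: enc_nat_append_inject)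

lemma enc_graph_pd_inject:
  assumes "enc_graph_pd N es bs = enc_graph_pd N' es' bs'"
  shows "N = N' \<and> es = es' \<and> bs = bs'"
proof -
  have bag: "as = as' \<and> r = s"
    if "enc_list enc_nat as @ r = enc_list enc_nat as' @ s" for as as' r s
    by (rule enc_list_append_inject[OF enc_nat_append_inject that])
  from assms have "N = N'" and rest: "enc_list enc_edge es @ enc_list (enc_list enc_nat) bs =
      enc_list enc_edge es' @ enc_list (enc_list enc_nat) bs'"
    unfolding enc_graph_pd_def using enc_nat_append_inject by blast+
  from enc_list_append_inject[OF enc_edge_append_inject rest]
  have "es = es'" and "enc_list (enc_list enc_nat) bs @ [] = enc_list (enc_list enc_nat) bs' @ []"
    by auto
  with enc_list_append_inject[OF bag] \<open>N = N'\<close> show ?thesis by blast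
qed

end

theory Submission
 imports Defs
begin

text \<open>
 Hardness. Configurations of a nondeterministic machine with space \<open>f k * log n\<close> are rows of
 \<open>V = O(f k * log n)\<close> cells, and the machine is slowed down: row \<open>r\<close> belongs to the input position
 \<open>r mod (|w| + 2)\<close>, and a step is possible only in a row that belongs to the position of the input
 head, which the cells store in binary. Acceptance then becomes a system of clauses that relate a
 cell to its right neighbour and to the cell above, hence only cells at distance at most \<open>V\<close>.
 Replacing clauses by OR gates turns the system into a 3-coloring instance with bags of \<open>V + 1\<close>
 consecutive cells. All parts of this graph are given by arithmetic expressions, which a machine
 evaluates in logarithmic space; \<open>f k\<close> is bounded by the running time of a machine that computes
 it, which is run as a clock.

 Membership. Instances are parsed by a finite automaton. The verifier guesses the colors bag by bag
 and stores those of two consecutive bags only.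

 Choices of nondeterministic machines are taken from a stream, so that programs have a functional
 semantics and acceptance means that some stream is good.
\<close>

section \<open>Structured programs for Turing machines\<close>

text \<open>The obstacle on the hardness side is the input tape: a local constraint cannot look up
  the symbol under a head whose position is itself guessed, and a bag has no room for the input.
  Once a row is tied to a fixed input position, that symbol and the bits of this position and of its
  two neighbours become constants of the row, which the reduction computes itself. The price is a
  factor \<open>length w + 2\<close> in the number of rows.

  Both machines come from one compiler. The exponents \<open>dg\<close> and \<open>sd\<close> are
  constants of the syntax, so all registers stay below \<open>X ^ const\<close> for
  \<open>X = t + length w + 2\<close>, where \<open>t\<close> is the clock, and fit into
  \<open>const * log X\<close> cells. Splitting this logarithm into a function of the parameter plus
  \<open>log n\<close> gives the space bound of a pl-reduction. The number \<open>n ^ k\<close> in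
  the width test has no constant exponent and therefore lives in the bit array.

  Resource bounds concern all computation paths. Hence programs are shown to end for every stream of
  choices, and a failed assertion is only recorded instead of ending the run.\<close>

type_synonym view = "insym \<times> nat list"
type_synonym effect = "direction \<times> (nat \<times> direction) list \<times> bool list"

text \<open>A primitive is one machine step given by an arbitrary function of the scanned symbols;
  finiteness enters only in \<open>assemble\<close>, which tabulates it for symbols below
  \<open>A\<close>.\<close>

datatype com =
  Prim "view \<Rightarrow> effect"
 | Seq com com (infixr ";;" 60)
 | Cond "view \<Rightarrow> bool" com com
 | While "view \<Rightarrow> bool" com
 | Choose com com

datatype micro = Op "view \<Rightarrow> nat \<times> effect" | Br nat nat

definition stay :: "view \<Rightarrow> effect" where
 "stay v = (Stay, map (\<lambda>s. (s, Stay)) (snd v), [])"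

primrec clen :: "com \<Rightarrow> nat" where
 "clen (Prim f) = 1"
| "clen (a ;; b) = clen a + clen b"
| "clen (Cond P a b) = clen a + clen b + 2"
| "clen (While P a) = clen a + 2"
| "clen (Choose a b) = clen a + clen b + 2"

text \<open>States are absolute code addresses: a block placed at \<open>n\<close> is left at
  address \<open>n + clen c\<close>. The first branch of \<open>Cond\<close> and
  \<open>Choose\<close> ends with a jump over the second one, a loop body with a jump back to its
  test.\<close>

primrec comp :: "com \<Rightarrow> nat \<Rightarrow> micro list" where
 "comp (Prim f) n = [Op (\<lambda>v. (Suc n, f v))]"
| "comp (a ;; b) n = comp a n @ comp b (n + clen a)"
| "comp (Cond P a b) n =
   Op (\<lambda>v. (if P v then Suc n else n + 2 + clen a, stay v)) # comp a (Suc n) @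
   Op (\<lambda>v. (n + 2 + clen a + clen b, stay v)) # comp b (n + 2 + clen a)"
| "comp (While P a) n =
   Op (\<lambda>v. (if P v then Suc n else n + 2 + clen a, stay v)) # comp a (Suc n) @
   [Op (\<lambda>v. (n, stay v))]"
| "comp (Choose a b) n =
   Br (Suc n) (n + 2 + clen a) # comp a (Suc n) @
   Op (\<lambda>v. (n + 2 + clen a + clen b, stay v)) # comp b (n + 2 + clen a)"

primrec choiceless :: "com \<Rightarrow> bool" where
 "choiceless (Prim f) \<longleftrightarrow> True"
| "choiceless (a ;; b) \<longleftrightarrow> choiceless a \<and> choiceless b"
| "choiceless (Cond P a b) \<longleftrightarrow> choiceless a \<and> choiceless b"
| "choiceless (While P a) \<longleftrightarrow> choiceless a"
| "choiceless (Choose a b) \<longleftrightarrow> False"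

lemma length_comp [simp]: "length (comp c n) = clen c"
 by (induction c arbitrary: n) auto

definition code_at :: "'a list \<Rightarrow> nat \<Rightarrow> 'a list \<Rightarrow> bool" where
 "code_at P a is \<longleftrightarrow> (\<exists>xs ys. P = xs @ is @ ys \<and> length xs = a)"

lemma code_at_append:
 assumes "code_at P a (x @ y)"
 shows "code_at P a x" "code_at P (a + length x) y"
proof -
 from assms obtain xs ys where P: "P = xs @ (x @ y) @ ys" "length xs = a"
  unfolding code_at_def by blast
 from P have "P = xs @ x @ (y @ ys)" by simp
 with P(2) show "code_at P a x" unfolding code_at_def by blast
 from P have "P = (xs @ x) @ y @ ys \<and> length (xs @ x) = a + length x" by simp
 then show "code_at P (a + length x) y" unfolding code_at_def by blast
qed

lemma code_at_Cons:
 assumes "code_at P a (m # ms)"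
 shows "a < length P" "P ! a = m" "code_at P (Suc a) ms"
proof -
 from assms obtain xs ys where P: "P = xs @ (m # ms) @ ys" "length xs = a"
  unfolding code_at_def by blast
 then show "a < length P" "P ! a = m" by auto
 from code_at_append(2)[of P a "[m]" ms] assms show "code_at P (Suc a) ms" by simp
qed

text \<open>The last component is the stream of nondeterministic choices still to be consumed.\<close>

type_synonym mst = "nat \<times> work_tape list \<times> bool list \<times> (nat \<Rightarrow> bool)"

definition look :: "bool list \<Rightarrow> mst \<Rightarrow> view" where
 "look w s = (scan_input w (fst s), map (\<lambda>(t, h). t h) (fst (snd s)))"

definition eff :: "bool list \<Rightarrow> effect \<Rightarrow> mst \<Rightarrow> mst" where
 "eff w e s = (min (move (fst e) (fst s)) (length w + 1), map2 act (fst (snd e)) (fst (snd s)),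
   fst (snd (snd s)) @ snd (snd e), snd (snd (snd s)))"

definition tail_choice :: "mst \<Rightarrow> mst" where
 "tail_choice s = (fst s, fst (snd s), fst (snd (snd s)), \<lambda>i. snd (snd (snd s)) (Suc i))"

definition next_choice :: "mst \<Rightarrow> bool" where
 "next_choice s = snd (snd (snd s)) 0"

section \<open>Big-step semantics and its translation to micro code\<close>

locale machine_env =
 fixes w :: "bool list" and K A H :: nat
begin

text \<open>The invariant carries the space bound: \<open>H\<close> limits the head positions. The
  bound \<open>A\<close> on the symbols guarantees that the finite instruction table has an entry
  for what is scanned.\<close>

definition good :: "mst \<Rightarrow> bool" where
 "good s \<longleftrightarrow> fst s \<le> length w + 1 \<and> length (fst (snd s)) = K \<and>
   (\<forall>(t, h)\<in>set (fst (snd s)). h < H \<and> (\<forall>j. t j < A))"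

text \<open>The counter is the exact number of machine steps, tests and jumps included. Goodness is
  demanded around every primitive, so that an execution certifies the space bound for all
  intermediate states as well.\<close>

inductive exec :: "com \<Rightarrow> mst \<Rightarrow> nat \<Rightarrow> mst \<Rightarrow> bool" where
 Prim: "good s \<Longrightarrow> length (fst (snd (f (look w s)))) = K \<Longrightarrow> good (eff w (f (look w s)) s) \<Longrightarrow>
   exec (Prim f) s 1 (eff w (f (look w s)) s)"
| Seq: "exec a s n s' \<Longrightarrow> exec b s' m s'' \<Longrightarrow> exec (a ;; b) s (n + m) s''"
| CondT: "P (look w s) \<Longrightarrow> exec a s n s' \<Longrightarrow> exec (Cond P a b) s (n + 2) s'"
| CondF: "\<not> P (look w s) \<Longrightarrow> exec b s n s' \<Longrightarrow> exec (Cond P a b) s (n + 1) s'"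
| WhileF: "good s \<Longrightarrow> \<not> P (look w s) \<Longrightarrow> exec (While P a) s 1 s"
| WhileT: "P (look w s) \<Longrightarrow> exec a s n s' \<Longrightarrow> exec (While P a) s' m s'' \<Longrightarrow>
   exec (While P a) s (n + 2 + m) s''"
| ChooseT: "next_choice s \<Longrightarrow> good s \<Longrightarrow> exec a (tail_choice s) n s' \<Longrightarrow> exec (Choose a b) s (n + 2) s'"
| ChooseF: "\<not> next_choice s \<Longrightarrow> good s \<Longrightarrow> exec b (tail_choice s) n s' \<Longrightarrow> exec (Choose a b) s (n + 1) s'"

lemma exec_good: "exec c s n s' \<Longrightarrow> good s \<and> good s'"
 by (induction rule: exec.induct) auto

definition nx :: "micro list \<Rightarrow> nat \<times> mst \<Rightarrow> nat \<times> mst" where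
 "nx P x = (case P ! fst x of
   Op f \<Rightarrow> (fst (f (look w (snd x))), eff w (snd (f (look w (snd x)))) (snd x))
  | Br a b \<Rightarrow> (if next_choice (snd x) then a else b, tail_choice (snd x)))"

definition okstep :: "micro list \<Rightarrow> nat \<times> mst \<Rightarrow> bool" where
 "okstep P x \<longleftrightarrow> fst x < length P \<and> good (snd x) \<and>
   (case P ! fst x of Op f \<Rightarrow> length (fst (snd (snd (f (look w (snd x)))))) = K | Br a b \<Rightarrow> True)"

inductive tr :: "micro list \<Rightarrow> nat \<times> mst \<Rightarrow> nat \<Rightarrow> nat \<times> mst \<Rightarrow> bool" for P where
 tr0: "tr P x 0 x"
| trS: "okstep P x \<Longrightarrow> tr P (nx P x) n y \<Longrightarrow> tr P x (Suc n) y"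

lemma tr_trans: "tr P x n y \<Longrightarrow> tr P y m z \<Longrightarrow> tr P x (n + m) z"
 by (induction rule: tr.induct) (auto intro: tr.intros)

lemma tr1: "okstep P x \<Longrightarrow> nx P x = y \<Longrightarrow> tr P x 1 y"
 by (metis trS tr0 One_nat_def)

lemma map2_stay [simp]:
 "map2 act (map (\<lambda>s. (s, Stay)) (map (\<lambda>(t, h). t h) T)) T = T"
 by (induction T) (auto simp: case_prod_unfold)

lemma eff_stay: "good s \<Longrightarrow> eff w (stay (look w s)) s = s"
 by (auto simp: eff_def stay_def look_def good_def prod_eq_iff min_def
   simp del: map_map zip_map1)

lemma length_stay: "length (fst (snd (stay (look w s)))) = length (fst (snd s))"
 by (simp add: stay_def look_def)

lemma good_length: "good s \<Longrightarrow> length (fst (snd s)) = K"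
 by (simp add: good_def)

lemma tr_jump:
 assumes "good s" "q < length P" "P ! q = Op (\<lambda>v. (f v, stay v))" "f (look w s) = q'"
 shows "tr P (q, s) 1 (q', s)"
 by (rule tr1) (use assms in \<open>auto simp: okstep_def nx_def eff_stay length_stay good_length\<close>)

text \<open>Rule induction. The units that \<open>exec\<close> adds for tests and jumps are
  applications of \<open>tr_jump\<close>; a choice is one \<open>Br\<close> step, which also
  shortens the stream.\<close>

lemma exec_tr: "exec c s n s' \<Longrightarrow> code_at P q (comp c q) \<Longrightarrow> tr P (q, s) n (q + clen c, s')"
proof (induction arbitrary: q rule: exec.induct)
 case (Prim s f)
 then show ?case
  using code_at_Cons[OF Prim.prems[simplified]]
  by (intro tr1) (auto simp: okstep_def nx_def)
next
 case (Seq a s n s' b m s'')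
 from code_at_append[of P q "comp a q"] Seq.prems have "code_at P q (comp a q)"
  "code_at P (q + clen a) (comp b (q + clen a))" by simp_all
 from Seq.IH(1)[OF this(1)] Seq.IH(2)[OF this(2)] show ?case
  by (auto simp: add.assoc intro: tr_trans)
next
 case (CondT R s a n s' b)
 note c = code_at_Cons[OF CondT.prems[simplified]]
 note d = code_at_append[OF c(3)]
 note e = code_at_Cons[OF d(2)]
 have g: "good s" "good s'" using exec_good[OF CondT.hyps(2)] by auto
 have "tr P (q, s) 1 (Suc q, s)"
  by (rule tr_jump[OF g(1) c(1) c(2)]) (simp add: CondT)
 moreover have "tr P (Suc q, s) n (Suc q + clen a, s')" by (rule CondT.IH[OF d(1)])
 moreover have "tr P (Suc q + clen a, s') 1 (q + 2 + clen a + clen b, s')"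
  by (rule tr_jump[OF g(2)]) (use e in auto)
 ultimately have "tr P (q, s) (1 + n + 1) (q + 2 + clen a + clen b, s')" by (blast intro: tr_trans)
 then show ?case by (simp add: algebra_simps)
next
 case (CondF R s b n s' a)
 note c = code_at_Cons[OF CondF.prems[simplified]]
 note d = code_at_append[OF c(3)]
 note e = code_at_Cons[OF d(2)]
 have g: "good s" "good s'" using exec_good[OF CondF.hyps(2)] by auto
 have "tr P (q, s) 1 (q + 2 + clen a, s)"
  by (rule tr_jump[OF g(1) c(1) c(2)]) (simp add: CondF)
 moreover have "tr P (q + 2 + clen a, s) n (q + 2 + clen a + clen b, s')"
  by (rule CondF.IH) (use e(3) in simp)
 ultimately have "tr P (q, s) (1 + n) (q + 2 + clen a + clen b, s')" by (blast intro: tr_trans)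
 then show ?case by (simp add: algebra_simps)
next
 case (WhileF s R a)
 note c = code_at_Cons[OF WhileF.prems[simplified]]
 have "tr P (q, s) 1 (q + 2 + clen a, s)"
  by (rule tr_jump[OF WhileF(1) c(1) c(2)]) (simp add: WhileF)
 then show ?case by (simp add: algebra_simps)
next
 case (WhileT R s a n s' m s'')
 note c = code_at_Cons[OF WhileT.prems[simplified]]
 note d = code_at_append[OF c(3)]
 note e = code_at_Cons[OF d(2)]
 have g: "good s" "good s'" using exec_good[OF WhileT.hyps(2)] by auto
 have "tr P (q, s) 1 (Suc q, s)"
  by (rule tr_jump[OF g(1) c(1) c(2)]) (simp add: WhileT)
 moreover have "tr P (Suc q, s) n (Suc q + clen a, s')" by (rule WhileT.IH(1)[OF d(1)])
 moreover have "tr P (Suc q + clen a, s') 1 (q, s')"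
  by (rule tr_jump[OF g(2)]) (use e in auto)
 moreover have "tr P (q, s') m (q + clen (While R a), s'')" by (rule WhileT.IH(2)[OF WhileT.prems])
 ultimately have "tr P (q, s) (1 + n + 1 + m) (q + clen (While R a), s'')"
  by (blast intro: tr_trans)
 then show ?case by (simp add: algebra_simps)
next
 case (ChooseT s a n s' b)
 note c = code_at_Cons[OF ChooseT.prems[simplified]]
 note d = code_at_append[OF c(3)]
 note e = code_at_Cons[OF d(2)]
 have g: "good s'" using exec_good[OF ChooseT.hyps(3)] by auto
 have "tr P (q, s) 1 (Suc q, tail_choice s)"
  by (rule tr1) (use ChooseT c in \<open>auto simp: okstep_def nx_def\<close>)
 moreover have "tr P (Suc q, tail_choice s) n (Suc q + clen a, s')" by (rule ChooseT.IH[OF d(1)])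
 moreover have "tr P (Suc q + clen a, s') 1 (q + 2 + clen a + clen b, s')"
  by (rule tr_jump[OF g]) (use e in auto)
 ultimately have "tr P (q, s) (1 + n + 1) (q + 2 + clen a + clen b, s')" by (blast intro: tr_trans)
 then show ?case by (simp add: algebra_simps)
next
 case (ChooseF s b n s' a)
 note c = code_at_Cons[OF ChooseF.prems[simplified]]
 note d = code_at_append[OF c(3)]
 note e = code_at_Cons[OF d(2)]
 have "tr P (q, s) 1 (q + 2 + clen a, tail_choice s)"
  by (rule tr1) (use ChooseF c in \<open>auto simp: okstep_def nx_def\<close>)
 moreover have "tr P (q + 2 + clen a, tail_choice s) n (q + 2 + clen a + clen b, s')"
  by (rule ChooseF.IH) (use e(3) in simp)
 ultimately have "tr P (q, s) (1 + n) (q + 2 + clen a + clen b, s')" by (blast intro: tr_trans)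
 then show ?case by (simp add: algebra_simps)
qed

end

section \<open>From micro code to Turing machines\<close>

fun outcomes :: "micro \<Rightarrow> view \<Rightarrow> (nat \<times> effect) set" where
 "outcomes (Op f) v = {f v}"
| "outcomes (Br a b) v = {(a, stay v), (b, stay v)}"

fun mk_instr :: "nat \<Rightarrow> view \<Rightarrow> nat \<times> effect \<Rightarrow> instr" where
 "mk_instr q (a, ss) (q', d, as, bs) = \<lparr>src = q, in_read = a, wk_read = ss, dst = q', in_dir = d,
   wk_act = as, emit = bs\<rparr>"

text \<open>Tabulating only views over symbols below \<open>A\<close> and effects of length
  \<open>K\<close> makes the instruction set finite and well formed. Addresses from
  \<open>length P\<close> on have no instruction, hence they halt.\<close>

definition assemble :: "nat \<Rightarrow> nat \<Rightarrow> micro list \<Rightarrow> nat \<Rightarrow> tm" where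
 "assemble K A P acc = \<lparr>n_tapes = K,
   instrs = {i. \<exists>q a ss r. q < length P \<and> set ss \<subseteq> {..<A} \<and> length ss = K \<and>
    r \<in> outcomes (P ! q) (a, ss) \<and> length (fst (snd (snd r))) = K \<and> i = mk_instr q (a, ss) r},
   start = 0, accepting = {acc}\<rparr>"

lemma UNIV_insym: "UNIV = {Start_Mark, Bit True, Bit False, End_Mark}"
proof (rule UNIV_eq_I)
 show "x \<in> {Start_Mark, Bit True, Bit False, End_Mark}" for x by (cases x) auto
qed

lemma instrs_assemble_iff:
 "i \<in> instrs (assemble K A P acc) \<longleftrightarrow> (\<exists>q a ss r. q < length P \<and> set ss \<subseteq> {..<A} \<and> length ss = K \<and>
   r \<in> outcomes (P ! q) (a, ss) \<and> length (fst (snd (snd r))) = K \<and> i = mk_instr q (a, ss) r)"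
 by (simp add: assemble_def)

lemma mk_instr_sel [simp]:
 "src (mk_instr q v r) = q" "in_read (mk_instr q v r) = fst v" "wk_read (mk_instr q v r) = snd v"
 by (cases v; cases r; simp)+

lemma well_formed_assemble: "well_formed (assemble K A P acc)"
proof -
 let ?S = "\<Union>q<length P. \<Union>a. \<Union>ss\<in>{ss. set ss \<subseteq> {..<A} \<and> length ss = K}.
   mk_instr q (a, ss) ` outcomes (P ! q) (a, ss)"
 have "finite (UNIV :: insym set)" by (simp add: UNIV_insym)
 moreover have "finite {ss :: nat list. set ss \<subseteq> {..<A} \<and> length ss = K}"
  by (rule finite_lists_length_eq) simp
 moreover have "finite (outcomes m v)" for m v by (cases m) auto
 ultimately have "finite ?S" by simp
 moreover have "instrs (assemble K A P acc) \<subseteq> ?S"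
 proof
  fix i assume "i \<in> instrs (assemble K A P acc)"
  then obtain q a ss r where "q < length P" "set ss \<subseteq> {..<A} \<and> length ss = K"
   "i = mk_instr q (a, ss) r" "r \<in> outcomes (P ! q) (a, ss)"
   unfolding instrs_assemble_iff by blast
  then show "i \<in> ?S" by (intro UN_I[of q] UN_I[of a] UN_I[of ss] image_eqI[of _ _ r]) simp_all
 qed
 ultimately have "finite (instrs (assemble K A P acc))" by (rule rev_finite_subset)
 moreover have "length (wk_read i) = K \<and> length (wk_act i) = K" if i: "i \<in> instrs (assemble K A P acc)" for i
 proof -
  from i obtain q a ss r where r: "length ss = K" "length (fst (snd (snd r))) = K" "i = mk_instr q (a, ss) r"
   unfolding instrs_assemble_iff by blast
  obtain x y z u where "r = (x, y, z, u)" by (cases r) auto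
  with r show ?thesis by simp
 qed
 ultimately show ?thesis unfolding well_formed_def by (simp add: assemble_def)
qed

lemma deterministic_assemble:
 assumes "\<And>a b. Br a b \<notin> set P"
 shows "deterministic (assemble K A P acc)"
proof -
 define F where "F q v = mk_instr q v (case P ! q of Op f \<Rightarrow> f v | Br a b \<Rightarrow> undefined)" for q v
 have *: "i = F (src i) (in_read i, wk_read i)" if "i \<in> instrs (assemble K A P acc)" for i
 proof -
  from that obtain q a ss r where i: "q < length P" "i = mk_instr q (a, ss) r" "r \<in> outcomes (P ! q) (a, ss)"
   unfolding instrs_assemble_iff by blast
  from i(1) assms obtain f where f: "P ! q = Op f" by (metis micro.exhaust nth_mem)
  with i(3) have "r = f (a, ss)" by simp
  then show ?thesis unfolding i(2) mk_instr_sel fst_conv snd_conv F_def f by simp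
 qed
 show ?thesis unfolding deterministic_def
 proof (intro ballI impI)
  fix i j assume ij: "i \<in> instrs (assemble K A P acc)" "j \<in> instrs (assemble K A P acc)"
   and "src i = src j \<and> in_read i = in_read j \<and> wk_read i = wk_read j"
  then have "F (src i) (in_read i, wk_read i) = F (src j) (in_read j, wk_read j)" by simp
  from *[OF ij(1)] this *[OF ij(2), symmetric] show "i = j" by (rule trans[OF trans])
 qed
qed

lemma comp_choiceless: "choiceless c \<Longrightarrow> Br a b \<notin> set (comp c n)"
 by (induction c arbitrary: n) auto

fun cfg :: "nat \<times> mst \<Rightarrow> config" where
 "cfg (q, p, T, v, ch) = \<lparr>state = q, in_pos = p, work = T, out_word = v\<rparr>"

context machine_env
begin

text \<open>A configuration does not contain the stream. Its successors arise by putting an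
  arbitrary next choice \<open>b\<close> in front of the stream; for an \<open>Op\<close> all values
  of \<open>b\<close> give the same configuration.\<close>

lemma step_assemble:
 assumes ok: "okstep P (q, p, T, v, ch)"
 shows "step (assemble K A P acc) w (cfg (q, p, T, v, ch)) c' \<longleftrightarrow>
  (\<exists>b. c' = cfg (nx P (q, p, T, v, \<lambda>i. case i of 0 \<Rightarrow> b | Suc j \<Rightarrow> ch j)))"
proof -
 define vv where "vv = look w (p, T, v, ch)"
 have q: "q < length P" and g: "good (p, T, v, ch)" using ok by (auto simp: okstep_def)
 have v: "vv \<in> UNIV \<times> {ss. set ss \<subseteq> {..<A} \<and> length ss = K}"
  using g by (auto simp: vv_def look_def good_def)
 have lv: "look w (p, T, v, ch') = vv" for ch' by (simp add: vv_def look_def)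
 have st: "step (assemble K A P acc) w (cfg (q, p, T, v, ch)) c' \<longleftrightarrow>
  (\<exists>r\<in>outcomes (P ! q) vv. length (fst (snd (snd r))) = K \<and> c' = execute w (mk_instr q vv r) (cfg (q, p, T, v, ch)))"
  (is "?L = ?R")
 proof
  assume ?L
  then obtain i where i: "i \<in> instrs (assemble K A P acc)" "src i = q" "in_read i = scan_input w p"
   "wk_read i = map (\<lambda>(t, h). t h) T" "c' = execute w i (cfg (q, p, T, v, ch))"
   by (auto simp: step_def applicable_def)
  then obtain q' a ss r where *: "i = mk_instr q' (a, ss) r" "r \<in> outcomes (P ! q') (a, ss)"
   "length (fst (snd (snd r))) = K"
   unfolding instrs_assemble_iff by blast
  obtain x y z u where r: "r = (x, y, z, u)" by (cases r) auto
  have "(a, ss) = vv" "q' = q" using i * r by (auto simp: vv_def look_def)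
  with * i show ?R by auto
 next
  assume ?R
  then obtain r where r: "r \<in> outcomes (P ! q) vv" "length (fst (snd (snd r))) = K"
   "c' = execute w (mk_instr q vv r) (cfg (q, p, T, v, ch))" by blast
  have "mk_instr q vv r \<in> instrs (assemble K A P acc)"
   unfolding instrs_assemble_iff using r q v
   by (intro exI[of _ q] exI[of _ "fst vv"] exI[of _ "snd vv"] exI[of _ r]) auto
  moreover have "in_read (mk_instr q vv r) = scan_input w p" "wk_read (mk_instr q vv r) = map (\<lambda>(t, h). t h) T"
   by (simp_all add: vv_def look_def)
  ultimately show ?L using r(3) unfolding step_def applicable_def by (intro exI[of _ "mk_instr q vv r"]) simp
 qed
 have ex: "execute w (mk_instr q vv (q', e)) (cfg (q, p, T, v, ch)) = cfg (q', eff w e (p, T, v, ch'))" for q' e ch'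
  by (cases e; cases vv) (simp add: execute_def eff_def)
 show ?thesis
 proof (cases "P ! q")
  case (Op f)
  have "length (fst (snd (snd (f vv)))) = K" using ok Op by (simp add: okstep_def lv)
  then show ?thesis unfolding st Op nx_def using ex[of "fst (f vv)" "snd (f vv)"]
   by (simp add: Op lv prod.case_eq_if)
 next
  case (Br a b)
  have *: "length (fst (snd (stay vv))) = K" using g by (simp add: vv_def length_stay good_def)
  have **: "cfg (x, eff w (stay vv) (p, T, v, ch)) = cfg (x, p, T, v, ch')" for x ch'
   using eff_stay[OF g] by (simp add: vv_def)
  show ?thesis unfolding st Br
   using * ex[of _ _ ch] ** by (auto simp: nx_def Br next_choice_def tail_choice_def)
 qed
qed

lemma nx_choice:
 "nx P (q, p, T, v, ch) = (case P ! q of Op f \<Rightarrow>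
   (fst (nx P (q, p, T, v, ch')), fst (snd (nx P (q, p, T, v, ch'))), fst (snd (snd (nx P (q, p, T, v, ch')))),
    fst (snd (snd (snd (nx P (q, p, T, v, ch'))))), ch)
  | Br a b \<Rightarrow> (if ch 0 then a else b, p, T, v, \<lambda>i. ch (Suc i)))"
 by (auto simp: nx_def look_def eff_def next_choice_def tail_choice_def split: micro.split)

definition halts_good :: "micro list \<Rightarrow> nat \<times> mst \<Rightarrow> nat \<Rightarrow> bool" where
 "halts_good P x N \<longleftrightarrow> (\<exists>n y. n \<le> N \<and> tr P x n y \<and> length P \<le> fst y \<and> good (snd y))"

lemma halts_good_step:
 assumes "halts_good P x N" "fst x < length P"
 shows "okstep P x" "\<exists>N'. N = Suc N' \<and> halts_good P (nx P x) N'"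
proof -
 from assms(1) obtain n y where y: "n \<le> N" "tr P x n y" "length P \<le> fst y" "good (snd y)"
  unfolding halts_good_def by blast
 from y(2) show "okstep P x" by cases (use y assms in auto)
 from y(2) obtain m where m: "n = Suc m" "tr P (nx P x) m y" by cases (use y assms in auto)
 with y(1) obtain N' where N': "N = Suc N'" "m \<le> N'" by (cases N) auto
 with m y have "halts_good P (nx P x) N'" unfolding halts_good_def by blast
 with N' show "\<exists>N'. N = Suc N' \<and> halts_good P (nx P x) N'" by blast
qed

lemma halts_good_good: "halts_good P x N \<Longrightarrow> good (snd x)"
proof -
 have "tr P x n y \<Longrightarrow> good (snd y) \<Longrightarrow> good (snd x)" for n y
  by (erule tr.cases) (simp_all add: okstep_def)
 then show "halts_good P x N \<Longrightarrow> good (snd x)" unfolding halts_good_def by blast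
qed

lemma no_step_assemble: "length P \<le> q \<Longrightarrow> \<not> step (assemble K A P acc) w (cfg (q, s)) c'"
proof
 assume "length P \<le> q" "step (assemble K A P acc) w (cfg (q, s)) c'"
 then obtain i where "i \<in> instrs (assemble K A P acc)" "src i = q"
  unfolding step_def applicable_def by (cases s) force
 then obtain q' a ss r where "q' < length P" "i = mk_instr q' (a, ss) r"
  unfolding instrs_assemble_iff by blast
 with \<open>src i = q\<close> \<open>length P \<le> q\<close> show False by auto
qed

text \<open>If all streams lead to a halt, then every machine path is the run of some stream: its
  first step fixes the next choice, and the induction hypothesis supplies a stream for the rest. In
  this way bounds for streams become bounds for all paths.\<close>

lemma path_tr:
 assumes "\<And>ch. halts_good P (q, p, T, v, ch) N"
  and "(step (assemble K A P acc) w ^^ m) (cfg (q, p, T, v, ch0)) c'"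
 shows "m \<le> N \<and> (\<exists>ch y N'. tr P (q, p, T, v, ch) m y \<and> c' = cfg y \<and> halts_good P y N')"
 using assms
proof (induction m arbitrary: q p T v ch0 N)
 case 0
 have "tr P (q, p, T, v, ch0) 0 (q, p, T, v, ch0)" by (rule tr0)
 moreover have "c' = cfg (q, p, T, v, ch0)" using 0(2) by simp
 ultimately show ?case using 0(1)[of ch0] by blast
next
 case (Suc m)
 from Suc.prems(2) obtain c1 where c1: "step (assemble K A P acc) w (cfg (q, p, T, v, ch0)) c1"
  "(step (assemble K A P acc) w ^^ m) c1 c'" by (blast elim: relpowp_Suc_E2)
 have q: "q < length P" using no_step_assemble c1(1) by (meson not_less)
 have hs: "okstep P (q, p, T, v, ch)" "\<exists>N'. N = Suc N' \<and> halts_good P (nx P (q, p, T, v, ch)) N'" for ch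
  using halts_good_step[OF Suc.prems(1)[of ch]] q by auto
 then obtain N' where N: "N = Suc N'" and hs2: "halts_good P (nx P (q, p, T, v, ch)) N'" for ch by blast
 from c1(1) obtain b where b: "c1 = cfg (nx P (q, p, T, v, \<lambda>i. case i of 0 \<Rightarrow> b | Suc j \<Rightarrow> ch0 j))"
  using step_assemble[OF hs(1)] by blast
 let ?z = "nx P (q, p, T, v, \<lambda>i. case i of 0 \<Rightarrow> b | Suc j \<Rightarrow> ch0 j)"
 \<comment> \<open>\<open>f ch\<close> is a stream whose first step leads to the components of
   \<open>?z\<close> and leaves \<open>ch\<close>: it is \<open>ch\<close> itself for an
   \<open>Op\<close>, and \<open>ch\<close> preceded by \<open>b\<close> for a
   \<open>Br\<close>.\<close>
 have "\<exists>f. \<forall>ch. halts_good P (fst ?z,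
   fst (snd ?z),
   fst (snd (snd ?z)),
   fst (snd (snd (snd ?z))), ch) N' \<and>
   nx P (q, p, T, v, f ch) = (fst ?z,
   fst (snd ?z),
   fst (snd (snd ?z)),
   fst (snd (snd (snd ?z))), ch)"
 proof (cases "P ! q")
  case (Op f)
  have "nx P (q, p, T, v, ch) = (fst ?z,
   fst (snd ?z),
   fst (snd (snd ?z)),
   fst (snd (snd (snd ?z))), ch)" for ch
   using nx_choice[of P q p T v ch] Op by auto
  with hs2 show ?thesis by (intro exI[of _ "\<lambda>ch. ch"]) metis
 next
  case (Br a b')
  have "nx P (q, p, T, v, \<lambda>i. case i of 0 \<Rightarrow> b | Suc j \<Rightarrow> ch j) = (if b then a else b', p, T, v, ch)" for ch
   using nx_choice[of P q p T v "\<lambda>i. case i of 0 \<Rightarrow> b | Suc j \<Rightarrow> ch j"] Br by auto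
  moreover from this hs2 have "halts_good P (if b then a else b', p, T, v, ch) N'" for ch
   by metis
  ultimately show ?thesis
   by (intro exI[of _ "\<lambda>ch. (\<lambda>i. case i of 0 \<Rightarrow> b | Suc j \<Rightarrow> ch j)"]) simp
 qed
 then obtain f q1 p1 T1 v1 where f: "\<And>ch. halts_good P (q1, p1, T1, v1, ch) N'"
  "\<And>ch. nx P (q, p, T, v, f ch) = (q1, p1, T1, v1, ch)"
  and q1: "q1 = fst ?z"
  "p1 = fst (snd ?z)"
  "T1 = fst (snd (snd ?z))"
  "v1 = fst (snd (snd (snd ?z)))"
  by blast
 have "c1 = cfg (q1, p1, T1, v1, ch0)"
  unfolding b q1 by (metis cfg.simps prod.collapse)
 with Suc.IH[OF f(1)] c1(2) obtain ch y N'' where "m \<le> N'" "tr P (q1, p1, T1, v1, ch) m y" "c' = cfg y"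
  "halts_good P y N''" by blast
 moreover from this(2) f(2)[of ch] hs(1)[of "f ch"] have "tr P (q, p, T, v, f ch) (Suc m) y"
  by (metis trS)
 ultimately show ?case using N by blast
qed

lemma tr_path: "tr P x m y \<Longrightarrow> (step (assemble K A P acc) w ^^ m) (cfg x) (cfg y)"
proof (induction rule: tr.induct)
 case (trS x n y)
 obtain q p T v ch where x: "x = (q, p, T, v, ch)" by (cases x) auto
 have *: "(\<lambda>i. case i of 0 \<Rightarrow> ch 0 | Suc j \<Rightarrow> ch (Suc j)) = ch"
  by (rule ext) (simp split: nat.split)
 obtain c0 where c0: "cfg (q, p, T, v, \<lambda>j. ch (Suc j)) = c0" by simp
 have "okstep P (q, p, T, v, \<lambda>j. ch (Suc j))"
  using trS(1) unfolding x okstep_def good_def look_def fst_conv snd_conv .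
 from step_assemble[OF this] * have "step (assemble K A P acc) w (cfg x) (cfg (nx P x))"
  unfolding x by (metis cfg.simps)
 with trS.IH show ?case by (blast intro: relpowp_Suc_I2)
qed simp

lemma tr_det:
 "tr P x n y \<Longrightarrow> tr P x m z \<Longrightarrow> length P \<le> fst y \<Longrightarrow> length P \<le> fst z \<Longrightarrow> y = z"
proof (induction arbitrary: m rule: tr.induct)
 case (tr0 x)
 from tr0(1) show ?case by cases (use tr0 in \<open>auto simp: okstep_def\<close>)
next
 case (trS x n y)
 from trS(4) show ?case by cases (use trS in \<open>auto simp: okstep_def\<close>)
qed

end

text \<open>The appended test leads to address \<open>clen c + 1\<close> or
  \<open>clen c + 2\<close>. The code has length \<open>clen c + 1\<close>, so both addresses halt;
  \<open>tm_of\<close> declares the first one accepting.\<close>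

definition program :: "com \<Rightarrow> (view \<Rightarrow> bool) \<Rightarrow> micro list" where
 "program c Q = comp c 0 @ [Op (\<lambda>v. (if Q v then clen c + 1 else clen c + 2, stay v))]"

definition tm_of :: "nat \<Rightarrow> nat \<Rightarrow> com \<Rightarrow> (view \<Rightarrow> bool) \<Rightarrow> tm" where
 "tm_of K A c Q = assemble K A (program c Q) (clen c + 1)"

lemma well_formed_tm_of: "well_formed (tm_of K A c Q)"
 by (simp add: tm_of_def well_formed_assemble)

lemma deterministic_tm_of: "choiceless c \<Longrightarrow> deterministic (tm_of K A c Q)"
 unfolding tm_of_def by (rule deterministic_assemble) (auto simp: program_def comp_choiceless)

context machine_env
begin

abbreviation init_state :: "(nat \<Rightarrow> bool) \<Rightarrow> mst" where
 "init_state ch \<equiv> (0, replicate K (\<lambda>_. 0, 0), [], ch)"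

lemma exec_program:
 assumes "exec c s n s'"
 shows "tr (program c Q) (0, s) (n + 1) (if Q (look w s') then clen c + 1 else clen c + 2, s')"
proof -
 have "code_at (program c Q) 0 (comp c 0)"
  unfolding program_def code_at_def by (rule exI[of _ "[]"]) auto
 from exec_tr[OF assms this] have "tr (program c Q) (0, s) n (clen c, s')" by simp
 moreover have "tr (program c Q) (clen c, s') 1 (if Q (look w s') then clen c + 1 else clen c + 2, s')"
  by (rule tr_jump) (use exec_good[OF assms] in \<open>auto simp: program_def nth_append\<close>)
 ultimately show ?thesis by (rule tr_trans)
qed

lemma cfg_init: "cfg (0, init_state ch) = init (tm_of K A c Q)"
 by (simp add: init_def tm_of_def assemble_def)

text \<open>By \<open>path_tr\<close> the assumption about streams covers all machine paths;
  \<open>N + 1\<close> includes the final test. For acceptance, \<open>tr_det\<close> identifies the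
  end of an accepting path with the result of the execution for its stream.\<close>

lemma
 assumes ex: "\<And>ch. \<exists>n s'. n \<le> N \<and> exec c (init_state ch) n s'"
 shows runs_in_time_tm_of: "runs_in_time (tm_of K A c Q) w (real (N + 1))"
  and runs_in_space_tm_of: "runs_in_space (tm_of K A c Q) w (real H)"
  and accepts_tm_of: "accepts (tm_of K A c Q) w \<longleftrightarrow> (\<exists>ch n s'. exec c (init_state ch) n s' \<and> Q (look w s'))"
  and outputs_tm_of: "exec c (init_state ch) n s' \<Longrightarrow> outputs (tm_of K A c Q) w (fst (snd (snd s')))"
proof -
 let ?P = "program c Q" and ?M = "tm_of K A c Q"
 have lP: "length ?P = clen c + 1" by (simp add: program_def)
 have hg: "halts_good ?P (0, init_state ch) (N + 1)" for ch
 proof -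
  from ex[of ch] obtain n s' where "n \<le> N" "exec c (init_state ch) n s'" by blast
  with exec_program[OF this(2), of Q] exec_good[OF this(2)] lP show ?thesis
   unfolding halts_good_def by (intro exI[of _ "n + 1"] exI) auto
 qed
 note path = path_tr[OF hg, where acc = "clen c + 1", folded tm_of_def, unfolded cfg_init[where c = c and Q = Q]]
 show "runs_in_time ?M w (real (N + 1))" unfolding runs_in_time_def
  using path by (metis of_nat_mono)
 have reach: "\<exists>m ch y N'. tr ?P (0, init_state ch) m y \<and> c' = cfg y \<and> halts_good ?P y N'"
  if "reachable ?M w c'" for c'
 proof -
  from that obtain m where "(step ?M w ^^ m) (init ?M) c'"
   unfolding reachable_def by (metis rtranclp_imp_relpowp)
  with path show ?thesis by blast
 qed
 show "runs_in_space ?M w (real H)" unfolding runs_in_space_def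
 proof (intro allI impI ballI)
  fix c' x assume "reachable ?M w c'" and x: "x \<in> set (work c')"
  from reach[OF this(1)] obtain y N' where y: "c' = cfg y" "halts_good ?P y N'" by blast
  obtain q p T v ch where "y = (q, p, T, v, ch)" by (cases y) auto
  with x y halts_good_good[OF y(2)] have "case x of (t, h) \<Rightarrow> h < H \<and> (\<forall>j. t j < A)"
   unfolding good_def by simp
  then show "case x of (t, h) \<Rightarrow> real (h + 1) \<le> real H" by (cases x) simp
 qed
 have halt: "halted ?M w (cfg y)" if "length ?P \<le> fst y" for y
  using no_step_assemble[of ?P "fst y" _ "snd y"] that by (auto simp: halted_def tm_of_def)
 have ex_halt: "\<exists>y. reachable ?M w (cfg y) \<and> halted ?M w (cfg y) \<and> snd y = s' \<and>
   fst y = (if Q (look w s') then clen c + 1 else clen c + 2)"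
  if e: "exec c (init_state ch) n s'" for ch n s'
 proof -
  from tr_path[OF exec_program[OF e, of Q], of "clen c + 1", folded tm_of_def, unfolded cfg_init[where c = c and Q = Q]]
  have "reachable ?M w (cfg (if Q (look w s') then clen c + 1 else clen c + 2, s'))"
   unfolding reachable_def by (meson relpowp_imp_rtranclp)
  moreover have "halted ?M w (cfg (if Q (look w s') then clen c + 1 else clen c + 2, s'))"
   by (rule halt) (simp add: lP)
  ultimately show ?thesis
   by (intro exI[of _ "(if Q (look w s') then clen c + 1 else clen c + 2, s')"] conjI)
    (simp_all only: fst_conv snd_conv)
 qed
 have state_cfg: "state (cfg y) = fst y" for y by (cases y) auto
 have acc: "accepting ?M = {clen c + 1}" by (simp add: tm_of_def assemble_def)
 show "accepts ?M w \<longleftrightarrow> (\<exists>ch n s'. exec c (init_state ch) n s' \<and> Q (look w s'))"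
 proof
  assume "accepts ?M w"
  then obtain c' where c': "reachable ?M w c'" "halted ?M w c'" "state c' \<in> accepting ?M"
   unfolding accepts_def by blast
  from reach[OF c'(1)] obtain m ch y N' where y: "tr ?P (0, init_state ch) m y" "c' = cfg y" by blast
  have fy: "fst y = clen c + 1" using c'(3) y(2) acc state_cfg by simp
  from ex[of ch] obtain n s' where e: "exec c (init_state ch) n s'" by blast
  have "y = (if Q (look w s') then clen c + 1 else clen c + 2, s')"
   by (rule tr_det[OF y(1) exec_program[OF e]]) (auto simp: fy lP)
  with fy have "Q (look w s')" by (simp split: if_splits)
  with e show "\<exists>ch n s'. exec c (init_state ch) n s' \<and> Q (look w s')" by blast
 next
  assume "\<exists>ch n s'. exec c (init_state ch) n s' \<and> Q (look w s')"
  with ex_halt show "accepts ?M w" unfolding accepts_def using acc state_cfg by (metis insertI1)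
 qed
 show "outputs ?M w (fst (snd (snd s')))" if "exec c (init_state ch) n s'"
 proof -
  from ex_halt[OF that] obtain y where "reachable ?M w (cfg y)" "halted ?M w (cfg y)" "snd y = s'"
   by blast
  moreover have "out_word (cfg y) = fst (snd (snd (snd y)))" by (cases y) auto
  ultimately show ?thesis unfolding outputs_def by blast
 qed
qed

end

section \<open>Tapes as registers\<close>

text \<open>\<open>tape ls rs\<close> holds \<open>rev ls @ rs\<close>, followed by blanks, and its head scans the first symbol of \<open>rs\<close>.\<close>

definition tape :: "nat list \<Rightarrow> nat list \<Rightarrow> work_tape" where
 "tape ls rs = (nth_default 0 (rev ls @ rs), length ls)"

definition rd :: "work_tape \<Rightarrow> nat" where
 "rd x = fst x (snd x)"

lemma set_replicate_subset [simp]: "set (replicate k a) \<subseteq> S \<longleftrightarrow> k = 0 \<or> a \<in> S"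
 by (auto simp: set_replicate_conv_if)

lemma rd_tape [simp]: "rd (tape ls []) = 0" "rd (tape ls (x # rs)) = x"
 by (simp_all add: rd_def tape_def nth_default_def nth_append)

lemma nth_default_upd:
 "(nth_default (0::nat) (xs @ y # ys))(length xs := a) = nth_default 0 (xs @ a # ys)"
 by (rule ext) (simp add: nth_default_def nth_append nth_Cons')

lemma nth_default_upd_nil:
 "(nth_default (0::nat) xs)(length xs := a) = nth_default 0 (xs @ [a])"
 by (rule ext) (simp add: nth_default_def nth_append)

lemma tape_zero: "tape ls (rs @ [0]) = tape ls rs"
 by (simp add: tape_def flip: append_assoc)

lemma tape_zero' [simp]: "tape ls [0] = tape ls []" "tape ls [x, 0] = tape ls [x]"
 using tape_zero[of ls "[]"] tape_zero[of ls "[x]"] by simp_all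

lemma act_right [simp]:
 "act (a, Right) (tape ls (x # rs)) = tape (a # ls) rs"
 "act (a, Right) (tape ls []) = tape (a # ls) []"
 using nth_default_upd[of "rev ls" x rs a] nth_default_upd_nil[of "rev ls" a]
 by (simp_all add: tape_def)

lemma act_stay [simp]:
 "act (a, Stay) (tape ls (x # rs)) = tape ls (a # rs)"
 "act (a, Stay) (tape ls []) = tape ls [a]"
 using nth_default_upd[of "rev ls" x rs a] nth_default_upd_nil[of "rev ls" a]
 by (simp_all add: tape_def)

lemma act_back: "act (rd (tape (l # ls) rs), Left) (tape (l # ls) rs) = tape ls (l # rs)"
proof -
 have "act (rd x, Left) x = (fst x, snd x - 1)" for x :: work_tape
  by (cases x) (simp add: rd_def)
 then show ?thesis by (simp only:) (simp add: tape_def)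
qed

lemma act_back_nil: "act (0, Left) (tape (l # ls) []) = tape ls [l]"
 using act_back[of l ls "[]"] by simp

text \<open>Bijective base 2, least significant digit first: the symbol 2 is the digit 1 and the
  symbol 4 is the digit 2. Numerals are unique without a convention about leading zeros, and the
  number 0 is the empty numeral, so a test for 0 is a single look for a blank.\<close>

function rep :: "nat \<Rightarrow> nat list" where
 "rep n = (if n = 0 then [] else (if odd n then 2 else 4) # rep ((n - 1) div 2))"
 by auto
termination by (relation "measure id") auto

declare rep.simps [simp del]

lemma rep_0 [simp]: "rep 0 = []" by (simp add: rep.simps)

lemma rep_odd: "rep (Suc (2 * m)) = 2 # rep m"
 using rep.simps[of "Suc (2 * m)"] by simp

lemma rep_even: "rep (Suc (Suc (2 * m))) = 4 # rep m"
 using rep.simps[of "Suc (Suc (2 * m))"] by simp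

lemma nat_bij2_cases:
 obtains "n = 0" | m where "n = Suc (2 * m)" "m < n" | m where "n = Suc (Suc (2 * m))" "m < n"
proof -
 have "n = 0 \<or> n = Suc (2 * ((n - 1) div 2)) \<or> n = Suc (Suc (2 * ((n - 1) div 2)))" by presburger
 moreover have "n \<noteq> 0 \<Longrightarrow> (n - 1) div 2 < n" by simp
 ultimately show ?thesis using that by (cases "n = 0") blast+
qed

lemma rep_digits: "set (rep n) \<subseteq> {2, 4}"
proof (induction n rule: less_induct)
 case (less n)
 have "set (rep m) \<subseteq> {2, 4}" if "m < n" for m using less that by blast
 then show ?case by (cases n rule: nat_bij2_cases) (simp_all add: rep_odd rep_even)
qed

lemma rep_eq_Nil: "rep n = [] \<longleftrightarrow> n = 0"
 by (simp add: rep.simps)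

lemma length_rep: "2 ^ length (rep n) \<le> Suc n"
proof (induction n rule: less_induct)
 case (less n)
 show ?case
 proof (cases n rule: nat_bij2_cases)
  case (2 m)
  then show ?thesis using less[OF 2(2)] by (simp add: rep_odd)
 next
  case (3 m)
  then show ?thesis using less[OF 3(2)] by (simp add: rep_even)
 qed simp
qed

text \<open>Carry propagation: the initial run of digits 2 turns into digits 1, and the digit behind
  it is either created as 1 or raised from 1 to 2. Read from right to left this is the borrow of
  \<open>dec\<close>.\<close>

lemma rep_Suc:
 "\<exists>k. (rep n = replicate k 4 \<and> rep (Suc n) = replicate (Suc k) 2) \<or>
  (\<exists>rs. rep n = replicate k 4 @ 2 # rs \<and> rep (Suc n) = replicate k 2 @ 4 # rs)"
proof (induction n rule: less_induct)
 case (less n)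
 show ?case
 proof (cases n rule: nat_bij2_cases)
  case 1
  then show ?thesis using rep_odd[of 0] by (intro exI[of _ 0]) simp
 next
  case (2 m)
  then show ?thesis by (intro exI[of _ 0]) (simp add: rep_odd rep_even)
 next
  case (3 m)
  then have s: "rep n = 4 # rep m" "rep (Suc n) = 2 # rep (Suc m)"
   using rep_odd[of "Suc m"] by (simp_all add: rep_even)
  from less[OF 3(2)] obtain k where "(rep m = replicate k 4 \<and> rep (Suc m) = replicate (Suc k) 2) \<or>
   (\<exists>rs. rep m = replicate k 4 @ 2 # rs \<and> rep (Suc m) = replicate k 2 @ 4 # rs)" by blast
  with s show ?thesis by (intro exI[of _ "Suc k"]) auto
 qed
qed

text \<open>Cell 0 carries the end mark 3, at which \<open>rewind\<close> stops; between operations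
  the head rests on the least significant digit.\<close>

definition num :: "nat \<Rightarrow> work_tape" where
 "num n = tape [3] (rep n)"

lemma rd_num: "rd (num n) = 0 \<longleftrightarrow> n = 0"
 using rep_digits[of n] rep_eq_Nil[of n] by (cases "rep n") (auto simp: num_def)

section \<open>Incrementing and decrementing counters\<close>

definition sym :: "nat \<Rightarrow> view \<Rightarrow> nat" where
 "sym r v = snd v ! r"

definition
 "tprim r g = Prim (\<lambda>v. (Stay, map (\<lambda>j. if j = r then g (snd v ! j) else (snd v ! j, Stay)) [0..<length (snd v)], []))"

definition
 "rewind r = While (\<lambda>v. sym r v \<noteq> 3) (tprim r (\<lambda>s. (s, Left))) ;; tprim r (\<lambda>s. (s, Right))"

definition
 "inc r = While (\<lambda>v. sym r v = 4) (tprim r (\<lambda>s. (2, Right))) ;;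
   tprim r (\<lambda>s. (if s = 2 then 4 else 2, Stay)) ;; rewind r"

text \<open>While borrowing, digits 1 become digits 2. If the blank behind the numeral is reached,
  all digits were 1 and the numeral gets shorter: the symbol 4 that was just written last has to be
  erased.\<close>

definition
 "dec r = While (\<lambda>v. sym r v = 2) (tprim r (\<lambda>s. (4, Right))) ;;
   Cond (\<lambda>v. sym r v = 4) (tprim r (\<lambda>s. (2, Stay)))
    (tprim r (\<lambda>s. (0, Left)) ;; tprim r (\<lambda>s. (0, Stay))) ;; rewind r"

definition
 "loop r c = While (\<lambda>v. sym r v \<noteq> 0) (dec r ;; c)"

lemma choiceless_macros [simp]:
 "choiceless (tprim r g)" "choiceless (rewind r)" "choiceless (inc r)" "choiceless (dec r)"
 "choiceless (loop r c) \<longleftrightarrow> choiceless c"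
 by (simp_all add: tprim_def rewind_def inc_def dec_def loop_def)

context machine_env
begin

definition tgood :: "work_tape \<Rightarrow> bool" where
 "tgood x \<longleftrightarrow> snd x < H \<and> (\<forall>j. fst x j < A)"

lemma good_iff: "good (p, T, v, ch) \<longleftrightarrow> p \<le> length w + 1 \<and> length T = K \<and> (\<forall>x\<in>set T. tgood x)"
 by (auto simp: good_def tgood_def)

lemma good_update: "good (p, T, v, ch) \<Longrightarrow> tgood x \<Longrightarrow> good (p, T[r := x], v, ch)"
 unfolding good_iff using set_update_subset_insert[of T r x] by auto

lemma tgood_tape:
 assumes "length ls < H" "set ls \<subseteq> {..<A}" "set rs \<subseteq> {..<A}" "0 < A"
 shows "tgood (tape ls rs)"
proof -
 have "nth_default 0 xs j < A" if "set xs \<subseteq> {..<A}" for xs j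
  using that assms(4) by (auto simp: nth_default_def dest!: nth_mem)
 from this[of "rev ls @ rs"] assms show ?thesis by (simp add: tgood_def tape_def)
qed

text \<open>A Hoare triple for tape \<open>r\<close> alone; the quantification over the rest of the
  state is the frame rule.\<close>

definition tx :: "com \<Rightarrow> nat \<Rightarrow> work_tape \<Rightarrow> nat \<Rightarrow> work_tape \<Rightarrow> bool" where
 "tx c r x n y \<longleftrightarrow> (\<forall>p T v ch. good (p, T, v, ch) \<longrightarrow> exec c (p, T[r := x], v, ch) n (p, T[r := y], v, ch))"

lemma sym_look [simp]: "r < length T \<Longrightarrow> sym r (look w (p, T[r := x], v, ch)) = rd x"
 by (simp add: sym_def look_def rd_def case_prod_unfold)

lemma sym_look': "r < length T \<Longrightarrow> sym r (look w (p, T, v, ch)) = rd (T ! r)"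
 by (simp add: sym_def look_def rd_def case_prod_unfold)

lemma tx_prim:
 assumes "r < K" "tgood x" "tgood (act (g (rd x)) x)"
 shows "tx (tprim r g) r x 1 (act (g (rd x)) x)"
 unfolding tx_def
proof (intro allI impI)
 fix p T v and ch :: "nat \<Rightarrow> bool"
 assume g: "good (p, T, v, ch)"
 let ?s = "(p, T[r := x], v, ch)"
 let ?f = "\<lambda>v :: view. (Stay, map (\<lambda>j. if j = r then g (snd v ! j) else (snd v ! j, Stay)) [0..<length (snd v)], [] :: bool list)"
 from g have len: "length T = K" and p: "p \<le> length w + 1" by (simp_all add: good_iff)
 have "map2 act (map (\<lambda>j. if j = r then g (snd (look w ?s) ! j) else (snd (look w ?s) ! j, Stay))
   [0..<length (snd (look w ?s))]) (T[r := x]) = T[r := act (g (rd x)) x]"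
 proof (rule nth_equalityI)
  fix i assume "i < length (map2 act (map (\<lambda>j. if j = r then g (snd (look w ?s) ! j) else (snd (look w ?s) ! j, Stay))
   [0..<length (snd (look w ?s))]) (T[r := x]))"
  then have i: "i < length T" by (simp add: look_def)
  have a: "act (fst y (snd y), Stay) y = y" for y :: work_tape by (cases y) simp
  from i show "map2 act (map (\<lambda>j. if j = r then g (snd (look w ?s) ! j) else (snd (look w ?s) ! j, Stay))
   [0..<length (snd (look w ?s))]) (T[r := x]) ! i = T[r := act (g (rd x)) x] ! i"
   using a by (auto simp: look_def rd_def case_prod_unfold nth_list_update)
 qed (simp add: look_def)
 then have e: "eff w (?f (look w ?s)) ?s = (p, T[r := act (g (rd x)) x], v, ch)"
  using p by (simp add: eff_def)
 have "exec (Prim ?f) ?s 1 (eff w (?f (look w ?s)) ?s)"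
  by (rule exec.Prim, rule good_update[OF g assms(2)], simp add: look_def len, unfold e,
   rule good_update[OF g assms(3)])
 then show "exec (tprim r g) ?s 1 (p, T[r := act (g (rd x)) x], v, ch)"
  unfolding e tprim_def .
qed

lemma tx_prim': "r < K \<Longrightarrow> tgood x \<Longrightarrow> act (g (rd x)) x = y \<Longrightarrow> tgood y \<Longrightarrow> tx (tprim r g) r x 1 y"
 using tx_prim by blast

lemma tx_seq: "tx a r x n y \<Longrightarrow> tx b r y m z \<Longrightarrow> tx (a ;; b) r x (n + m) z"
 unfolding tx_def by (blast intro: exec.Seq)

lemma tx_condT: "r < K \<Longrightarrow> P (rd x) \<Longrightarrow> tx a r x n y \<Longrightarrow> tx (Cond (\<lambda>v. P (sym r v)) a b) r x (n + 2) y"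
 unfolding tx_def by (intro allI impI exec.CondT) (auto simp: good_iff)

lemma tx_condF: "r < K \<Longrightarrow> \<not> P (rd x) \<Longrightarrow> tx b r x n y \<Longrightarrow> tx (Cond (\<lambda>v. P (sym r v)) a b) r x (n + 1) y"
 unfolding tx_def by (intro allI impI exec.CondF) (auto simp: good_iff)

lemma tx_whileF: "r < K \<Longrightarrow> tgood x \<Longrightarrow> \<not> P (rd x) \<Longrightarrow> tx (While (\<lambda>v. P (sym r v)) a) r x 1 x"
 unfolding tx_def by (intro allI impI exec.WhileF good_update) (auto simp: good_iff)

lemma tx_whileT: "r < K \<Longrightarrow> P (rd x) \<Longrightarrow> tx a r x n y \<Longrightarrow> tx (While (\<lambda>v. P (sym r v)) a) r y m z \<Longrightarrow>
  tx (While (\<lambda>v. P (sym r v)) a) r x (n + 2 + m) z"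
 unfolding tx_def
proof (intro allI impI)
 fix p T v and ch :: "nat \<Rightarrow> bool"
 assume a: "r < K" "P (rd x)" "\<forall>p T v ch. good (p, T, v, ch) \<longrightarrow> exec a (p, T[r := x], v, ch) n (p, T[r := y], v, ch)"
  "\<forall>p T v ch. good (p, T, v, ch) \<longrightarrow> exec (While (\<lambda>v. P (sym r v)) a) (p, T[r := y], v, ch) m (p, T[r := z], v, ch)"
  and g: "good (p, T, v, ch)"
 show "exec (While (\<lambda>v. P (sym r v)) a) (p, T[r := x], v, ch) (n + 2 + m) (p, T[r := z], v, ch)"
  by (rule exec.WhileT[of _ _ a n "(p, T[r := y], v, ch)"]) (use a g in \<open>auto simp: good_iff\<close>)
qed

lemma tx_run:
 assumes "r < K" "a \<noteq> b" "A > 4" "a < A" "b < A" "set ls \<subseteq> {..<A}" "set rs \<subseteq> {..<A}"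
  "length ls + k < H" "rd (tape [] rs) \<noteq> a"
 shows "tx (While (\<lambda>v. sym r v = a) (tprim r (\<lambda>s. (b, Right)))) r (tape ls (replicate k a @ rs))
  (3 * k + 1) (tape (replicate k b @ ls) rs)"
 using assms(6,8)
proof (induction k arbitrary: ls)
 case 0
 have "rd (tape ls rs) \<noteq> a" using assms(9) by (cases rs) auto
 then show ?case using tx_whileF[OF assms(1) tgood_tape, of ls rs "\<lambda>s. s = a"] 0 assms by auto
next
 case (Suc k)
 have r: "set (replicate k a @ rs) \<subseteq> {..<A}" using assms by auto
 have "tx (tprim r (\<lambda>s. (b, Right))) r (tape ls (replicate (Suc k) a @ rs)) 1 (tape (b # ls) (replicate k a @ rs))"
  by (rule tx_prim') (use Suc.prems assms r in \<open>auto intro!: tgood_tape\<close>)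
 moreover have "tx (While (\<lambda>v. sym r v = a) (tprim r (\<lambda>s. (b, Right)))) r (tape (b # ls) (replicate k a @ rs))
  (3 * k + 1) (tape (replicate k b @ b # ls) rs)"
  by (rule Suc.IH) (use Suc.prems assms in auto)
 ultimately have "tx (While (\<lambda>v. sym r v = a) (tprim r (\<lambda>s. (b, Right)))) r (tape ls (replicate (Suc k) a @ rs))
  (1 + 2 + (3 * k + 1)) (tape (replicate k b @ b # ls) rs)"
  by (intro tx_whileT[where P = "\<lambda>s. s = a"] assms(1)) auto
 moreover have "1 + 2 + (3 * k + 1) = 3 * Suc k + 1" "replicate k b @ b # ls = replicate (Suc k) b @ ls"
  by (simp_all add: replicate_app_Cons_same)
 ultimately show ?case by (simp only:)
qed

lemma tx_rewind:
 assumes "r < K" "A > 4" "3 \<notin> set xs" "set xs \<subseteq> {..<A}" "set rs \<subseteq> {..<A}" "length xs + 1 < H"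
  "rd (tape [] rs) \<noteq> 3"
 shows "tx (rewind r) r (tape (xs @ [3]) rs) (3 * length xs + 5) (tape [3] (rev xs @ rs))"
proof -
 have "tx (While (\<lambda>v. sym r v \<noteq> 3) (tprim r (\<lambda>s. (s, Left)))) r (tape (xs @ [3]) rs)
  (3 * length xs + 4) (tape [] (3 # rev xs @ rs))"
  using assms(3-)
 proof (induction xs arbitrary: rs)
  case Nil
  have "rd (tape [3] rs) \<noteq> 3" using Nil by (cases rs) auto
  moreover have "tx (tprim r (\<lambda>s. (s, Left))) r (tape [3] rs) 1 (tape [] (3 # rs))"
   by (rule tx_prim') (use Nil assms in \<open>auto intro!: tgood_tape simp: act_back\<close>)
  moreover have "tx (While (\<lambda>v. sym r v \<noteq> 3) (tprim r (\<lambda>s. (s, Left)))) r (tape [] (3 # rs)) 1 (tape [] (3 # rs))"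
   by (rule tx_whileF) (use Nil assms in \<open>auto intro!: tgood_tape\<close>)
  ultimately have "tx (While (\<lambda>v. sym r v \<noteq> 3) (tprim r (\<lambda>s. (s, Left)))) r (tape [3] rs) (1 + 2 + 1) (tape [] (3 # rs))"
   by (intro tx_whileT[where P = "\<lambda>s. s \<noteq> 3"] assms(1))
  then show ?case by (simp add: eval_nat_numeral)
 next
  case (Cons x xs)
  have "rd (tape (x # xs @ [3]) rs) \<noteq> 3" using Cons.prems by (cases rs) auto
  moreover have "tx (tprim r (\<lambda>s. (s, Left))) r (tape (x # xs @ [3]) rs) 1 (tape (xs @ [3]) (x # rs))"
   by (rule tx_prim') (use Cons.prems assms in \<open>auto intro!: tgood_tape simp: act_back\<close>)
  moreover have "tx (While (\<lambda>v. sym r v \<noteq> 3) (tprim r (\<lambda>s. (s, Left)))) r (tape (xs @ [3]) (x # rs))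
   (3 * length xs + 4) (tape [] (3 # rev xs @ x # rs))"
   by (rule Cons.IH) (use Cons.prems in auto)
  ultimately have "tx (While (\<lambda>v. sym r v \<noteq> 3) (tprim r (\<lambda>s. (s, Left)))) r (tape (x # xs @ [3]) rs)
   (1 + 2 + (3 * length xs + 4)) (tape [] (3 # rev xs @ x # rs))"
   by (intro tx_whileT[where P = "\<lambda>s. s \<noteq> 3"] assms(1))
  moreover have "1 + 2 + (3 * length xs + 4) = 3 * length (x # xs) + 4" by simp
  ultimately show ?case by (simp only: append_Cons append_assoc append_Nil rev.simps)
 qed
 moreover have "tx (tprim r (\<lambda>s. (s, Right))) r (tape [] (3 # rev xs @ rs)) 1 (tape [3] (rev xs @ rs))"
  by (rule tx_prim') (use assms in \<open>auto intro!: tgood_tape\<close>)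
 ultimately have "tx (rewind r) r (tape (xs @ [3]) rs) (3 * length xs + 4 + 1) (tape [3] (rev xs @ rs))"
  unfolding rewind_def by (rule tx_seq)
 moreover have "3 * length xs + 4 + 1 = 3 * length xs + 5" by simp
 ultimately show ?thesis by (simp only:)
qed

lemma rep_syms: "A > 4 \<Longrightarrow> set (rep n) \<subseteq> {..<A}"
 using rep_digits[of n] by auto

lemma tx_inc:
 assumes "r < K" "A > 4" "length (rep n) + 3 < H"
 shows "\<exists>m \<le> 6 * length (rep n) + 9. tx (inc r) r (num n) m (num (Suc n))"
proof -
 from rep_Suc[of n] obtain k where k: "(rep n = replicate k 4 \<and> rep (Suc n) = replicate (Suc k) 2) \<or>
  (\<exists>rs. rep n = replicate k 4 @ 2 # rs \<and> rep (Suc n) = replicate k 2 @ 4 # rs)" by blast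
 then obtain rs rs' where rs: "rep n = replicate k 4 @ rs" "rep (Suc n) = replicate k 2 @ rs'"
  "(rs = [] \<and> rs' = [2]) \<or> (\<exists>zs. rs = 2 # zs \<and> rs' = 4 # zs)"
  by (metis append_Nil2 replicate_Suc replicate_append_same)
 have s: "set rs \<subseteq> {..<A}" "set rs' \<subseteq> {..<A}"
  using rep_syms[OF assms(2), of n] rep_syms[OF assms(2), of "Suc n"] rs by auto
 have kl: "k \<le> length (rep n)" using rs(1) by simp
 have "tx (While (\<lambda>v. sym r v = 4) (tprim r (\<lambda>s. (2, Right)))) r (num n) (3 * k + 1) (tape (replicate k 2 @ [3]) rs)"
  unfolding num_def rs(1) by (rule tx_run) (use assms s rs kl in auto)
 moreover have "tx (tprim r (\<lambda>s. (if s = 2 then 4 else 2, Stay))) r (tape (replicate k 2 @ [3]) rs) 1 (tape (replicate k 2 @ [3]) rs')"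
  by (rule tx_prim') (use assms rs s kl in \<open>auto intro!: tgood_tape\<close>)
 moreover have "tx (rewind r) r (tape (replicate k 2 @ [3]) rs') (3 * k + 5) (num (Suc n))"
  using tx_rewind[of r "replicate k 2" rs'] assms s rs kl unfolding num_def rs(2)
  by (auto simp: subset_iff)
 ultimately have "tx (inc r) r (num n) (3 * k + 1 + (1 + (3 * k + 5))) (num (Suc n))"
  unfolding inc_def by (intro tx_seq)
 with kl show ?thesis by (intro exI conjI) simp_all
qed

lemma tx_dec:
 assumes "r < K" "A > 4" "length (rep (Suc n)) + 3 < H"
 shows "\<exists>m \<le> 6 * length (rep (Suc n)) + 12. tx (dec r) r (num (Suc n)) m (num n)"
proof -
 from rep_Suc[of n] obtain k where "(rep n = replicate k 4 \<and> rep (Suc n) = replicate (Suc k) 2) \<or>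
  (\<exists>rs. rep n = replicate k 4 @ 2 # rs \<and> rep (Suc n) = replicate k 2 @ 4 # rs)" by blast
 then show ?thesis
 proof
  assume k: "rep n = replicate k 4 \<and> rep (Suc n) = replicate (Suc k) 2"
  have kl: "Suc k = length (rep (Suc n))" using k by simp
  with assms have kH: "k + 4 < H" by simp
  have "tx (While (\<lambda>v. sym r v = 2) (tprim r (\<lambda>s. (4, Right)))) r (tape [3] (replicate (Suc k) 2 @ []))
   (3 * Suc k + 1) (tape (replicate (Suc k) 4 @ [3]) [])"
   by (rule tx_run) (use assms(1,2) kH in auto)
  moreover have "tx (tprim r (\<lambda>s. (0, Left)) ;; tprim r (\<lambda>s. (0, Stay))) r (tape (replicate (Suc k) 4 @ [3]) [])
   (1 + 1) (tape (replicate k 4 @ [3]) [])"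
   by (rule tx_seq[of _ _ _ _ "tape (replicate k 4 @ [3]) [4]"]; rule tx_prim')
    (use assms(1,2) kH in \<open>auto intro!: tgood_tape simp: act_back_nil\<close>)
  then have "tx (Cond (\<lambda>v. sym r v = 4) (tprim r (\<lambda>s. (2, Stay)))
    (tprim r (\<lambda>s. (0, Left)) ;; tprim r (\<lambda>s. (0, Stay)))) r (tape (replicate (Suc k) 4 @ [3]) [])
   (1 + 1 + 1) (tape (replicate k 4 @ [3]) [])"
   by (intro tx_condF[where P = "\<lambda>s. s = 4"]) (use assms in auto)
  moreover have "tx (rewind r) r (tape (replicate k 4 @ [3]) []) (3 * k + 5) (num n)"
   using tx_rewind[of r "replicate k 4" "[]"] assms(1,2) k kH unfolding num_def by auto
  ultimately have "tx (dec r) r (num (Suc n)) (3 * Suc k + 1 + (1 + 1 + 1 + (3 * k + 5))) (num n)"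
   unfolding dec_def num_def[of "Suc n"] k[THEN conjunct2] append_Nil2 by (intro tx_seq)
  with kl show ?thesis by (intro exI conjI) auto
 next
  assume "\<exists>rs. rep n = replicate k 4 @ 2 # rs \<and> rep (Suc n) = replicate k 2 @ 4 # rs"
  then obtain rs where k: "rep n = replicate k 4 @ 2 # rs" "rep (Suc n) = replicate k 2 @ 4 # rs" by blast
  have kl: "k \<le> length (rep (Suc n))" using k by simp
  have s: "set (4 # rs) \<subseteq> {..<A}"  using rep_syms[OF assms(2), of "Suc n"] k by auto
  have "tx (While (\<lambda>v. sym r v = 2) (tprim r (\<lambda>s. (4, Right)))) r (num (Suc n))
   (3 * k + 1) (tape (replicate k 4 @ [3]) (4 # rs))"
   unfolding num_def k by (rule tx_run) (use assms kl s in auto)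
  moreover have "tx (tprim r (\<lambda>s. (2, Stay))) r (tape (replicate k 4 @ [3]) (4 # rs)) 1
    (tape (replicate k 4 @ [3]) (2 # rs))"
   by (rule tx_prim') (use assms kl s in \<open>auto intro!: tgood_tape\<close>)
  then have "tx (Cond (\<lambda>v. sym r v = 4) (tprim r (\<lambda>s. (2, Stay)))
    (tprim r (\<lambda>s. (0, Left)) ;; tprim r (\<lambda>s. (0, Stay)))) r (tape (replicate k 4 @ [3]) (4 # rs))
   (1 + 2) (tape (replicate k 4 @ [3]) (2 # rs))"
   by (intro tx_condT[where P = "\<lambda>s. s = 4"]) (use assms in auto)
  moreover have "tx (rewind r) r (tape (replicate k 4 @ [3]) (2 # rs)) (3 * k + 5) (num n)"
   using tx_rewind[of r "replicate k 4" "2 # rs"] assms s kl unfolding num_def k(1)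
   by (auto simp: set_replicate_conv_if)
  ultimately have "tx (dec r) r (num (Suc n)) (3 * k + 1 + (1 + 2 + (3 * k + 5))) (num n)"
   unfolding dec_def by (intro tx_seq)
  with kl show ?thesis by (intro exI conjI) auto
 qed
qed

text \<open>From here on only upper bounds on the number of steps are tracked, which lets the two
  branches of a test share one cost.\<close>

definition
 "ex c t s s' \<longleftrightarrow> (\<exists>n\<le>t. exec c s n s')"

lemma ex_good: "ex c t s s' \<Longrightarrow> good s \<and> good s'"
 unfolding ex_def using exec_good by blast

lemma ex_mono: "ex c t s s' \<Longrightarrow> t \<le> t' \<Longrightarrow> ex c t' s s'"
 unfolding ex_def using order_trans by blast

lemma ex_seq:
 assumes "ex a t s s'" "ex b u s' s''"
 shows "ex (a ;; b) (t + u) s s''"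
proof -
 from assms obtain n m where "n \<le> t" "exec a s n s'" "m \<le> u" "exec b s' m s''" unfolding ex_def by blast
 then show ?thesis unfolding ex_def by (intro exI[of _ "n + m"] conjI exec.Seq) auto
qed

lemma ex_cond:
 assumes "ex (if P (look w s) then a else b) t s s'"
 shows "ex (Cond P a b) (t + 2) s s'"
proof -
 from assms obtain n where n: "n \<le> t" "exec (if P (look w s) then a else b) s n s'" unfolding ex_def by blast
 show ?thesis
 proof (cases "P (look w s)")
  case True
  with n show ?thesis unfolding ex_def by (intro exI[of _ "n + 2"] conjI exec.CondT) auto
 next
  case False
  with n show ?thesis unfolding ex_def by (intro exI[of _ "n + 1"] conjI exec.CondF) auto
 qed
qed

lemma ex_choose:
 assumes "good s" "ex (if next_choice s then a else b) t (tail_choice s) s'"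
 shows "ex (Choose a b) (t + 2) s s'"
proof -
 from assms obtain n where n: "n \<le> t" "exec (if next_choice s then a else b) (tail_choice s) n s'"
  unfolding ex_def by blast
 show ?thesis
 proof (cases "next_choice s")
  case True
  with n assms show ?thesis unfolding ex_def by (intro exI[of _ "n + 2"] conjI exec.ChooseT) auto
 next
  case False
  with n assms show ?thesis unfolding ex_def by (intro exI[of _ "n + 1"] conjI exec.ChooseF) auto
 qed
qed

lemma ex_while:
 assumes "\<And>i. i < n \<Longrightarrow> ex c t (st i) (st (Suc i))" "\<And>i. i < n \<Longrightarrow> P (look w (st i))"
  "\<not> P (look w (st n))" "good (st n)"
 shows "ex (While P c) (n * (t + 2) + 1) (st 0) (st n)"
proof -
 have "ex (While P c) (j * (t + 2) + 1) (st (n - j)) (st n)" if "j \<le> n" for j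
  using that
 proof (induction j)
  case 0
  have "exec (While P c) (st n) 1 (st n)" by (rule exec.WhileF) (use assms in auto)
  then show ?case unfolding ex_def by auto
 next
  case (Suc j)
  let ?i = "n - Suc j"
  have i: "?i < n" "Suc ?i = n - j" using Suc.prems by auto
  from Suc obtain m where m: "m \<le> j * (t + 2) + 1" "exec (While P c) (st (Suc ?i)) m (st n)"
   unfolding ex_def i(2) by auto
  from assms(1)[OF i(1)] obtain m' where m': "m' \<le> t" "exec c (st ?i) m' (st (Suc ?i))"
   unfolding ex_def by blast
  have "exec (While P c) (st ?i) (m' + 2 + m) (st n)"
   by (rule exec.WhileT[OF _ m'(2) m(2)]) (rule assms(2)[OF i(1)])
  with m m' show ?case unfolding ex_def by (intro exI[of _ "m' + 2 + m"]) auto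
 qed
 from this[of n] show ?thesis by simp
qed

end

text \<open>The tapes below \<open>R\<close> are counters with values up to \<open>B\<close>, hence
  with at most \<open>h\<close> digits. The slack in \<open>h + 3 < H\<close> leaves room for the
  end mark, for the digit that an increment may append, and for the blank behind the
  numeral.\<close>

locale reg_env = machine_env w K A H for w K A H +
 fixes R B h :: nat
 assumes A4: "A > 4" and RK: "R \<le> K" and hB: "B < 2 ^ h" and hH: "h + 3 < H"
begin

definition mk :: "(nat \<Rightarrow> nat) \<Rightarrow> work_tape list \<Rightarrow> work_tape list" where
 "mk g oth = map (\<lambda>i. num (g i)) [0..<R] @ oth"

definition okst :: "nat \<Rightarrow> (nat \<Rightarrow> nat) \<Rightarrow> work_tape list \<Rightarrow> bool" where
 "okst p g oth \<longleftrightarrow> p \<le> length w + 1 \<and> (\<forall>i<R. g i \<le> B) \<and> R + length oth = K \<and> (\<forall>x\<in>set oth. tgood x)"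

lemma length_rep_le: "n \<le> B \<Longrightarrow> length (rep n) \<le> h"
proof -
 assume "n \<le> B"
 with hB length_rep[of n] have "(2::nat) ^ length (rep n) \<le> 2 ^ h" by linarith
 then show ?thesis by (simp add: power_le_imp_le_exp)
qed

lemma tgood_num: "n \<le> B \<Longrightarrow> tgood (num n)"
 unfolding num_def by (rule tgood_tape) (use rep_syms[of n] A4 hH in auto)

lemma okst_good: "okst p g oth \<Longrightarrow> good (p, mk g oth, v, ch)"
 by (auto simp: okst_def good_iff mk_def intro!: tgood_num)

lemma mk_upd: "r < R \<Longrightarrow> mk (g(r := n)) oth = (mk g oth)[r := num n]"
 unfolding mk_def by (rule nth_equalityI) (auto simp: nth_append nth_list_update)

lemma mk_self: "r < R \<Longrightarrow> (mk g oth)[r := num (g r)] = mk g oth"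
 using mk_upd[of r g "g r" oth] by simp

lemma sym_mk: "r < R \<Longrightarrow> sym r (look w (p, mk g oth, v, ch)) = 0 \<longleftrightarrow> g r = 0"
 by (subst sym_look') (simp_all add: mk_def nth_append rd_num)

lemma okst_upd: "okst p g oth \<Longrightarrow> n \<le> B \<Longrightarrow> okst p (g(r := n)) oth"
 by (auto simp: okst_def)

definition cI :: nat where "cI = 6 * h + 12"

lemma ex_tx:
 assumes "tx c r (num (g r)) m (num n)" "okst p g oth" "r < R"
 shows "exec c (p, mk g oth, v, ch) m (p, mk (g(r := n)) oth, v, ch)"
 using assms(1)[unfolded tx_def, rule_format, OF okst_good[OF assms(2)]] assms(3)
 by (simp add: mk_self mk_upd)

lemma ex_inc:
 assumes "okst p g oth" "r < R"
 shows "ex (inc r) cI (p, mk g oth, v, ch) (p, mk (g(r := Suc (g r))) oth, v, ch)"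
proof -
 have l: "length (rep (g r)) \<le> h" using assms by (intro length_rep_le) (auto simp: okst_def)
 then obtain m where m: "m \<le> 6 * length (rep (g r)) + 9" "tx (inc r) r (num (g r)) m (num (Suc (g r)))"
  using tx_inc[of r "g r"] A4 RK hH assms(2) by auto
 from ex_tx[OF m(2) assms] m(1) l show ?thesis unfolding ex_def cI_def by (intro exI[of _ m]) auto
qed

lemma ex_dec:
 assumes "okst p g oth" "r < R" "g r = Suc n"
 shows "ex (dec r) cI (p, mk g oth, v, ch) (p, mk (g(r := n)) oth, v, ch)"
proof -
 have l: "length (rep (Suc n)) \<le> h" using assms by (intro length_rep_le) (auto simp: okst_def)
 then obtain m where m: "m \<le> 6 * length (rep (Suc n)) + 12" "tx (dec r) r (num (g r)) m (num n)"
  using tx_dec[of r n] A4 RK hH assms(2,3) by auto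
 from ex_tx[OF m(2) assms(1,2)] m(1) l show ?thesis unfolding ex_def cI_def by (intro exI[of _ m]) auto
qed

text \<open>The families \<open>p\<close>, \<open>F\<close>, \<open>oth\<close>, \<open>v\<close>
  and \<open>ch\<close> describe the state after \<open>i\<close> rounds; the loop register
  overrides its entry in \<open>F i\<close> and counts down. The body sees the register already
  decremented.\<close>

lemma ex_loop:
 assumes ok: "\<And>i. i \<le> n \<Longrightarrow> okst (p i) ((F i)(r := n - i)) (oth i)" and r: "r < R"
  and body: "\<And>i. i < n \<Longrightarrow> ex c t (p i, mk ((F i)(r := n - Suc i)) (oth i), v i, ch i)
    (p (Suc i), mk ((F (Suc i))(r := n - Suc i)) (oth (Suc i)), v (Suc i), ch (Suc i))"
 shows "ex (loop r c) (n * (cI + t + 2) + 1) (p 0, mk ((F 0)(r := n)) (oth 0), v 0, ch 0)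
    (p n, mk ((F n)(r := 0)) (oth n), v n, ch n)"
proof -
 let ?st = "\<lambda>i. (p i, mk ((F i)(r := n - i)) (oth i), v i, ch i)"
 have "ex (While (\<lambda>v. sym r v \<noteq> 0) (dec r ;; c)) (n * (cI + t + 2) + 1) (?st 0) (?st n)"
 proof (rule ex_while[where st = ?st and n = n])
  fix i assume i: "i < n"
  have "ex (dec r) cI (?st i) (p i, mk (((F i)(r := n - i))(r := n - Suc i)) (oth i), v i, ch i)"
   by (rule ex_dec) (use ok[of i] r i in auto)
  then have "ex (dec r) cI (?st i) (p i, mk ((F i)(r := n - Suc i)) (oth i), v i, ch i)" by simp
  with body[OF i] show "ex (dec r ;; c) (cI + t) (?st i) (?st (Suc i))" by (intro ex_seq)
  show "sym r (look w (?st i)) \<noteq> 0" using i sym_mk[OF r] by simp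
 next
  show "\<not> sym r (look w (?st n)) \<noteq> 0" using sym_mk[OF r] by simp
  show "good (?st n)" by (rule okst_good) (use ok in blast)
 qed
 then show ?thesis by (simp add: loop_def)
qed

end

section \<open>Arithmetic expressions of polynomial growth\<close>

text \<open>
 \<open>Fold x y n d e\<close> starts with the value 0 and performs \<open>n\<close> rounds. In a round with index \<open>x\<close> and
 current value \<open>y\<close> the new value is \<open>e\<close>, cut off at \<open>y + d\<close>; as \<open>d\<close> may not depend on \<open>y\<close>,
 values stay polynomial. \<open>In e\<close> reads the input tape at position \<open>e\<close>, and \<open>Get e\<close> the auxiliary
 bit array, whose largest index is \<open>c\<close> in the semantics below.
\<close>

datatype aexp = Con nat | Var nat | Ari bool aexp aexp | In aexp | Get aexp
 | Fold nat nat aexp aexp aexp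

abbreviation "Add \<equiv> Ari True"
abbreviation "Sub \<equiv> Ari False"

fun in_code :: "insym \<Rightarrow> nat" where
 "in_code (Bit b) = of_bool b"
| "in_code _ = 2"

primrec ev :: "bool list \<Rightarrow> (nat \<Rightarrow> bool) \<Rightarrow> nat \<Rightarrow> aexp \<Rightarrow> (nat \<Rightarrow> nat) \<Rightarrow> nat" where
 "ev w a c (Con k) E = k"
| "ev w a c (Var x) E = E x"
| "ev w a c (Ari b d e) E = (if b then ev w a c d E + ev w a c e E else ev w a c d E - ev w a c e E)"
| "ev w a c (In e) E = in_code (scan_input w (ev w a c e E))"
| "ev w a c (Get e) E = of_bool (a (min (ev w a c e E) c))"
| "ev w a c (Fold x y n d e) E =
   rec_nat 0 (\<lambda>i s. min (s + ev w a c d (E(x := i))) (ev w a c e (E(x := i, y := s)))) (ev w a c n E)"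

lemma ev_Add [simp]: "ev w a c (Add d e) E = ev w a c d E + ev w a c e E"
 and ev_Sub [simp]: "ev w a c (Sub d e) E = ev w a c d E - ev w a c e E"
 by simp_all

text \<open>If all variables are at most \<open>X\<close>, then \<open>X ^ dg e\<close> bounds the
  value (\<open>ev_bound\<close>) and, up to the factor \<open>U\<close>, the running time of the
  compiled code (\<open>ex_cmp\<close>). The product in the case of \<open>Ari\<close> arises
  because the second operand is computed while a register holds the first one, of size
  \<open>X ^ dg d\<close>. The additive constants absorb the factors of the register macros through
  \<open>power_absorb\<close>.\<close>

primrec dg :: "aexp \<Rightarrow> nat" where
 "dg (Con k) = k + 2"
| "dg (Var x) = 4"
| "dg (Ari b d e) = dg d + dg d * dg e + dg e + 3"
| "dg (In e) = dg e + 4"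
| "dg (Get e) = dg e + 6"
| "dg (Fold x y n d e) = 11 * (dg n * (1 + dg d) * (2 * dg e + dg d + 2))"

lemma dg_pos: "0 < dg e"
 by (induction e) auto

text \<open>Both powers are at least 2, and then their sum is at most their product.\<close>

lemma sum_le_power:
 fixes X :: nat
 assumes "2 \<le> X" "u \<le> X ^ i" "v \<le> X ^ j" "0 < i" "0 < j"
 shows "u + v \<le> X ^ (i + j)"
proof -
 have "X ^ 1 \<le> X ^ i" "X ^ 1 \<le> X ^ j" using assms by (intro power_increasing; simp)+
 then have "2 \<le> X ^ i" "2 \<le> X ^ j" using assms(1) by simp_all
 then obtain p q where "X ^ i = p + 2" "X ^ j = q + 2" by (metis le_add_diff_inverse2)
 then have "X ^ i + X ^ j \<le> X ^ i * X ^ j" by simp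
 with assms show ?thesis by (simp add: power_add)
qed

lemma le_power_mono:
 fixes X :: nat
 shows "u \<le> X ^ i \<Longrightarrow> i \<le> j \<Longrightarrow> 2 \<le> X \<Longrightarrow> u \<le> X ^ j"
 by (metis le_trans one_le_numeral power_increasing)

lemma power_absorb: "2 \<le> (X::nat) \<Longrightarrow> c \<le> 2 ^ k \<Longrightarrow> c * M \<le> X ^ k * M"
 by (meson le_trans mult_le_mono1 power_mono zero_le)

text \<open>The cutoff lets the value grow by at most \<open>D\<close> in a round, whatever
  \<open>e\<close> is. This is what keeps nested folds polynomial.\<close>

lemma fold_bound:
 assumes "\<And>i. i < n \<Longrightarrow> d i \<le> (D :: nat)"
 shows "rec_nat 0 (\<lambda>i s. min (s + d i) (e i s)) n \<le> n * D"
 using assms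
proof (induction n)
 case (Suc n)
 then have "rec_nat 0 (\<lambda>i s. min (s + d i) (e i s)) n \<le> n * D" "d n \<le> D" by auto
 then show ?case by (simp add: min_def)
qed simp

lemma ev_bound:
 assumes "2 \<le> X" "\<And>x. E x \<le> X"
 shows "ev w a c e E \<le> X ^ dg e"
 using assms
proof (induction e arbitrary: E X)
 case (Con k)
 have "k < 2 ^ k" by (rule less_exp)
 also have "(2::nat) ^ k \<le> X ^ k" using Con.prems by (intro power_mono) auto
 also have "\<dots> \<le> X ^ (k + 2)" using Con.prems by (intro power_increasing) auto
 finally show ?case by simp
next
 case (Var x)
 have "E x \<le> X ^ 1" using Var by simp
 then have "E x \<le> X ^ 4" by (rule le_power_mono) (use Var in auto)
 then show ?case by simp
next
 case (Ari b d e)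
 have "ev w a c d E + ev w a c e E \<le> X ^ (dg d + dg e)"
  by (intro sum_le_power Ari dg_pos)
 then have "ev w a c (Ari b d e) E \<le> X ^ (dg d + dg e)"
  by (cases b) (auto intro: order_trans[OF diff_le_self] add_leD1)
 then show ?case by (rule le_power_mono) (use Ari in auto)
next
 case (In e)
 have "in_code s \<le> 2" for s by (cases s) auto
 from this[of "scan_input w (ev w a c e E)"] In.prems have "ev w a c (In e) E \<le> X ^ 1" by simp
 then show ?case by (rule le_power_mono) (use In.prems in auto)
next
 case (Get e)
 have "ev w a c (Get e) E \<le> X ^ 1" using Get.prems by simp
 then show ?case by (rule le_power_mono) (use Get.prems in auto)
next
 case (Fold x y n d e)
 let ?N = "X ^ dg n"
 have n: "ev w a c n E \<le> ?N" by (intro Fold)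
 have "X ^ 1 \<le> ?N" using Fold.prems dg_pos[of n] by (intro power_increasing) auto
 then have X: "X \<le> ?N" by simp
 have "ev w a c d (E(x := i)) \<le> ?N ^ dg d" if "i < ev w a c n E" for i
  by (rule Fold.IH) (use Fold.prems X n that order_trans in auto)
 from fold_bound[OF this] have "ev w a c (Fold x y n d e) E \<le> ev w a c n E * ?N ^ dg d" by simp
 also have "\<dots> \<le> ?N * ?N ^ dg d" using n by simp
 finally have "ev w a c (Fold x y n d e) E \<le> X ^ (dg n * (1 + dg d))" by (simp add: power_mult power_add)
 then show ?case by (rule le_power_mono) (use Fold.prems in \<open>auto simp: algebra_simps\<close>)
qed

section \<open>Register macros and the compilation of expressions\<close>

definition "nop = Prim stay"
definition "mvR = Prim (\<lambda>v. (Right, map (\<lambda>s. (s, Stay)) (snd v), []))"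
definition "mvL = Prim (\<lambda>v. (Left, map (\<lambda>s. (s, Stay)) (snd v), []))"
definition "clr r = loop r nop"
definition "addto r s = loop r (inc s)"
definition
 "subfrom r s = loop r (Cond (\<lambda>v. sym s v = 0) nop (dec s))"
text \<open>Reading a counter destroys it, so the source is drained into both \<open>t\<close> and
  the scratch register \<open>u\<close> and then restored from \<open>u\<close>.\<close>

definition
 "cpy s t u = loop s (inc t ;; inc u) ;; loop u (inc s)"
text \<open>With a copy of \<open>s\<close> as loop counter, \<open>t\<close> is decremented as long
  as it is positive and \<open>u + 1\<close> counts how often this succeeds; that count is the
  minimum.\<close>

definition
 "minr t s u = cpy s u (u + 1) ;;
   loop u (Cond (\<lambda>v. sym t v = 0) nop (dec t ;; inc (u + 1))) ;; clr t ;; addto (u + 1) t"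
definition "home = While (\<lambda>v. fst v \<noteq> Start_Mark) mvL"
text \<open>A head at the right end marker does not move on, so that positions behind the word read
  as \<open>End_Mark\<close>, in agreement with \<open>scan_input\<close>.\<close>

definition
 "input_at t = loop t mvR ;; Cond (\<lambda>v. fst v = Bit False) nop
   (Cond (\<lambda>v. fst v = Bit True) (inc t) (inc t ;; inc t)) ;; home"
definition
 "seek R t = loop t (tprim R (\<lambda>s. (s, Right)))"
definition
 "array_at R t = seek R t ;; Cond (\<lambda>v. sym R v = 2) (inc t) nop ;; rewind R"

primrec incs :: "nat \<Rightarrow> nat \<Rightarrow> com" where
 "incs r 0 = nop"
| "incs r (Suc n) = incs r n ;; inc r"

text \<open>\<open>R\<close> is the index of the auxiliary tape and \<open>\<rho>\<close> assigns registers below \<open>t\<close> to the variables;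
 register 0 contains the largest index of the array.\<close>

primrec cmp :: "nat \<Rightarrow> aexp \<Rightarrow> (nat \<Rightarrow> nat) \<Rightarrow> nat \<Rightarrow> com" where
 "cmp R (Con k) \<rho> t = incs t k"
| "cmp R (Var x) \<rho> t = cpy (\<rho> x) t (t + 1)"
| "cmp R (Ari b d e) \<rho> t = cmp R d \<rho> t ;; cmp R e \<rho> (t + 1) ;; (if b then addto else subfrom) (t + 1) t"
| "cmp R (In e) \<rho> t = cmp R e \<rho> t ;; input_at t"
| "cmp R (Get e) \<rho> t = cmp R e \<rho> t ;; minr t 0 (t + 1) ;; array_at R t"
| "cmp R (Fold x y n d e) \<rho> t = cmp R n \<rho> (t + 2) ;;
   loop (t + 2) (cmp R d (\<rho>(x := t + 1)) (t + 3) ;; cpy t (t + 3) (t + 4) ;;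
    cmp R e (\<rho>(x := t + 1, y := t)) (t + 4) ;; minr (t + 4) (t + 3) (t + 5) ;;
    clr t ;; clr (t + 3) ;; addto (t + 4) t ;; inc (t + 1)) ;; clr (t + 1)"

text \<open>The number of registers that the compiled expression may use from \<open>t\<close>
  on.\<close>

primrec hi :: "aexp \<Rightarrow> nat" where
 "hi (Con k) = 1"
| "hi (Var x) = 2"
| "hi (Ari b d e) = hi d + hi e + 2"
| "hi (In e) = hi e + 1"
| "hi (Get e) = hi e + 3"
| "hi (Fold x y n d e) = hi n + hi d + hi e + 7"

lemma choiceless_incs [simp]: "choiceless (incs r n)"
 by (induction n) (simp_all add: nop_def)

lemma choiceless_macros2 [simp]: "choiceless nop" "choiceless mvR" "choiceless mvL" "choiceless (clr r)"
 "choiceless (addto r s)" "choiceless (subfrom r s)" "choiceless (cpy r s t)" "choiceless (minr r s t)"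
 "choiceless home" "choiceless (input_at r)" "choiceless (array_at r s)" "choiceless (seek r s)"
 by (simp_all add: nop_def mvR_def mvL_def clr_def addto_def subfrom_def cpy_def minr_def home_def
   input_at_def array_at_def seek_def)

lemma choiceless_cmp [simp]: "choiceless (cmp R e \<rho> t)"
 by (induction e arbitrary: \<rho> t) simp_all

text \<open>The end mark 3 in cell 0 shifts index \<open>j\<close> of the array to cell
  \<open>Suc j\<close>; true is the symbol 2, false the blank.\<close>

definition auxt :: "(nat \<Rightarrow> bool) \<Rightarrow> nat \<Rightarrow> work_tape" where
 "auxt a h = (\<lambda>i. if i = 0 then 3 else if a (i - 1) then 2 else 0, h)"

context machine_env
begin

lemma ex_nop: "good s \<Longrightarrow> ex nop 1 s s"
proof -
 assume g: "good s"
 have "exec (Prim stay) s 1 (eff w (stay (look w s)) s)"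
  by (rule exec.Prim) (use g in \<open>simp_all add: eff_stay length_stay good_length\<close>)
 then show ?thesis unfolding ex_def nop_def eff_stay[OF g] by blast
qed

lemma ex_mv:
 assumes "good (p, T, v, ch)"
 shows "ex mvR 1 (p, T, v, ch) (min (Suc p) (length w + 1), T, v, ch)"
  and "ex mvL 1 (p, T, v, ch) (p - 1, T, v, ch)"
proof -
 have g: "good (q, T, v, ch)" if "q \<le> length w + 1" for q using assms that by (simp add: good_iff)
 have e: "eff w (d, map (\<lambda>s. (s, Stay)) (snd (look w (p, T, v, ch))), []) (p, T, v, ch) =
  (min (move d p) (length w + 1), T, v, ch)" for d
  by (simp add: eff_def look_def del: map_map)
 have l: "length (snd (look w (p, T, v, ch))) = K" using assms by (simp add: look_def good_iff)
 have p: "p \<le> length w + 1" using assms by (simp add: good_iff)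
 have "exec mvR (p, T, v, ch) 1 (eff w (Right, map (\<lambda>s. (s, Stay)) (snd (look w (p, T, v, ch))), []) (p, T, v, ch))"
  unfolding mvR_def by (rule exec.Prim) (use assms l in \<open>simp_all add: e g\<close>)
 then show "ex mvR 1 (p, T, v, ch) (min (Suc p) (length w + 1), T, v, ch)"
  unfolding ex_def e by auto
 have "exec mvL (p, T, v, ch) 1 (eff w (Left, map (\<lambda>s. (s, Stay)) (snd (look w (p, T, v, ch))), []) (p, T, v, ch))"
  unfolding mvL_def by (rule exec.Prim) (use assms l in \<open>simp_all add: e g\<close>)
 moreover have "min (p - 1) (length w + 1) = p - 1" using p by simp
 ultimately show "ex mvL 1 (p, T, v, ch) (p - 1, T, v, ch)" unfolding ex_def e by auto
qed

lemma scan_start: "scan_input w p = Start_Mark \<longleftrightarrow> p = 0"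
 by (simp add: scan_input_def)

lemma ex_home:
 assumes "good (p, T, v, ch)"
 shows "ex home (p * 3 + 1) (p, T, v, ch) (0, T, v, ch)"
proof -
 have g: "good (q, T, v, ch)" if "q \<le> p" for q using assms that by (simp add: good_iff)
 have "ex home (p * (1 + 2) + 1) (p - 0, T, v, ch) (p - p, T, v, ch)"
  unfolding home_def
 proof (rule ex_while[where st = "\<lambda>i. (p - i, T, v, ch)"])
  fix i assume i: "i < p"
  show "ex mvL 1 (p - i, T, v, ch) (p - Suc i, T, v, ch)"
   using ex_mv(2)[OF g[of "p - i"]] by simp
  show "fst (look w (p - i, T, v, ch)) \<noteq> Start_Mark" using i by (simp add: look_def scan_start)
 next
  show "\<not> fst (look w (p - p, T, v, ch)) \<noteq> Start_Mark" by (simp add: look_def scan_start)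
  show "good (p - p, T, v, ch)" by (rule g) simp
 qed
 moreover have "p * (1 + 2) + 1 = p * 3 + 1" by simp
 ultimately show ?thesis by (simp only: diff_self_eq_0 minus_nat.diff_0)
qed

end

context reg_env
begin

text \<open>A cost unit that swallows the cost \<open>cI\<close> of one counter operation and the
  overhead of loops, so that every cost below is a number times \<open>U\<close> times a power of
  \<open>X\<close>.\<close>

definition U :: nat where "U = cI + 10"

lemma ex_cond_zero:
 assumes "r < R" "ex (if g r = 0 then a else b) t (p, mk g oth, v, ch) s'"
 shows "ex (Cond (\<lambda>v. sym r v = 0) a b) (t + 2) (p, mk g oth, v, ch) s'"
 by (rule ex_cond) (use assms sym_mk[OF assms(1)] in simp)

lemma ex_clr:
 assumes "okst p g oth" "r < R" "g r \<le> M" "2 \<le> M"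
 shows "ex (clr r) (U * M) (p, mk g oth, v, ch) (p, mk (g(r := 0)) oth, v, ch)"
proof -
 let ?s = "\<lambda>g. (p, mk g oth, v, ch)"
 have "g r \<le> B" using assms by (simp add: okst_def)
 then have gB: "g r - i \<le> B" for i by (meson diff_le_self le_trans)
 have "ex (loop r nop) (g r * (cI + 1 + 2) + 1) (?s (g(r := g r))) (?s (g(r := 0)))"
 proof (rule ex_loop[where F = "\<lambda>i. g" and p = "\<lambda>_. p" and v = "\<lambda>_. v" and ch = "\<lambda>_. ch" and oth = "\<lambda>_. oth"])
  show "ex nop 1 (?s (g(r := g r - Suc i))) (?s (g(r := g r - Suc i)))" for i
   by (intro ex_nop okst_good okst_upd assms(1) gB)
  show "okst p (g(r := g r - i)) oth" for i by (intro okst_upd assms(1) gB)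
 qed (rule assms)
 then have l: "ex (loop r nop) (g r * (cI + 1 + 2) + 1) (?s g) (?s (g(r := 0)))" by simp
 have "g r * (cI + 1 + 2) + 1 \<le> M * (cI + 1 + 2) + M" using assms by (intro add_mono mult_mono) auto
 also have "\<dots> \<le> U * M" by (simp add: U_def algebra_simps)
 finally show ?thesis unfolding clr_def using l ex_mono by blast
qed

lemma ex_addto:
 assumes "okst p g oth" "r < R" "s < R" "r \<noteq> s" "g r \<le> M" "2 \<le> M" "g s + g r \<le> B"
 shows "ex (addto r s) (2 * U * M) (p, mk g oth, v, ch) (p, mk (g(r := 0, s := g s + g r)) oth, v, ch)"
proof -
 let ?s = "\<lambda>g. (p, mk g oth, v, ch)"
 have "ex (loop r (inc s)) (g r * (cI + cI + 2) + 1) (?s ((g(s := g s + 0))(r := g r)))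
   (?s ((g(s := g s + g r))(r := 0)))"
 proof (rule ex_loop[where F = "\<lambda>i. g(s := g s + i)" and p = "\<lambda>_. p" and v = "\<lambda>_. v" and ch = "\<lambda>_. ch" and oth = "\<lambda>_. oth"])
  fix i assume i: "i < g r"
  have "ex (inc s) cI (?s (g(s := g s + i, r := g r - Suc i)))
    (?s ((g(s := g s + i, r := g r - Suc i))(s := Suc ((g(s := g s + i, r := g r - Suc i)) s))))"
   by (rule ex_inc) (use assms i in \<open>auto simp: okst_def\<close>)
  then show "ex (inc s) cI (?s (g(s := g s + i, r := g r - Suc i)))
    (?s (g(s := g s + Suc i, r := g r - Suc i)))"
   using assms(4) by (simp add: fun_upd_twist)
 qed (use assms in \<open>auto simp: okst_def\<close>)
 then have l: "ex (loop r (inc s)) (g r * (cI + cI + 2) + 1) (?s g)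
   (?s (g(r := 0, s := g s + g r)))" using assms(4) by (simp add: fun_upd_twist)
 have "g r * (cI + cI + 2) + 1 \<le> M * (cI + cI + 2) + M" using assms by (intro add_mono mult_mono) auto
 also have "\<dots> \<le> 2 * U * M" by (simp add: U_def algebra_simps)
 finally show ?thesis unfolding addto_def using l ex_mono by blast
qed

lemma ex_subfrom:
 assumes "okst p g oth" "r < R" "s < R" "r \<noteq> s" "g r \<le> M" "2 \<le> M"
 shows "ex (subfrom r s) (2 * U * M) (p, mk g oth, v, ch) (p, mk (g(r := 0, s := g s - g r)) oth, v, ch)"
proof -
 let ?s = "\<lambda>g. (p, mk g oth, v, ch)"
 have "ex (loop r (Cond (\<lambda>v. sym s v = 0) nop (dec s))) (g r * (cI + (cI + 1 + 2) + 2) + 1)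
   (?s ((g(s := g s - 0))(r := g r))) (?s ((g(s := g s - g r))(r := 0)))"
 proof (rule ex_loop[where F = "\<lambda>i. g(s := g s - i)" and p = "\<lambda>_. p" and v = "\<lambda>_. v" and ch = "\<lambda>_. ch" and oth = "\<lambda>_. oth"])
  fix i assume i: "i < g r"
  let ?g = "g(s := g s - i, r := g r - Suc i)"
  have ok: "okst p ?g oth" using assms by (auto simp: okst_def intro: order_trans[OF diff_le_self])
  have gs: "?g s = g s - i" using assms(4) by simp
  have "ex (if ?g s = 0 then nop else dec s) (cI + 1) (?s ?g) (?s (g(s := g s - Suc i, r := g r - Suc i)))"
  proof (cases "g s - i")
   case 0
   then have e: "g(s := g s - Suc i, r := g r - Suc i) = ?g" by (simp add: fun_eq_iff)
   have "ex nop (cI + 1) (?s ?g) (?s ?g)"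
    by (rule ex_mono[OF ex_nop[OF okst_good[OF ok]]]) simp
   then show ?thesis unfolding e gs using 0 by simp
  next
   case (Suc n)
   have e: "g(s := g s - Suc i, r := g r - Suc i) = ?g(s := n)" using Suc assms(4) by (auto simp: fun_eq_iff)
   have "ex (dec s) (cI + 1) (?s ?g) (?s (?g(s := n)))"
    by (rule ex_mono[OF ex_dec[OF ok assms(3)]]) (use gs Suc in auto)
   then show ?thesis unfolding e gs using Suc by simp
  qed
  from ex_cond_zero[where g = ?g, OF assms(3) this] show "ex (Cond (\<lambda>v. sym s v = 0) nop (dec s)) (cI + 1 + 2)
   (?s ?g) (?s (g(s := g s - Suc i, r := g r - Suc i)))" .
 qed (use assms in \<open>auto simp: okst_def intro: order_trans[OF diff_le_self]\<close>)
 then have l: "ex (loop r (Cond (\<lambda>v. sym s v = 0) nop (dec s))) (g r * (cI + (cI + 1 + 2) + 2) + 1) (?s g)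
   (?s (g(r := 0, s := g s - g r)))" using assms(4) by (simp add: fun_upd_twist)
 have "g r * (cI + (cI + 1 + 2) + 2) + 1 \<le> M * (cI + (cI + 1 + 2) + 2) + M" using assms by (intro add_mono mult_mono) auto
 also have "\<dots> \<le> 2 * U * M" by (simp add: U_def algebra_simps)
 finally show ?thesis unfolding subfrom_def using l ex_mono by blast
qed

lemma ex_cpy:
 assumes "okst p g oth" "s < R" "t < R" "u < R" "s \<noteq> t" "s \<noteq> u" "t \<noteq> u" "g u = 0" "g s \<le> M" "2 \<le> M" "g t + g s \<le> B"
 shows "ex (cpy s t u) (5 * U * M) (p, mk g oth, v, ch) (p, mk (g(t := g t + g s)) oth, v, ch)"
proof -
 let ?s = "\<lambda>g. (p, mk g oth, v, ch)"
 have "ex (loop s (inc t ;; inc u)) (g s * (cI + (cI + cI) + 2) + 1) (?s ((g(t := g t + 0, u := 0))(s := g s)))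
   (?s ((g(t := g t + g s, u := g s))(s := 0)))"
 proof (rule ex_loop[where F = "\<lambda>i. g(t := g t + i, u := i)" and p = "\<lambda>_. p" and v = "\<lambda>_. v" and ch = "\<lambda>_. ch" and oth = "\<lambda>_. oth"])
  fix i assume i: "i < g s"
  let ?g = "g(t := g t + i, u := i, s := g s - Suc i)"
  have ok: "okst p ?g oth" "okst p (?g(t := Suc (?g t))) oth" using assms i by (auto simp: okst_def)
  have "ex (inc t ;; inc u) (cI + cI) (?s ?g)
   (?s (?g(t := Suc (?g t), u := Suc ((?g(t := Suc (?g t))) u))))"
   by (rule ex_seq[OF ex_inc[OF ok(1) assms(3)] ex_inc[OF ok(2) assms(4)]])
  moreover have "?g(t := Suc (?g t), u := Suc ((?g(t := Suc (?g t))) u)) = g(t := g t + Suc i, u := Suc i, s := g s - Suc i)"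
   using assms by (auto simp: fun_eq_iff)
  ultimately show "ex (inc t ;; inc u) (cI + cI) (?s ?g)
   (?s (g(t := g t + Suc i, u := Suc i, s := g s - Suc i)))" by simp
 qed (use assms in \<open>auto simp: okst_def\<close>)
 moreover have "(g(t := g t + 0, u := 0))(s := g s) = g" using assms(8) by (auto simp: fun_eq_iff)
 ultimately have l: "ex (loop s (inc t ;; inc u)) (g s * (cI + (cI + cI) + 2) + 1) (?s g)
   (?s (g(t := g t + g s, u := g s, s := 0)))" by simp
 let ?h = "g(t := g t + g s, u := g s, s := 0)"
 have "ex (addto u s) (2 * U * M) (?s ?h) (?s (?h(u := 0, s := ?h s + ?h u)))"
  by (rule ex_addto) (use assms in \<open>auto simp: okst_def\<close>)
 moreover have "?h(u := 0, s := ?h s + ?h u) = g(t := g t + g s)" using assms by (auto simp: fun_eq_iff)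
 ultimately have "ex (cpy s t u) (g s * (cI + (cI + cI) + 2) + 1 + 2 * U * M) (?s g) (?s (g(t := g t + g s)))"
  unfolding cpy_def addto_def using l ex_seq by (metis (no_types, lifting))
 moreover have "g s * (cI + (cI + cI) + 2) + 1 \<le> M * (cI + (cI + cI) + 2) + M" using assms by (intro add_mono mult_mono) auto
 moreover have "M * (cI + (cI + cI) + 2) + M \<le> 3 * U * M" by (simp add: U_def algebra_simps)
 ultimately show ?thesis by (elim ex_mono) (simp add: algebra_simps)
qed

lemma ex_minr:
 assumes "okst p g oth" "s < R" "t < R" "u + 1 < R" "s \<noteq> t" "s < u" "t < u" "g u = 0" "g (u + 1) = 0"
  "g s \<le> M" "g t \<le> M" "2 \<le> M"
 shows "ex (minr t s u) (11 * U * M) (p, mk g oth, v, ch) (p, mk (g(t := min (g t) (g s))) oth, v, ch)"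
proof -
 let ?s = "\<lambda>g. (p, mk g oth, v, ch)"
 have B: "g s \<le> B" "g t \<le> B" using assms by (auto simp: okst_def)
 have "ex (cpy s u (u + 1)) (5 * U * M) (?s g) (?s (g(u := g u + g s)))"
  by (rule ex_cpy) (use assms B in auto)
 then have 1: "ex (cpy s u (u + 1)) (5 * U * M) (?s g) (?s (g(u := g s)))"
  using assms(8) by simp
 let ?F = "\<lambda>i. g(t := g t - i, u + 1 := min (g t) i)"
 have "ex (loop u (Cond (\<lambda>v. sym t v = 0) nop (dec t ;; inc (u + 1)))) (g s * (cI + (cI + cI + 1 + 2) + 2) + 1)
   (?s ((?F 0)(u := g s))) (?s ((?F (g s))(u := 0)))"
 proof (rule ex_loop[where F = ?F and p = "\<lambda>_. p" and v = "\<lambda>_. v" and ch = "\<lambda>_. ch" and oth = "\<lambda>_. oth"])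
  fix i assume i: "i < g s"
  let ?g = "(?F i)(u := g s - Suc i)"
  have ok: "okst p ?g oth" by (intro okst_upd assms(1)) (use B in \<open>auto simp: min_def\<close>)
  have gt: "?g t = g t - i" using assms by simp
  have "ex (if ?g t = 0 then nop else dec t ;; inc (u + 1)) (cI + cI + 1) (?s ?g) (?s ((?F (Suc i))(u := g s - Suc i)))"
  proof (cases "g t - i")
   case 0
   then have e: "(?F (Suc i))(u := g s - Suc i) = ?g" by (auto simp: fun_eq_iff)
   have "ex nop (cI + cI + 1) (?s ?g) (?s ?g)"
    by (rule ex_mono[OF ex_nop[OF okst_good[OF ok]]]) simp
   then show ?thesis unfolding e gt using 0 by simp
  next
   case (Suc n)
   have "n \<le> B" using Suc B by simp
   then have ok2: "okst p (?g(t := n)) oth" by (intro okst_upd ok)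
   have "ex (dec t ;; inc (u + 1)) (cI + cI) (?s ?g) (?s (?g(t := n, u + 1 := Suc ((?g(t := n)) (u + 1)))))"
    by (rule ex_seq[OF ex_dec[OF ok assms(3)] ex_inc[OF ok2 assms(4)]]) (use gt Suc in auto)
   moreover have "?g(t := n, u + 1 := Suc ((?g(t := n)) (u + 1))) = (?F (Suc i))(u := g s - Suc i)"
    using Suc assms by (auto simp: fun_eq_iff min_def)
   ultimately have "ex (dec t ;; inc (u + 1)) (cI + cI + 1) (?s ?g) (?s ((?F (Suc i))(u := g s - Suc i)))"
    using ex_mono[of _ "cI + cI" _ _ "cI + cI + 1"] by simp
   then show ?thesis unfolding gt using Suc by simp
  qed
  from ex_cond_zero[where g = ?g, OF assms(3) this] show "ex (Cond (\<lambda>v. sym t v = 0) nop (dec t ;; inc (u + 1))) (cI + cI + 1 + 2)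
   (?s ?g) (?s ((?F (Suc i))(u := g s - Suc i)))" .
 next
  show "okst p ((?F i)(u := g s - i)) oth" for i by (intro okst_upd assms(1)) (use B in \<open>auto simp: min_def\<close>)
  show "u < R" using assms by simp
 qed
 moreover have "(?F 0)(u := g s) = g(u := g s)" using assms by (auto simp: fun_eq_iff)
 ultimately have 2: "ex (loop u (Cond (\<lambda>v. sym t v = 0) nop (dec t ;; inc (u + 1)))) (g s * (cI + (cI + cI + 1 + 2) + 2) + 1)
   (?s (g(u := g s))) (?s ((?F (g s))(u := 0)))" by simp
 have "g s * (cI + (cI + cI + 1 + 2) + 2) + 1 \<le> M * (cI + (cI + cI + 1 + 2) + 2) + M" using assms by (intro add_mono mult_mono) auto
 also have "\<dots> \<le> 3 * U * M" by (simp add: U_def algebra_simps)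
 finally have 2: "ex (loop u (Cond (\<lambda>v. sym t v = 0) nop (dec t ;; inc (u + 1)))) (3 * U * M)
   (?s (g(u := g s))) (?s ((?F (g s))(u := 0)))" using 2 ex_mono by blast
 let ?g = "(?F (g s))(u := 0)"
 have ok: "okst p ?g oth" "okst p (?g(t := 0)) oth"
  by (intro okst_upd assms(1); use B in \<open>auto simp: min_def\<close>)+
 have 3: "ex (clr t) (U * M) (?s ?g) (?s (?g(t := 0)))"
  by (rule ex_clr) (use assms ok in auto)
 have 4: "ex (addto (u + 1) t) (2 * U * M) (?s (?g(t := 0)))
  (?s ((?g(t := 0))(u + 1 := 0, t := (?g(t := 0)) t + (?g(t := 0)) (u + 1))))"
  by (rule ex_addto) (use assms ok B in auto)
 have 5: "(?g(t := 0))(u + 1 := 0, t := (?g(t := 0)) t + (?g(t := 0)) (u + 1)) = g(t := min (g t) (g s))"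
  using assms by (auto simp: fun_eq_iff)
 from ex_seq[OF 1 ex_seq[OF 2 ex_seq[OF 3 4]]] show ?thesis
  unfolding 5 minr_def by (elim ex_mono) (simp add: algebra_simps)
qed

lemma ex_incs:
 assumes "okst p g oth" "r < R" "g r + n \<le> B"
 shows "ex (incs r n) (1 + n * cI) (p, mk g oth, v, ch) (p, mk (g(r := g r + n)) oth, v, ch)"
 using assms(3)
proof (induction n)
 case 0
 show ?case using ex_nop[OF okst_good[OF assms(1)]] by simp
next
 case (Suc n)
 have "ex (inc r) cI (p, mk (g(r := g r + n)) oth, v, ch) (p, mk (g(r := g r + Suc n)) oth, v, ch)"
  using ex_inc[of p "g(r := g r + n)" oth r] assms Suc by (simp add: okst_upd)
 moreover have "ex (incs r n) (1 + n * cI) (p, mk g oth, v, ch) (p, mk (g(r := g r + n)) oth, v, ch)"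
  by (rule Suc.IH) (use Suc.prems in simp)
 ultimately have "ex (incs r n ;; inc r) (1 + n * cI + cI) (p, mk g oth, v, ch) (p, mk (g(r := g r + Suc n)) oth, v, ch)"
  by (intro ex_seq)
 moreover have "1 + n * cI + cI = 1 + Suc n * cI" by simp
 ultimately show ?case by (simp only: incs.simps)
qed

lemma ex_input_at:
 assumes "okst 0 g oth" "t < R" "g t \<le> M" "2 \<le> M" "2 \<le> B"
 shows "ex (input_at t) (3 * U * M) (0, mk g oth, v, ch) (0, mk (g(t := in_code (scan_input w (g t)))) oth, v, ch)"
proof -
 let ?p = "\<lambda>i. min i (length w + 1)"
 have okp: "okst (?p i) g' oth" if "okst 0 g' oth" for i g' using that by (simp add: okst_def)
 have ok0: "okst 0 (g(t := n)) oth" if "n \<le> B" for n using assms(1) that by (rule okst_upd)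
 have gB: "g t \<le> B" using assms by (simp add: okst_def)
 have "ex (loop t mvR) (g t * (cI + 1 + 2) + 1) (?p 0, mk (g(t := g t)) oth, v, ch) (?p (g t), mk (g(t := 0)) oth, v, ch)"
 proof (rule ex_loop[where F = "\<lambda>_. g" and p = ?p and v = "\<lambda>_. v" and ch = "\<lambda>_. ch" and oth = "\<lambda>_. oth"])
  fix i assume "i < g t"
  have "?p (Suc i) = min (Suc (?p i)) (length w + 1)" by auto
  note e = this
  have b: "g t - Suc i \<le> B" using gB by simp
  show "ex mvR 1 (?p i, mk (g(t := g t - Suc i)) oth, v, ch) (?p (Suc i), mk (g(t := g t - Suc i)) oth, v, ch)"
   unfolding e by (rule ex_mv(1)[OF okst_good[OF okp[OF ok0[OF b]]]])
 next
  show "okst (?p i) (g(t := g t - i)) oth" for i by (intro okp ok0) (use gB in simp)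
 qed (rule assms)
 then have 1: "ex (loop t mvR) (g t * (cI + 1 + 2) + 1) (0, mk g oth, v, ch) (?p (g t), mk (g(t := 0)) oth, v, ch)" by simp
 let ?s = "scan_input w (g t)"
 have lk: "fst (look w (?p (g t), T, v, ch)) = ?s" for T
  by (auto simp: look_def scan_input_def)
 let ?h = "g(t := 0)"
 have ok: "okst (?p (g t)) ?h oth" "okst (?p (g t)) (?h(t := Suc (?h t))) oth"
  using okp[OF ok0[of 0]] okp[OF ok0[of 1]] assms by simp_all
 note n = ex_mono[OF ex_nop[OF okst_good[OF ok(1)]], of "cI + cI + 2"]
 note i1 = ex_mono[OF ex_inc[OF ok(1) assms(2)], of "cI + cI"]
 note i2 = ex_seq[OF ex_inc[OF ok(1) assms(2)] ex_inc[OF ok(2) assms(2)]]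
 have "ex (Cond (\<lambda>v. fst v = Bit False) nop (Cond (\<lambda>v. fst v = Bit True) (inc t) (inc t ;; inc t))) (cI + cI + 2 + 2)
  (?p (g t), mk ?h oth, v, ch) (?p (g t), mk (g(t := in_code ?s)) oth, v, ch)"
 proof (rule ex_cond)
  have "ex (Cond (\<lambda>v. fst v = Bit True) (inc t) (inc t ;; inc t)) (cI + cI + 2)
    (?p (g t), mk ?h oth, v, ch) (?p (g t), mk (g(t := in_code ?s)) oth, v, ch)" if "?s \<noteq> Bit False"
   by (rule ex_cond, unfold lk) (use i1 i2 that in \<open>cases ?s; simp add: eval_nat_numeral\<close>)
  with n show "ex (if fst (look w (?p (g t), mk ?h oth, v, ch)) = Bit False then nop else Cond (\<lambda>v. fst v = Bit True) (inc t) (inc t ;; inc t))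
   (cI + cI + 2) (?p (g t), mk ?h oth, v, ch) (?p (g t), mk (g(t := in_code ?s)) oth, v, ch)"
   unfolding lk by (cases "?s = Bit False") simp_all
 qed
 note 2 = this
 have 3: "ex home (?p (g t) * 3 + 1) (?p (g t), mk (g(t := in_code ?s)) oth, v, ch) (0, mk (g(t := in_code ?s)) oth, v, ch)"
  using ex_good[OF 2] by (intro ex_home) simp
 have "g t * (cI + 1 + 2) + 1 + (cI + cI + 2 + 2 + (?p (g t) * 3 + 1)) \<le> M * (cI + 1 + 2) + M + (M * (cI + 2) + (M * 3 + M))"
 proof -
  have "cI + cI + 2 + 2 = 2 * (cI + 2)" by simp
  also have "\<dots> \<le> M * (cI + 2)" using assms by (intro mult_mono) auto
  finally have a: "cI + cI + 2 + 2 \<le> M * (cI + 2)" .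
  have b: "g t * (cI + 1 + 2) \<le> M * (cI + 1 + 2)" using assms by (intro mult_mono) auto
  have "?p (g t) \<le> M" using assms by simp
  then show ?thesis by (intro add_mono a b mult_mono) (use assms in auto)
 qed
 also have "\<dots> \<le> 3 * U * M" by (simp add: U_def algebra_simps)
 finally show ?thesis unfolding input_at_def using ex_seq[OF 1 ex_seq[OF 2 3]] ex_mono by blast
qed

lemma rd_auxt: "rd (auxt a (Suc j)) = (if a j then 2 else 0)" "rd (auxt a 0) = 3"
 by (simp_all add: rd_def auxt_def)

lemma act_auxt:
 "act (rd (auxt a j), Right) (auxt a j) = auxt a (Suc j)"
 "act (rd (auxt a (Suc j)), Left) (auxt a (Suc j)) = auxt a j"
 "act (if b then 2 else 0, Stay) (auxt a (Suc j)) = auxt (a(j := b)) (Suc j)"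
 by (auto simp: rd_def auxt_def fun_eq_iff)

lemma tgood_auxt: "j < H \<Longrightarrow> tgood (auxt a j)"
 using A4 by (simp add: tgood_def auxt_def)

lemma tx_auxt_rewind:
 assumes "j < H" "R < K"
 shows "tx (rewind R) R (auxt a j) (3 * j + 2) (auxt a 1)"
proof -
 have "tx (While (\<lambda>v. sym R v \<noteq> 3) (tprim R (\<lambda>s. (s, Left)))) R (auxt a j) (3 * j + 1) (auxt a 0)"
  using assms(1)
 proof (induction j)
  case 0
  then show ?case
   using tx_whileF[OF assms(2) tgood_auxt[OF 0], where P = "\<lambda>s. s \<noteq> 3"] by (simp add: rd_auxt)
 next
  case (Suc j)
  have "tx (tprim R (\<lambda>s. (s, Left))) R (auxt a (Suc j)) 1 (auxt a j)"
   by (rule tx_prim') (use Suc assms in \<open>auto intro!: tgood_auxt simp: act_auxt\<close>)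
  then have "tx (While (\<lambda>v. sym R v \<noteq> 3) (tprim R (\<lambda>s. (s, Left)))) R (auxt a (Suc j)) (1 + 2 + (3 * j + 1)) (auxt a 0)"
   by (intro tx_whileT[where P = "\<lambda>s. s \<noteq> 3"] assms(2) Suc) (use Suc in \<open>auto simp: rd_auxt\<close>)
  moreover have "1 + 2 + (3 * j + 1) = 3 * Suc j + 1" by simp
  ultimately show ?case by (simp only:)
 qed
 moreover have "tx (tprim R (\<lambda>s. (s, Right))) R (auxt a 0) 1 (auxt a 1)"
  by (rule tx_prim') (use hH assms in \<open>auto intro!: tgood_auxt simp: act_auxt\<close>)
 ultimately have "tx (rewind R) R (auxt a j) (3 * j + 1 + 1) (auxt a 1)" unfolding rewind_def by (rule tx_seq)
 then show ?thesis by (simp add: eval_nat_numeral)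
qed

lemma mk_aux: "(mk g (x # oth))[R := y] = mk g (y # oth)"
 by (simp add: mk_def list_update_append)

lemma RK_aux: "okst p g (x # oth) \<Longrightarrow> R < K"
 by (auto simp: okst_def)

lemma okst_aux: "okst p g (x # oth) \<Longrightarrow> tgood y \<Longrightarrow> okst p g (y # oth)"
 by (auto simp: okst_def)

lemma ex_tx_aux:
 assumes "tx c R x m y" "okst p g (x # oth)"
 shows "ex c m (p, mk g (x # oth), v, ch) (p, mk g (y # oth), v, ch)"
 using assms(1)[unfolded tx_def, rule_format, OF okst_good[OF assms(2)]] unfolding ex_def
 by (auto simp: mk_aux)

lemma ex_seek:
 assumes "okst 0 g (auxt a 1 # oth)" "t < R" "g t \<le> M" "2 \<le> M" "g t + 1 < H"
 shows "ex (seek R t) (U * M) (0, mk g (auxt a 1 # oth), v, ch) (0, mk (g(t := 0)) (auxt a (Suc (g t)) # oth), v, ch)"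
proof -
 have gB: "g t \<le> B" using assms by (simp add: okst_def)
 have ok: "okst 0 (g(t := n)) (auxt a (Suc i) # oth)" if "n \<le> B" "i \<le> g t" for n i
  using okst_aux[OF okst_upd[OF assms(1) that(1)] tgood_auxt] that assms by simp
 have "ex (loop t (tprim R (\<lambda>s. (s, Right)))) (g t * (cI + 1 + 2) + 1) (0, mk (g(t := g t)) (auxt a (Suc 0) # oth), v, ch)
   (0, mk (g(t := 0)) (auxt a (Suc (g t)) # oth), v, ch)"
 proof (rule ex_loop[where F = "\<lambda>_. g" and p = "\<lambda>_. 0" and v = "\<lambda>_. v" and ch = "\<lambda>_. ch" and oth = "\<lambda>i. auxt a (Suc i) # oth"])
  fix i assume i: "i < g t"
  show "ex (tprim R (\<lambda>s. (s, Right))) 1 (0, mk (g(t := g t - Suc i)) (auxt a (Suc i) # oth), v, ch)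
   (0, mk (g(t := g t - Suc i)) (auxt a (Suc (Suc i)) # oth), v, ch)"
   by (rule ex_tx_aux[OF tx_prim' ok]) (use i assms gB RK_aux[OF assms(1)] in \<open>auto simp: act_auxt intro!: tgood_auxt\<close>)
 qed (use assms gB in \<open>auto intro!: ok\<close>)
 then have l: "ex (seek R t) (g t * (cI + 1 + 2) + 1) (0, mk g (auxt a 1 # oth), v, ch)
   (0, mk (g(t := 0)) (auxt a (Suc (g t)) # oth), v, ch)" by (simp add: seek_def)
 have "g t * (cI + 1 + 2) + 1 \<le> M * (cI + 1 + 2) + M" using assms by (intro add_mono mult_mono) auto
 also have "\<dots> \<le> U * M" by (simp add: U_def algebra_simps)
 finally show ?thesis using l ex_mono by blast
qed

lemma ex_array_at:
 assumes "okst 0 g (auxt a 1 # oth)" "t < R" "g t \<le> M" "2 \<le> M" "g t + 1 < H" "1 \<le> B"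
 shows "ex (array_at R t) (3 * U * M) (0, mk g (auxt a 1 # oth), v, ch) (0, mk (g(t := of_bool (a (g t)))) (auxt a 1 # oth), v, ch)"
proof -
 note 1 = ex_seek[OF assms(1-5)]
 note RK' = RK_aux[OF assms(1)]
 let ?x = "auxt a (Suc (g t))"
 have ok: "okst 0 (g(t := n)) (?x # oth)" if "n \<le> B" for n
  using okst_aux[OF okst_upd[OF assms(1) that] tgood_auxt] assms by simp
 have sy: "sym R (look w (0, mk (g(t := 0)) (?x # oth), v, ch)) = (if a (g t) then 2 else 0)"
  using sym_look'[of R "mk (g(t := 0)) (?x # oth)"] by (simp add: mk_def rd_auxt nth_append)
 have 2: "ex (Cond (\<lambda>v. sym R v = 2) (inc t) nop) (cI + 1 + 2) (0, mk (g(t := 0)) (?x # oth), v, ch)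
  (0, mk (g(t := of_bool (a (g t)))) (?x # oth), v, ch)"
 proof (rule ex_cond)
  note i = ex_mono[OF ex_inc[OF ok[of 0] assms(2)], of "cI + 1" v ch]
  note n = ex_mono[OF ex_nop[OF okst_good[OF ok[of 0]]], of "cI + 1" v ch]
  show "ex (if sym R (look w (0, mk (g(t := 0)) (?x # oth), v, ch)) = 2 then inc t else nop) (cI + 1)
   (0, mk (g(t := 0)) (?x # oth), v, ch) (0, mk (g(t := of_bool (a (g t)))) (?x # oth), v, ch)"
  proof (cases "a (g t)")
   case True
   then show ?thesis using i by (simp add: sy)
  next
   case False
   then show ?thesis using n by (simp add: sy)
  qed
 qed
 have 3: "ex (rewind R) (3 * Suc (g t) + 2) (0, mk (g(t := of_bool (a (g t)))) (?x # oth), v, ch) (0, mk (g(t := of_bool (a (g t)))) (auxt a 1 # oth), v, ch)"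
  by (rule ex_tx_aux[OF tx_auxt_rewind ok]) (use assms RK' in auto)
 have "U * M + (cI + 1 + 2 + (3 * Suc (g t) + 2)) \<le> U * M + (M * (cI + 8) + M * 3)"
 proof -
  have "cI + 1 + 2 + 5 \<le> M * (cI + 8)" using assms(4) by (cases M) auto
  then show ?thesis using assms(3) by simp
 qed
 also have "\<dots> \<le> 3 * U * M" by (simp add: U_def algebra_simps)
 finally show ?thesis unfolding array_at_def using ex_seq[OF 1 ex_seq[OF 2 3]] ex_mono by blast
qed

end

context reg_env
begin

lemma okst_I: "okst p g0 oth \<Longrightarrow> (\<And>i. g i \<le> B) \<Longrightarrow> okst p g oth"
 by (simp add: okst_def)

text \<open>All registers from \<open>t\<close> on are empty at the beginning, and only
  \<open>t\<close> is filled at the end, so compiled subexpressions can be chained. They are run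
  with increasing bounds in place of \<open>X\<close>, since these must also cover the registers
  filled in the meantime; this is where the products in \<open>dg\<close> come from.\<close>

lemma ex_cmp:
 assumes base: "okst 0 (\<lambda>_. 0) (auxt a 1 # oth)"
  and "\<And>x. \<rho> x < t" "0 < t" "t + hi e \<le> R" "\<And>i. t \<le> i \<Longrightarrow> g i = 0" "\<And>i. g i \<le> X" "2 \<le> X"
   "X ^ dg e \<le> B" "g 0 + 1 < H"
 shows "ex (cmp R e \<rho> t) (U * X ^ dg e) (0, mk g (auxt a 1 # oth), v, ch)
  (0, mk (g(t := ev w a (g 0) e (g \<circ> \<rho>))) (auxt a 1 # oth), v, ch)"
proof -
 let ?C = "\<lambda>g. (0 :: nat, mk g (auxt a 1 # oth), v, ch)"
 show ?thesis
 using assms(2-)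
proof (induction e arbitrary: \<rho> t g X)
 case (Con k)
 have "k < 2 ^ k" by (rule less_exp)
 also have "(2::nat) ^ k \<le> X ^ k" using Con.prems by (intro power_mono) auto
 finally have k: "k < X ^ k" .
 have XX: "X ^ k \<le> X ^ (k + 2)" using Con.prems by (intro power_increasing) auto
 have gB: "g i \<le> B" for i
 proof -
  have "g i \<le> X ^ 1" using Con.prems by simp
  then show ?thesis using le_power_mono[of "g i" X 1 "k + 2"] Con.prems by simp
 qed
 have gt: "g t = 0" using Con.prems(4) by simp
 have "k \<le> X ^ (k + 2)" using k XX by linarith
 also have "\<dots> \<le> B" using Con.prems(7) by (simp only: dg.simps)
 finally have kB: "g t + k \<le> B" using gt by simp
 have tR: "t < R" using Con.prems(3) by simp
 have "ex (incs t k) (1 + k * cI) (?C g) (?C (g(t := g t + k)))"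
  by (rule ex_incs[OF okst_I[OF base gB, of "\<lambda>i. i"] tR kB])
 moreover have "1 + k * cI \<le> U * X ^ (k + 2)"
 proof -
  have "1 + k * cI \<le> X ^ k + X ^ k * cI" using k by (intro add_mono mult_mono) auto
  also have "\<dots> \<le> U * X ^ k" by (simp add: U_def algebra_simps)
  also have "\<dots> \<le> U * X ^ (k + 2)" using XX by (intro mult_mono) auto
  finally show ?thesis .
 qed
 ultimately show ?case unfolding cmp.simps ev.simps dg.simps gt add_0 by (rule ex_mono)
next
 case (Var x)
 have gB: "g i \<le> X ^ 4" for i
 proof -
  have "g i \<le> X ^ 1" using Var.prems by simp
  then show ?thesis using le_power_mono[of "g i" X 1 4] Var.prems by simp
 qed
 have gB: "g i \<le> B" for i using gB[of i] Var.prems by simp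
 have ne: "\<rho> x \<noteq> t" "\<rho> x \<noteq> t + 1" "\<rho> x < R" using Var.prems(1)[of x] Var.prems(3) by auto
 have z: "g t = 0" "g (t + 1) = 0" using Var.prems(4) by auto
 have "ex (cpy (\<rho> x) t (t + 1)) (5 * U * X) (?C g)
  (?C (g(t := g t + g (\<rho> x))))"
  by (rule ex_cpy[OF okst_I[OF base gB]]) (use Var.prems ne z gB in auto)
 moreover have "5 * U * X \<le> U * X ^ 4"
 proof -
  have "5 * X \<le> X ^ 3 * X" by (rule power_absorb) (use Var.prems in auto)
  also have "X ^ 3 * X = X ^ 4" by (simp add: eval_nat_numeral)
  finally have "U * (5 * X) \<le> U * X ^ 4" by (rule mult_le_mono2)
  then show ?thesis by (simp add: ac_simps)
 qed
 ultimately show ?case unfolding cmp.simps ev.simps dg.simps z(1) add_0 o_apply by (rule ex_mono)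
next
 case (Ari b d e)
 let ?vd = "ev w a (g 0) d (g \<circ> \<rho>)" and ?ve = "ev w a (g 0) e (g \<circ> \<rho>)"
 have X1: "X ^ 1 \<le> X ^ dg d" using Ari.prems dg_pos[of d] by (intro power_increasing) auto
 have le: "X ^ k \<le> B" if "k \<le> dg (Ari b d e)" for k
  using Ari.prems(7) le_power_mono[OF order_refl that] Ari.prems(6) by (meson le_trans)
 have vd: "?vd \<le> X ^ dg d" and ve: "?ve \<le> X ^ dg e" by (rule ev_bound; use Ari.prems in simp)+
 have 1: "ex (cmp R d \<rho> t) (U * X ^ dg d) (?C g) (?C (g(t := ?vd)))"
  by (rule Ari.IH(1)) (use Ari.prems le in auto)
 have "(g(t := ?vd)) \<circ> \<rho> = g \<circ> \<rho>" using Ari.prems(1) by (auto simp: fun_eq_iff less_imp_neq)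
 moreover have "(g(t := ?vd)) 0 = g 0" using Ari.prems(2) by simp
 moreover have "ex (cmp R e \<rho> (t + 1)) (U * (X ^ dg d) ^ dg e) (?C (g(t := ?vd)))
   (?C ((g(t := ?vd))(t + 1 := ev w a ((g(t := ?vd)) 0) e ((g(t := ?vd)) \<circ> \<rho>))))"
 proof (rule Ari.IH(2))
  show "\<rho> x < t + 1" for x using Ari.prems(1)[of x] by simp
  show "(g(t := ?vd)) i \<le> X ^ dg d" for i using vd X1 Ari.prems(5)[of i] by simp
  have "2 \<le> X" by (rule Ari.prems)
  with X1 show "2 \<le> X ^ dg d" by simp
  show "(X ^ dg d) ^ dg e \<le> B" using le[of "dg d * dg e"] by (simp add: power_mult)
 qed (use Ari.prems in auto)
 ultimately have 2: "ex (cmp R e \<rho> (t + 1)) (U * (X ^ dg d) ^ dg e) (?C (g(t := ?vd)))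
   (?C (g(t := ?vd, t + 1 := ?ve)))" by simp
 let ?g = "g(t := ?vd, t + 1 := ?ve)"
 have gX: "g i \<le> B" for i using X1 le[of "dg d"] Ari.prems(5)[of i] by simp
 have sum: "?vd + ?ve \<le> B"
  using sum_le_power[OF Ari.prems(6) vd ve dg_pos dg_pos] le[of "dg d + dg e"] by simp
 have "X ^ 1 \<le> X ^ dg e" using Ari.prems dg_pos[of e] by (intro power_increasing) auto
 with Ari.prems(6) have e2: "2 \<le> X ^ dg e" by simp
 have 3: "ex ((if b then addto else subfrom) (t + 1) t) (2 * U * X ^ dg e) (?C ?g)
  (?C (?g(t + 1 := 0, t := if b then ?g t + ?g (t + 1) else ?g t - ?g (t + 1))))"
 proof (cases b)
  case True
  have "ex (addto (t + 1) t) (2 * U * X ^ dg e) (?C ?g) (?C (?g(t + 1 := 0, t := ?g t + ?g (t + 1))))"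
   by (rule ex_addto[OF okst_I[OF base]]) (use Ari.prems ve e2 sum gX in auto)
  then show ?thesis by (simp only: True if_True)
 next
  case False
  have "ex (subfrom (t + 1) t) (2 * U * X ^ dg e) (?C ?g) (?C (?g(t + 1 := 0, t := ?g t - ?g (t + 1))))"
   by (rule ex_subfrom[OF okst_I[OF base]]) (use Ari.prems ve e2 sum gX in auto)
  then show ?thesis by (simp only: False if_False)
 qed
 have eq: "?g(t + 1 := 0, t := if b then ?g t + ?g (t + 1) else ?g t - ?g (t + 1)) = g(t := if b then ?vd + ?ve else ?vd - ?ve)"
  using Ari.prems(4)[of "t + 1"] by (auto simp: fun_eq_iff)
 have "2 * X ^ dg e \<le> X ^ (dg e + 1)" using Ari.prems(6) by simp
 from sum_le_power[OF Ari.prems(6) order_refl[of "X ^ (dg d * dg e)"] this]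
 have "X ^ (dg d * dg e) + 2 * X ^ dg e \<le> X ^ (dg d * dg e + (dg e + 1))" using dg_pos[of d] dg_pos[of e] by simp
 from sum_le_power[OF Ari.prems(6) order_refl[of "X ^ dg d"] this]
 have "X ^ dg d + (X ^ (dg d * dg e) + 2 * X ^ dg e) \<le> X ^ (dg d + (dg d * dg e + (dg e + 1)))" using dg_pos[of d] by simp
 then have "X ^ dg d + (X ^ (dg d * dg e) + 2 * X ^ dg e) \<le> X ^ dg (Ari b d e)"
  by (rule le_power_mono) (use Ari.prems in auto)
 from mult_le_mono2[OF this, of U] ex_seq[OF 1 ex_seq[OF 2 3]] show ?case
  unfolding cmp.simps eq ev.simps by (elim ex_mono) (simp add: power_mult algebra_simps)
next
 case (In e)
 let ?ve = "ev w a (g 0) e (g \<circ> \<rho>)"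
 have X1: "X ^ 1 \<le> X ^ dg e" using In.prems dg_pos[of e] by (intro power_increasing) auto
 have le: "X ^ k \<le> B" if "k \<le> dg (In e)" for k
  using In.prems(7) le_power_mono[OF order_refl that] In.prems(6) by (meson le_trans)
 have ve: "?ve \<le> X ^ dg e" by (rule ev_bound; use In.prems in simp)
 have 1: "ex (cmp R e \<rho> t) (U * X ^ dg e) (?C g) (?C (g(t := ?ve)))"
  by (rule In.IH) (use In.prems le in auto)
 let ?g = "g(t := ?ve)"
 have X2: "2 \<le> X" by (rule In.prems)
 have 2: "ex (input_at t) (3 * U * X ^ dg e) (?C ?g)
   (?C (?g(t := in_code (scan_input w (?g t)))))"
 proof (rule ex_input_at[OF okst_I[OF base]])
  show "?g i \<le> B" for i using ve X1 le[of "dg e"] In.prems(5)[of i] by simp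
  show "t < R" using In.prems by simp
  show "?g t \<le> X ^ dg e" using ve by simp
  show "2 \<le> X ^ dg e" using X1 X2 by simp
  then show "2 \<le> B" using le[of "dg e"] by simp
 qed
 have "4 * X ^ dg e \<le> X ^ 4 * X ^ dg e" by (rule power_absorb) (use X2 in auto)
 also have "\<dots> = X ^ dg (In e)" by (simp add: power_add)
 finally have "U * (4 * X ^ dg e) \<le> U * X ^ dg (In e)" by (rule mult_le_mono2)
 then have "U * X ^ dg e + 3 * U * X ^ dg e \<le> U * X ^ dg (In e)" by (simp add: algebra_simps)
 from ex_mono[OF ex_seq[OF 1 2] this] show ?case by (simp only: cmp.simps ev.simps fun_upd_same fun_upd_upd)
next
 case (Get e)
 let ?ve = "ev w a (g 0) e (g \<circ> \<rho>)"
 have X1: "X ^ 1 \<le> X ^ dg e" using Get.prems dg_pos[of e] by (intro power_increasing) auto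
 have le: "X ^ k \<le> B" if "k \<le> dg (Get e)" for k
  using Get.prems(7) le_power_mono[OF order_refl that] Get.prems(6) by (meson le_trans)
 have ve: "?ve \<le> X ^ dg e" by (rule ev_bound; use Get.prems in simp)
 have 1: "ex (cmp R e \<rho> t) (U * X ^ dg e) (?C g) (?C (g(t := ?ve)))"
  by (rule Get.IH) (use Get.prems le in auto)
 let ?g = "g(t := ?ve)"
 have X2: "2 \<le> X" by (rule Get.prems)
 have X3: "2 \<le> X ^ dg e" using X1 X2 by simp
 have gB: "?g i \<le> B" for i using ve X1 le[of "dg e"] Get.prems(5)[of i] by simp
 have g0: "?g 0 = g 0" using Get.prems(2) by simp
 have 2: "ex (minr t 0 (t + 1)) (11 * U * X ^ dg e) (?C ?g)
   (?C (?g(t := min (?g t) (?g 0))))"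
 proof (rule ex_minr[OF okst_I[OF base gB]])
  show "?g 0 \<le> X ^ dg e" using X1 Get.prems(5)[of 0] g0 by simp
 qed (use Get.prems ve X3 in auto)
 let ?h = "g(t := min ?ve (g 0))"
 have 2: "ex (minr t 0 (t + 1)) (11 * U * X ^ dg e) (?C ?g)
   (?C ?h)" using 2 g0 by simp
 have 3: "ex (array_at R t) (3 * U * X ^ dg e) (?C ?h)
   (?C (?h(t := of_bool (a (?h t)))))"
 proof (rule ex_array_at[OF okst_I[OF base]])
  show "?h i \<le> B" for i using gB[of i] gB[of t] by (auto simp: min_def split: if_splits)
  show "t < R" using Get.prems by simp
  show "?h t \<le> X ^ dg e" using ve by simp
  show "2 \<le> X ^ dg e" by (rule X3)
  show "?h t + 1 < H" using Get.prems(8) by simp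
  show "1 \<le> B" using X3 le[of "dg e"] by simp
 qed
 have "15 * X ^ dg e \<le> X ^ 6 * X ^ dg e" by (rule power_absorb) (use X2 in auto)
 also have "\<dots> = X ^ dg (Get e)" by (simp add: power_add)
 finally have "U * (15 * X ^ dg e) \<le> U * X ^ dg (Get e)" by (rule mult_le_mono2)
 then have "U * X ^ dg e + (11 * U * X ^ dg e + 3 * U * X ^ dg e) \<le> U * X ^ dg (Get e)" by (simp add: algebra_simps)
 from ex_mono[OF ex_seq[OF 1 ex_seq[OF 2 3]] this] show ?case
  by (simp only: cmp.simps ev.simps fun_upd_same fun_upd_upd)
next
 case (Fold x y n d e)
 let ?E = "g \<circ> \<rho>" and ?S = "auxt a 1 # oth"
 define N where "N = ev w a (g 0) n ?E"
 define acc where "acc = rec_nat 0 (\<lambda>i s. min (s + ev w a (g 0) d (?E(x := i))) (ev w a (g 0) e (?E(x := i, y := s))))"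
 \<comment> \<open>\<open>P\<close> bounds the number of rounds, \<open>Y\<close> the accumulator
   and all registers at the start of a round, and \<open>Z\<close> every value and cost that occurs
   inside a round.\<close>
 define P where "P = X ^ dg n"
 define Y where "Y = P * P ^ dg d"
 define Z where "Z = Y ^ (2 * dg e + dg d + 2)"
 have X2: "2 \<le> X" by (rule Fold.prems)
 have X1: "X ^ 1 \<le> P" unfolding P_def using X2 dg_pos[of n] by (intro power_increasing) auto
 have XP: "X \<le> P" using X1 by simp
 have Pd: "P ^ 1 \<le> P ^ dg d" using XP X2 dg_pos[of d] by (intro power_increasing) auto
 have PY: "P \<le> Y" "P ^ dg d \<le> Y" using XP X2 Pd by (simp_all add: Y_def)
 have Y2: "2 \<le> Y" using PY XP X2 by linarith
 have YZ: "Y ^ k \<le> Z" if "k \<le> 2 * dg e + dg d + 2" for k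
  unfolding Z_def using that Y2 by (intro power_increasing) auto
 have Z2: "2 \<le> Z" and YZ1: "Y \<le> Z" using YZ[of 1] Y2 by simp_all
 have ZX: "Z = X ^ (dg n * (1 + dg d) * (2 * dg e + dg d + 2))"
  unfolding Z_def Y_def P_def by (simp add: power_mult power_add)
 have Z11: "Z ^ 11 = X ^ dg (Fold x y n d e)" unfolding ZX by (simp add: ac_simps flip: power_mult)
 have "Z ^ 1 \<le> Z ^ 11" using Z2 by (intro power_increasing) auto
 then have ZB: "Z \<le> B" using Z11 Fold.prems(7) by simp
 have NP: "N \<le> P" unfolding N_def P_def by (rule ev_bound) (use Fold.prems in auto)
 have dP: "ev w a (g 0) d (?E(x := i)) \<le> P ^ dg d" if "i \<le> N" for i
  by (rule ev_bound) (use Fold.prems(5) XP X2 NP that order_trans in auto)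
 have accY: "acc i \<le> Y" if "i \<le> N" for i
 proof -
  have "acc i \<le> i * P ^ dg d" unfolding acc_def by (rule fold_bound) (use dP that in simp)
  also have "\<dots> \<le> P * P ^ dg d" using that NP by (intro mult_mono) auto
  finally show ?thesis by (simp add: Y_def)
 qed
 have gX: "g i \<le> Y" for i using Fold.prems(5)[of i] XP PY by linarith
 have z: "g t = 0" "g (t + 1) = 0" "g (t + 2) = 0" "g (t + 3) = 0" "g (t + 4) = 0" "g (t + 5) = 0" "g (t + 6) = 0"
  using Fold.prems(4) by simp_all
 have hR: "t + 6 < R" "t + 2 + hi n \<le> R" "t + 3 + hi d \<le> R" "t + 4 + hi e \<le> R" using Fold.prems(3) by simp_all
 have 1: "ex (cmp R n \<rho> (t + 2)) (U * P) (?C g) (?C (g(t + 2 := N)))"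
  unfolding N_def P_def
 proof (rule Fold.IH(1))
  show "\<rho> x < t + 2" for x using Fold.prems(1)[of x] by simp
  show "X ^ dg n \<le> B" using PY(1) YZ1 ZB by (simp add: P_def)
 qed (use Fold.prems hR in auto)
 let ?F = "\<lambda>i. g(t := acc i, t + 1 := i)"
 let ?body = "cmp R d (\<rho>(x := t + 1)) (t + 3) ;; cpy t (t + 3) (t + 4) ;;
    cmp R e (\<rho>(x := t + 1, y := t)) (t + 4) ;; minr (t + 4) (t + 3) (t + 5) ;;
    clr t ;; clr (t + 3) ;; addto (t + 4) t ;; inc (t + 1)"
 \<comment> \<open>The factor 23 is the sum of the factors 1, 5, 1, 11, 1, 1, 2, 1 of the eight
   commands in the body.\<close>
 have body: "ex ?body (23 * U * Z) (?C ((?F i)(t + 2 := N - Suc i)))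
   (?C ((?F (Suc i))(t + 2 := N - Suc i)))" if i: "i < N" for i
 proof -
  define g0 where "g0 = (?F i)(t + 2 := N - Suc i)"
  define dv where "dv = ev w a (g 0) d (?E(x := i))"
  define evv where "evv = ev w a (g 0) e (?E(x := i, y := acc i))"
  have iY: "i \<le> Y" "N - Suc i \<le> Y" using i NP PY by linarith+
  have g0Y: "g0 j \<le> Y" for j unfolding g0_def using gX iY accY i by simp
  have g00: "g0 0 = g 0" unfolding g0_def using Fold.prems(2) by simp
  have \<rho>: "\<rho> u < t" for u by (rule Fold.prems)
  have \<rho>': "\<rho> u \<noteq> t" "\<rho> u \<noteq> t + 1" "\<rho> u \<noteq> t + 2" "\<rho> u \<noteq> t + 3" "\<rho> u \<noteq> Suc t" for u using \<rho>[of u] by auto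
  have env: "g0 \<circ> \<rho>(x := t + 1) = ?E(x := i)"
   unfolding g0_def using \<rho>' by (auto simp: fun_eq_iff)
  have dvY: "dv \<le> Y" using dP[of i] i PY unfolding dv_def by simp
  have b1: "ex (cmp R d (\<rho>(x := t + 1)) (t + 3)) (U * Y ^ dg d) (?C g0) (?C (g0(t + 3 := dv)))"
  proof -
   have "ex (cmp R d (\<rho>(x := t + 1)) (t + 3)) (U * Y ^ dg d) (?C g0)
    (?C (g0(t + 3 := ev w a (g0 0) d (g0 \<circ> \<rho>(x := t + 1)))))"
   proof (rule Fold.IH(2))
    show "(\<rho>(x := t + 1)) u < t + 3" for u using \<rho>[of u] by simp
    show "g0 j = 0" if "t + 3 \<le> j" for j using that Fold.prems(4)[of j] unfolding g0_def by simp
    show "Y ^ dg d \<le> B" using YZ[of "dg d"] ZB by simp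
    show "g0 0 + 1 < H" using g00 Fold.prems(8) by simp
   qed (use hR g0Y Y2 in auto)
   then show ?thesis unfolding env g00 dv_def .
  qed
  let ?g1 = "g0(t + 3 := dv)"
  have g1: "?g1 t = acc i" "?g1 (t + 3) = dv" "?g1 (t + 4) = 0" using z by (simp_all add: g0_def)
  have YB: "u \<le> Y \<Longrightarrow> u \<le> B" for u using YZ1 ZB by simp
  have "Y + Y \<le> Y ^ 2" using mult_le_mono1[OF Y2, of Y] by (simp add: power2_eq_square mult_2)
  moreover have "Y ^ 2 \<le> Z" by (rule YZ) simp
  ultimately have sY: "dv + acc i \<le> Y ^ 2" "dv + acc i \<le> Z" using dvY accY[of i] i by auto
  have b2: "ex (cpy t (t + 3) (t + 4)) (5 * U * Y) (?C ?g1) (?C (?g1(t + 3 := ?g1 (t + 3) + ?g1 t)))"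
  proof (rule ex_cpy[OF okst_I[OF base]])
   show "?g1 j \<le> B" for j using g0Y dvY YB by simp
   show "?g1 t \<le> Y" "?g1 (t + 3) + ?g1 t \<le> B" "?g1 (t + 4) = 0" using g1 accY i sY ZB by simp_all
  qed (use hR Y2 in auto)
  let ?g2 = "g0(t + 3 := dv + acc i)"
  have b2: "ex (cpy t (t + 3) (t + 4)) (5 * U * Y) (?C ?g1) (?C ?g2)"
   using b2 unfolding g1 by simp
  have env2: "?g2 \<circ> \<rho>(x := t + 1, y := t) = ?E(x := i, y := acc i)"
   unfolding g0_def using \<rho>' by (auto simp: fun_eq_iff)
  have g20: "?g2 0 = g 0" using g00 by simp
  \<comment> \<open>While \<open>e\<close> is evaluated, register \<open>t + 3\<close> holds the sum
    of the accumulator and the allowed increment. Hence the bound is \<open>Y ^ 2\<close> instead of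
    \<open>Y\<close>, and \<open>dg\<close> contains \<open>2 * dg e\<close>.\<close>
  have g2Y: "?g2 j \<le> Y ^ 2" for j using g0Y[of j] sY le_power_mono[of "g0 j" Y 1 2] Y2 by simp
  have b3: "ex (cmp R e (\<rho>(x := t + 1, y := t)) (t + 4)) (U * (Y ^ 2) ^ dg e) (?C ?g2) (?C (?g2(t + 4 := evv)))"
  proof -
   have "ex (cmp R e (\<rho>(x := t + 1, y := t)) (t + 4)) (U * (Y ^ 2) ^ dg e) (?C ?g2)
    (?C (?g2(t + 4 := ev w a (?g2 0) e (?g2 \<circ> \<rho>(x := t + 1, y := t)))))"
   proof (rule Fold.IH(3))
    show "(\<rho>(x := t + 1, y := t)) u < t + 4" for u using \<rho>[of u] by simp
    show "?g2 j = 0" if "t + 4 \<le> j" for j using that Fold.prems(4)[of j] unfolding g0_def by simp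
    show "(Y ^ 2) ^ dg e \<le> B" using YZ[of "2 * dg e"] ZB by (simp add: power_mult)
    show "?g2 0 + 1 < H" using g20 Fold.prems(8) by simp
    show "2 \<le> Y ^ 2" using le_power_mono[of 2 Y 1 2] Y2 by simp
   qed (use hR g2Y in auto)
   then show ?thesis unfolding env2 g20 evv_def .
  qed
  let ?g3 = "?g2(t + 4 := evv)"
  have "evv \<le> Y ^ dg e" unfolding evv_def by (rule ev_bound[OF Y2]) (use gX iY accY[of i] i in simp)
  also have "\<dots> \<le> Z" by (rule YZ) simp
  finally have evvZ: "evv \<le> Z" .
  have g3: "?g3 (t + 4) = evv" "?g3 (t + 3) = dv + acc i" by simp_all
  have g3Z: "?g3 j \<le> Z" for j using g0Y[of j] YZ1 sY evvZ by simp
  have b4: "ex (minr (t + 4) (t + 3) (t + 5)) (11 * U * Z) (?C ?g3) (?C (?g3(t + 4 := min (?g3 (t + 4)) (?g3 (t + 3)))))"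
  proof (rule ex_minr[OF okst_I[OF base]])
   show "?g3 j \<le> B" for j using g3Z[of j] ZB by simp
   show "?g3 (t + 5) = 0" "?g3 (t + 5 + 1) = 0" using z z(7)[unfolded add.commute[of t]] by (simp_all add: g0_def)
   show "?g3 (t + 3) \<le> Z" "?g3 (t + 4) \<le> Z" by (rule g3Z)+
  qed (use hR Z2 in auto)
  let ?m = "min evv (dv + acc i)"
  let ?g4 = "?g2(t + 4 := ?m)"
  have b4: "ex (minr (t + 4) (t + 3) (t + 5)) (11 * U * Z) (?C ?g3) (?C ?g4)"
   using b4 unfolding g3 by simp
  have mZ: "?m \<le> Z" using evvZ by simp
  have g4Z: "?g4 j \<le> Z" for j using g0Y[of j] YZ1 sY mZ by simp
  have b5: "ex (clr t) (U * Z) (?C ?g4) (?C (?g4(t := 0)))"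
  proof (rule ex_clr[OF okst_I[OF base]])
   show "?g4 j \<le> B" for j by (rule order_trans[OF g4Z ZB])
   show "?g4 t \<le> Z" by (rule g4Z)
  qed (use hR Z2 in auto)
  have g5Z: "(?g4(t := 0)) j \<le> Z" for j using g4Z[of j] by simp
  have b6: "ex (clr (t + 3)) (U * Z) (?C (?g4(t := 0))) (?C (?g4(t := 0, t + 3 := 0)))"
  proof (rule ex_clr[OF okst_I[OF base]])
   show "(?g4(t := 0)) j \<le> B" for j by (rule order_trans[OF g5Z ZB])
   show "(?g4(t := 0)) (t + 3) \<le> Z" by (rule g5Z)
  qed (use hR Z2 in auto)
  let ?g6 = "?g4(t := 0, t + 3 := 0)"
  have g6: "?g6 t = 0" "?g6 (t + 4) = ?m" by simp_all
  have b7: "ex (addto (t + 4) t) (2 * U * Z) (?C ?g6) (?C (?g6(t + 4 := 0, t := ?g6 t + ?g6 (t + 4))))"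
  proof (rule ex_addto[OF okst_I[OF base]])
   show "?g6 j \<le> B" for j using g5Z[of j] ZB by (auto split: if_splits)
   show "?g6 (t + 4) \<le> Z" using mZ by simp
   show "?g6 t + ?g6 (t + 4) \<le> B" using mZ ZB unfolding g6 by simp
  qed (use hR Z2 in auto)
  let ?g7 = "?g6(t + 4 := 0, t := ?m)"
  have b7: "ex (addto (t + 4) t) (2 * U * Z) (?C ?g6) (?C ?g7)"
   using b7 unfolding g6 by simp
  have b8: "ex (inc (t + 1)) cI (?C ?g7) (?C (?g7(t + 1 := Suc (?g7 (t + 1)))))"
  proof (rule ex_inc[OF okst_I[OF base]])
   show "?g7 j \<le> B" for j using g5Z[of j] ZB mZ by (auto split: if_splits)
  qed (use hR in simp)
  have accS: "acc (Suc i) = ?m" unfolding acc_def dv_def evv_def by (simp add: min.commute add.commute)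
  have fin: "?g7(t + 1 := Suc (?g7 (t + 1))) = (?F (Suc i))(t + 2 := N - Suc i)"
   unfolding g0_def accS using z by (auto simp: fun_eq_iff)
  have "U * Y ^ dg d \<le> U * Z" "U * (Y ^ 2) ^ dg e \<le> U * Z" "5 * U * Y \<le> 5 * U * Z"
   using YZ[of "dg d"] YZ[of "2 * dg e"] YZ1 by (simp_all flip: power_mult)
  moreover have "cI \<le> U * Z" using mult_le_mono[of 1 Z cI U] Z2 by (simp add: U_def mult.commute)
  ultimately have "U * Y ^ dg d + (5 * U * Y + (U * (Y ^ 2) ^ dg e + (11 * U * Z + (U * Z + (U * Z + (2 * U * Z + cI)))))) \<le> 23 * U * Z"
   by linarith
  from ex_mono[OF ex_seq[OF b1 ex_seq[OF b2 ex_seq[OF b3 ex_seq[OF b4 ex_seq[OF b5 ex_seq[OF b6 ex_seq[OF b7 b8]]]]]]] this]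
  show ?thesis unfolding fin unfolding g0_def .
 qed
 have accR: "acc N \<le> Y" by (rule accY) simp
 have 2: "ex (loop (t + 2) ?body) (N * (cI + 23 * U * Z + 2) + 1) (?C ((?F 0)(t + 2 := N)))
   (?C ((?F N)(t + 2 := 0)))"
 proof (rule ex_loop[where F = ?F and p = "\<lambda>_. 0" and v = "\<lambda>_. v" and ch = "\<lambda>_. ch" and oth = "\<lambda>_. ?S"])
  fix i assume "i \<le> N"
  moreover have "N - i \<le> Y" using NP PY by linarith
  ultimately have F: "((?F i)(t + 2 := N - i)) j \<le> Y" for j using gX accY[of i] NP PY by simp
  show "okst 0 ((?F i)(t + 2 := N - i)) ?S"
   by (rule okst_I[OF base]) (rule order_trans[OF order_trans[OF F YZ1] ZB])
 qed (use body hR in auto)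
 have 0: "(?F 0)(t + 2 := N) = g(t + 2 := N)" unfolding acc_def using z by (auto simp: fun_eq_iff)
 let ?g = "(?F N)(t + 2 := 0)"
 have gY: "?g j \<le> Y" for j using gX[of j] accR NP PY by simp
 have 3: "ex (clr (t + 1)) (U * Z) (?C ?g) (?C (?g(t + 1 := 0)))"
 proof (rule ex_clr[OF okst_I[OF base]])
  show "?g j \<le> B" for j by (rule order_trans[OF order_trans[OF gY YZ1] ZB])
  show "?g (t + 1) \<le> Z" by (rule order_trans[OF gY YZ1])
 qed (use hR Z2 in auto)
 have fin: "?g(t + 1 := 0) = g(t := ev w a (g 0) (Fold x y n d e) ?E)"
  using z by (auto simp: fun_eq_iff acc_def N_def)
 have "N * (cI + 23 * U * Z + 2) + 1 \<le> Z * (U * Z + 23 * U * Z) + U * Z * Z"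
 proof -
  have "cI + 2 \<le> U * Z" using mult_le_mono[of 1 Z "cI + 2" U] Z2 by (simp add: U_def mult.commute)
  then have "cI + 23 * U * Z + 2 \<le> U * Z + 23 * U * Z" by linarith
  moreover have "N \<le> Z" using NP PY YZ1 by linarith
  ultimately have "N * (cI + 23 * U * Z + 2) \<le> Z * (U * Z + 23 * U * Z)" by (rule mult_le_mono[rotated])
  moreover have "1 \<le> U * Z * Z" using Z2 by (simp add: U_def)
  ultimately show ?thesis by (rule add_mono)
 qed
 moreover have "U * P \<le> U * Z * Z" "U * Z \<le> U * Z * Z" using PY YZ1 Z2 mult_le_mono[of P Z 1 Z] by simp_all
 moreover have "Z * (U * Z + 23 * U * Z) + U * Z * Z = 25 * (U * Z * Z)" by (simp add: algebra_simps)
 ultimately have "U * P + (N * (cI + 23 * U * Z + 2) + 1 + U * Z) \<le> 27 * (U * Z * Z)"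
  by linarith
 \<comment> \<open>Nine powers of \<open>Z\<close> absorb the number 27, and two more come from
   rounds times cost per round: this is the 11 in \<open>dg\<close>.\<close>
 also have "\<dots> \<le> Z ^ 9 * (U * Z * Z)" by (rule power_absorb) (use Z2 in auto)
 also have "\<dots> = U * Z ^ 11" by (simp add: eval_nat_numeral)
 finally have "U * P + (N * (cI + 23 * U * Z + 2) + 1 + U * Z) \<le> U * X ^ dg (Fold x y n d e)"
  unfolding Z11 .
 from ex_mono[OF ex_seq[OF 1 ex_seq[OF 2[unfolded 0] 3]] this] show ?case
  unfolding fin cmp.simps .
qed
qed

end

section \<open>Statements\<close>

text \<open>The state consists of the array, the output, the remaining choices and a flag that is
 cleared by failing assertions.\<close>

datatype stm = Emit "bool list" | SSeq stm stm (infixr ";" 55) | For nat aexp stm | Put aexp aexp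
 | Guess aexp | Assert aexp

type_synonym pst = "(nat \<Rightarrow> bool) \<times> bool list \<times> (nat \<Rightarrow> bool) \<times> bool"

text \<open>Indices are cut off at \<open>c\<close>, so that no program can leave the available part
  of the array. A failed assertion only clears the flag and the run goes on, which keeps all paths
  within the same bounds.\<close>

primrec sem :: "bool list \<Rightarrow> nat \<Rightarrow> stm \<Rightarrow> (nat \<Rightarrow> nat) \<Rightarrow> pst \<Rightarrow> pst" where
 "sem w c (Emit bs) E s = (fst s, fst (snd s) @ bs, snd (snd s))"
| "sem w c (s1 ; s2) E s = sem w c s2 E (sem w c s1 E s)"
| "sem w c (For x e b) E s = rec_nat s (\<lambda>i. sem w c b (E(x := i))) (ev w (fst s) c e E)"
| "sem w c (Put d e) E s = ((fst s)(min (ev w (fst s) c d E) c := ev w (fst s) c e E \<noteq> 0), snd s)"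
| "sem w c (Guess d) E s = ((fst s)(min (ev w (fst s) c d E) c := fst (snd (snd s)) 0), fst (snd s),
   \<lambda>i. fst (snd (snd s)) (Suc i), snd (snd (snd s)))"
| "sem w c (Assert e) E s = (fst s, fst (snd s), fst (snd (snd s)), snd (snd (snd s)) \<and> ev w (fst s) c e E \<noteq> 0)"

primrec sd :: "stm \<Rightarrow> nat" where
 "sd (Emit bs) = 1"
| "sd (s1 ; s2) = sd s1 + sd s2"
| "sd (For x e b) = dg e * (sd b + 4)"
| "sd (Put d e) = dg d + dg d * dg e + dg e + 12"
| "sd (Guess d) = dg d + 12"
| "sd (Assert e) = dg e + 5"

primrec shi :: "stm \<Rightarrow> nat" where
 "shi (Emit bs) = 1"
| "shi (s1 ; s2) = shi s1 + shi s2"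
| "shi (For x e b) = hi e + shi b + 3"
| "shi (Put d e) = hi d + hi e + 4"
| "shi (Guess d) = hi d + 4"
| "shi (Assert e) = hi e + 1"

primrec guessless :: "stm \<Rightarrow> bool" where
 "guessless (Emit bs) \<longleftrightarrow> True"
| "guessless (s1 ; s2) \<longleftrightarrow> guessless s1 \<and> guessless s2"
| "guessless (For x e b) \<longleftrightarrow> guessless b"
| "guessless (Put d e) \<longleftrightarrow> True"
| "guessless (Guess d) \<longleftrightarrow> False"
| "guessless (Assert e) \<longleftrightarrow> True"

section \<open>Compilation of statements\<close>

definition
 "emit_com bs = Prim (\<lambda>v. (Stay, map (\<lambda>s. (s, Stay)) (snd v), bs))"

definition
 "write_aux R b = tprim R (\<lambda>s. (if b then 2 else 0, Stay))"

text \<open>Register 1 is the negated flag: 0 until the first failed assertion, then 1 for ever.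
  Register \<open>t\<close> serves as the loop variable of \<open>For\<close>, and register
  \<open>t + 1\<close> as its counter.\<close>

primrec cs :: "nat \<Rightarrow> stm \<Rightarrow> (nat \<Rightarrow> nat) \<Rightarrow> nat \<Rightarrow> com" where
 "cs R (Emit bs) \<rho> t = emit_com bs"
| "cs R (s1 ; s2) \<rho> t = cs R s1 \<rho> t ;; cs R s2 \<rho> t"
| "cs R (For x e b) \<rho> t = cmp R e \<rho> (t + 1) ;; loop (t + 1) (cs R b (\<rho>(x := t)) (t + 2) ;; inc t) ;; clr t"
| "cs R (Put d e) \<rho> t = cmp R d \<rho> t ;; cmp R e \<rho> (t + 1) ;; (minr t 0 (t + 2) ;; seek R t ;;
   Cond (\<lambda>v. sym (t + 1) v = 0) (write_aux R False) (write_aux R True) ;; rewind R) ;; clr (t + 1)"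
| "cs R (Guess d) \<rho> t = cmp R d \<rho> t ;; minr t 0 (t + 1) ;; seek R t ;;
   Choose (write_aux R True) (write_aux R False) ;; rewind R"
| "cs R (Assert e) \<rho> t = cmp R e \<rho> t ;;
   Cond (\<lambda>v. sym t v = 0) (Cond (\<lambda>v. sym 1 v = 0) (inc 1) nop) nop ;; clr t"

lemma choiceless_cs: "guessless s \<Longrightarrow> choiceless (cs R s \<rho> t)"
 by (induction s arbitrary: \<rho> t) (simp_all add: emit_com_def write_aux_def)

lemma sd_pos: "0 < sd s"
 by (induction s) (simp_all add: dg_pos)

context reg_env
begin

lemma ex_emit:
 assumes "good (p, T, v, ch)"
 shows "ex (emit_com bs) 1 (p, T, v, ch) (p, T, v @ bs, ch)"
proof -
 have g: "good (p, T, v @ bs, ch)" using assms by (simp add: good_iff)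
 have p: "p \<le> length w + 1" using assms by (simp add: good_iff)
 have e: "eff w (Stay, map (\<lambda>s. (s, Stay)) (snd (look w (p, T, v, ch))), bs) (p, T, v, ch) = (p, T, v @ bs, ch)"
  using p by (simp add: eff_def look_def del: map_map)
 have l: "length (snd (look w (p, T, v, ch))) = K" using assms by (simp add: look_def good_iff)
 have "exec (emit_com bs) (p, T, v, ch) 1 (eff w (Stay, map (\<lambda>s. (s, Stay)) (snd (look w (p, T, v, ch))), bs) (p, T, v, ch))"
  unfolding emit_com_def by (rule exec.Prim) (use assms l in \<open>simp_all add: e g\<close>)
 then show ?thesis unfolding ex_def e by blast
qed

lemma ex_write_aux:
 assumes "okst 0 g (auxt a (Suc j) # oth)"
 shows "ex (write_aux R b) 1 (0, mk g (auxt a (Suc j) # oth), v, ch) (0, mk g (auxt (a(j := b)) (Suc j) # oth), v, ch)"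
proof -
 have j: "Suc j < H" using assms by (auto simp: okst_def tgood_def auxt_def)
 show ?thesis unfolding write_aux_def
  by (rule ex_tx_aux[OF tx_prim' assms]) (use RK_aux[OF assms] j in \<open>auto simp: act_auxt intro!: tgood_auxt\<close>)
qed

lemma ex_write_at:
 assumes base: "okst 0 (\<lambda>_. 0) (auxt a 1 # oth)"
  and gB: "\<And>i. g i \<le> B" and t: "0 < t" "t < u" "u + 1 < R" "g u = 0" "g (u + 1) = 0"
  and M: "g t \<le> M" "g 0 \<le> M" "2 \<le> M" "g 0 + 1 < H"
  and j: "j = min (g t) (g 0)"
  and wr: "ex c 3 (0, mk (g(t := 0)) (auxt a (Suc j) # oth), v, ch)
   (0, mk (g(t := 0)) (auxt (a(j := b)) (Suc j) # oth), v', ch')"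
 shows "ex (minr t 0 u ;; seek R t ;; c ;; rewind R) (14 * U * M)
   (0, mk g (auxt a 1 # oth), v, ch) (0, mk (g(t := 0)) (auxt (a(j := b)) 1 # oth), v', ch')"
proof -
 have base': "okst 0 (\<lambda>_. 0) (auxt a' 1 # oth)" for a' using okst_aux[OF base tgood_auxt[of 1 a']] hH by simp
 have 1: "ex (minr t 0 u) (11 * U * M) (0, mk g (auxt a 1 # oth), v, ch)
  (0, mk (g(t := min (g t) (g 0))) (auxt a 1 # oth), v, ch)"
  by (rule ex_minr[OF okst_I[OF base]]) (use assms in auto)
 let ?g = "g(t := j)"
 have gt: "?g t = j" "?g(t := 0) = g(t := 0)" by simp_all
 have jM: "j \<le> M" "j + 1 < H" using j M by auto
 have 2: "ex (seek R t) (U * M) (0, mk ?g (auxt a 1 # oth), v, ch) (0, mk (?g(t := 0)) (auxt a (Suc (?g t)) # oth), v, ch)"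
 proof (rule ex_seek[OF okst_I[OF base]])
  show "?g i \<le> B" for i using gB[of i] gB[of t] j by (auto simp: min_def)
 qed (use t jM M in auto)
 have "okst 0 (g(t := 0)) (auxt (a(j := b)) 1 # oth)" by (rule okst_I[OF base']) (use gB in simp)
 then have ok: "okst 0 (g(t := 0)) (auxt (a(j := b)) (Suc j) # oth)"
  by (rule okst_aux) (use tgood_auxt jM in simp)
 have 3: "ex (rewind R) (3 * Suc j + 2) (0, mk (g(t := 0)) (auxt (a(j := b)) (Suc j) # oth), v', ch')
   (0, mk (g(t := 0)) (auxt (a(j := b)) 1 # oth), v', ch')"
  by (rule ex_tx_aux[OF tx_auxt_rewind ok]) (use jM RK_aux[OF base] in auto)
 have "3 + (3 * Suc j + 2) \<le> 10 * M" using jM M by simp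
 also have "\<dots> \<le> U * M" by (simp add: U_def)
 finally have "11 * U * M + (U * M + (3 + (3 * Suc j + 2))) \<le> 14 * U * M" by linarith
 from ex_mono[OF ex_seq[OF 1[folded j] ex_seq[OF 2[unfolded gt] ex_seq[OF wr 3]]] this] show ?thesis .
qed

text \<open>Same scheme as \<open>ex_cmp\<close>, except that afterwards all registers but the flag
  are restored. A loop body is run with the bound \<open>X ^ dg e\<close>, because the loop variable
  and the counter can be that large; so nested loops multiply exponents.\<close>

lemma ex_cs:
 assumes base: "okst 0 (\<lambda>_. 0) (auxt a 1 # oth)"
  and "\<And>x. \<rho> x < t" "\<And>x. \<rho> x \<noteq> 1" "1 < t" "t + shi s \<le> R" "\<And>i. t \<le> i \<Longrightarrow> g i = 0" "\<And>i. g i \<le> X" "2 \<le> X"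
   "X ^ sd s \<le> B" "g 0 + 1 < H" "g 1 = of_bool (\<not> f)" "sem w (g 0) s (g \<circ> \<rho>) (a, v, ch, f) = (a', v', ch', f')"
 shows "ex (cs R s \<rho> t) (U * X ^ sd s) (0, mk g (auxt a 1 # oth), v, ch)
  (0, mk (g(1 := of_bool (\<not> f'))) (auxt a' 1 # oth), v', ch')"
proof -
 let ?C = "\<lambda>g a j v ch. (0 :: nat, mk g (auxt a j # oth), v, ch)"
 show ?thesis
 using assms
proof (induction s arbitrary: \<rho> t g X a v ch f a' v' ch' f')
 case (Emit bs)
 have gB: "g i \<le> B" for i using Emit.prems(7)[of i] Emit.prems(9) by simp
 have g: "g(1 := of_bool (\<not> f')) = g" using Emit.prems(11,12) by (auto simp: fun_eq_iff)
 have "ex (emit_com bs) 1 (?C g a 1 v ch) (?C g a 1 (v @ bs) ch)"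
  by (rule ex_emit[OF okst_good[OF okst_I[OF Emit.prems(1) gB, of "\<lambda>i. i"]]])
 moreover have "1 \<le> U * X ^ sd (Emit bs)" using Emit.prems(8) by (simp add: U_def)
 ultimately show ?case unfolding g using Emit.prems(12) ex_mono by (simp del: One_nat_def)
next
 case (SSeq s1 s2)
 have sm: "sem w (g 0) (s1 ; s2) (g \<circ> \<rho>) (a, v, ch, f) = (a', v', ch', f')" by (rule SSeq.prems)
 have X2: "2 \<le> X" by (rule SSeq.prems)
 obtain a1 v1 ch1 f1 where s1: "sem w (g 0) s1 (g \<circ> \<rho>) (a, v, ch, f) = (a1, v1, ch1, f1)" by (metis prod_cases4)
 have le: "X ^ k \<le> B" if "k \<le> sd (s1 ; s2)" for k
  using SSeq.prems(9) le_power_mono[OF order_refl that] X2 by (meson le_trans)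
 have base1: "okst 0 (\<lambda>_. 0) (auxt a1 1 # oth)"
  using okst_aux[OF SSeq.prems(1) tgood_auxt[of 1 a1]] hH by simp
 have 1: "ex (cs R s1 \<rho> t) (U * X ^ sd s1) (?C g a 1 v ch)
  (?C (g(1 := of_bool (\<not> f1))) a1 1 v1 ch1)"
 proof (rule SSeq.IH(1)[OF SSeq.prems(1)])
  show "sem w (g 0) s1 (g \<circ> \<rho>) (a, v, ch, f) = (a1, v1, ch1, f1)" by (rule s1)
 qed (use SSeq.prems le in auto)
 let ?g = "g(1 := of_bool (\<not> f1))"
 have e: "?g \<circ> \<rho> = g \<circ> \<rho>" "?g 0 = g 0" "?g(1 := of_bool (\<not> f')) = g(1 := of_bool (\<not> f'))"
  using SSeq.prems(3) by (auto simp: fun_eq_iff)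
 have "ex (cs R s2 \<rho> t) (U * X ^ sd s2) (?C ?g a1 1 v1 ch1)
  (?C (?g(1 := of_bool (\<not> f'))) a' 1 v' ch')"
 proof (rule SSeq.IH(2)[OF base1])
  show "sem w (?g 0) s2 (?g \<circ> \<rho>) (a1, v1, ch1, f1) = (a', v', ch', f')"
   using sm s1 unfolding e by simp
  show "?g i \<le> X" for i using SSeq.prems(7)[of i] X2 by simp
  show "?g i = 0" if "t \<le> i" for i using SSeq.prems(6)[OF that] SSeq.prems(4) that by simp
  show "?g 0 + 1 < H" using SSeq.prems(10) by simp
  show "t + shi s2 \<le> R" using SSeq.prems(5) by simp
 qed (use SSeq.prems le in auto)
 note 2 = this[unfolded e(3)]
 have "X ^ sd s1 + X ^ sd s2 \<le> X ^ sd (s1 ; s2)"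
  using sum_le_power[OF X2 order_refl order_refl sd_pos sd_pos] by simp
 from mult_le_mono2[OF this, of U] have "U * X ^ sd s1 + U * X ^ sd s2 \<le> U * X ^ sd (s1 ; s2)" by (simp add: algebra_simps)
 from ex_mono[OF ex_seq[OF 1 2] this] show ?case by (simp only: cs.simps)
next
 case (For x e b)
 have sm: "sem w (g 0) (For x e b) (g \<circ> \<rho>) (a, v, ch, f) = (a', v', ch', f')" by (rule For.prems)
 have X2: "2 \<le> X" by (rule For.prems)
 define N where "N = ev w a (g 0) e (g \<circ> \<rho>)"
 define Y where "Y = X ^ dg e"
 have X1: "X ^ 1 \<le> Y" unfolding Y_def using X2 dg_pos[of e] by (intro power_increasing) auto
 have XY: "X \<le> Y" and Y2: "2 \<le> Y" using X1 X2 by simp_all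
 have YB: "Y ^ k \<le> B" if "k \<le> sd b + 4" for k
 proof -
  have "Y ^ k \<le> Y ^ (sd b + 4)" using that Y2 by (intro power_increasing) auto
  then show ?thesis using For.prems(9) by (simp add: Y_def power_mult)
 qed
 have NY: "N \<le> Y" unfolding N_def Y_def by (rule ev_bound) (use For.prems in auto)
 have gY: "g i \<le> Y" for i using For.prems(7)[of i] XY by simp
 have YB1: "Y \<le> B" using YB[of 1] by simp
 have \<rho>: "\<rho> u < t" "\<rho> u \<noteq> 1" for u by (rule For.prems)+
 have z: "g t = 0" "g (t + 1) = 0" using For.prems(6) by simp_all
 have hR: "t + 2 + shi b \<le> R" "t + 1 + hi e \<le> R" "t + 1 < R" using For.prems(5) by simp_all
 have t1: "1 < t" by (rule For.prems)
 have base': "okst 0 (\<lambda>_. 0) (auxt a' 1 # oth)" for a' using okst_aux[OF For.prems(1) tgood_auxt[of 1 a']] hH by simp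
 have 1: "ex (cmp R e \<rho> (t + 1)) (U * Y) (?C g a 1 v ch) (?C (g(t + 1 := N)) a 1 v ch)"
  unfolding N_def Y_def
 proof (rule ex_cmp[OF For.prems(1)])
  show "\<rho> u < t + 1" for u using \<rho>(1)[of u] by simp
  show "X ^ dg e \<le> B" using YB1 by (simp add: Y_def)
 qed (use For.prems hR in auto)
 define st where "st i = rec_nat (a, v, ch, f) (\<lambda>i. sem w (g 0) b ((g \<circ> \<rho>)(x := i))) i" for i
 define aa where "aa i = fst (st i)" for i
 define vv where "vv i = fst (snd (st i))" for i
 define cc where "cc i = fst (snd (snd (st i)))" for i
 define ff where "ff i = snd (snd (snd (st i)))" for i
 have st: "st i = (aa i, vv i, cc i, ff i)" for i by (simp add: aa_def vv_def cc_def ff_def)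
 have st0: "aa 0 = a" "vv 0 = v" "cc 0 = ch" "ff 0 = f" by (simp_all add: aa_def vv_def cc_def ff_def st_def)
 have stN: "aa N = a'" "vv N = v'" "cc N = ch'" "ff N = f'"
  using sm by (simp_all add: aa_def vv_def cc_def ff_def st_def N_def)
 have stS: "sem w (g 0) b ((g \<circ> \<rho>)(x := i)) (aa i, vv i, cc i, ff i) = (aa (Suc i), vv (Suc i), cc (Suc i), ff (Suc i))" for i
  unfolding st[symmetric] by (simp add: st_def)
 let ?F = "\<lambda>i. g(1 := of_bool (\<not> ff i), t := i)"
 have body: "ex (cs R b (\<rho>(x := t)) (t + 2) ;; inc t) (U * Y ^ sd b + cI)
   (?C ((?F i)(t + 1 := N - Suc i)) (aa i) 1 (vv i) (cc i))
   (?C ((?F (Suc i))(t + 1 := N - Suc i)) (aa (Suc i)) 1 (vv (Suc i)) (cc (Suc i)))" if i: "i < N" for i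
 proof -
  let ?g = "(?F i)(t + 1 := N - Suc i)"
  have \<rho>': "\<rho> u \<noteq> t" "\<rho> u \<noteq> t + 1" "\<rho> u \<noteq> Suc 0" "\<rho> u \<noteq> Suc t" for u using \<rho>[of u] by auto
  have e: "?g \<circ> \<rho>(x := t) = (g \<circ> \<rho>)(x := i)" "?g 0 = g 0"
   using \<rho>' t1 by (auto simp: fun_eq_iff)
  have "N - Suc i \<le> Y" "i \<le> Y" using NY i by linarith+
  then have gY': "?g j \<le> Y" for j using gY[of j] Y2 by simp
  have b1: "ex (cs R b (\<rho>(x := t)) (t + 2)) (U * Y ^ sd b) (?C ?g (aa i) 1 (vv i) (cc i))
   (?C (?g(1 := of_bool (\<not> ff (Suc i)))) (aa (Suc i)) 1 (vv (Suc i)) (cc (Suc i)))"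
  proof (rule For.IH[OF base'])
   show "sem w (?g 0) b (?g \<circ> \<rho>(x := t)) (aa i, vv i, cc i, ff i) = (aa (Suc i), vv (Suc i), cc (Suc i), ff (Suc i))"
    unfolding e by (rule stS)
   show "(\<rho>(x := t)) u < t + 2" for u using \<rho>(1)[of u] by simp
   show "(\<rho>(x := t)) u \<noteq> 1" for u using \<rho>(2)[of u] t1 by simp
   show "?g j = 0" if "t + 2 \<le> j" for j using that For.prems(6)[of j] t1 by simp
   show "Y ^ sd b \<le> B" by (rule YB) simp
   show "?g 0 + 1 < H" unfolding e by (rule For.prems)
  qed (use hR t1 Y2 gY' in auto)
  have b2: "ex (inc t) cI (?C (?g(1 := of_bool (\<not> ff (Suc i)))) (aa (Suc i)) 1 (vv (Suc i)) (cc (Suc i)))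
   (?C ((?g(1 := of_bool (\<not> ff (Suc i))))(t := Suc ((?g(1 := of_bool (\<not> ff (Suc i)))) t))) (aa (Suc i)) 1 (vv (Suc i)) (cc (Suc i)))"
  proof (rule ex_inc[OF okst_I[OF base']])
   show "(?g(1 := of_bool (\<not> ff (Suc i)))) j \<le> B" for j using gY'[of j] YB1 Y2 by (auto split: if_splits)
  qed (use hR in simp)
  have b3: "(?g(1 := of_bool (\<not> ff (Suc i))))(t := Suc ((?g(1 := of_bool (\<not> ff (Suc i)))) t)) = (?F (Suc i))(t + 1 := N - Suc i)"
   using t1 by (auto simp: fun_eq_iff)
  show ?thesis using ex_seq[OF b1 b2] unfolding b3 .
 qed
 have 2: "ex (loop (t + 1) (cs R b (\<rho>(x := t)) (t + 2) ;; inc t)) (N * (cI + (U * Y ^ sd b + cI) + 2) + 1)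
   (?C ((?F 0)(t + 1 := N)) (aa 0) 1 (vv 0) (cc 0)) (?C ((?F N)(t + 1 := 0)) (aa N) 1 (vv N) (cc N))"
 proof (rule ex_loop[where F = ?F and p = "\<lambda>_. 0" and v = vv and ch = cc and oth = "\<lambda>i. auxt (aa i) 1 # oth"])
  fix i assume "i \<le> N"
  then have "N - i \<le> Y" "i \<le> Y" using NY by linarith+
  then have F: "((?F i)(t + 1 := N - i)) j \<le> Y" for j using gY[of j] Y2 by simp
  show "okst 0 ((?F i)(t + 1 := N - i)) (auxt (aa i) 1 # oth)"
   by (rule okst_I[OF base']) (rule order_trans[OF F YB1])
 qed (rule hR(3), rule body)
 have F0: "(?F 0)(t + 1 := N) = g(t + 1 := N)" using z For.prems(11) st0 by (auto simp: fun_eq_iff)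
 let ?g = "(?F N)(t + 1 := 0)"
 have gYN: "?g j \<le> Y" for j using gY[of j] NY Y2 by simp
 have 3: "ex (clr t) (U * Y) (?C ?g a' 1 v' ch') (?C (?g(t := 0)) a' 1 v' ch')"
 proof (rule ex_clr[OF okst_I[OF base']])
  show "?g j \<le> B" for j by (rule order_trans[OF gYN YB1])
  show "?g t \<le> Y" by (rule gYN)
 qed (use hR Y2 in auto)
 have fin: "?g(t := 0) = g(1 := of_bool (\<not> f'))" using z stN t1 by (auto simp: fun_eq_iff)
 define Q where "Q = Y ^ sd b"
 have Q1: "1 \<le> Q" using Y2 by (simp add: Q_def)
 have "N * (cI + (U * Q + cI) + 2) + 1 \<le> Y * (U * Q + (U * Q + U * Q)) + U * (Y * Q)"
 proof -
  have c: "cI \<le> U * Q" "cI + 2 \<le> U * Q" using mult_le_mono[of cI U 1 Q] mult_le_mono[of "cI + 2" U 1 Q] Q1 by (simp_all add: U_def)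
  then have "cI + (U * Q + cI) + 2 \<le> U * Q + (U * Q + U * Q)" by linarith
  then have "N * (cI + (U * Q + cI) + 2) \<le> Y * (U * Q + (U * Q + U * Q))" by (rule mult_le_mono[OF NY])
  moreover have "1 \<le> U * (Y * Q)" using Y2 Q1 by (simp add: U_def)
  ultimately show ?thesis by (rule add_mono)
 qed
 moreover have "Y * (U * Q + (U * Q + U * Q)) = 3 * (U * (Y * Q))" by (simp add: algebra_simps)
 moreover have "U * Y \<le> U * (Y * Q)" using Q1 by simp
 ultimately have "U * Y + (N * (cI + (U * Q + cI) + 2) + 1 + U * Y) \<le> 6 * (U * (Y * Q))" by linarith
 also have "\<dots> \<le> Y ^ 3 * (U * (Y * Q))" by (rule power_absorb) (use Y2 in auto)
 also have "\<dots> = U * Y ^ (sd b + 4)" by (simp add: Q_def power_add eval_nat_numeral)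
 also have "\<dots> = U * X ^ sd (For x e b)" by (simp add: Y_def power_mult)
 finally have T: "U * Y + (N * (cI + (U * Y ^ sd b + cI) + 2) + 1 + U * Y) \<le> U * X ^ sd (For x e b)" unfolding Q_def .
 from ex_mono[OF ex_seq[OF 1 ex_seq[OF 2[unfolded F0, unfolded st0(1-3) stN(1-3)] 3]] T] show ?case unfolding fin cs.simps .
next
 case (Put d e)
 have sm: "sem w (g 0) (Put d e) (g \<circ> \<rho>) (a, v, ch, f) = (a', v', ch', f')" by (rule Put.prems)
 let ?vd = "ev w a (g 0) d (g \<circ> \<rho>)" and ?ve = "ev w a (g 0) e (g \<circ> \<rho>)"
 have X2: "2 \<le> X" by (rule Put.prems)
 have X1: "X ^ 1 \<le> X ^ dg d" using X2 dg_pos[of d] by (intro power_increasing) auto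
 have e1: "X ^ 1 \<le> X ^ dg e" using X2 dg_pos[of e] by (intro power_increasing) auto
 have le: "X ^ k \<le> B" if "k \<le> sd (Put d e)" for k
  using Put.prems(9) le_power_mono[OF order_refl that] X2 by (meson le_trans)
 have vd: "?vd \<le> X ^ dg d" and ve: "?ve \<le> X ^ dg e" by (rule ev_bound; use Put.prems in simp)+
 have t1: "1 < t" by (rule Put.prems)
 have hR: "t + hi d \<le> R" "t + 1 + hi e \<le> R" "t + 3 < R" "t + 1 < R" using Put.prems(5) by simp_all
 have z: "g t = 0" "g (t + 1) = 0" "g (t + 2) = 0" "g (t + 3) = 0" using Put.prems(6) by simp_all
 have 1: "ex (cmp R d \<rho> t) (U * X ^ dg d) (?C g a 1 v ch) (?C (g(t := ?vd)) a 1 v ch)"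
  by (rule ex_cmp[OF Put.prems(1)]) (use Put.prems hR le in auto)
 have e: "(g(t := ?vd)) \<circ> \<rho> = g \<circ> \<rho>" "(g(t := ?vd)) 0 = g 0"
  using Put.prems(2) t1 by (auto simp: fun_eq_iff less_imp_neq)
 have "ex (cmp R e \<rho> (t + 1)) (U * (X ^ dg d) ^ dg e) (?C (g(t := ?vd)) a 1 v ch)
   (?C ((g(t := ?vd))(t + 1 := ev w a ((g(t := ?vd)) 0) e ((g(t := ?vd)) \<circ> \<rho>))) a 1 v ch)"
 proof (rule ex_cmp[OF Put.prems(1)])
  show "\<rho> x < t + 1" for x using Put.prems(2)[of x] by simp
  show "(g(t := ?vd)) i \<le> X ^ dg d" for i using vd X1 Put.prems(7)[of i] by simp
  show "2 \<le> X ^ dg d" using X1 X2 by simp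
  show "(X ^ dg d) ^ dg e \<le> B" using le[of "dg d * dg e"] by (simp add: power_mult)
 qed (use Put.prems hR in auto)
 note 2 = this[unfolded e]
 let ?g = "g(t := ?vd, t + 1 := ?ve)"
 define j where "j = min (?g t) (?g 0)"
 have j: "j = min ?vd (g 0)" using t1 by (simp add: j_def)
 define M where "M = X ^ dg d"
 have gB: "?g i \<le> B" for i using X1 le[of "dg d"] le[of "dg e"] Put.prems(7)[of i] vd ve by simp
 have base': "okst 0 (\<lambda>_. 0) (auxt a' 1 # oth)" for a' using okst_aux[OF Put.prems(1) tgood_auxt[of 1 a']] hH by simp
 have ok0: "okst 0 (?g(t := 0)) (auxt a 1 # oth)"
  by (rule okst_I[OF Put.prems(1)]) (use gB in \<open>simp add: fun_upd_def\<close>)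
 have jH: "Suc j < H" using j Put.prems(10) by simp
 have ok: "okst 0 (?g(t := 0)) (auxt a (Suc j) # oth)" by (rule okst_aux[OF ok0 tgood_auxt[OF jH]])
 have wr: "ex (Cond (\<lambda>v. sym (t + 1) v = 0) (write_aux R False) (write_aux R True)) 3 (?C (?g(t := 0)) a (Suc j) v ch)
   (?C (?g(t := 0)) (a(j := ?ve \<noteq> 0)) (Suc j) v ch)"
 proof -
  have "ex (if (?g(t := 0)) (t + 1) = 0 then write_aux R False else write_aux R True) 1 (?C (?g(t := 0)) a (Suc j) v ch)
   (?C (?g(t := 0)) (a(j := ?ve \<noteq> 0)) (Suc j) v ch)"
   using ex_write_aux[OF ok, of False v ch] ex_write_aux[OF ok, of True v ch] by (cases "?ve = 0") simp_all
  from ex_cond_zero[where g = "?g(t := 0)", OF hR(4) this] have "ex (Cond (\<lambda>v. sym (t + 1) v = 0) (write_aux R False) (write_aux R True)) (1 + 2) (?C (?g(t := 0)) a (Suc j) v ch)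
   (?C (?g(t := 0)) (a(j := ?ve \<noteq> 0)) (Suc j) v ch)" .
  then show ?thesis by (rule ex_mono) simp
 qed
 have 3: "ex (minr t 0 (t + 2) ;; seek R t ;; Cond (\<lambda>v. sym (t + 1) v = 0) (write_aux R False) (write_aux R True) ;; rewind R) (14 * U * M)
   (?C ?g a 1 v ch) (?C (?g(t := 0)) (a(j := ?ve \<noteq> 0)) 1 v ch)"
 proof (rule ex_write_at[where g = ?g, OF Put.prems(1) gB])
  show "?g (t + 2) = 0" "?g (t + 2 + 1) = 0" using z by (simp_all add: eval_nat_numeral)
  show "?g t \<le> M" using vd by (simp add: M_def)
  show "?g 0 \<le> M" using Put.prems(7)[of 0] X1 t1 by (simp add: M_def)
  show "2 \<le> M" using X1 X2 by (simp add: M_def)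
  show "?g 0 + 1 < H" using Put.prems(10) t1 by simp
  show "j = min (?g t) (?g 0)" by (rule j_def)
  show "ex (Cond (\<lambda>v. sym (t + 1) v = 0) (write_aux R False) (write_aux R True)) 3 (?C (?g(t := 0)) a (Suc j) v ch)
   (?C (?g(t := 0)) (a(j := ?ve \<noteq> 0)) (Suc j) v ch)" by (rule wr)
 qed (use t1 hR in auto)
 have 4: "ex (clr (t + 1)) (U * X ^ dg e) (?C (?g(t := 0)) (a(j := ?ve \<noteq> 0)) 1 v ch)
   (?C (?g(t := 0, t + 1 := 0)) (a(j := ?ve \<noteq> 0)) 1 v ch)"
 proof (rule ex_clr[OF okst_I[OF base']])
  show "(?g(t := 0)) i \<le> B" for i using gB[of i] by (simp add: fun_upd_def split: if_splits)
  show "(?g(t := 0)) (t + 1) \<le> X ^ dg e" using ve by simp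
  show "2 \<le> X ^ dg e" using e1 X2 by simp
 qed (use hR in auto)
 have fin: "?g(t := 0, t + 1 := 0) = g(1 := of_bool (\<not> f'))" "a' = a(j := ?ve \<noteq> 0)" "v' = v" "ch' = ch"
  using z Put.prems(11) sm j by (auto simp: fun_eq_iff)
 have "16 * X ^ dg d \<le> X ^ 4 * X ^ dg d" by (rule power_absorb) (use X2 in auto)
 then have "16 * X ^ dg d \<le> X ^ (dg d + 4)" by (simp add: power_add mult.commute)
 from sum_le_power[OF X2 order_refl[of "X ^ (dg d * dg e)"] this]
 have "X ^ (dg d * dg e) + 16 * X ^ dg d \<le> X ^ (dg d * dg e + (dg d + 4))" using dg_pos[of d] dg_pos[of e] by simp
 from sum_le_power[OF X2 this order_refl[of "X ^ dg e"]]
 have "X ^ (dg d * dg e) + 16 * X ^ dg d + X ^ dg e \<le> X ^ (dg d * dg e + (dg d + 4) + dg e)" using dg_pos[of e] by simp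
 then have "X ^ (dg d * dg e) + 16 * X ^ dg d + X ^ dg e \<le> X ^ sd (Put d e)"
  by (rule le_power_mono) (use X2 in auto)
 from mult_le_mono2[OF this, of U]
 have T: "U * X ^ dg d + (U * (X ^ dg d) ^ dg e + (14 * U * M + U * X ^ dg e)) \<le> U * X ^ sd (Put d e)"
  by (simp add: power_mult algebra_simps M_def)
 from ex_mono[OF ex_seq[OF 1 ex_seq[OF 2 ex_seq[OF 3 4]]] T] show ?case unfolding fin cs.simps .
next
 case (Guess d)
 have sm: "sem w (g 0) (Guess d) (g \<circ> \<rho>) (a, v, ch, f) = (a', v', ch', f')" by (rule Guess.prems)
 let ?vd = "ev w a (g 0) d (g \<circ> \<rho>)"
 have X2: "2 \<le> X" by (rule Guess.prems)
 have X1: "X ^ 1 \<le> X ^ dg d" using X2 dg_pos[of d] by (intro power_increasing) auto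
 have le: "X ^ k \<le> B" if "k \<le> sd (Guess d)" for k
  using Guess.prems(9) le_power_mono[OF order_refl that] X2 by (meson le_trans)
 have vd: "?vd \<le> X ^ dg d" by (rule ev_bound; use Guess.prems in simp)
 have t1: "1 < t" by (rule Guess.prems)
 have hR: "t + hi d \<le> R" "t + 3 < R" using Guess.prems(5) by simp_all
 have z: "g t = 0" "g (t + 1) = 0" "g (t + 2) = 0" using Guess.prems(6) by simp_all
 have 1: "ex (cmp R d \<rho> t) (U * X ^ dg d) (?C g a 1 v ch) (?C (g(t := ?vd)) a 1 v ch)"
  by (rule ex_cmp[OF Guess.prems(1)]) (use Guess.prems hR le in auto)
 let ?g = "g(t := ?vd)"
 define j where "j = min (?g t) (?g 0)"
 have j: "j = min ?vd (g 0)" using t1 by (simp add: j_def)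
 define M where "M = X ^ dg d"
 have gB: "?g i \<le> B" for i using X1 le[of "dg d"] Guess.prems(7)[of i] vd by simp
 have ok0: "okst 0 (?g(t := 0)) (auxt a 1 # oth)"
  by (rule okst_upd[OF okst_I[OF Guess.prems(1) gB, of "\<lambda>i. i"]]) simp
 have jH: "Suc j < H" using j Guess.prems(10) by simp
 have ok: "okst 0 (?g(t := 0)) (auxt a (Suc j) # oth)" by (rule okst_aux[OF ok0 tgood_auxt[OF jH]])
 have wr: "ex (Choose (write_aux R True) (write_aux R False)) 3 (?C (?g(t := 0)) a (Suc j) v ch)
   (?C (?g(t := 0)) (a(j := ch 0)) (Suc j) v (\<lambda>i. ch (Suc i)))"
 proof -
  have "ex (Choose (write_aux R True) (write_aux R False)) (1 + 2) (?C (?g(t := 0)) a (Suc j) v ch)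
   (?C (?g(t := 0)) (a(j := ch 0)) (Suc j) v (\<lambda>i. ch (Suc i)))"
  proof (rule ex_choose[OF okst_good[OF ok]])
   show "ex (if next_choice (?C (?g(t := 0)) a (Suc j) v ch) then write_aux R True else write_aux R False) 1
    (tail_choice (?C (?g(t := 0)) a (Suc j) v ch)) (?C (?g(t := 0)) (a(j := ch 0)) (Suc j) v (\<lambda>i. ch (Suc i)))"
    using ex_write_aux[OF ok, of False v "\<lambda>i. ch (Suc i)"] ex_write_aux[OF ok, of True v "\<lambda>i. ch (Suc i)"]
    unfolding next_choice_def tail_choice_def by (cases "ch 0") simp_all
  qed
  then show ?thesis by (rule ex_mono) simp
 qed
 have 2: "ex (minr t 0 (t + 1) ;; seek R t ;; Choose (write_aux R True) (write_aux R False) ;; rewind R) (14 * U * M)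
   (?C ?g a 1 v ch) (?C (?g(t := 0)) (a(j := ch 0)) 1 v (\<lambda>i. ch (Suc i)))"
 proof (rule ex_write_at[where g = ?g, OF Guess.prems(1) gB])
  show "?g (t + 1) = 0" "?g (t + 1 + 1) = 0" using z by (simp_all add: eval_nat_numeral)
  show "?g t \<le> M" using vd by (simp add: M_def)
  show "?g 0 \<le> M" using Guess.prems(7)[of 0] X1 t1 by (simp add: M_def)
  show "2 \<le> M" using X1 X2 by (simp add: M_def)
  show "?g 0 + 1 < H" using Guess.prems(10) t1 by simp
  show "j = min (?g t) (?g 0)" by (rule j_def)
  show "ex (Choose (write_aux R True) (write_aux R False)) 3 (?C (?g(t := 0)) a (Suc j) v ch)
   (?C (?g(t := 0)) (a(j := ch 0)) (Suc j) v (\<lambda>i. ch (Suc i)))" by (rule wr)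
 qed (use t1 hR in auto)
 have fin: "?g(t := 0) = g(1 := of_bool (\<not> f'))" "a' = a(j := ch 0)" "v' = v" "ch' = (\<lambda>i. ch (Suc i))"
  using z Guess.prems(11) sm j by (auto simp: fun_eq_iff)
 have "15 * X ^ dg d \<le> X ^ 12 * X ^ dg d" by (rule power_absorb) (use X2 in auto)
 then have "15 * X ^ dg d \<le> X ^ sd (Guess d)" by (simp add: power_add mult.commute)
 from mult_le_mono2[OF this, of U]
 have T: "U * X ^ dg d + 14 * U * M \<le> U * X ^ sd (Guess d)" by (simp add: algebra_simps M_def)
 from ex_mono[OF ex_seq[OF 1 2] T] show ?case unfolding fin cs.simps .
next
 case (Assert e)
 have sm: "sem w (g 0) (Assert e) (g \<circ> \<rho>) (a, v, ch, f) = (a', v', ch', f')" by (rule Assert.prems)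
 let ?ve = "ev w a (g 0) e (g \<circ> \<rho>)"
 have X2: "2 \<le> X" by (rule Assert.prems)
 have X1: "X ^ 1 \<le> X ^ dg e" using X2 dg_pos[of e] by (intro power_increasing) auto
 have le: "X ^ k \<le> B" if "k \<le> sd (Assert e)" for k
  using Assert.prems(9) le_power_mono[OF order_refl that] X2 by (meson le_trans)
 have ve: "?ve \<le> X ^ dg e" by (rule ev_bound; use Assert.prems in simp)
 have t1: "1 < t" by (rule Assert.prems)
 have hR: "t + hi e \<le> R" "t < R" "1 < R" using Assert.prems(5) t1 by simp_all
 have z: "g t = 0" using Assert.prems(6) by simp
 have B1: "1 \<le> B" "X \<le> B" "X ^ dg e \<le> B" using le[of 0] le[of 1] le[of "dg e"] by simp_all
 have 1: "ex (cmp R e \<rho> t) (U * X ^ dg e) (?C g a 1 v ch) (?C (g(t := ?ve)) a 1 v ch)"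
  by (rule ex_cmp[OF Assert.prems(1)]) (use Assert.prems hR le in auto)
 let ?g = "g(t := ?ve)"
 let ?h = "?g(1 := of_bool (\<not> f'))"
 have f': "f' \<longleftrightarrow> f \<and> ?ve \<noteq> 0" using sm by auto
 have gB: "?g i \<le> B" for i using X1 B1 Assert.prems(7)[of i] ve by simp
 have ok: "okst 0 ?g (auxt a 1 # oth)" by (rule okst_I[OF Assert.prems(1) gB])
 have g1: "?g 1 = of_bool (\<not> f)" using Assert.prems(11) t1 by simp
 have 2: "ex (Cond (\<lambda>v. sym t v = 0) (Cond (\<lambda>v. sym 1 v = 0) (inc 1) nop) nop) (cI + 1 + 2 + 2)
   (?C ?g a 1 v ch) (?C ?h a 1 v ch)"
 proof (rule ex_cond_zero[OF hR(2)])
  note n = ex_nop[OF okst_good[OF ok], of v ch]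
  note i = ex_inc[OF ok hR(3), of v ch]
  have "ex (Cond (\<lambda>v. sym 1 v = 0) (inc 1) nop) (cI + 1 + 2) (?C ?g a 1 v ch) (?C (?g(1 := 1)) a 1 v ch)"
  proof (rule ex_cond_zero[OF hR(3)])
   show "ex (if ?g 1 = 0 then inc 1 else nop) (cI + 1) (?C ?g a 1 v ch) (?C (?g(1 := 1)) a 1 v ch)"
   proof (cases f)
    case True
    then show ?thesis using ex_mono[OF i, of "cI + 1"] unfolding g1 by simp
   next
    case False
    then have "?g(1 := 1) = ?g" using g1 by (auto simp: fun_eq_iff)
    then show ?thesis using ex_mono[OF n, of "cI + 1"] False unfolding g1 by simp
   qed
  qed
  moreover have "ex nop (cI + 1 + 2) (?C ?g a 1 v ch) (?C ?g a 1 v ch)"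
   by (rule ex_mono[OF n]) simp
  moreover have "?h = ?g" if "?ve \<noteq> 0" using that f' g1 by (auto simp: fun_eq_iff)
  moreover have "?h = ?g(1 := 1)" if "?ve = 0" using that f' by simp
  ultimately show "ex (if ?g t = 0 then Cond (\<lambda>v. sym 1 v = 0) (inc 1) nop else nop) (cI + 1 + 2)
   (?C ?g a 1 v ch) (?C ?h a 1 v ch)"
   by (cases "?ve = 0") simp_all
 qed
 have 3: "ex (clr t) (U * X ^ dg e) (?C ?h a 1 v ch) (?C (?h(t := 0)) a 1 v ch)"
 proof (rule ex_clr[OF okst_I[OF Assert.prems(1)]])
  show "?h i \<le> B" for i using gB[of i] B1 by simp
  show "?h t \<le> X ^ dg e" using ve t1 by simp
  show "2 \<le> X ^ dg e" using X1 X2 by simp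
 qed (use hR in auto)
 have fin: "?h(t := 0) = g(1 := of_bool (\<not> f'))" "a' = a" "v' = v" "ch' = ch"
  using z t1 sm by (auto simp: fun_eq_iff)
 have "cI + 1 + 2 + 2 \<le> U * X ^ dg e" using mult_le_mono[of "cI + 5" U 1 "X ^ dg e"] X2 by (simp add: U_def)
 then have "U * X ^ dg e + (cI + 1 + 2 + 2 + U * X ^ dg e) \<le> 3 * (U * X ^ dg e)" by linarith
 also have "\<dots> \<le> X ^ 5 * (U * X ^ dg e)" by (rule power_absorb) (use X2 in auto)
 also have "\<dots> = U * X ^ sd (Assert e)" by (simp add: power_add ac_simps)
 finally have T: "U * X ^ dg e + (cI + 1 + 2 + 2 + U * X ^ dg e) \<le> U * X ^ sd (Assert e)" .
 from ex_mono[OF ex_seq[OF 1 ex_seq[OF 2 3]] T] show ?case unfolding fin cs.simps .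
qed
qed

end

section \<open>Initialization with a clock\<close>

text \<open>
 A machine \<open>F\<close> that computes a resource bound is run on the unary parameter, with its state kept
 on a tape of its own and the separator \<open>0\<close> read as the right end marker; only its number of steps
 is kept, in register 2. Register 3 receives the length of the input plus 1.
\<close>

definition
 "boot_init R q = Prim (\<lambda>v. (Stay, map (\<lambda>j. if j \<le> R then (3, Right) else if j = Suc R then (q, Stay)
   else (snd v ! j, Stay)) [0..<length (snd v)], []))"

definition seen :: "insym \<Rightarrow> insym" where
 "seen a = (if a = Bit False then End_Mark else a)"

definition matching :: "tm \<Rightarrow> nat \<Rightarrow> view \<Rightarrow> instr \<Rightarrow> bool" where
 "matching F R v i \<longleftrightarrow> i \<in> instrs F \<and> src i = snd v ! Suc R \<and> in_read i = seen (fst v) \<and>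
   wk_read i = drop (R + 2) (snd v)"

text \<open>On its short input the simulated head would be held back by the end marker. On the real
  tape that marker is an ordinary bit, therefore a move to the right is replaced by staying. Output
  is suppressed.\<close>

definition
 "clock_eff F R v = (let i = (SOME i. matching F R v i) in
   (if seen (fst v) = End_Mark \<and> in_dir i = Right then Stay else in_dir i,
   map (\<lambda>s. (s, Stay)) (take (R + 1) (snd v)) @ (dst i, Stay) # wk_act i, []))"

text \<open>Variable 1 of a program is the length of the input plus 1 (register 3); every other free
  variable is the step count of the clock (register 2).\<close>

definition boot_map :: "nat \<Rightarrow> nat" where "boot_map x = (if x = 1 then 3 else 2)"

definition boot_env :: "nat \<Rightarrow> nat \<Rightarrow> nat \<Rightarrow> nat" where "boot_env u m x = (if x = 1 then m else u)"

text \<open>The largest array index is computed by \<open>cp\<close> while register 0 is still 0,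
  then moved to register 0, where the compiled code of \<open>Get\<close>, \<open>Put\<close> and
  \<open>Guess\<close> expects it.\<close>

definition
 "boot F R cp st = boot_init R (start F) ;;
   While (\<lambda>v. \<exists>i. matching F R v i) (Prim (clock_eff F R) ;; inc 2) ;; home ;;
   While (\<lambda>v. fst v \<noteq> End_Mark) (mvR ;; inc 3) ;; home ;;
   cmp R cp boot_map 4 ;; addto 4 0 ;; cs R st boot_map 4"

lemma choiceless_boot: "guessless st \<Longrightarrow> choiceless (boot F R cp st)"
 by (simp add: boot_def boot_init_def choiceless_cs)

definition qtape :: "nat \<Rightarrow> work_tape" where "qtape q = ((\<lambda>_. 0)(0 := q), 0)"

text \<open>States of \<open>F\<close> are bounded together with the symbols because the state is
  stored as a symbol on a tape.\<close>

definition
 "sym_bound F A \<longleftrightarrow> 4 < A \<and> start F < A \<and> (\<forall>i\<in>instrs F. dst i < A \<and> (\<forall>x\<in>set (wk_act i). fst x < A))"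

lemma sym_bound_exists:
 assumes "well_formed F"
 shows "\<exists>A. sym_bound F A"
proof -
 let ?S = "{4, start F} \<union> dst ` instrs F \<union> (\<Union>i\<in>instrs F. fst ` set (wk_act i))"
 have "finite ?S" using assms by (auto simp: well_formed_def)
 then obtain A where "\<forall>n\<in>?S. n < A" unfolding finite_nat_set_iff_bounded by blast
 then show ?thesis unfolding sym_bound_def by (intro exI[of _ A]) auto
qed

text \<open>A head moves by at most one cell per step, so \<open>n\<close> also bounds the space.
  This gives the space used by the clock.\<close>

lemma steps_invariant:
 assumes wf: "well_formed F" and A: "sym_bound F A"
  and "(step F u ^^ n) (init F) c"
 shows "in_pos c \<le> length u + 1 \<and> length (work c) = n_tapes F \<and> state c < A \<and>
  (\<forall>x\<in>set (work c). snd x \<le> n \<and> (\<forall>j. fst x j < A))"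
 using assms(3)
proof (induction n arbitrary: c)
 case 0
 then show ?case using A by (auto simp: init_def sym_bound_def)
next
 case (Suc n)
 then obtain d where d: "(step F u ^^ n) (init F) d" "step F u d c" by (auto elim: relpowp_Suc_E)
 note IH = Suc.IH[OF d(1)]
 from d(2) obtain i where i: "applicable F u d i" "c = execute u i d" unfolding step_def by blast
 have iF: "i \<in> instrs F" using i(1) by (simp add: applicable_def)
 have len: "length (wk_act i) = n_tapes F" using wf iF by (simp add: well_formed_def)
 have mv: "move dr h \<le> Suc h" for dr h by (cases dr) auto
 have "snd x \<le> Suc n \<and> (\<forall>j. fst x j < A)" if x: "x \<in> set (map2 act (wk_act i) (work d))" for x
 proof -
  from x obtain y z where yz: "(y, z) \<in> set (zip (wk_act i) (work d))" "x = act y z" by auto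
  from set_zip_leftD[OF yz(1)] set_zip_rightD[OF yz(1)] have m: "y \<in> set (wk_act i)" "z \<in> set (work d)" by auto
  have y: "fst y < A" using A iF m(1) by (auto simp: sym_bound_def)
  have z: "snd z \<le> n" "\<And>j. fst z j < A" using IH m(2) by auto
  show ?thesis using y z mv[of "snd y" "snd z"] yz(2) by (cases y; cases z) (auto intro: le_trans)
 qed
 then show ?case using i(2) len IH A iF by (auto simp: execute_def sym_bound_def)
qed

text \<open>The case \<open>r = []\<close> is the input format of \<open>computable\<close>, and
  \<open>r = False # x\<close> is that of \<open>tape_word\<close>; both are served by the same
  machine.\<close>

locale booting = reg_env w K A H R B h for w K A H R B h +
 fixes F :: tm and k :: nat and r :: "bool list" and t :: nat and cf :: config
 assumes wf: "well_formed F" and det: "deterministic F" and symA: "sym_bound F A"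
  and w: "w = replicate k True @ r" and r: "r = [] \<or> (\<exists>x. r = False # x)"
  and steps: "(step F (replicate k True) ^^ t) (init F) cf" and halt: "halted F (replicate k True) cf"
  and K: "K = R + 2 + n_tapes F" and R4: "4 < R" and tH: "t < H" and tB: "t \<le> B" and wB: "length w + 1 \<le> B"
begin

abbreviation "u \<equiv> replicate k True"
abbreviation "aux0 \<equiv> auxt (\<lambda>_. False) 1"

text \<open>Behind the \<open>k\<close> ones stands either the real end marker or the separator, and
  \<open>seen\<close> turns the latter into an end marker. The simulated head never gets beyond
  position \<open>k + 1\<close>.\<close>

lemma seen_scan: "p \<le> k + 1 \<Longrightarrow> seen (scan_input w p) = scan_input u p"
 using r by (auto simp: w seen_def scan_input_def nth_append)

lemma kw: "k \<le> length w" by (simp add: w)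

definition conf :: "(nat \<Rightarrow> nat) \<Rightarrow> config \<Rightarrow> (nat \<Rightarrow> bool) \<Rightarrow> mst" where
 "conf g c ch = (in_pos c, mk g (aux0 # qtape (state c) # work c), [], ch)"

lemma look_conf:
 "look w (conf g c ch) = (scan_input w (in_pos c),
   map rd (mk g [aux0]) @ state c # map (\<lambda>(t, h). t h) (work c))"
 by (simp add: look_def conf_def mk_def rd_def case_prod_unfold qtape_def)

lemma length_mk1: "length (mk g [x]) = R + 1"
 by (simp add: mk_def)

lemma matching_conf:
 assumes "in_pos c \<le> k + 1"
 shows "matching F R (look w (conf g c ch)) i \<longleftrightarrow> applicable F u c i"
 unfolding matching_def applicable_def look_conf
 using seen_scan[OF assms] length_mk1[of g aux0] by (auto simp: nth_append)

lemma matching_unique: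
 assumes "in_pos c \<le> k + 1" "applicable F u c i"
 shows "(SOME i. matching F R (look w (conf g c ch)) i) = i"
proof (rule some_equality)
 show "matching F R (look w (conf g c ch)) i" using matching_conf assms by blast
 fix j assume "matching F R (look w (conf g c ch)) j"
 then have "applicable F u c j" using matching_conf assms by blast
 with assms(2) det show "j = i" unfolding deterministic_def applicable_def by metis
qed

lemma tgood_qtape: "q < A \<Longrightarrow> tgood (qtape q)"
 using A4 hH by (simp add: tgood_def qtape_def)

lemma reach_good:
 assumes "(step F u ^^ n) (init F) c" "n \<le> t" "\<And>i. g i \<le> B"
 shows "okst (in_pos c) g (aux0 # qtape (state c) # work c)" "in_pos c \<le> k + 1"
proof -
 note I = steps_invariant[OF wf symA assms(1)]
 show "in_pos c \<le> k + 1" using I by simp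
 have "tgood x" if "x \<in> set (work c)" for x
  using I that assms(2) tH unfolding tgood_def by (meson le_less_trans le_trans)
 moreover have "tgood aux0" by (rule tgood_auxt) (use hH in simp)
 ultimately show "okst (in_pos c) g (aux0 # qtape (state c) # work c)"
  unfolding okst_def using I kw K assms(3) tgood_qtape by simp
qed

lemma ex_clock_step:
 assumes c: "(step F u ^^ n) (init F) c" "n < t" and c': "step F u c c'" and g: "\<And>i. g i \<le> B"
 shows "ex (Prim (clock_eff F R)) 1 (conf g c ch) (conf g c' ch)"
proof -
 have c'n: "(step F u ^^ Suc n) (init F) c'" using c(1) c' by auto
 note G = reach_good[where g = g, OF c(1) less_imp_le[OF c(2)] g] and G' = reach_good[where g = g, OF c'n Suc_leI[OF c(2)] g]
 from c' obtain i where i: "applicable F u c i" "c' = execute u i c" unfolding step_def by blast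
 define v where "v = look w (conf g c ch)"
 have sm: "(SOME i. matching F R v i) = i" unfolding v_def by (rule matching_unique[OF G(2) i(1)])
 have fv: "fst v = scan_input w (in_pos c)" "snd v = map rd (mk g [aux0]) @ state c # map (\<lambda>(t, h). t h) (work c)"
  unfolding v_def look_conf by simp_all
 have tk: "take (R + 1) (snd v) = map rd (mk g [aux0])" unfolding fv using length_mk1[of g aux0] by simp
 have iF: "i \<in> instrs F" using i(1) by (simp add: applicable_def)
 have len: "length (wk_act i) = n_tapes F" using wf iF by (simp add: well_formed_def)
 have lw: "length (work c) = n_tapes F" using steps_invariant[OF wf symA c(1)] by blast
 have ce: "clock_eff F R v = (if scan_input u (in_pos c) = End_Mark \<and> in_dir i = Right then Stay else in_dir i,
   map (\<lambda>s. (s, Stay)) (map rd (mk g [aux0])) @ (dst i, Stay) # wk_act i, [])"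
  unfolding clock_eff_def sm Let_def fv(1) seen_scan[OF G(2)] tk ..
 have mk1: "mk g (aux0 # qtape q # T) = mk g [aux0] @ qtape q # T" for q T by (simp add: mk_def)
 have st: "map2 act (map (\<lambda>s. (s, Stay)) (map rd T)) T = T" for T :: "work_tape list"
  by (induction T) (auto simp: rd_def)
 have pos: "min (move (fst (clock_eff F R v)) (in_pos c)) (length w + 1) = in_pos c'"
 proof -
  have e: "scan_input u p = End_Mark \<longleftrightarrow> k < p" for p by (auto simp: scan_input_def)
  have "in_pos c' = min (move (in_dir i) (in_pos c)) (k + 1)" using i(2) by (simp add: execute_def)
  then show ?thesis using G(2) kw unfolding ce e by (cases "in_dir i") auto
 qed
 have "map2 act (fst (snd (clock_eff F R v))) (mk g (aux0 # qtape (state c) # work c)) =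
   mk g (aux0 # qtape (state c') # work c')"
  unfolding ce mk1 fst_conv snd_conv
  using i(2) by (subst zip_append) (auto simp: st execute_def qtape_def fun_eq_iff simp del: map_map)
 note m = this
 have sc: "snd (snd (clock_eff F R v)) = []" unfolding ce by simp
 have e: "eff w (clock_eff F R v) (conf g c ch) = conf g c' ch"
  by (simp only: eff_def conf_def fst_conv snd_conv pos m sc append_Nil2)
 have "exec (Prim (clock_eff F R)) (conf g c ch) 1 (eff w (clock_eff F R v) (conf g c ch))"
  unfolding v_def
 proof (rule exec.Prim)
  show "good (conf g c ch)" unfolding conf_def by (rule okst_good[OF G(1)])
  show "length (fst (snd (clock_eff F R (look w (conf g c ch))))) = K"
   unfolding v_def[symmetric] ce using len K length_mk1[of g aux0] by simp
  show "good (eff w (clock_eff F R (look w (conf g c ch))) (conf g c ch))"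
   unfolding v_def[symmetric] e unfolding conf_def by (rule okst_good[OF G'(1)])
 qed
 then show ?thesis unfolding e ex_def by blast
qed

lemma ex_boot_init: "ex (boot_init R (start F)) 1 (init_state ch) (conf (\<lambda>_. 0) (init F) ch)"
proof -
 let ?v = "look w (init_state ch)"
 let ?f = "\<lambda>v :: view. (Stay, map (\<lambda>j. if j \<le> R then (3, Right) else if j = Suc R then (start F, Stay)
   else (snd v ! j, Stay)) [0..<length (snd v)], [] :: bool list)"
 have G: "good (conf (\<lambda>_. 0) (init F) ch)"
  unfolding conf_def using reach_good(1)[of 0 "init F" "\<lambda>_. 0"] by (intro okst_good) simp
 have g0: "good (init_state ch)" using A4 hH by (auto simp: good_def)
 have sv: "snd ?v = replicate K 0" by (simp add: look_def)
 have n0: "act (3, Right) (\<lambda>_. 0, 0) = num 0" "act (3, Right) (\<lambda>_. 0, 0) = aux0"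
  by (auto simp: num_def tape_def auxt_def fun_eq_iff nth_default_def)
 have l1: "length (map2 act (fst (snd (?f ?v))) (replicate K (\<lambda>_. 0, 0))) = K" by (simp add: sv)
 have l2: "length (mk (\<lambda>_. 0) (aux0 # qtape (start F) # replicate (n_tapes F) (\<lambda>_. 0, 0))) = K"
  by (simp add: mk_def K)
 have "map2 act (fst (snd (?f ?v))) (replicate K (\<lambda>_. 0, 0)) = mk (\<lambda>_. 0) (aux0 # qtape (start F) # replicate (n_tapes F) (\<lambda>_. 0, 0))"
 proof (rule nth_equalityI)
  fix i assume "i < length (map2 act (fst (snd (?f ?v))) (replicate K (\<lambda>_. 0, 0)))"
  then have i: "i < K" by (simp only: l1)
  have lhs: "map2 act (fst (snd (?f ?v))) (replicate K (\<lambda>_. 0, 0)) ! i =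
   act (if i \<le> R then (3, Right) else if i = Suc R then (start F, Stay) else (0, Stay)) (\<lambda>_. 0, 0)"
   using i by (simp add: sv del: act.simps)
  have s: "act (0, Stay) (\<lambda>_. 0, 0) = (\<lambda>_. 0, 0 :: nat)" by (simp add: fun_eq_iff)
  show "map2 act (fst (snd (?f ?v))) (replicate K (\<lambda>_. 0, 0)) ! i =
    mk (\<lambda>_. 0) (aux0 # qtape (start F) # replicate (n_tapes F) (\<lambda>_. 0, 0)) ! i"
  proof (cases "i < R")
   case True
   then show ?thesis unfolding lhs using n0 by (simp add: mk_def nth_append del: act.simps)
  next
   case False
   then consider "i = R" | "i = Suc R" | j where "i = R + 2 + j"
    by (metis add_2_eq_Suc' add_Suc_right less_Suc_eq_le less_imp_Suc_add linorder_neqE_nat nat_less_le not_less_eq add.commute add_Suc)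
   then show ?thesis
   proof cases
    case 1
    then show ?thesis unfolding lhs using n0 by (simp add: mk_def nth_append del: act.simps)
   next
    case 2
    then show ?thesis unfolding lhs by (simp add: mk_def nth_append qtape_def)
   next
    case 3
    then have "j < n_tapes F" using i K by simp
    then show ?thesis unfolding lhs using 3 s by (simp add: mk_def nth_append del: act.simps)
   qed
  qed
 qed (simp only: l1 l2)
 then have e: "eff w (?f ?v) (init_state ch) = conf (\<lambda>_. 0) (init F) ch"
  unfolding eff_def conf_def by (simp add: init_def)
 have "exec (Prim ?f) (init_state ch) 1 (eff w (?f ?v) (init_state ch))"
  by (rule exec.Prim[OF g0]) (use G in \<open>simp_all only: e\<close>, simp add: sv)
 then show ?thesis unfolding e boot_init_def ex_def by blast
qed

lemma ex_clock:
 "ex (While (\<lambda>v. \<exists>i. matching F R v i) (Prim (clock_eff F R) ;; inc 2)) (t * (1 + cI + 2) + 1)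
   (conf (\<lambda>_. 0) (init F) ch) (conf ((\<lambda>_ :: nat. 0 :: nat)(2 := t)) cf ch)"
proof -
 from steps obtain f where f: "f 0 = init F" "f t = cf" "\<And>i. i < t \<Longrightarrow> step F u (f i) (f (Suc i))"
  unfolding relpowp_fun_conv by blast
 have fn: "(step F u ^^ i) (init F) (f i)" if "i \<le> t" for i
  using that
 proof (induction i)
  case (Suc i)
  then have "(step F u ^^ i) (init F) (f i)" "step F u (f i) (f (Suc i))" using f(3)[of i] by auto
  then show ?case by auto
 qed (simp add: f)
 let ?g = "\<lambda>i. (\<lambda>_ :: nat. 0 :: nat)(2 := i)"
 have gB: "(?g i) j \<le> B" if "i \<le> t" for i j using that tB by simp
 have "ex (While (\<lambda>v. \<exists>i. matching F R v i) (Prim (clock_eff F R) ;; inc 2)) (t * ((1 + cI) + 2) + 1)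
   (conf (?g 0) (f 0) ch) (conf (?g t) (f t) ch)"
 proof (rule ex_while[where st = "\<lambda>i. conf (?g i) (f i) ch"])
  fix i assume i: "i < t"
  have 1: "ex (Prim (clock_eff F R)) 1 (conf (?g i) (f i) ch) (conf (?g i) (f (Suc i)) ch)"
   by (rule ex_clock_step[OF fn i f(3)]) (use i gB in auto)
  have o: "okst (in_pos (f (Suc i))) (?g i) (aux0 # qtape (state (f (Suc i))) # work (f (Suc i)))"
   by (rule reach_good(1)[OF fn]) (use i gB in auto)
  have 2: "ex (inc 2) cI (conf (?g i) (f (Suc i)) ch) (conf (?g (Suc i)) (f (Suc i)) ch)"
   unfolding conf_def using ex_inc[OF o, of 2] R4 by simp
  show "ex (Prim (clock_eff F R) ;; inc 2) (1 + cI) (conf (?g i) (f i) ch) (conf (?g (Suc i)) (f (Suc i)) ch)"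
   by (rule ex_seq[OF 1 2])
  have p: "in_pos (f i) \<le> k + 1" by (rule reach_good(2)[OF fn, of i "\<lambda>_. 0"]) (use i in auto)
  show "\<exists>j. matching F R (look w (conf (?g i) (f i) ch)) j"
   using f(3)[OF i] unfolding matching_conf[OF p] step_def by blast
 next
  have p: "in_pos (f t) \<le> k + 1" by (rule reach_good(2)[OF fn, of t "\<lambda>_. 0"]) auto
  show "\<not> (\<exists>j. matching F R (look w (conf (?g t) (f t) ch)) j)"
   using halt unfolding f(2) matching_conf[OF p[unfolded f(2)]] halted_def step_def by blast
  show "good (conf (?g t) (f t) ch)" unfolding conf_def
   by (rule okst_good[OF reach_good(1)[OF fn]]) (use gB in auto)
 qed
 moreover have "?g 0 = (\<lambda>_. 0)" by auto
 ultimately show ?thesis using f by simp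
qed

lemma ex_measure:
 assumes "okst 0 g oth" "g 3 = 0" "\<And>i. g i \<le> B"
 shows "ex (While (\<lambda>v. fst v \<noteq> End_Mark) (mvR ;; inc 3)) ((length w + 1) * (1 + cI + 2) + 1)
  (0, mk g oth, v, ch) (length w + 1, mk (g(3 := length w + 1)) oth, v, ch)"
proof -
 have ok: "okst p (g(3 := i)) oth" if "i \<le> length w + 1" "p \<le> length w + 1" for i p
  using assms that wB by (auto simp: okst_def)
 have "ex (While (\<lambda>v. fst v \<noteq> End_Mark) (mvR ;; inc 3)) ((length w + 1) * (1 + cI + 2) + 1)
  (0, mk (g(3 := 0)) oth, v, ch) (length w + 1, mk (g(3 := length w + 1)) oth, v, ch)"
 proof (rule ex_while[where st = "\<lambda>i. (i, mk (g(3 := i)) oth, v, ch)" and n = "length w + 1"])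
  fix i assume i: "i < length w + 1"
  have m: "min (Suc i) (length w + 1) = Suc i" using i by simp
  have 1: "ex mvR 1 (i, mk (g(3 := i)) oth, v, ch) (Suc i, mk (g(3 := i)) oth, v, ch)"
   using ex_mv(1)[OF okst_good[OF ok], of i i v ch] i unfolding m by simp
  have 2: "ex (inc 3) cI (Suc i, mk (g(3 := i)) oth, v, ch) (Suc i, mk (g(3 := Suc i)) oth, v, ch)"
   using ex_inc[OF ok[of i "Suc i"], of 3] i R4 by simp
  show "ex (mvR ;; inc 3) (1 + cI) (i, mk (g(3 := i)) oth, v, ch) (Suc i, mk (g(3 := Suc i)) oth, v, ch)"
   by (rule ex_seq[OF 1 2])
  show "fst (look w (i, mk (g(3 := i)) oth, v, ch)) \<noteq> End_Mark" using i by (auto simp: look_def scan_input_def)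
 next
  show "\<not> fst (look w (length w + 1, mk (g(3 := length w + 1)) oth, v, ch)) \<noteq> End_Mark"
   by (simp add: look_def scan_input_def)
  show "good (length w + 1, mk (g(3 := length w + 1)) oth, v, ch)" by (rule okst_good[OF ok]) auto
 qed
 moreover have "g(3 := 0) = g" using assms(2) by auto
 ultimately show ?thesis by simp
qed

lemma ex_boot:
 assumes R: "4 + hi cp \<le> R" "4 + shi st \<le> R"
  and X: "2 \<le> X" "t \<le> X" "length w + 1 \<le> X" and XB: "(X ^ dg cp) ^ sd st \<le> B"
  and cap: "cap = ev w (\<lambda>_. False) 0 cp (boot_env t (length w + 1))" "cap + 1 < H"
  and sm: "sem w cap st (boot_env t (length w + 1)) (\<lambda>_. False, [], ch, True) = (a', v', ch', f')"
 shows "\<exists>s. ex (boot F R cp st) (9 * U * (X ^ dg cp) ^ sd st) (init_state ch) s \<and>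
  (sym 1 (look w s) = 0 \<longleftrightarrow> f') \<and> fst (snd (snd s)) = v'"
proof -
 define Y where "Y = X ^ dg cp"
 define Z where "Z = Y ^ sd st"
 have "X ^ 1 \<le> Y" unfolding Y_def using X dg_pos[of cp] by (intro power_increasing) auto
 then have XY: "X \<le> Y" by simp
 then have Y2: "2 \<le> Y" using X by simp
 have "Y ^ 1 \<le> Z" unfolding Z_def using Y2 sd_pos[of st] by (intro power_increasing) auto
 then have YZ: "Y \<le> Z" by simp
 have ZB: "Z \<le> B" using XB by (simp add: Z_def Y_def)
 let ?oth = "qtape (state cf) # work cf"
 let ?g = "(\<lambda>_ :: nat. 0 :: nat)(2 := t, 3 := length w + 1)"
 have ok0: "okst 0 g (aux0 # ?oth)" if "\<And>i. g i \<le> B" for g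
  using reach_good(1)[where g = g, OF steps order_refl that] by (simp add: okst_def)
 have g1: "((\<lambda>_ :: nat. 0 :: nat)(2 := t)) i \<le> B" for i using tB by simp
 have 1: "ex home (in_pos cf * 3 + 1) (conf ((\<lambda>_ :: nat. 0 :: nat)(2 := t)) cf ch) (0, mk ((\<lambda>_ :: nat. 0 :: nat)(2 := t)) (aux0 # ?oth), [], ch)"
  unfolding conf_def by (rule ex_home[OF okst_good[OF reach_good(1)[where g = "(\<lambda>_ :: nat. 0 :: nat)(2 := t)", OF steps order_refl g1]]])
 have 2: "ex (While (\<lambda>v. fst v \<noteq> End_Mark) (mvR ;; inc 3)) ((length w + 1) * (1 + cI + 2) + 1)
  (0, mk ((\<lambda>_ :: nat. 0 :: nat)(2 := t)) (aux0 # ?oth), [], ch) (length w + 1, mk ?g (aux0 # ?oth), [], ch)"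
  by (rule ex_measure[OF ok0[where g = "(\<lambda>_ :: nat. 0 :: nat)(2 := t)", OF g1]]) (use g1 in auto)
 have gB: "?g i \<le> B" for i using tB wB by simp
 have 3: "ex home ((length w + 1) * 3 + 1) (length w + 1, mk ?g (aux0 # ?oth), [], ch) (0, mk ?g (aux0 # ?oth), [], ch)"
  by (rule ex_home) (use ex_good[OF 2] in blast)
 have en: "?g \<circ> boot_map = boot_env t (length w + 1)"
  by (auto simp: fun_eq_iff boot_map_def boot_env_def)
 have gX: "?g i \<le> X" for i using X by simp
 have base: "okst 0 (\<lambda>_. 0) (aux0 # ?oth)" by (rule ok0) simp
 have bm: "boot_map x < 4" "boot_map x \<noteq> 1" "boot_map x \<noteq> 0" "boot_map x \<noteq> 4" for x by (simp_all add: boot_map_def)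
 have capX: "cap \<le> Y" unfolding cap(1) Y_def by (rule ev_bound[OF X(1)]) (use X in \<open>simp add: boot_env_def\<close>)
 have 4: "ex (cmp R cp boot_map 4) (U * Y) (0, mk ?g (aux0 # ?oth), [], ch)
   (0, mk (?g(4 := cap)) (aux0 # ?oth), [], ch)"
 proof -
  have "ex (cmp R cp boot_map 4) (U * X ^ dg cp) (0, mk ?g (aux0 # ?oth), [], ch)
   (0, mk (?g(4 := ev w (\<lambda>_. False) (?g 0) cp (?g \<circ> boot_map))) (aux0 # ?oth), [], ch)"
   by (rule ex_cmp[OF base bm(1)]) (use R gX X YZ ZB hH in \<open>auto simp: Y_def\<close>)
  then show ?thesis unfolding en by (simp add: cap(1) Y_def)
 qed
 let ?h = "?g(4 := cap)"
 have hB: "?h i \<le> B" for i using gB[of i] capX YZ ZB by simp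
 have 5: "ex (addto 4 0) (2 * U * Y) (0, mk ?h (aux0 # ?oth), [], ch)
   (0, mk (?h(4 := 0, 0 := ?h 0 + ?h 4)) (aux0 # ?oth), [], ch)"
  by (rule ex_addto[OF ok0[where g = ?h, OF hB]]) (use R4 capX Y2 YZ ZB in auto)
 let ?j = "?g(0 := cap)"
 have j: "?h(4 := 0, 0 := ?h 0 + ?h 4) = ?j" by (auto simp: fun_eq_iff)
 have ej: "?j \<circ> boot_map = boot_env t (length w + 1)" "?j 0 = cap"
  using bm by (auto simp: fun_eq_iff boot_map_def boot_env_def)
 have 6: "ex (cs R st boot_map 4) (U * Z) (0, mk ?j (aux0 # ?oth), [], ch)
   (0, mk (?j(1 := of_bool (\<not> f'))) (auxt a' 1 # ?oth), v', ch')"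
  unfolding Z_def
 proof (rule ex_cs[OF base bm(1,2)])
  show "sem w (?j 0) st (?j \<circ> boot_map) (\<lambda>_. False, [], ch, True) = (a', v', ch', f')" unfolding ej by (rule sm)
  show "?j i \<le> Y" for i using gX[of i] XY capX by simp
  show "?j 0 + 1 < H" using cap(2) by simp
  show "Y ^ sd st \<le> B" using ZB by (simp add: Z_def)
 qed (use R Y2 in auto)
 note chain = ex_seq[OF ex_boot_init ex_seq[OF ex_clock ex_seq[OF 1 ex_seq[OF 2 ex_seq[OF 3 ex_seq[OF 4 ex_seq[OF 5[unfolded j] 6]]]]]]]
 have XZ: "X \<le> Z" using XY YZ by simp
 have Z1: "1 \<le> Z" using XZ X by simp
 have s1: "t * (1 + cI + 2) + 1 \<le> U * Z"
 proof -
  have "t * (1 + cI + 2) + 1 \<le> Z * (1 + cI + 2) + Z" using X XZ Z1 by (intro add_mono mult_mono) auto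
  also have "\<dots> \<le> U * Z" by (simp add: U_def algebra_simps)
  finally show ?thesis .
 qed
 have s2: "(length w + 1) * (1 + cI + 2) + 1 \<le> U * Z"
 proof -
  have "length w + 1 \<le> Z" using X XZ by simp
  then have "(length w + 1) * (1 + cI + 2) + 1 \<le> Z * (1 + cI + 2) + Z" using Z1 by (intro add_mono mult_mono) auto
  also have "\<dots> \<le> U * Z" by (simp add: U_def algebra_simps)
  finally show ?thesis .
 qed
 have "(length w + 1) * 3 + 1 \<le> 10 * Z" using X XZ Z1 by simp
 also have "10 * Z \<le> U * Z" by (simp add: U_def)
 finally have s3: "(length w + 1) * 3 + 1 \<le> U * Z" .
 have "in_pos cf \<le> k + 1" using steps_invariant[OF wf symA steps] by simp
 then have "in_pos cf \<le> length w + 1" using kw by simp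
 then have "in_pos cf * 3 + 1 \<le> (length w + 1) * 3 + 1" by simp
 then have s4: "in_pos cf * 3 + 1 \<le> U * Z" using s3 by (rule le_trans)
 have s5: "U * Y \<le> U * Z" "2 * U * Y \<le> 2 * U * Z" using YZ by simp_all
 have s6: "1 \<le> U * Z" using Z1 by (simp add: U_def)
 \<comment> \<open>The nine units: one each for initialization, clock, both returns of the head,
   measuring the input, \<open>cp\<close> and the program, and two for moving the result of
   \<open>cp\<close> to register 0.\<close>
 have T: "1 + (t * (1 + cI + 2) + 1 + (in_pos cf * 3 + 1 + ((length w + 1) * (1 + cI + 2) + 1 + ((length w + 1) * 3 + 1 +
   (U * Y + (2 * U * Y + U * Z)))))) \<le> 9 * U * Z"
  using s1 s2 s3 s4 s5 s6 by linarith
 have "ex (boot F R cp st) (9 * U * Z) (init_state ch) (0, mk (?j(1 := of_bool (\<not> f'))) (auxt a' 1 # ?oth), v', ch')"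
  unfolding boot_def by (rule ex_mono[OF chain T])
 moreover have "sym 1 (look w (0, mk (?j(1 := of_bool (\<not> f'))) (auxt a' 1 # ?oth), v', ch')) = 0 \<longleftrightarrow> f'"
  by (subst sym_mk) (use R4 in auto)
 ultimately show ?thesis unfolding Z_def Y_def by (intro exI conjI) auto
qed

end

text \<open>Besides the registers there are the array, the tape for the state of \<open>F\<close>,
  and the tapes of \<open>F\<close>.\<close>

definition
 "boot_tm F A cp st = tm_of (9 + hi cp + shi st + n_tapes F) A
   (boot F (7 + hi cp + shi st) cp st) (\<lambda>v. sym 1 v = 0)"

lemma well_formed_boot_tm: "well_formed (boot_tm F A cp st)"
 by (simp add: boot_tm_def well_formed_tm_of)

lemma deterministic_boot_tm: "guessless st \<Longrightarrow> deterministic (boot_tm F A cp st)"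
 by (simp add: boot_tm_def deterministic_tm_of choiceless_boot)

text \<open>The exponent is a product because the program runs with the value of \<open>cp\<close>,
  up to \<open>X ^ dg cp\<close>, in register 0. The space is made up of \<open>h\<close> digits for
  a register, \<open>cap\<close> for the array and \<open>t\<close> for the tapes of the
  clock.\<close>

theorem
 assumes "well_formed F" "deterministic F" "sym_bound F A"
  and "w = replicate k True @ r" "r = [] \<or> (\<exists>x. r = False # x)"
  and "(step F (replicate k True) ^^ t) (init F) cf" "halted F (replicate k True) cf"
  and X: "X = t + length w + 2" and h: "X ^ (dg cp * sd st) < 2 ^ h"
  and cap: "cap = ev w (\<lambda>_. False) 0 cp (boot_env t (length w + 1))"
 shows runs_in_time_boot_tm: "runs_in_time (boot_tm F A cp st) w (real (9 * (6 * h + 22) * X ^ (dg cp * sd st) + 1))"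
  and runs_in_space_boot_tm: "runs_in_space (boot_tm F A cp st) w (real (h + cap + t + 5))"
  and accepts_boot_tm: "accepts (boot_tm F A cp st) w \<longleftrightarrow>
   (\<exists>ch. snd (snd (snd (sem w cap st (boot_env t (length w + 1)) (\<lambda>_. False, [], ch, True)))))"
  and outputs_boot_tm: "outputs (boot_tm F A cp st) w
   (fst (snd (sem w cap st (boot_env t (length w + 1)) (\<lambda>_. False, [], ch, True))))"
proof -
 let ?R = "7 + hi cp + shi st" and ?H = "h + cap + t + 5" and ?B = "X ^ (dg cp * sd st)"
 have X2: "2 \<le> X" using X by simp
 have "X ^ 1 \<le> ?B" using X2 dg_pos[of cp] sd_pos[of st] by (intro power_increasing) auto
 then have XB: "X \<le> ?B" by simp
 interpret booting w "9 + hi cp + shi st + n_tapes F" A ?H ?R ?B h F k r t cf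
  using assms XB by unfold_locales (auto simp: sym_bound_def)
 have U: "U = 6 * h + 22" by (simp add: U_def cI_def)
 note E = ex_boot[where cp = cp and st = st and X = X and cap = cap, OF _ _ X2 _ _ _ cap]
 have ex1: "\<exists>s n. n \<le> 9 * (6 * h + 22) * ?B \<and> exec (boot F ?R cp st) (init_state ch) n s \<and>
   (sym 1 (look w s) = 0 \<longleftrightarrow> snd (snd (snd (sem w cap st (boot_env t (length w + 1)) (\<lambda>_. False, [], ch, True))))) \<and>
   fst (snd (snd s)) = fst (snd (sem w cap st (boot_env t (length w + 1)) (\<lambda>_. False, [], ch, True)))" for ch
 proof -
  obtain a' v' ch' f' where sm: "sem w cap st (boot_env t (length w + 1)) (\<lambda>_. False, [], ch, True) = (a', v', ch', f')"
   by (metis prod_cases4)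
  from E[OF _ _ _ _ _ _ sm] X obtain s where s: "ex (boot F ?R cp st) (9 * U * (X ^ dg cp) ^ sd st) (init_state ch) s"
   "(sym 1 (look w s) = 0 \<longleftrightarrow> f') \<and> fst (snd (snd s)) = v'" by (auto simp: power_mult)
  from s(1) obtain n where "n \<le> 9 * U * (X ^ dg cp) ^ sd st" "exec (boot F ?R cp st) (init_state ch) n s"
   unfolding ex_def by blast
  with s(2) show ?thesis unfolding U sm by (intro exI[of _ s] exI[of _ n]) (simp add: power_mult)
 qed
 then have ex2: "\<exists>n s. n \<le> 9 * (6 * h + 22) * ?B \<and> exec (boot F ?R cp st) (init_state ch) n s" for ch by blast
 \<comment> \<open>Executions for one stream have one result. This lets the existential
   characterization of acceptance speak about the execution found in \<open>ex1\<close>.\<close>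
 have fn: "s = s'" if "exec (boot F ?R cp st) (init_state ch) n s" "exec (boot F ?R cp st) (init_state ch) n' s'" for ch n n' s s'
  using tr_det[OF exec_program[OF that(1), of "\<lambda>_. True"] exec_program[OF that(2), of "\<lambda>_. True"]]
  by (simp add: program_def)
 show "runs_in_time (boot_tm F A cp st) w (real (9 * (6 * h + 22) * ?B + 1))"
  unfolding boot_tm_def by (rule runs_in_time_tm_of[OF ex2])
 show "runs_in_space (boot_tm F A cp st) w (real ?H)"
  unfolding boot_tm_def by (rule runs_in_space_tm_of[OF ex2])
 show "accepts (boot_tm F A cp st) w \<longleftrightarrow>
   (\<exists>ch. snd (snd (snd (sem w cap st (boot_env t (length w + 1)) (\<lambda>_. False, [], ch, True)))))"
  unfolding boot_tm_def accepts_tm_of[OF ex2] using ex1 fn by metis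
 from ex1[of ch] obtain s n where "exec (boot F ?R cp st) (init_state ch) n s"
  "fst (snd (snd s)) = fst (snd (sem w cap st (boot_env t (length w + 1)) (\<lambda>_. False, [], ch, True)))" by blast
 with outputs_tm_of[OF ex2 this(1), of "\<lambda>v. sym 1 v = 0"]
 show "outputs (boot_tm F A cp st) w (fst (snd (sem w cap st (boot_env t (length w + 1)) (\<lambda>_. False, [], ch, True))))"
  unfolding boot_tm_def by simp
qed

section \<open>Clause systems as 3-coloring instances\<close>

lemma pair_graph_iff:
 "pair_graph (graph_of N es) \<longleftrightarrow> (\<forall>(u, v)\<in>set es. u < N \<and> v < N \<and> u \<noteq> v)"
proof
 assume "pair_graph (graph_of N es)"
 then interpret pair_graph "graph_of N es" .
 show "\<forall>(u, v)\<in>set es. u < N \<and> v < N \<and> u \<noteq> v"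
 proof (intro ballI, clarify)
  fix u v assume "(u, v) \<in> set es"
  then have "(u, v) \<in> parcs (graph_of N es)" by (simp add: graph_of_def)
  from arc_fst_in_verts[OF this] arc_snd_in_verts[OF this] pair_no_loops[OF this]
  show "u < N \<and> v < N \<and> u \<noteq> v" by (simp add: graph_of_def)
 qed
next
 assume *: "\<forall>(u, v)\<in>set es. u < N \<and> v < N \<and> u \<noteq> v"
 have "{(u, v). (u, v) \<in> set es \<or> (v, u) \<in> set es} = set es \<union> (set es)\<inverse>" by auto
 then have "finite {(u, v). (u, v) \<in> set es \<or> (v, u) \<in> set es}" by simp
 with * show "pair_graph (graph_of N es)"
  by unfold_locales (auto simp: graph_of_def symmetric_def intro!: symI)
qed

lemma three_colorable_graph_of:
 "three_colorable (graph_of N es) \<longleftrightarrow> (\<exists>col :: nat \<Rightarrow> nat. (\<forall>v<N. col v < 3) \<and> (\<forall>(u, v)\<in>set es. col u \<noteq> col v))"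
 unfolding three_colorable_def graph_of_def by (rule iff_exI) (auto simp: eq_commute)

text \<open>
 A clause \<open>(\<phi>, p, ls)\<close> applies to the blocks with flags \<open>\<phi>\<close>; it demands that one of the literals,
 variables \<open>z\<close> of the block at distance \<open>offs V k\<close> for \<open>(k, z) \<in> set ls\<close>, does not have the value \<open>p\<close>.
\<close>

type_synonym clause = "bool list \<times> bool \<times> (nat \<times> nat) list"

text \<open>The codes 0, 1 and 2 stand for the block itself, its right neighbour and the block in
  the same column of the next row.\<close>

definition offs :: "nat \<Rightarrow> nat \<Rightarrow> nat" where "offs V k = (if k = 2 then V else k)"

datatype node = Pal nat | Nd nat nat

text \<open>The palette comes first, and block \<open>b\<close> owns the \<open>D\<close> numbers
  from \<open>3 + b * D\<close> on. Consecutive blocks are thus intervals of numbers, which a bag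
  can list by arithmetic.\<close>

fun vtx :: "nat \<Rightarrow> nat \<Rightarrow> nat \<Rightarrow> node \<Rightarrow> nat" where
 "vtx V D b (Pal p) = p"
| "vtx V D b (Nd k j) = 3 + (b + offs V k) * D + j"

text \<open>Palette vertex 0 has the color of true, vertex 1 that of false, and vertex 2 the neutral
  one. So \<open>bad p\<close> is the palette vertex of the truth value that a literal should
  avoid.\<close>

definition bad :: "bool \<Rightarrow> nat" where "bad p = (if p then 0 else 1)"

definition gn :: "nat \<Rightarrow> nat \<Rightarrow> nat \<Rightarrow> nat \<Rightarrow> nat \<Rightarrow> nat" where
 "gn nz mL i l j = nz + (i * mL + l) * 3 + j"

text \<open>
 The gadget for one literal is the usual OR gate: its output node \<open>gn nz mL i l 2\<close> can only be
 good, i.e. different from \<open>bad p\<close>, if the previous output or the literal is.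
\<close>

definition lit_edges :: "nat \<Rightarrow> nat \<Rightarrow> nat \<Rightarrow> bool \<Rightarrow> (nat \<times> nat) list \<Rightarrow> nat \<Rightarrow> (node \<times> node) list" where
 "lit_edges nz mL i p ls l =
   [(if l = 0 then Pal (bad p) else Nd 0 (gn nz mL i (l - 1) 2), Nd 0 (gn nz mL i l 0)),
   (Nd (fst (ls ! l)) (snd (ls ! l)), Nd 0 (gn nz mL i l 1)),
   (Nd 0 (gn nz mL i l 0), Nd 0 (gn nz mL i l 1)),
   (Nd 0 (gn nz mL i l 0), Nd 0 (gn nz mL i l 2)),
   (Nd 0 (gn nz mL i l 1), Nd 0 (gn nz mL i l 2)),
   (Nd 0 (gn nz mL i l 2), Pal 2)]"

text \<open>The gates form a chain that starts with the constant \<open>bad p\<close>; the last edge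
  excludes \<open>bad p\<close> as its final output, and the edge to \<open>Pal 2\<close> excludes
  the neutral color.\<close>

definition clause_edges :: "nat \<Rightarrow> nat \<Rightarrow> nat \<Rightarrow> clause \<Rightarrow> (bool list option \<times> node \<times> node) list" where
 "clause_edges nz mL i c = (case c of (\<phi>, p, ls) \<Rightarrow>
   map (Pair (Some \<phi>)) (concat (map (lit_edges nz mL i p ls) [0..<length ls]) @
    [(Nd 0 (gn nz mL i (length ls - 1) 2), Pal (bad p))]))"

text \<open>The guard \<open>None\<close> marks edges present in every block. Only the clauses
  enter, not the input word, so that the reduction has the whole template as a constant of its
  program.\<close>

definition template :: "nat \<Rightarrow> nat \<Rightarrow> clause list \<Rightarrow> (bool list option \<times> node \<times> node) list" where
 "template nz mL CL = map (\<lambda>z. (None, Nd 0 z, Pal 2)) [0..<nz] @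
   concat (map (\<lambda>i. clause_edges nz mL i (CL ! i)) [0..<length CL])"

definition active :: "bool list \<Rightarrow> bool list option \<Rightarrow> bool" where
 "active f g \<longleftrightarrow> g = None \<or> g = Some f"

definition block_edges :: "nat \<Rightarrow> nat \<Rightarrow> (bool list option \<times> node \<times> node) list \<Rightarrow> bool list \<Rightarrow> nat \<Rightarrow> (nat \<times> nat) list" where
 "block_edges V D TE f b = concat (map (\<lambda>(g, x, y). if active f g then [(vtx V D b x, vtx V D b y)] else []) TE)"

definition csp_edges :: "nat \<Rightarrow> nat \<Rightarrow> (bool list option \<times> node \<times> node) list \<Rightarrow> (nat \<Rightarrow> bool list) \<Rightarrow> nat \<Rightarrow> (nat \<times> nat) list" where
 "csp_edges V D TE fl Nb = [(0, 1), (0, 2), (1, 2)] @ concat (map (\<lambda>b. block_edges V D TE (fl b) b) [0..<Nb])"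

definition csp_bags :: "nat \<Rightarrow> nat \<Rightarrow> nat \<Rightarrow> nat list list" where
 "csp_bags V D Nb = map (\<lambda>b. [0, 1, 2] @ [3 + b * D..<3 + (b + V + 1) * D]) [0..<Nb - V]"

locale csp =
 fixes nz mL :: nat and CL :: "clause list" and V Nb :: nat and fl :: "nat \<Rightarrow> bool list"
 assumes V: "1 \<le> V" "V < Nb"
  and lits: "\<And>\<phi> p ls. (\<phi>, p, ls) \<in> set CL \<Longrightarrow> ls \<noteq> [] \<and> length ls \<le> mL \<and> (\<forall>(k, z)\<in>set ls. k \<le> 2 \<and> z < nz)"
  and inside: "\<And>b p ls k z. b < Nb \<Longrightarrow> (fl b, p, ls) \<in> set CL \<Longrightarrow> (k, z) \<in> set ls \<Longrightarrow> b + offs V k < Nb"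
begin

text \<open>Every block reserves nodes for all clauses and every clause reserves nodes for
  \<open>mL\<close> literals, so that all blocks have equal size; nodes of clauses that do not apply
  stay isolated.\<close>

definition D :: nat where "D = nz + 3 * mL * length CL"

abbreviation "N \<equiv> 3 + D * Nb"
abbreviation "es \<equiv> csp_edges V D (template nz mL CL) fl Nb"

abbreviation "gd i l j \<equiv> Nd 0 (gn nz mL i l j)"
abbreviation "vx b x \<equiv> vtx V D b x"

lemma gn_less: "i < length CL \<Longrightarrow> l < mL \<Longrightarrow> j < 3 \<Longrightarrow> gn nz mL i l j < D"
proof -
 assume a: "i < length CL" "l < mL" "j < 3"
 have "i * mL + l < (i + 1) * mL" using a by simp
 also have "\<dots> \<le> length CL * mL" using a by (intro mult_le_mono1) simp
 finally have "i * mL + l + 1 \<le> length CL * mL" by simp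
 then have "(i * mL + l + 1) * 3 \<le> length CL * mL * 3" by (rule mult_le_mono1)
 then show ?thesis using a by (simp add: gn_def D_def algebra_simps)
qed

lemma vx_less: "b + offs V k < Nb \<Longrightarrow> j < D \<Longrightarrow> vx b (Nd k j) < N"
proof -
 assume "b + offs V k < Nb" "j < D"
 then have "(b + offs V k + 1) * D \<le> Nb * D" by (intro mult_le_mono1) simp
 then show ?thesis using \<open>j < D\<close> by (simp add: algebra_simps)
qed

lemma mem_es:
 "(u, v) \<in> set es \<longleftrightarrow> (u, v) \<in> {(0, 1), (0, 2), (1, 2)} \<or>
   (\<exists>b<Nb. (\<exists>z<nz. u = vx b (Nd 0 z) \<and> v = 2) \<or>
    (\<exists>i<length CL. \<exists>p ls. CL ! i = (fl b, p, ls) \<and>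
     ((\<exists>l<length ls. \<exists>(x, y)\<in>set (lit_edges nz mL i p ls l). u = vx b x \<and> v = vx b y) \<or>
     (u = vx b (gd i (length ls - 1) 2) \<and> v = bad p))))"
proof -
 have ce: "(g, x, y) \<in> set (clause_edges nz mL i c) \<longleftrightarrow> (\<exists>\<phi> p ls. c = (\<phi>, p, ls) \<and> g = Some \<phi> \<and>
   ((\<exists>l<length ls. (x, y) \<in> set (lit_edges nz mL i p ls l)) \<or>
   (x = gd i (length ls - 1) 2 \<and> y = Pal (bad p))))" for g x y i c
 proof -
  have mp: "(g, x, y) \<in> set (map (Pair h) L) \<longleftrightarrow> g = h \<and> (x, y) \<in> set L" for h :: "bool list option" and L :: "(node \<times> node) list"
   by auto
  obtain \<phi> p ls where "c = (\<phi>, p, ls)" by (cases c)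
  then show ?thesis unfolding clause_edges_def by (simp add: mp del: set_map) auto
 qed
 have te: "(g, x, y) \<in> set (template nz mL CL) \<longleftrightarrow> (\<exists>z<nz. g = None \<and> x = Nd 0 z \<and> y = Pal 2) \<or>
   (\<exists>i<length CL. (g, x, y) \<in> set (clause_edges nz mL i (CL ! i)))" for g x y
  unfolding template_def by (simp add: image_iff Bex_def) blast
 have be: "(u, v) \<in> set (block_edges V D TE f b) \<longleftrightarrow>
   (\<exists>g x y. (g, x, y) \<in> set TE \<and> active f g \<and> u = vx b x \<and> v = vx b y)" for TE f b
 proof
  assume "(u, v) \<in> set (block_edges V D TE f b)"
  then obtain t where t: "t \<in> set TE" "(u, v) \<in> set ((\<lambda>(g, x, y). if active f g then [(vx b x, vx b y)] else []) t)"
   unfolding block_edges_def by auto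
  obtain g x y where "t = (g, x, y)" by (cases t)
  with t show "\<exists>g x y. (g, x, y) \<in> set TE \<and> active f g \<and> u = vx b x \<and> v = vx b y"
   by (auto split: if_splits)
 next
  assume "\<exists>g x y. (g, x, y) \<in> set TE \<and> active f g \<and> u = vx b x \<and> v = vx b y"
  then obtain g x y where "(g, x, y) \<in> set TE" "active f g" "u = vx b x" "v = vx b y" by blast
  then show "(u, v) \<in> set (block_edges V D TE f b)"
   unfolding block_edges_def by (auto intro!: bexI[of _ "(g, x, y)"])
 qed
 have b: "(u, v) \<in> set (block_edges V D (template nz mL CL) (fl b) b) \<longleftrightarrow>
   (\<exists>z<nz. u = vx b (Nd 0 z) \<and> v = 2) \<or>
    (\<exists>i<length CL. \<exists>p ls. CL ! i = (fl b, p, ls) \<and>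
     ((\<exists>l<length ls. \<exists>(x, y)\<in>set (lit_edges nz mL i p ls l). u = vx b x \<and> v = vx b y) \<or>
     (u = vx b (gd i (length ls - 1) 2) \<and> v = bad p)))" (is "?L \<longleftrightarrow> ?R") for b
 proof
  assume ?L
  then obtain g x y where 1: "(g, x, y) \<in> set (template nz mL CL)" "active (fl b) g" "u = vx b x" "v = vx b y"
   unfolding be by blast
  from 1(1) show ?R unfolding te
  proof
   assume "\<exists>z<nz. g = None \<and> x = Nd 0 z \<and> y = Pal 2"
   then show ?R using 1 by auto
  next
   assume "\<exists>i<length CL. (g, x, y) \<in> set (clause_edges nz mL i (CL ! i))"
   then obtain i \<phi> p ls where i: "i < length CL" "CL ! i = (\<phi>, p, ls)" "g = Some \<phi>"
    "(\<exists>l<length ls. (x, y) \<in> set (lit_edges nz mL i p ls l)) \<or>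
     (x = gd i (length ls - 1) 2 \<and> y = Pal (bad p))" unfolding ce by blast
   have "\<phi> = fl b" using 1(2) i(3) by (simp add: active_def)
   with i(2) have c: "CL ! i = (fl b, p, ls)" by simp
   from i(4) show ?R
   proof
    assume "\<exists>l<length ls. (x, y) \<in> set (lit_edges nz mL i p ls l)"
    then obtain l where "l < length ls" "(x, y) \<in> set (lit_edges nz mL i p ls l)" by blast
    then have "\<exists>l<length ls. \<exists>(x, y)\<in>set (lit_edges nz mL i p ls l). u = vx b x \<and> v = vx b y"
     using 1(3,4) by blast
    with c i(1) show ?R by blast
   next
    assume "x = gd i (length ls - 1) 2 \<and> y = Pal (bad p)"
    then have "u = vx b (gd i (length ls - 1) 2) \<and> v = bad p" using 1(3,4) by simp
    with c i(1) show ?R by blast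
   qed
  qed
 next
  assume ?R
  then show ?L
  proof (elim disjE exE conjE)
   fix z assume "z < nz" "u = vx b (Nd 0 z)" "v = 2"
   then show ?L unfolding be te active_def by (intro exI[of _ None] exI[of _ "Nd 0 z"] exI[of _ "Pal 2"]) auto
  next
   fix i p ls l assume i: "i < length CL" "CL ! i = (fl b, p, ls)" "l < length ls"
    "\<exists>(x, y)\<in>set (lit_edges nz mL i p ls l). u = vx b x \<and> v = vx b y"
   then obtain x y where xy: "(x, y) \<in> set (lit_edges nz mL i p ls l)" "u = vx b x" "v = vx b y" by blast
   have "(Some (fl b), x, y) \<in> set (clause_edges nz mL i (CL ! i))" unfolding ce using i xy(1) by blast
   then show ?L unfolding be te active_def using i(1) xy by blast
  next
   fix i p ls assume i: "i < length CL" "CL ! i = (fl b, p, ls)"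
    "u = vx b (gd i (length ls - 1) 2)" "v = bad p"
   have "(Some (fl b), gd i (length ls - 1) 2, Pal (bad p)) \<in> set (clause_edges nz mL i (CL ! i))"
    unfolding ce using i by blast
   moreover have "v = vx b (Pal (bad p))" using i by simp
   ultimately show ?L unfolding be te active_def using i(1,3) by blast
  qed
 qed
 have "set es = {(0, 1), (0, 2), (1, 2)} \<union> (\<Union>b\<in>{..<Nb}. set (block_edges V D (template nz mL CL) (fl b) b))"
  unfolding csp_edges_def by (simp add: atLeast0LessThan)
 then show ?thesis by (simp only: Un_iff UN_iff b Bex_def lessThan_iff)
qed

lemma pal_edge_mem: "(0, 1) \<in> set es" "(0, 2) \<in> set es" "(1, 2) \<in> set es"
 unfolding csp_edges_def by simp_all

lemma var_edge_mem:
 assumes "b < Nb" "z < nz"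
 shows "(vx b (Nd 0 z), 2) \<in> set es"
 unfolding mem_es
 by (rule disjI2, rule exI[of _ b], rule conjI, fact, rule disjI1, rule exI[of _ z], use assms in simp)

lemma lit_edge_mem:
 assumes "b < Nb" "i < length CL" "CL ! i = (fl b, p, ls)" "l < length ls" "(x, y) \<in> set (lit_edges nz mL i p ls l)"
 shows "(vx b x, vx b y) \<in> set es"
proof -
 have "\<exists>(x', y')\<in>set (lit_edges nz mL i p ls l). vx b x = vx b x' \<and> vx b y = vx b y'"
  by (rule bexI[OF _ assms(5)]) simp
 then show ?thesis unfolding mem_es
  by (rule_tac disjI2, rule_tac exI[of _ b], rule_tac conjI[OF assms(1)], rule_tac disjI2, rule_tac exI[of _ i],
   rule_tac conjI[OF assms(2)], rule_tac exI[of _ p], rule_tac exI[of _ ls], rule_tac conjI[OF assms(3)],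
   rule_tac disjI1, rule_tac exI[of _ l], use assms(4) in simp)
qed

lemma last_edge_mem:
 assumes "b < Nb" "i < length CL" "CL ! i = (fl b, p, ls)"
 shows "(vx b (gd i (length ls - 1) 2), bad p) \<in> set es"
 unfolding mem_es
 by (rule disjI2, rule exI[of _ b], rule conjI, fact, rule disjI2, rule exI[of _ i], rule conjI, fact,
  rule exI[of _ p], rule exI[of _ ls], rule conjI, fact, rule disjI2, simp)

lemma CL_facts:
 assumes "b < Nb" "i < length CL" "CL ! i = (fl b, p, ls)"
 shows "ls \<noteq> []" "length ls \<le> mL" "l < length ls \<Longrightarrow> b + offs V (fst (ls ! l)) < Nb \<and> snd (ls ! l) < D \<and> snd (ls ! l) < nz"
proof -
 have m: "(fl b, p, ls) \<in> set CL" using assms nth_mem by metis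
 show "ls \<noteq> []" "length ls \<le> mL" using lits[OF m] by auto
 assume "l < length ls"
 then have "(fst (ls ! l), snd (ls ! l)) \<in> set ls" by simp
 from inside[OF assms(1) m this] lits[OF m] this show "b + offs V (fst (ls ! l)) < Nb \<and> snd (ls ! l) < D \<and> snd (ls ! l) < nz"
  by (auto simp: D_def)
qed

lemma bad_simps: "bad p < 2" "bad p \<noteq> 2" "bad p \<noteq> bad (\<not> p)" "bad (\<not> p) \<noteq> bad p"
 by (auto simp: bad_def)

lemma es_cases:
 assumes "(u, v) \<in> set es"
 obtains "(u, v) \<in> {(0, 1), (0, 2), (1, 2)}"
 | b z where "b < Nb" "z < nz" "u = vx b (Nd 0 z)" "v = 2"
 | b i p ls l x y where "b < Nb" "i < length CL" "CL ! i = (fl b, p, ls)" "l < length ls" "l < mL"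
   "(x, y) \<in> set (lit_edges nz mL i p ls l)" "u = vx b x" "v = vx b y"
 | b i p ls where "b < Nb" "i < length CL" "CL ! i = (fl b, p, ls)" "length ls - 1 < length ls" "length ls - 1 < mL"
   "u = vx b (gd i (length ls - 1) 2)" "v = bad p"
proof -
 from assms consider "(u, v) \<in> {(0, 1), (0, 2), (1, 2)}"
  | "\<exists>b<Nb. \<exists>z<nz. u = vx b (Nd 0 z) \<and> v = 2"
  | "\<exists>b<Nb. \<exists>i<length CL. \<exists>p ls. CL ! i = (fl b, p, ls) \<and> (\<exists>l<length ls. \<exists>(x, y)\<in>set (lit_edges nz mL i p ls l). u = vx b x \<and> v = vx b y)"
  | "\<exists>b<Nb. \<exists>i<length CL. \<exists>p ls. CL ! i = (fl b, p, ls) \<and> u = vx b (gd i (length ls - 1) 2) \<and> v = bad p"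
  unfolding mem_es by blast
 then show ?thesis
 proof cases
  case 1
  then show ?thesis by (rule that(1))
 next
  case 2
  then show ?thesis using that(2) by blast
 next
  case 3
  then obtain b i p ls l x y where h: "b < Nb" "i < length CL" "CL ! i = (fl b, p, ls)" "l < length ls"
   "(x, y) \<in> set (lit_edges nz mL i p ls l)" "u = vx b x" "v = vx b y" by blast
  from h(4) CL_facts(2)[OF h(1-3)] have "l < mL" by simp
  then show ?thesis using that(3)[OF h(1-4) _ h(5-7)] by blast
 next
  case 4
  then obtain b i p ls where h: "b < Nb" "i < length CL" "CL ! i = (fl b, p, ls)"
   "u = vx b (gd i (length ls - 1) 2)" "v = bad p" by blast
  from CL_facts(1,2)[OF h(1-3)] have "length ls - 1 < length ls" "length ls - 1 < mL" by (cases ls; simp)+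
  then show ?thesis using that(4)[OF h(1-3) _ _ h(4-5)] by blast
 qed
qed

lemma offs0 [simp]: "offs V 0 = 0" by (simp add: offs_def)

lemma V3: "2 < N" "0 < N" "1 < N" by simp_all

lemma es_ok: "(u, v) \<in> set es \<Longrightarrow> u < N \<and> v < N \<and> u \<noteq> v"
proof (erule es_cases)
 fix b z assume "b < Nb" "z < nz" "u = vx b (Nd 0 z)" "v = 2"
 then show "u < N \<and> v < N \<and> u \<noteq> v" using vx_less[of b 0 z] by (auto simp: D_def)
next
 fix b i p ls l x y assume h: "b < Nb" "i < length CL" "CL ! i = (fl b, p, ls)" "l < length ls" "l < mL"
   "(x, y) \<in> set (lit_edges nz mL i p ls l)" "u = vx b x" "v = vx b y"
 have g: "gn nz mL i l j < D" "gn nz mL i (l - 1) j < D" if "j < 3" for j using gn_less h that by auto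
 note f = CL_facts(3)[OF h(1-4)]
 \<comment> \<open>Modulo \<open>D\<close> the numbers of the two nodes are their indices inside a
   block. Variables lie below \<open>nz\<close>, gate nodes do not, so the edge is no loop even if
   the literal is in another block.\<close>
 have n: "vx b (Nd (fst (ls ! l)) (snd (ls ! l))) \<noteq> vx b (gd i l 1)"
 proof
  assume "vx b (Nd (fst (ls ! l)) (snd (ls ! l))) = vx b (gd i l 1)"
  then have "((b + offs V (fst (ls ! l))) * D + snd (ls ! l)) mod D = (b * D + gn nz mL i l 1) mod D" by simp
  then have "snd (ls ! l) = gn nz mL i l 1" using f g(1)[of 1] by simp
  with f show False by (simp add: gn_def)
 qed
 have "x \<noteq> y \<and> vx b x \<noteq> vx b y \<and> vx b x < N \<and> vx b y < N"
  using h(6) f n vx_less[of b 0 "gn nz mL i l 0"] vx_less[of b 0 "gn nz mL i l 1"] vx_less[of b 0 "gn nz mL i l 2"]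
   vx_less[of b 0 "gn nz mL i (l - 1) 2"] vx_less[of b "fst (ls ! l)" "snd (ls ! l)"] g[of 0] g[of 1] g[of 2] h(1) bad_simps(1)[of p]
  unfolding lit_edges_def by (auto simp: gn_def bad_def split: if_splits)
 then show "u < N \<and> v < N \<and> u \<noteq> v" using h by simp
next
 fix b i p ls assume h: "b < Nb" "i < length CL" "CL ! i = (fl b, p, ls)" "length ls - 1 < length ls" "length ls - 1 < mL"
   "u = vx b (gd i (length ls - 1) 2)" "v = bad p"
 show "u < N \<and> v < N \<and> u \<noteq> v" using vx_less[of b 0 "gn nz mL i (length ls - 1) 2"] gn_less[OF h(2,5)] h bad_simps(1)[of p] by auto
qed auto

lemma pair_graph_csp: "pair_graph (graph_of N es)"
 unfolding pair_graph_iff using es_ok by blast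

definition satisfied :: "(nat \<Rightarrow> nat \<Rightarrow> bool) \<Rightarrow> bool" where
 "satisfied Y \<longleftrightarrow> (\<forall>b<Nb. \<forall>p ls. (fl b, p, ls) \<in> set CL \<longrightarrow> (\<exists>(k, z)\<in>set ls. Y (b + offs V k) z \<noteq> p))"

text \<open>A variable is read as true if it has the color of palette vertex 0. The final output of
  each gate chain is good, and goodness of an output can be traced back to some literal.\<close>

lemma satisfied_if_colorable:
 assumes "three_colorable (graph_of N es)"
 shows "\<exists>Y. satisfied Y"
proof -
 from assms obtain col where c3: "\<And>v. v < N \<Longrightarrow> col v < (3 :: nat)"
  and e: "\<And>u v. (u, v) \<in> set es \<Longrightarrow> col u \<noteq> col v" unfolding three_colorable_graph_of by blast
 have pal: "col 0 \<noteq> col 1" "col 0 \<noteq> col 2" "col 1 \<noteq> col 2" by (rule e[OF pal_edge_mem(1)], rule e[OF pal_edge_mem(2)], rule e[OF pal_edge_mem(3)])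
 have pb: "col (bad p) \<noteq> col 2" "col (bad p) \<noteq> col (bad (\<not> p))" for p using pal by (auto simp: bad_def)
 have c3': "col 0 < 3" "col 1 < 3" "col 2 < 3" using c3 V3 by blast+
 have three: "x = col (bad p) \<or> x = col (bad (\<not> p)) \<or> x = col 2" if "x < 3" for x p
  using that pal c3' unfolding bad_def by (cases p) auto
 let ?Y = "\<lambda>b z. col (vx b (Nd 0 z)) = col 0"
 have lit: "?Y b z \<noteq> p" if "b < Nb" "z < nz" "col (vx b (Nd 0 z)) = col (bad (\<not> p))" for b z p
  using that pal by (auto simp: bad_def split: if_splits)
 have "\<exists>(k, z)\<in>set ls. ?Y (b + offs V k) z \<noteq> p" if b: "b < Nb" and cl: "(fl b, p, ls) \<in> set CL" for b p ls
 proof -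
  from cl obtain i where i: "i < length CL" "CL ! i = (fl b, p, ls)" by (metis in_set_conv_nth)
  note F = CL_facts[OF b i]
  define s where "s l = col (vx b (gd i l 2))" for l
  have E: "col (vx b x) \<noteq> col (vx b y)" if "l < length ls" "(x, y) \<in> set (lit_edges nz mL i p ls l)" for l x y
   by (rule e[OF lit_edge_mem[OF b i that]])
  \<comment> \<open>Suppose that the output is good and the previous output is bad. The three gate
    nodes form a triangle; node 0 avoids bad and good, so it is neutral, node 1 is bad, and the
    literal, being neither neutral nor bad, is good.\<close>
  have step1: "?Y (b + offs V (fst (ls ! l))) (snd (ls ! l)) \<noteq> p \<or> (0 < l \<and> s (l - 1) = col (bad (\<not> p)))"
   if s: "l < length ls" "s l = col (bad (\<not> p))" for l
  proof (rule disjCI)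
   let ?prev = "if l = 0 then Pal (bad p) else gd i (l - 1) 2" and ?lit = "Nd (fst (ls ! l)) (snd (ls ! l))"
   assume np: "\<not> (0 < l \<and> s (l - 1) = col (bad (\<not> p)))"
   have l: "l < mL" using s(1) F(2) by linarith
   have G: "col (vx b (gd i l j)) < 3" if "j < 3" for j
    by (rule c3[OF vx_less]) (use b gn_less[OF i(1) l that] in auto)
   have L: "col (vx b ?lit) < 3" by (rule c3[OF vx_less]) (use F(3)[OF s(1)] in auto)
   have prev: "col (vx b ?prev) = col (bad p)"
   proof (cases "l = 0")
    case False
    have "s (l - 1) < 3" unfolding s_def by (rule c3[OF vx_less]) (use b gn_less[OF i(1), of "l - 1" 2] l in auto)
    moreover have "s (l - 1) \<noteq> col 2"
     using E[of "l - 1" "gd i (l - 1) 2" "Pal 2"] s(1) unfolding lit_edges_def s_def by simp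
    ultimately show ?thesis using np False three[of "s (l - 1)" p] by (auto simp: s_def)
   qed simp
   have eds: "col (bad p) \<noteq> col (vx b (gd i l 0))" "col (vx b ?lit) \<noteq> col (vx b (gd i l 1))"
    "col (vx b (gd i l 0)) \<noteq> col (vx b (gd i l 1))"
    "col (vx b (gd i l 0)) \<noteq> s l" "col (vx b (gd i l 1)) \<noteq> s l"
    using E[OF s(1), of ?prev "gd i l 0", unfolded prev]
     E[OF s(1), of ?lit "gd i l 1"]
     E[OF s(1), of "gd i l 0" "gd i l 1"]
     E[OF s(1), of "gd i l 0" "gd i l 2"]
     E[OF s(1), of "gd i l 1" "gd i l 2"]
    unfolding lit_edges_def s_def by simp_all
   have "(vx (b + offs V (fst (ls ! l))) (Nd 0 (snd (ls ! l))), 2) \<in> set es"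
    by (rule var_edge_mem) (use F(3)[OF s(1)] in auto)
   from e[OF this] have x2: "col (vx b ?lit) \<noteq> col 2" by simp
   have "col (vx b ?lit) = col (bad (\<not> p))"
    using eds x2 s(2) three[OF G[of 0], of p] three[OF G[of 1], of p] three[OF L, of p] by auto
   then show "?Y (b + offs V (fst (ls ! l))) (snd (ls ! l)) \<noteq> p"
    by (intro lit) (use F(3)[OF s(1)] in auto)
  qed
  have step: "\<exists>l'\<le>l. ?Y (b + offs V (fst (ls ! l'))) (snd (ls ! l')) \<noteq> p" if "l < length ls" "s l = col (bad (\<not> p))" for l
   using that
  proof (induction l)
   case 0
   with step1[of 0] show ?case by blast
  next
   case (Suc l)
   with step1[of "Suc l"] show ?case by (metis Suc_lessD diff_Suc_1 le_SucI order_refl)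
  qed
  let ?l = "length ls - 1"
  have l: "?l < length ls" "?l < mL" using F(1,2) by (cases ls; simp)+
  have "(vx b (gd i ?l 2), bad p) \<in> set es" by (rule last_edge_mem[OF b i])
  from e[OF this] have 1: "s ?l \<noteq> col (bad p)" unfolding s_def .
  have 2: "s ?l \<noteq> col 2" using E[OF l(1), of "gd i ?l 2" "Pal 2"] unfolding lit_edges_def s_def by simp
  have 3: "s ?l < 3" unfolding s_def by (rule c3[OF vx_less]) (use b gn_less[OF i(1) l(2), of 2] in auto)
  from three[OF 3, of p] 1 2 have "s ?l = col (bad (\<not> p))" by auto
  from step[OF l(1) this] obtain l' where "l' \<le> ?l" "?Y (b + offs V (fst (ls ! l'))) (snd (ls ! l')) \<noteq> p" by blast
  moreover from this(1) l(1) have "ls ! l' \<in> set ls" by (intro nth_mem) linarith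
  ultimately show ?thesis by (intro bexI[of _ "ls ! l'"]) (auto simp: case_prod_unfold)
 qed
 then have "satisfied ?Y" unfolding satisfied_def by blast
 then show ?thesis by blast
qed

definition sat :: "(nat \<Rightarrow> nat \<Rightarrow> bool) \<Rightarrow> nat \<Rightarrow> nat \<Rightarrow> nat \<Rightarrow> bool" where
 "sat Y b i l \<longleftrightarrow> (case CL ! i of (\<phi>, p, ls) \<Rightarrow> \<exists>l'<l. l' < length ls \<and> Y (b + offs V (fst (ls ! l'))) (snd (ls ! l')) \<noteq> p)"

text \<open>The output is good as soon as one of the literals so far is satisfied. Nodes 0 and 1
  share the two remaining colors in the order that makes node 0 differ from the previous output and
  node 1 from the literal.\<close>

definition gcol :: "(nat \<Rightarrow> nat \<Rightarrow> bool) \<Rightarrow> nat \<Rightarrow> nat \<Rightarrow> nat \<Rightarrow> nat \<Rightarrow> nat" where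
 "gcol Y b i l j = (let p = fst (snd (CL ! i)) in
   if j = 2 then (if sat Y b i (Suc l) then bad (\<not> p) else bad p)
   else if j = 0 then (if \<not> sat Y b i (Suc l) then bad (\<not> p) else if \<not> sat Y b i l then 2 else bad p)
   else (if \<not> sat Y b i (Suc l) then 2 else if \<not> sat Y b i l then bad p else 2))"

definition coloring :: "(nat \<Rightarrow> nat \<Rightarrow> bool) \<Rightarrow> nat \<Rightarrow> nat" where
 "coloring Y v = (if v < 3 then v else
   let b = (v - 3) div D; j = (v - 3) mod D; q = j - nz in
   if j < nz then (if Y b j then 0 else 1) else gcol Y b (q div 3 div mL) (q div 3 mod mL) (q mod 3))"

lemma gcol_less: "gcol Y b i l j < 3"
 by (simp add: gcol_def bad_def Let_def)

lemma coloring_less: "coloring Y v < 3"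
 using gcol_less by (simp add: coloring_def Let_def)

lemma coloring_var: "z < nz \<Longrightarrow> coloring Y (vx b (Nd k z)) = (if Y (b + offs V k) z then 0 else 1)"
proof -
 assume z: "z < nz"
 then have "z < D" by (simp add: D_def)
 then show ?thesis using z by (simp add: coloring_def)
qed

lemma coloring_gadget:
 assumes "i < length CL" "l < mL" "j < 3"
 shows "coloring Y (vx b (gd i l j)) = gcol Y b i l j"
proof -
 let ?q = "(i * mL + l) * 3 + j"
 have 1: "gn nz mL i l j < D" by (rule gn_less[OF assms])
 have 2: "gn nz mL i l j - nz = ?q" "\<not> gn nz mL i l j < nz" by (simp_all add: gn_def)
 have "(a * 3 + j) div 3 = a" "(a * 3 + j) mod 3 = j" for a using assms(3) by simp_all
 note 3 = this[of "i * mL + l"]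
 have 4: "(i * mL + l) div mL = i" "(i * mL + l) mod mL = l" using assms(2) by simp_all
 have "vx b (gd i l j) - 3 = b * D + gn nz mL i l j" by simp
 then have 5: "(vx b (gd i l j) - 3) div D = b" "(vx b (gd i l j) - 3) mod D = gn nz mL i l j"
  using 1 by (simp_all del: vtx.simps)
 have 6: "(vx b (gd i l j) < 3) = False" by simp
 show ?thesis by (simp only: coloring_def Let_def 2 3 4 5 6 if_False)
qed

lemma sat_Suc: "CL ! i = (\<phi>, p, ls) \<Longrightarrow> l < length ls \<Longrightarrow>
 sat Y b i (Suc l) \<longleftrightarrow> sat Y b i l \<or> Y (b + offs V (fst (ls ! l))) (snd (ls ! l)) \<noteq> p"
 by (auto simp: sat_def less_Suc_eq)

lemma colorable_if_satisfied:
 assumes "satisfied Y"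
 shows "three_colorable (graph_of N es)"
 unfolding three_colorable_graph_of
proof (intro exI[of _ "coloring Y"] conjI allI impI ballI, goal_cases)
 case (1 v)
 show ?case by (rule coloring_less)
next
 case (2 e)
 have low: "v < 3 \<Longrightarrow> coloring Y v = v" for v by (simp add: coloring_def)
 obtain u v where e: "e = (u, v)" by (cases e)
 from 2 have "(u, v) \<in> set es" by (simp add: e)
 then have "coloring Y u \<noteq> coloring Y v"
 proof (cases rule: es_cases)
  case 1
  then show ?thesis by (auto simp: low)
 next
  case (2 b z)
  then show ?thesis by (simp add: coloring_var low del: vtx.simps)
 next
  case h: (3 b i p ls l x y)
  note F = CL_facts[OF h(1-3)]
  have pp: "fst (snd (CL ! i)) = p" using h(3) by simp
  note S = sat_Suc[OF h(3,4), of Y b]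
  have cv: "coloring Y (vx b (Nd (fst (ls ! l)) (snd (ls ! l)))) = bad (Y (b + offs V (fst (ls ! l))) (snd (ls ! l)))"
   using F(3)[OF h(4)] by (subst coloring_var) (auto simp: bad_def)
  have g: "coloring Y (vx b (gd i l j)) = gcol Y b i l j" if "j < 3" for j
   by (rule coloring_gadget[OF h(2,5) that])
  have pv: "coloring Y (vx b (if l = 0 then Pal (bad p) else gd i (l - 1) 2)) = (if sat Y b i l then bad (\<not> p) else bad p)"
  proof (cases l)
   case 0
   then have "\<not> sat Y b i l" using h(3) by (simp add: sat_def)
   then show ?thesis using 0 bad_simps(1)[of p] by (simp add: low)
  next
   case (Suc m)
   have "coloring Y (vx b (gd i m 2)) = gcol Y b i m 2"
    by (rule coloring_gadget) (use h Suc in auto)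
   then show ?thesis using Suc pp by (simp add: gcol_def del: vtx.simps)
  qed
  have c2: "coloring Y (vx b (Pal 2)) = 2" by (simp add: low)
  have gs: "gcol Y b i l 2 = (if sat Y b i (Suc l) then bad (\<not> p) else bad p)"
   "gcol Y b i l 0 = (if \<not> sat Y b i (Suc l) then bad (\<not> p) else if \<not> sat Y b i l then 2 else bad p)"
   "gcol Y b i l 1 = (if \<not> sat Y b i (Suc l) then 2 else if \<not> sat Y b i l then bad p else 2)"
   by (simp_all add: gcol_def pp)
  have lt: "0 < (3::nat)" "1 < (3::nat)" "2 < (3::nat)" by simp_all
  have "coloring Y (vx b x) \<noteq> coloring Y (vx b y)"
   using h(6) unfolding lit_edges_def set_simps insert_iff empty_iff prod.inject
  proof (elim disjE conjE)
   assume "x = (if l = 0 then Pal (bad p) else gd i (l - 1) 2)" "y = gd i l 0"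
   then show ?thesis using S unfolding \<open>x = _\<close> \<open>y = _\<close> pv g[OF lt(1)] gs by (simp add: bad_def)
  next
   assume "x = Nd (fst (ls ! l)) (snd (ls ! l))" "y = gd i l 1"
   then show ?thesis using S unfolding \<open>x = _\<close> \<open>y = _\<close> cv g[OF lt(2)] gs by (auto simp: bad_def)
  next
   assume "x = gd i l 0" "y = gd i l 1"
   then show ?thesis using S unfolding \<open>x = _\<close> \<open>y = _\<close> g[OF lt(1)] g[OF lt(2)] gs by (simp add: bad_def)
  next
   assume "x = gd i l 0" "y = gd i l 2"
   then show ?thesis using S unfolding \<open>x = _\<close> \<open>y = _\<close> g[OF lt(1)] g[OF lt(3)] gs by (simp add: bad_def)
  next
   assume "x = gd i l 1" "y = gd i l 2"
   then show ?thesis using S unfolding \<open>x = _\<close> \<open>y = _\<close> g[OF lt(2)] g[OF lt(3)] gs by (simp add: bad_def)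
  next
   assume "x = gd i l 2" "y = Pal 2"
   then show ?thesis unfolding \<open>x = _\<close> \<open>y = _\<close> g[OF lt(3)] gs c2 by (simp add: bad_def)
  qed simp
  then show ?thesis using h by simp
 next
  case h: (4 b i p ls)
  have "(fl b, p, ls) \<in> set CL" using h nth_mem by metis
  with assms h(1) obtain k z where kz: "(k, z) \<in> set ls" "Y (b + offs V k) z \<noteq> p" unfolding satisfied_def by blast
  then obtain l' where "l' < length ls" "ls ! l' = (k, z)" by (metis in_set_conv_nth)
  then have "sat Y b i (Suc (length ls - 1))" using h(3,4) kz by (auto simp: sat_def intro!: exI[of _ l'])
  then have "gcol Y b i (length ls - 1) 2 = bad (\<not> p)" using h(3) by (simp add: gcol_def)
  with coloring_gadget[OF h(2,5), of 2 Y b] have "coloring Y u = bad (\<not> p)" using h(6) by simp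
  moreover have "coloring Y v = bad p" using h(7) bad_simps(1)[of p] by (simp add: low)
  ultimately show ?thesis by (simp add: bad_simps)
 qed
 then show ?case by (simp add: e)
qed

theorem colorable_iff_satisfied: "three_colorable (graph_of N es) \<longleftrightarrow> (\<exists>Y. satisfied Y)"
 using satisfied_if_colorable colorable_if_satisfied by blast

lemma bag_vx: "v \<in> set ([0, 1, 2] @ [3 + b * D..<3 + (b + V + 1) * D]) \<longleftrightarrow> v < 3 \<or> (3 + b * D \<le> v \<and> v < 3 + (b + V + 1) * D)"
 by auto

lemma vx_in_bag:
 assumes "b0 \<le> b + offs V k" "b + offs V k \<le> b0 + V" "j < D"
 shows "vx b (Nd k j) \<in> set ([0, 1, 2] @ [3 + b0 * D..<3 + (b0 + V + 1) * D])"
proof -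
 have "b0 * D \<le> (b + offs V k) * D" using assms by (intro mult_le_mono1) simp
 moreover have "(b + offs V k + 1) * D \<le> (b0 + V + 1) * D" using assms by (intro mult_le_mono1) simp
 ultimately show ?thesis unfolding bag_vx using assms(3) by (simp add: algebra_simps)
qed

lemma path_decomposition_csp: "path_decomposition (graph_of N es) (map set (csp_bags V D Nb))"
proof -
 let ?bag = "\<lambda>b. set ([0, 1, 2] @ [3 + b * D..<3 + (b + V + 1) * D])"
 have P: "map set (csp_bags V D Nb) = map ?bag [0..<Nb - V]" by (simp add: csp_bags_def)
 have sub: "?bag b \<subseteq> {..<N}" if "b < Nb - V" for b
 proof -
  have "(b + V + 1) * D \<le> Nb * D" using that by (intro mult_le_mono1) simp
  then show ?thesis unfolding bag_vx[abs_def] subset_iff bag_vx by (auto simp: algebra_simps)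
 qed
 \<comment> \<open>There are \<open>Nb - V\<close> windows of \<open>V + 1\<close> blocks. A block
   is treated in the window that starts with it, and the last blocks in the last window; by
   \<open>inside\<close> their clauses do not reach beyond it.\<close>
 define b0 where "b0 b = min b (Nb - V - 1)" for b
 have b0: "b0 b < Nb - V" "b < Nb \<Longrightarrow> b0 b \<le> b \<and> b \<le> b0 b + V" for b using V unfolding b0_def by auto
 have blk: "vx b (Nd k j) \<in> ?bag (b0 b)" if "b < Nb" "b + offs V k < Nb" "j < D" "k \<le> 2" for b k j
 proof (rule vx_in_bag[OF _ _ that(3)])
  have "k = 0 \<or> k = 1 \<or> k = 2" using that(4) by auto
  then show "b0 b \<le> b + offs V k" "b + offs V k \<le> b0 b + V" using that V unfolding b0_def offs_def by auto
 qed
 have pal: "v \<in> ?bag b" if "v < 3" for v b using that by auto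
 have verts: "\<exists>B\<in>set (map ?bag [0..<Nb - V]). v \<in> B" if "v < N" for v
 proof (cases "v < 3")
  case True
  then show ?thesis using pal[OF True] b0(1) by auto
 next
  case False
  have D0: "0 < D" using that False by (cases D) auto
  have lt: "(v - 3) div D < Nb" using that False by (intro less_mult_imp_div_less) (simp add: mult.commute)
  have "vx ((v - 3) div D) (Nd 0 ((v - 3) mod D)) = v" using False by simp
  with blk[OF lt, of 0 "(v - 3) mod D"] lt D0 have "v \<in> ?bag (b0 ((v - 3) div D))" by (simp del: vtx.simps)
  then show ?thesis using b0(1) by (intro bexI[of _ "?bag (b0 ((v - 3) div D))"]) auto
 qed
 have both: "\<exists>B\<in>set (map ?bag [0..<Nb - V]). u \<in> B \<and> v \<in> B" if "(u, v) \<in> set es" for u v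
 proof -
  have "\<exists>b. u \<in> ?bag (b0 b) \<and> v \<in> ?bag (b0 b)"
   using that
  proof (cases rule: es_cases)
   case 1
   then show ?thesis using pal[of u "b0 0"] pal[of v "b0 0"] by (intro exI[of _ 0]) auto
  next
   case (2 b z)
   then have "u \<in> ?bag (b0 b)" using blk[of b 0 z] by (simp add: D_def del: vtx.simps)
   moreover have "v \<in> ?bag (b0 b)" using 2 by (intro pal) simp
   ultimately show ?thesis by blast
  next
   case h: (3 b i p ls l x y)
   have "(fl b, p, ls) \<in> set CL" using h nth_mem by metis
   from lits[OF this] h(4) have k2: "fst (ls ! l) \<le> 2" using nth_mem[of l ls] by (auto simp: case_prod_unfold)
   have g: "vx b (gd i l j) \<in> ?bag (b0 b)" "vx b (gd i (l - 1) j) \<in> ?bag (b0 b)" if "j < 3" for j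
    using blk[OF h(1), of 0 "gn nz mL i l j"] blk[OF h(1), of 0 "gn nz mL i (l - 1) j"] gn_less[OF h(2) _ that] h(1,5)
    by (simp_all del: vtx.simps)
   have v: "vx b (Nd (fst (ls ! l)) (snd (ls ! l))) \<in> ?bag (b0 b)" using CL_facts(3)[OF h(1-4)] k2 h(1) by (intro blk) auto
   have q: "vx b (Pal (bad p)) \<in> ?bag (b0 b)" "vx b (Pal 2) \<in> ?bag (b0 b)"
    using pal[of "bad p"] pal[of 2] bad_simps(1)[of p] by (simp_all only: vtx.simps)
   define S where "S = ?bag (b0 b)"
   note m = g[of 0, folded S_def] g[of 1, folded S_def] g[of 2, folded S_def] v[folded S_def] q[folded S_def]
   have "\<forall>(x, y)\<in>set (lit_edges nz mL i p ls l). vx b x \<in> S \<and> vx b y \<in> S"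
    unfolding lit_edges_def using m by (simp del: vtx.simps split del: if_split) (cases "l = 0"; simp del: vtx.simps)
   then have "vx b x \<in> ?bag (b0 b) \<and> vx b y \<in> ?bag (b0 b)" using h(6) unfolding S_def by blast
   then show ?thesis using h by blast
  next
   case h: (4 b i p ls)
   have "u \<in> ?bag (b0 b)" unfolding h(6) using gn_less[OF h(2,5), of 2] h(1) by (intro blk) auto
   moreover have "v \<in> ?bag (b0 b)" using h(7) bad_simps(1)[of p] by (intro pal) simp
   ultimately show ?thesis by blast
  qed
  then obtain b where "u \<in> ?bag (b0 b) \<and> v \<in> ?bag (b0 b)" by blast
  then show ?thesis using b0(1)[of b] by (intro bexI[of _ "?bag (b0 b)"]) auto
 qed
 \<comment> \<open>Both ends of the intervals grow with the index of the bag, so a number in an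
   earlier and in a later interval lies in all intervals between.\<close>
 have conv: "v \<in> ?bag j" if "i \<le> j" "j \<le> l" "v \<in> ?bag i" "v \<in> ?bag l" for i j l v
 proof -
  have "j * D \<le> l * D" "(i + V + 1) * D \<le> (j + V + 1) * D" using that by (intro mult_le_mono1; simp)+
  then show ?thesis using that(3,4) unfolding bag_vx by linarith
 qed
 show ?thesis unfolding path_decomposition_def P
 proof (intro conjI allI impI)
  show "map ?bag [0..<Nb - V] \<noteq> []" using V by simp
  show "\<forall>B\<in>set (map ?bag [0..<Nb - V]). B \<subseteq> pverts (graph_of N es)"
  proof
   fix B assume "B \<in> set (map ?bag [0..<Nb - V])"
   then obtain b where "b < Nb - V" "B = ?bag b"
    unfolding set_map set_upt by (elim imageE) simp
   with sub show "B \<subseteq> pverts (graph_of N es)" by (simp add: graph_of_def del: set_append)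
  qed
  show "\<forall>v\<in>pverts (graph_of N es). \<exists>B\<in>set (map ?bag [0..<Nb - V]). v \<in> B" using verts by (simp add: graph_of_def del: set_append)
  show "\<forall>(u, v)\<in>parcs (graph_of N es). \<exists>B\<in>set (map ?bag [0..<Nb - V]). u \<in> B \<and> v \<in> B"
  proof (intro ballI, clarify)
   fix u v assume "(u, v) \<in> parcs (graph_of N es)"
   then have "(u, v) \<in> set es \<or> (v, u) \<in> set es" by (simp add: graph_of_def)
   then show "\<exists>B\<in>set (map ?bag [0..<Nb - V]). u \<in> B \<and> v \<in> B" using both by blast
  qed
  fix i j l v
  assume a: "i \<le> j \<and> j \<le> l \<and> l < length (map ?bag [0..<Nb - V]) \<and> v \<in> map ?bag [0..<Nb - V] ! i \<and> v \<in> map ?bag [0..<Nb - V] ! l"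
  have nth: "map ?bag [0..<Nb - V] ! x = ?bag x" if "x < Nb - V" for x using that by (simp del: set_append)
  from a have lt: "i < Nb - V" "j < Nb - V" "l < Nb - V" by simp_all
  from a show "v \<in> map ?bag [0..<Nb - V] ! j" unfolding nth[OF lt(1)] nth[OF lt(2)] nth[OF lt(3)]
   using conv by blast
 qed
qed

lemma pd_width_csp: "pd_width (map set (csp_bags V D Nb)) = int (2 + (V + 1) * D)"
proof -
 let ?bag = "\<lambda>b. set ([0, 1, 2] @ [3 + b * D..<3 + (b + V + 1) * D])"
 have "card (?bag b) = 3 + (V + 1) * D" for b
 proof -
  have "distinct ([0, 1, 2] @ [3 + b * D..<3 + (b + V + 1) * D])" by auto
  from distinct_card[OF this] show ?thesis by (simp add: algebra_simps)
 qed
 then have "\<forall>B\<in>set (map set (csp_bags V D Nb)). card B = 3 + (V + 1) * D"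
  unfolding csp_bags_def by (simp del: set_append set_simps)
 then have "card ` set (map set (csp_bags V D Nb)) = (\<lambda>_. 3 + (V + 1) * D) ` set (map set (csp_bags V D Nb))"
  by (intro image_cong) auto
 moreover have "csp_bags V D Nb \<noteq> []" using V by (simp add: csp_bags_def)
 ultimately have "card ` set (map set (csp_bags V D Nb)) = {3 + (V + 1) * D}"
  by (simp add: image_constant_conv del: set_map)
 then show ?thesis by (simp add: pd_width_def del: set_map)
qed

end

section \<open>Computations as clause systems\<close>

definition final_instr :: "nat \<Rightarrow> nat \<Rightarrow> insym \<Rightarrow> nat list \<Rightarrow> instr" where
 "final_instr A q a ss = \<lparr>src = q, in_read = a, wk_read = ss, dst = A, in_dir = Stay,
   wk_act = map (\<lambda>s. (s, Stay)) ss, emit = []\<rparr>"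

text \<open>Accepting halting configurations get a successor with the fresh state \<open>A\<close>.\<close>

definition complete :: "nat \<Rightarrow> tm \<Rightarrow> tm" where
 "complete A M = M\<lparr>instrs := instrs M \<union> {final_instr A q a ss | q a ss. q \<in> accepting M \<and> q < A \<and>
   set ss \<subseteq> {..<A} \<and> length ss = n_tapes M \<and> (\<forall>i\<in>instrs M. \<not> (src i = q \<and> in_read i = a \<and> wk_read i = ss))}\<rparr>"

definition state_bound :: "tm \<Rightarrow> nat \<Rightarrow> bool" where
 "state_bound M A \<longleftrightarrow> sym_bound M A \<and> (\<forall>i\<in>instrs M. src i < A)"

lemma state_bound_exists:
 assumes "well_formed M"
 shows "\<exists>A. state_bound M A"
proof -
 from sym_bound_exists[OF assms] obtain A where A: "sym_bound M A" by blast
 have "finite (src ` instrs M)" using assms by (simp add: well_formed_def)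
 then obtain B where B: "\<forall>n\<in>src ` instrs M. n < B" unfolding finite_nat_set_iff_bounded by blast
 have "state_bound M (A + B)" using A B unfolding state_bound_def sym_bound_def by (auto intro: trans_less_add1 trans_less_add2)
 then show ?thesis ..
qed

lemma complete_simps [simp]: "n_tapes (complete A M) = n_tapes M" "start (complete A M) = start M"
 by (simp_all add: complete_def)

lemma instrs_complete: "i \<in> instrs (complete A M) \<longleftrightarrow> i \<in> instrs M \<or> (\<exists>q a ss. i = final_instr A q a ss \<and> q \<in> accepting M \<and> q < A \<and>
   set ss \<subseteq> {..<A} \<and> length ss = n_tapes M \<and> (\<forall>i\<in>instrs M. \<not> (src i = q \<and> in_read i = a \<and> wk_read i = ss)))"
 by (auto simp: complete_def)

lemma well_formed_complete:
 assumes "well_formed M"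
 shows "well_formed (complete A M)"
proof -
 let ?F = "(\<lambda>(q, a, ss). final_instr A q a ss) ` ({..<A} \<times> UNIV \<times> {ss. set ss \<subseteq> {..<A} \<and> length ss = n_tapes M})"
 have "finite (UNIV :: insym set)" by (simp add: UNIV_insym)
 then have "finite ?F" by (intro finite_imageI finite_cartesian_product finite_lists_length_eq) auto
 moreover have "instrs (complete A M) \<subseteq> instrs M \<union> ?F"
  unfolding subset_iff instrs_complete by (force simp: image_iff)
 ultimately have "finite (instrs (complete A M))"
  using assms by (meson finite_UnI finite_subset well_formed_def)
 then show ?thesis using assms unfolding well_formed_def by (auto simp: instrs_complete final_instr_def)
qed

lemma complete_bounds:
 assumes "state_bound M A" "i \<in> instrs (complete A M)"
 shows "src i < A" "dst i \<le> A" "\<forall>x\<in>set (wk_act i). fst x < A"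
 using assms by (auto simp: instrs_complete state_bound_def sym_bound_def final_instr_def less_imp_le)

lemma init_complete [simp]: "init (complete A M) = init M"
 by (simp add: init_def)

lemma step_complete:
 assumes M: "well_formed M" "state_bound M A" and c: "(step M w ^^ n) (init M) c"
 shows "step (complete A M) w c c' \<longleftrightarrow> step M w c c' \<or>
  (halted M w c \<and> state c \<in> accepting M \<and> c' = c\<lparr>state := A\<rparr>)"
proof -
 note I = steps_invariant[OF M(1) M(2)[unfolded state_bound_def, THEN conjunct1] c]
 have h: "halted M w c \<longleftrightarrow> (\<forall>i\<in>instrs M. \<not> (src i = state c \<and> in_read i = scan_input w (in_pos c) \<and> wk_read i = map (\<lambda>(t, h). t h) (work c)))"
  by (auto simp: halted_def step_def applicable_def)
 have e: "execute w (final_instr A q a (map (\<lambda>(t, h). t h) (work c))) c = c\<lparr>state := A\<rparr>" for q a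
  using I machine_env.map2_stay[of "work c"] by (simp add: execute_def final_instr_def del: map_map)
 have ss: "set (map (\<lambda>(t, h). t h) (work c)) \<subseteq> {..<A}" "length (map (\<lambda>(t, h). t h) (work c)) = n_tapes M" "state c < A"
  using I by (auto simp: case_prod_unfold)
 have "step (complete A M) w c c' \<longleftrightarrow> (\<exists>i. i \<in> instrs (complete A M) \<and> src i = state c \<and> in_read i = scan_input w (in_pos c) \<and>
   wk_read i = map (\<lambda>(t, h). t h) (work c) \<and> c' = execute w i c)" by (auto simp: step_def applicable_def)
 also have "\<dots> \<longleftrightarrow> step M w c c' \<or> (\<exists>i q a ss. i = final_instr A q a ss \<and> q \<in> accepting M \<and> q < A \<and>
   set ss \<subseteq> {..<A} \<and> length ss = n_tapes M \<and> (\<forall>i\<in>instrs M. \<not> (src i = q \<and> in_read i = a \<and> wk_read i = ss)) \<and>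
   src i = state c \<and> in_read i = scan_input w (in_pos c) \<and> wk_read i = map (\<lambda>(t, h). t h) (work c) \<and> c' = execute w i c)"
  unfolding instrs_complete step_def applicable_def by blast
 also have "\<dots> \<longleftrightarrow> step M w c c' \<or> (halted M w c \<and> state c \<in> accepting M \<and> c' = c\<lparr>state := A\<rparr>)"
  unfolding h using ss e by (auto simp: final_instr_def[of A, THEN arg_cong[where f = src], simplified]
    final_instr_def[of A, THEN arg_cong[where f = in_read], simplified] final_instr_def[of A, THEN arg_cong[where f = wk_read], simplified])
 finally show ?thesis .
qed

text \<open>No instruction of the completed machine starts in state \<open>A\<close>, so the
  additional instructions can only be used in the very last step.\<close>

lemma complete_steps:
 assumes M: "well_formed M" "state_bound M A" and "(step (complete A M) w ^^ n) (init M) c"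
 shows "(step M w ^^ n) (init M) c \<or> (state c = A \<and> (\<exists>m d. n = Suc m \<and> (step M w ^^ m) (init M) d \<and> halted M w d \<and>
  state d \<in> accepting M \<and> c = d\<lparr>state := A\<rparr>))"
 using assms(3)
proof (induction n arbitrary: c)
 case (Suc n)
 then obtain d where d: "(step (complete A M) w ^^ n) (init M) d" "step (complete A M) w d c" by (auto elim: relpowp_Suc_E)
 have "state d \<noteq> A" using d(2) complete_bounds(1)[OF M(2)] by (force simp: step_def applicable_def)
 with Suc.IH[OF d(1)] have m: "(step M w ^^ n) (init M) d" by blast
 from d(2)[unfolded step_complete[OF M m]] show ?case
 proof
  assume "step M w d c"
  then show ?thesis using m by auto
 next
  assume "halted M w d \<and> state d \<in> accepting M \<and> c = d\<lparr>state := A\<rparr>"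
  then show ?thesis using m by (intro disjI2) auto
 qed
qed simp

text \<open>Halting is the absence of an instruction, which is awkward to express in a tableau.
  After completion, acceptance is just reaching the state \<open>A\<close>, and the additional step
  explains \<open>Suc T\<close>. The original machine never enters \<open>A\<close>, as its states
  are below \<open>A\<close>.\<close>

lemma accepts_complete:
 assumes M: "well_formed M" "state_bound M A" and T: "runs_in_time M w (real T)"
 shows "accepts M w \<longleftrightarrow> (\<exists>n c. n \<le> Suc T \<and> (step (complete A M) w ^^ n) (init M) c \<and> state c = A)"
proof
 assume "accepts M w"
 then obtain d m where d: "(step M w ^^ m) (init M) d" "halted M w d" "state d \<in> accepting M"
  unfolding accepts_def reachable_def by (metis rtranclp_imp_relpowp)
 have mono: "(step M w ^^ j) (init M) e \<Longrightarrow> (step (complete A M) w ^^ j) (init M) e" for j e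
 proof (induction j arbitrary: e)
  case (Suc j)
  then obtain e' where e': "(step M w ^^ j) (init M) e'" "step M w e' e" by (auto elim: relpowp_Suc_E)
  then have "step (complete A M) w e' e" unfolding step_complete[OF M e'(1)] by blast
  with Suc.IH[OF e'(1)] show ?case by auto
 qed simp
 have "step (complete A M) w d (d\<lparr>state := A\<rparr>)" unfolding step_complete[OF M d(1)] using d by blast
 with mono[OF d(1)] have "(step (complete A M) w ^^ Suc m) (init M) (d\<lparr>state := A\<rparr>)" by auto
 moreover have "m \<le> T" using T d(1) unfolding runs_in_time_def by (metis of_nat_le_iff)
 ultimately show "\<exists>n c. n \<le> Suc T \<and> (step (complete A M) w ^^ n) (init M) c \<and> state c = A"
  by (intro exI[of _ "Suc m"] exI[of _ "d\<lparr>state := A\<rparr>"] conjI) (simp_all del: relpowp.simps)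
next
 assume "\<exists>n c. n \<le> Suc T \<and> (step (complete A M) w ^^ n) (init M) c \<and> state c = A"
 then obtain n c where c: "(step (complete A M) w ^^ n) (init M) c" "state c = A" by blast
 have "\<not> (step M w ^^ n) (init M) c"
  using steps_invariant[OF M(1) M(2)[unfolded state_bound_def, THEN conjunct1], where u = w and n = n and c = c] c(2) by auto
 with complete_steps[OF M c(1)] obtain m d where d: "(step M w ^^ m) (init M) d" "halted M w d" "state d \<in> accepting M" by blast
 then show "accepts M w" unfolding accepts_def reachable_def by (meson relpowp_imp_rtranclp)
qed

text \<open>The components are the instruction executed in this row (\<open>None\<close> if idle),
  the state, one bit of the input head position, and for each tape the symbol together with three
  marks: head here, head in the left neighbour, head in the right neighbour. The copies of the
  neighbours' marks let a constraint between two vertically adjacent cells handle head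
  moves.\<close>

type_synonym cell = "instr option \<times> nat \<times> bool \<times> (nat \<times> bool \<times> bool \<times> bool) list"

abbreviation (input) cop :: "cell \<Rightarrow> instr option" where "cop z \<equiv> fst z"
abbreviation (input) cst :: "cell \<Rightarrow> nat" where "cst z \<equiv> fst (snd z)"
abbreviation (input) cxb :: "cell \<Rightarrow> bool" where "cxb z \<equiv> fst (snd (snd z))"
abbreviation (input) csy :: "cell \<Rightarrow> nat \<Rightarrow> nat" where "csy z j \<equiv> fst (snd (snd (snd z)) ! j)"
abbreviation (input) cmk :: "cell \<Rightarrow> nat \<Rightarrow> bool" where "cmk z j \<equiv> fst (snd (snd (snd (snd z)) ! j))"
abbreviation (input) clm :: "cell \<Rightarrow> nat \<Rightarrow> bool" where "clm z j \<equiv> fst (snd (snd (snd (snd (snd z)) ! j)))"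
abbreviation (input) crm :: "cell \<Rightarrow> nat \<Rightarrow> bool" where "crm z j \<equiv> snd (snd (snd (snd (snd (snd z)) ! j)))"

definition nbit :: "nat \<Rightarrow> nat \<Rightarrow> bool" where "nbit p c \<longleftrightarrow> odd (p div 2 ^ c)"

definition in_class :: "bool \<Rightarrow> bool \<Rightarrow> insym" where
 "in_class x y = (if x then Bit y else if y then End_Mark else Start_Mark)"

text \<open>
 Block \<open>b\<close> is cell \<open>b mod V\<close> of row \<open>b div V\<close>. In row \<open>r\<close> the machine may move only if its input head
 is at position \<open>r mod (length w + 2)\<close>, which is known statically; this position is also the
 only input position whose symbol the constraints of the row refer to.
\<close>

definition flags :: "bool list \<Rightarrow> nat \<Rightarrow> nat \<Rightarrow> nat \<Rightarrow> bool list" where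
 "flags w V T b = (let r = b div V; c = b mod V; m = length w + 1; p = r mod (m + 1) in
   [r = 0, Suc r = T, c = 0, Suc c = V, nbit p c, nbit (min (p + 1) m) c, nbit (p - 1) c,
   0 < p \<and> p < m, (p = m \<or> (0 < p \<and> p < m \<and> w ! (p - 1)))])"

text \<open>Flags 0 and 1 mark the first and the last row, 2 and 3 the first and the last column; 4,
  5 and 6 are the bits of the row's input position and of the positions to its right and left; 7 and
  8 encode the input symbol. A row with an instruction must agree in all its bits with the row's
  position, so that position is the one of the head.\<close>

definition okU :: "tm \<Rightarrow> nat \<Rightarrow> bool list \<Rightarrow> cell \<Rightarrow> bool" where
 "okU M A f z \<longleftrightarrow>
   (f ! 0 \<longrightarrow> cst z = start M \<and> \<not> cxb z \<and> (\<forall>j<n_tapes M. csy z j = 0 \<and> (cmk z j \<longleftrightarrow> f ! 2))) \<and>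
   (f ! 1 \<longrightarrow> cst z = A) \<and>
   (f ! 2 \<longrightarrow> (\<forall>j<n_tapes M. \<not> clm z j)) \<and> (f ! 3 \<longrightarrow> (\<forall>j<n_tapes M. \<not> crm z j)) \<and>
   (\<forall>i. cop z = Some i \<longrightarrow> src i = cst z \<and> (cxb z \<longleftrightarrow> f ! 4) \<and> in_read i = in_class (f ! 7) (f ! 8) \<and>
    (\<forall>j<n_tapes M. cmk z j \<longrightarrow> csy z j = wk_read i ! j))"

definition okH :: "tm \<Rightarrow> cell \<Rightarrow> cell \<Rightarrow> bool" where
 "okH M z z' \<longleftrightarrow> cop z = cop z' \<and> (\<forall>j<n_tapes M. clm z' j = cmk z j \<and> crm z j = cmk z' j)"

text \<open>In the case \<open>Left\<close> a head mark arrives from the right neighbour, or stays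
  in the first column, as a head at position 0 does.\<close>

definition okV :: "tm \<Rightarrow> bool list \<Rightarrow> cell \<Rightarrow> cell \<Rightarrow> bool" where
 "okV M f z z' \<longleftrightarrow> (case cop z of
   None \<Rightarrow> cst z' = cst z \<and> cxb z' = cxb z \<and> (\<forall>j<n_tapes M. csy z' j = csy z j \<and> cmk z' j = cmk z j)
  | Some i \<Rightarrow> cst z' = dst i \<and> cxb z' = (case in_dir i of Stay \<Rightarrow> f ! 4 | Right \<Rightarrow> f ! 5 | Left \<Rightarrow> f ! 6) \<and>
    (\<forall>j<n_tapes M. csy z' j = (if cmk z j then fst (wk_act i ! j) else csy z j) \<and>
     cmk z' j = (case snd (wk_act i ! j) of Stay \<Rightarrow> cmk z j | Right \<Rightarrow> clm z j | Left \<Rightarrow> crm z j \<or> (f ! 2 \<and> cmk z j))))"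

definition cells :: "tm \<Rightarrow> nat \<Rightarrow> cell set" where
 "cells M A = (insert None (Some ` instrs M)) \<times> {..A} \<times> UNIV \<times>
   {ts. set ts \<subseteq> {..<A} \<times> UNIV \<times> UNIV \<times> UNIV \<and> length ts = n_tapes M}"

lemma finite_cells: "well_formed M \<Longrightarrow> finite (cells M A)"
 unfolding cells_def well_formed_def
 by (intro finite_cartesian_product finite_insert[THEN iffD2] finite_imageI finite_lists_length_eq) auto

definition tiling :: "tm \<Rightarrow> nat \<Rightarrow> bool list \<Rightarrow> nat \<Rightarrow> nat \<Rightarrow> (nat \<Rightarrow> cell) \<Rightarrow> bool" where
 "tiling M A w V T z \<longleftrightarrow> (\<forall>b<V * T. z b \<in> cells M A \<and> okU M A (flags w V T b) (z b) \<and>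
   (Suc (b mod V) \<noteq> V \<longrightarrow> okH M (z b) (z (b + 1))) \<and>
   (Suc (b div V) \<noteq> T \<longrightarrow> okV M (flags w V T b) (z b) (z (b + V))))"

definition cell_of :: "instr option \<Rightarrow> config \<Rightarrow> nat \<Rightarrow> cell" where
 "cell_of i c j = (i, state c, nbit (in_pos c) j, map (\<lambda>(t, h). (t j, h = j, Suc h = j, h = Suc j)) (work c))"

text \<open>Runs that advance the row counter and may move only in the row of the input position.\<close>

definition tick :: "tm \<Rightarrow> bool list \<Rightarrow> nat \<times> config \<Rightarrow> nat \<times> config \<Rightarrow> bool" where
 "tick M w x y \<longleftrightarrow> fst y = Suc (fst x) \<and> (snd y = snd x \<or>
   (in_pos (snd x) = fst x mod (length w + 2) \<and> step M w (snd x) (snd y)))"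

lemma tick_idle: "(tick M w ^^ n) (r, c) (r + n, c)"
proof (induction n)
 case (Suc n)
 have "tick M w (r + n, c) (r + Suc n, c)" by (simp add: tick_def)
 with Suc show ?case by auto
qed simp

text \<open>Each step is given one full round of \<open>length w + 2\<close> rows: idle until the
  row of the head's position, move there, and idle to the end of the round.\<close>

lemma tick_steps:
 assumes "\<And>j d. j \<le> n \<Longrightarrow> (step M w ^^ j) (init M) d \<Longrightarrow> in_pos d \<le> length w + 1"
  and "(step M w ^^ n) (init M) c"
 shows "(tick M w ^^ (n * (length w + 2))) (0, init M) (n * (length w + 2), c)"
 using assms
proof (induction n arbitrary: c)
 case (Suc n)
 let ?m = "length w + 2"
 from Suc.prems(2) obtain d where d: "(step M w ^^ n) (init M) d" "step M w d c" by (auto elim: relpowp_Suc_E)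
 have 1: "(tick M w ^^ (n * ?m)) (0, init M) (n * ?m, d)"
  by (rule Suc.IH[OF _ d(1)]) (use Suc.prems(1) le_SucI in blast)
 have p: "in_pos d < ?m" using Suc.prems(1)[of n d] d(1) by simp
 have 2: "(tick M w ^^ in_pos d) (n * ?m, d) (n * ?m + in_pos d, d)" by (rule tick_idle)
 have "(n * ?m + in_pos d) mod ?m = in_pos d" using p by (simp only: mod_mult_self3 mod_less)
 then have 3: "tick M w (n * ?m + in_pos d, d) (Suc (n * ?m + in_pos d), c)" using d(2) by (simp add: tick_def)
 have 4: "(tick M w ^^ (?m - Suc (in_pos d))) (Suc (n * ?m + in_pos d), c) (Suc (n * ?m + in_pos d) + (?m - Suc (in_pos d)), c)"
  by (rule tick_idle)
 have "(tick M w ^^ (n * ?m + in_pos d)) (0, init M) (n * ?m + in_pos d, d)"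
  using 1 2 by (auto simp: relpowp_add)
 with 3 have "(tick M w ^^ Suc (n * ?m + in_pos d)) (0, init M) (Suc (n * ?m + in_pos d), c)" by auto
 with 4 have "(tick M w ^^ (Suc (n * ?m + in_pos d) + (?m - Suc (in_pos d)))) (0, init M) (Suc (n * ?m + in_pos d) + (?m - Suc (in_pos d)), c)"
  unfolding relpowp_add by blast
 moreover have "Suc (n * ?m + in_pos d) + (?m - Suc (in_pos d)) = Suc n * ?m" using p by simp
 ultimately show ?case by (simp only:)
qed simp

lemma tick_reach:
 assumes "(tick M w ^^ n) (0, init M) (r, c)"
 shows "r = n \<and> (\<exists>m\<le>n. (step M w ^^ m) (init M) c)"
 using assms
proof (induction n arbitrary: r c)
 case (Suc n)
 then obtain r' d where d: "(tick M w ^^ n) (0, init M) (r', d)" "tick M w (r', d) (r, c)" by (auto elim: relpowp_Suc_E)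
 from Suc.IH[OF d(1)] obtain m where m: "r' = n" "m \<le> n" "(step M w ^^ m) (init M) d" by blast
 from d(2) have "r = Suc n" "c = d \<or> step M w d c" using m(1) by (auto simp: tick_def)
 then show ?case using m(2,3) by (metis Suc_le_mono le_SucI relpowp_Suc_I)
qed simp

section \<open>Tilings correspond to slowed-down runs\<close>

lemma nbit_inj:
 assumes "p < 2 ^ V" "q < 2 ^ V" "\<And>j. j < V \<Longrightarrow> nbit p j = nbit q j"
 shows "p = q"
 using assms
proof (induction V arbitrary: p q)
 case (Suc V)
 have "nbit (p div 2) j = nbit (q div 2) j" if "j < V" for j
  using Suc.prems(3)[of "Suc j"] that by (simp add: nbit_def div_mult2_eq)
 then have "p div 2 = q div 2" using Suc.prems(1,2) by (intro Suc.IH) auto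
 moreover have "odd p = odd q" using Suc.prems(3)[of 0] by (simp add: nbit_def)
 ultimately show ?case by (metis odd_two_times_div_two_succ even_two_times_div_two)
qed simp

locale tableau =
 fixes M :: tm and A :: nat and w :: "bool list" and V T :: nat
 assumes wf: "well_formed M" and bnd: "\<And>i. i \<in> instrs M \<Longrightarrow> src i < A \<and> dst i \<le> A \<and> (\<forall>x\<in>set (wk_act i). fst x < A)"
  and st: "start M < A" and V1: "1 \<le> V" and V2: "length w + 1 < 2 ^ V"
  and T: "2 \<le> T"
  and inv: "\<And>n c. n < T \<Longrightarrow> (step M w ^^ n) (init M) c \<Longrightarrow> in_pos c \<le> length w + 1 \<and> length (work c) = n_tapes M \<and>
    state c \<le> A \<and> (\<forall>x\<in>set (work c). snd x < V \<and> (\<forall>j. fst x j < A))"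
begin

abbreviation "fl r c \<equiv> flags w V T (r * V + c)"
abbreviation "ps r \<equiv> r mod (length w + 2)"

lemma flags_nth:
 "c < V \<Longrightarrow> fl r c = (let m = length w + 1; p = r mod (m + 1) in
   [r = 0, Suc r = T, c = 0, Suc c = V, nbit p c, nbit (min (p + 1) m) c, nbit (p - 1) c,
   0 < p \<and> p < m, (p = m \<or> (0 < p \<and> p < m \<and> w ! (p - 1)))])"
 by (simp add: flags_def)

lemma flag_simps:
 assumes "c < V"
 shows "fl r c ! 0 \<longleftrightarrow> r = 0" "fl r c ! 1 \<longleftrightarrow> Suc r = T"
  "fl r c ! 2 \<longleftrightarrow> c = 0" "fl r c ! 3 \<longleftrightarrow> Suc c = V"
  "fl r c ! 4 \<longleftrightarrow> nbit (ps r) c"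
  "fl r c ! 5 \<longleftrightarrow> nbit (min (ps r + 1) (length w + 1)) c"
  "fl r c ! 6 \<longleftrightarrow> nbit (ps r - 1) c"
  "in_class (fl r c ! 7) (fl r c ! 8) = scan_input w (ps r)"
proof -
 have m: "ps r < length w + 2" by simp
 show "fl r c ! 0 \<longleftrightarrow> r = 0" "fl r c ! 1 \<longleftrightarrow> Suc r = T"
  "fl r c ! 2 \<longleftrightarrow> c = 0" "fl r c ! 3 \<longleftrightarrow> Suc c = V"
  "fl r c ! 4 \<longleftrightarrow> nbit (ps r) c"
  "fl r c ! 5 \<longleftrightarrow> nbit (min (ps r + 1) (length w + 1)) c"
  "fl r c ! 6 \<longleftrightarrow> nbit (ps r - 1) c"
  unfolding flags_nth[OF assms] Let_def by (simp_all add: eval_nat_numeral)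
 show "in_class (fl r c ! 7) (fl r c ! 8) = scan_input w (ps r)"
 proof -
  define q where "q = ps r"
  have e: "length w + 1 + 1 = length w + 2" by simp
  show ?thesis using m unfolding flags_nth[OF assms] Let_def e q_def[symmetric]
   by (auto simp: in_class_def scan_input_def eval_nat_numeral)
 qed
qed

lemma tiling_rc:
 "tiling M A w V T z \<longleftrightarrow> (\<forall>r<T. \<forall>c<V. z (r * V + c) \<in> cells M A \<and> okU M A (fl r c) (z (r * V + c)) \<and>
   (Suc c < V \<longrightarrow> okH M (z (r * V + c)) (z (r * V + Suc c))) \<and>
   (Suc r < T \<longrightarrow> okV M (fl r c) (z (r * V + c)) (z (Suc r * V + c))))"
proof -
 have "(\<forall>b<V * T. P b) \<longleftrightarrow> (\<forall>r<T. \<forall>c<V. P (r * V + c))" for P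
 proof (intro iffI allI impI)
  fix r c assume "\<forall>b<V * T. P b" "r < T" "c < V"
  moreover have "Suc r * V \<le> T * V" using \<open>r < T\<close> by (intro mult_le_mono1) simp
  ultimately show "P (r * V + c)" by (simp add: mult.commute)
 next
  fix b assume "\<forall>r<T. \<forall>c<V. P (r * V + c)" "b < V * T"
  moreover have "b div V < T" using \<open>b < V * T\<close> by (intro less_mult_imp_div_less) (simp add: mult.commute)
  moreover have "b mod V < V" using V1 by simp
  ultimately show "P b" by (metis div_mult_mod_eq)
 qed
 note this[of "\<lambda>b. z b \<in> cells M A \<and> okU M A (flags w V T b) (z b) \<and>
   (Suc (b mod V) \<noteq> V \<longrightarrow> okH M (z b) (z (b + 1))) \<and>
   (Suc (b div V) \<noteq> T \<longrightarrow> okV M (flags w V T b) (z b) (z (b + V)))"]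
 moreover have "r < T \<Longrightarrow> Suc r \<noteq> T \<longleftrightarrow> Suc r < T" "c < V \<Longrightarrow> Suc c \<noteq> V \<longleftrightarrow> Suc c < V" for r c by auto
 ultimately show ?thesis unfolding tiling_def by (auto simp: algebra_simps)
qed

lemma tape_nth:
 assumes "j < length (work c)"
 shows "snd (snd (snd (cell_of i c x))) ! j = (fst (work c ! j) x, snd (work c ! j) = x, Suc (snd (work c ! j)) = x, snd (work c ! j) = Suc x)"
 using assms by (simp add: cell_of_def case_prod_unfold)

lemma tiling_if_run:
 assumes "(tick M w ^^ (T - 1)) (0, init M) (T - 1, cf)" "state cf = A"
 shows "\<exists>z. tiling M A w V T z"
proof -
 from assms(1) obtain g where g: "g 0 = (0, init M)" "g (T - 1) = (T - 1, cf)" "\<And>i. i < T - 1 \<Longrightarrow> tick M w (g i) (g (Suc i))"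
  unfolding relpowp_fun_conv by blast
 define f where "f r = snd (g r)" for r
 have gr: "(tick M w ^^ r) (0, init M) (g r)" if "r < T" for r
  using that
 proof (induction r)
  case (Suc r)
  then show ?case using g(3)[of r] by auto
 qed (simp add: g)
 have gf: "g r = (r, f r)" and I: "in_pos (f r) \<le> length w + 1 \<and> length (work (f r)) = n_tapes M \<and>
    state (f r) \<le> A \<and> (\<forall>x\<in>set (work (f r)). snd x < V \<and> (\<forall>j. fst x j < A))" if r: "r < T" for r
 proof -
  obtain x y where xy: "g r = (x, y)" by (cases "g r")
  from tick_reach[OF gr[OF r, unfolded xy]] obtain m where m: "x = r" "m \<le> r" "(step M w ^^ m) (init M) y" by blast
  then show "g r = (r, f r)" by (simp add: f_def xy)
  show "in_pos (f r) \<le> length w + 1 \<and> length (work (f r)) = n_tapes M \<and>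
    state (f r) \<le> A \<and> (\<forall>x\<in>set (work (f r)). snd x < V \<and> (\<forall>j. fst x j < A))"
   using inv[OF _ m(3)] m r by (simp add: f_def xy)
 qed
 \<comment> \<open>A step that leaves the configuration unchanged is recorded as idle, and so is the
   last row, which has no successor.\<close>
 define ops where "ops r = (if Suc r < T \<and> f (Suc r) \<noteq> f r then
   Some (SOME i. applicable M w (f r) i \<and> f (Suc r) = execute w i (f r)) else None)" for r
 have ops: "ops r = None \<Longrightarrow> Suc r < T \<Longrightarrow> f (Suc r) = f r"
  "ops r = Some i \<Longrightarrow> Suc r < T \<and> in_pos (f r) = ps r \<and> applicable M w (f r) i \<and> f (Suc r) = execute w i (f r)" for r i
 proof -
  show "ops r = None \<Longrightarrow> Suc r < T \<Longrightarrow> f (Suc r) = f r" by (auto simp: ops_def split: if_splits)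
  assume o: "ops r = Some i"
  then have r: "Suc r < T" "f (Suc r) \<noteq> f r" "i = (SOME i. applicable M w (f r) i \<and> f (Suc r) = execute w i (f r))"
   by (auto simp: ops_def split: if_splits)
  have "tick M w (r, f r) (Suc r, f (Suc r))" using g(3)[of r] gf[of r] gf[of "Suc r"] r(1) by simp
  with r(2) have t: "in_pos (f r) = ps r" "step M w (f r) (f (Suc r))" by (auto simp: tick_def)
  from t(2) have "\<exists>i. applicable M w (f r) i \<and> f (Suc r) = execute w i (f r)" by (simp add: step_def)
  from someI_ex[OF this] t(1) r show "Suc r < T \<and> in_pos (f r) = ps r \<and> applicable M w (f r) i \<and> f (Suc r) = execute w i (f r)"
   by blast
 qed
 define z where "z b = cell_of (ops (b div V)) (f (b div V)) (b mod V)" for b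
 have z: "z (r * V + c) = cell_of (ops r) (f r) c" if "c < V" for r c using that by (simp add: z_def)
 have "tiling M A w V T z" unfolding tiling_rc
 proof (intro allI impI conjI)
  fix r c assume r: "r < T" and c: "c < V"
  note Ir = I[OF r]
  note zr = z[OF c, of r]
  note F = flag_simps[OF c, of r]
  have tn: "snd (snd (snd (cell_of i (f r) x))) ! j = (fst (work (f r) ! j) x, snd (work (f r) ! j) = x, Suc (snd (work (f r) ! j)) = x, snd (work (f r) ! j) = Suc x)"
   if "j < n_tapes M" for i x j using that Ir by (intro tape_nth) simp
  have hV: "snd (work (f r) ! j) < V" if "j < n_tapes M" for j using Ir that by simp
  have sf: "fst (cell_of i d x) = i" "fst (snd (cell_of i d x)) = state d" "fst (snd (snd (cell_of i d x))) = nbit (in_pos d) x" for i d x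
   by (simp_all add: cell_of_def)
  show "z (r * V + c) \<in> cells M A"
  proof -
   have "ops r = None \<or> (\<exists>i\<in>instrs M. ops r = Some i)" using ops(2)[of r] by (cases "ops r") (auto simp: applicable_def)
   moreover have "(\<lambda>(t, h). (t c, h = c, Suc h = c, h = Suc c)) x \<in> {..<A} \<times> UNIV \<times> UNIV \<times> UNIV" if "x \<in> set (work (f r))" for x
    using Ir that by (cases x) auto
   ultimately show ?thesis unfolding zr using Ir by (auto simp: cells_def cell_of_def)
  qed
  show "okU M A (fl r c) (z (r * V + c))"
   unfolding okU_def zr F sf
  proof (intro conjI impI allI)
   assume "r = 0"
   then have fr: "f r = init M" using g(1) by (simp add: f_def)
   show "state (f r) = start M" "\<not> nbit (in_pos (f r)) c" unfolding fr by (simp_all add: init_def nbit_def)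
   fix j assume "j < n_tapes M"
   then show "csy (cell_of (ops r) (f r) c) j = 0" "cmk (cell_of (ops r) (f r) c) j = (c = 0)"
    unfolding tn[OF \<open>j < n_tapes M\<close>] using fr by (auto simp: init_def)
  next
   assume "Suc r = T"
   then have "f r = cf" using g(2) unfolding f_def by (metis diff_Suc_1 snd_conv)
   then show "state (f r) = A" using assms(2) by simp
  next
   fix j assume "c = 0" and j: "j < n_tapes M"
   then show "\<not> clm (cell_of (ops r) (f r) c) j" unfolding tn[OF j] by simp
  next
   fix j assume "Suc c = V" and j: "j < n_tapes M"
   then show "\<not> crm (cell_of (ops r) (f r) c) j" unfolding tn[OF j] using hV[OF j] by simp
  next
   fix i assume "ops r = Some i"
   note o = ops(2)[OF this]
   show "src i = state (f r)" "nbit (in_pos (f r)) c = nbit (ps r) c" "in_read i = scan_input w (ps r)"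
    using o by (auto simp: applicable_def)
   fix j assume j: "j < n_tapes M" and "cmk (cell_of (ops r) (f r) c) j"
   then have "snd (work (f r) ! j) = c" unfolding tn[OF j] by simp
   then show "csy (cell_of (ops r) (f r) c) j = wk_read i ! j" unfolding tn[OF j]
    using o j Ir by (auto simp: applicable_def case_prod_unfold)
  qed
  show "okH M (z (r * V + c)) (z (r * V + Suc c))" if "Suc c < V"
   unfolding okH_def zr z[OF that] sf using tn by auto
  show "okV M (fl r c) (z (r * V + c)) (z (Suc r * V + c))" if r': "Suc r < T"
  proof (cases "ops r")
   case None
   note fS = ops(1)[OF None r']
   show ?thesis unfolding okV_def zr z[OF c, of "Suc r"] fS sf None option.case using tn by auto
  next
   case (Some i)
   note o = ops(2)[OF Some]
   have iM: "i \<in> instrs M" using o by (simp add: applicable_def)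
   have la: "length (wk_act i) = n_tapes M" using wf iM by (simp add: well_formed_def)
   have fS: "f (Suc r) = execute w i (f r)" using o by blast
   have wn: "work (f (Suc r)) ! j = act (wk_act i ! j) (work (f r) ! j)" "j < length (work (f (Suc r)))" if "j < n_tapes M" for j
    using that la Ir unfolding fS execute_def by simp_all
   show ?thesis unfolding okV_def zr z[OF c, of "Suc r"] sf Some option.case F
   proof (intro conjI allI impI)
    show "state (f (Suc r)) = dst i" unfolding fS execute_def by simp
    show "nbit (in_pos (f (Suc r))) c = (case in_dir i of Stay \<Rightarrow> nbit (ps r) c
     | Right \<Rightarrow> nbit (min (ps r + 1) (length w + 1)) c | Left \<Rightarrow> nbit (ps r - 1) c)"
    proof -
     have p: "in_pos (f r) = ps r" using o by blast
     have "in_pos (f (Suc r)) = min (move (in_dir i) (in_pos (f r))) (length w + 1)" unfolding fS execute_def by simp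
     moreover have "min (in_pos (f r) - 1) (length w + 1) = in_pos (f r) - 1" "min (in_pos (f r)) (length w + 1) = in_pos (f r)"
      using Ir by auto
     ultimately show ?thesis unfolding p[symmetric] by (cases "in_dir i") simp_all
    qed
    fix j assume j: "j < n_tapes M"
    obtain a d where ad: "wk_act i ! j = (a, d)" by (cases "wk_act i ! j")
    obtain t h where th: "work (f r) ! j = (t, h)" by (cases "work (f r) ! j")
    have S: "snd (snd (snd (cell_of k (f (Suc r)) c))) ! j = ((t(h := a)) c, move d h = c, Suc (move d h) = c, move d h = Suc c)" for k
     unfolding tape_nth[OF wn(2)[OF j]] wn(1)[OF j] ad th by simp
    show "csy (cell_of (ops (Suc r)) (f (Suc r)) c) j = (if cmk (cell_of (Some i) (f r) c) j then fst (wk_act i ! j) else csy (cell_of (Some i) (f r) c) j)"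
     unfolding S tn[OF j] ad th by simp
    show "cmk (cell_of (ops (Suc r)) (f (Suc r)) c) j = (case snd (wk_act i ! j) of Stay \<Rightarrow> cmk (cell_of (Some i) (f r) c) j
      | Right \<Rightarrow> clm (cell_of (Some i) (f r) c) j | Left \<Rightarrow> crm (cell_of (Some i) (f r) c) j \<or> (c = 0 \<and> cmk (cell_of (Some i) (f r) c) j))"
     unfolding S tn[OF j] ad th by (cases d) auto
   qed
  qed
 qed
 then show ?thesis by blast
qed

lemma run_if_tiling:
 assumes z: "tiling M A w V T z"
 shows "\<exists>c. (tick M w ^^ (T - 1)) (0, init M) (T - 1, c) \<and> state c = A"
proof -
 have C: "z (r * V + c) \<in> cells M A" and Ux: "okU M A (fl r c) (z (r * V + c))"
  and Hx: "Suc c < V \<Longrightarrow> okH M (z (r * V + c)) (z (r * V + Suc c))"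
  and Vx: "Suc r < T \<Longrightarrow> okV M (fl r c) (z (r * V + c)) (z (Suc r * V + c))" if "r < T" "c < V" for r c
  using z that unfolding tiling_rc by blast+
 have op: "cop (z (r * V + c)) = cop (z (r * V))" if "r < T" "c < V" for r c
  using that(2)
 proof (induction c)
  case (Suc c)
  then show ?case using Hx[OF that(1), of c] by (simp add: okH_def)
 qed simp
 \<comment> \<open>The neighbour marks are left out of this invariant; \<open>lm\<close> and
   \<open>rm\<close> recover them from the adjacent cell by \<open>okH\<close>, and at the two
   borders from \<open>okU\<close>.\<close>
 define good where "good r d \<longleftrightarrow> (\<forall>x<V. cst (z (r * V + x)) = state d \<and> cxb (z (r * V + x)) = nbit (in_pos d) x \<and>
   (\<forall>j<n_tapes M. csy (z (r * V + x)) j = fst (work d ! j) x \<and> cmk (z (r * V + x)) j = (snd (work d ! j) = x)))" for r and d :: config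
 have lm: "clm (z (r * V + x)) j = (Suc (snd (work d ! j)) = x)" and rm: "crm (z (r * V + x)) j = (snd (work d ! j) = Suc x)"
  if g: "good r d" and r: "r < T" and x: "x < V" and j: "j < n_tapes M" and h: "snd (work d ! j) < V" for r d x j
 proof -
  note F = flag_simps[OF x, of r]
  show "clm (z (r * V + x)) j = (Suc (snd (work d ! j)) = x)"
  proof (cases x)
   case 0
   then show ?thesis using Ux[OF r x] j F(3) unfolding okU_def by simp
  next
   case (Suc y)
   then have "clm (z (r * V + x)) j = cmk (z (r * V + y)) j" using Hx[OF r, of y] x j unfolding okH_def by simp
   also have "y < V" using Suc x by simp
   with g j have "cmk (z (r * V + y)) j = (snd (work d ! j) = y)" unfolding good_def by blast
   finally show ?thesis using Suc by simp
  qed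
  show "crm (z (r * V + x)) j = (snd (work d ! j) = Suc x)"
  proof (cases "Suc x < V")
   case False
   then have "Suc x = V" using x by simp
   then show ?thesis using Ux[OF r x] j h F(4) unfolding okU_def by simp
  next
   case True
   then have "crm (z (r * V + x)) j = cmk (z (r * V + Suc x)) j" using Hx[OF r x] j unfolding okH_def by simp
   also have "\<dots> = (snd (work d ! j) = Suc x)" using g True j unfolding good_def by blast
   finally show ?thesis .
  qed
 qed
 have "\<exists>d. (tick M w ^^ r) (0, init M) (r, d) \<and> good r d" if "r < T" for r
  using that
 proof (induction r)
  case 0
  have "good 0 (init M)" unfolding good_def
  proof (intro allI impI)
   fix x assume x: "x < V"
   have "okU M A (flags w V T (0 * V + x)) (z (0 * V + x))" by (rule Ux) (use x T in auto)
   then show "cst (z (0 * V + x)) = state (init M) \<and> cxb (z (0 * V + x)) = nbit (in_pos (init M)) x \<and>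
    (\<forall>j<n_tapes M. csy (z (0 * V + x)) j = fst (work (init M) ! j) x \<and> cmk (z (0 * V + x)) j = (snd (work (init M) ! j) = x))"
    unfolding okU_def flag_simps[OF x] by (auto simp: init_def nbit_def)
  qed
  then show ?case by auto
 next
  case (Suc r)
  then obtain d where d: "(tick M w ^^ r) (0, init M) (r, d)" and g: "good r d" by auto
  have r: "r < T" "Suc r < T" using Suc.prems by simp_all
  from tick_reach[OF d] obtain n where n: "n \<le> r" "(step M w ^^ n) (init M) d" by blast
  have I: "in_pos d \<le> length w + 1" "length (work d) = n_tapes M" "\<And>j. j < n_tapes M \<Longrightarrow> snd (work d ! j) < V"
   using inv[OF _ n(2)] n(1) r by simp_all
  show ?case
  proof (cases "cop (z (r * V))")
   case None
   have "good (Suc r) d" unfolding good_def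
   proof (intro allI impI)
    fix x assume x: "x < V"
    show "cst (z (Suc r * V + x)) = state d \<and> cxb (z (Suc r * V + x)) = nbit (in_pos d) x \<and>
    (\<forall>j<n_tapes M. csy (z (Suc r * V + x)) j = fst (work d ! j) x \<and> cmk (z (Suc r * V + x)) j = (snd (work d ! j) = x))"
     using Vx[OF r(1) x r(2)] g x unfolding okV_def op[OF r(1) x] None option.case good_def by simp
   qed
   moreover have "tick M w (r, d) (Suc r, d)" by (simp add: tick_def)
   ultimately show ?thesis using d by auto
  next
   case (Some i)
   have o: "cop (z (r * V + x)) = Some i" if "x < V" for x using op[OF r(1) that] Some by simp
   have iM: "i \<in> instrs M" using C[OF r(1), of 0] Some V1 by (auto simp: cells_def)
   have la: "length (wk_act i) = n_tapes M" "length (wk_read i) = n_tapes M" using wf iM by (simp_all add: well_formed_def)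
   have UU: "src i = state d \<and> (nbit (in_pos d) x \<longleftrightarrow> nbit (ps r) x) \<and> in_read i = scan_input w (ps r) \<and>
    (\<forall>j<n_tapes M. snd (work d ! j) = x \<longrightarrow> fst (work d ! j) x = wk_read i ! j)" if x: "x < V" for x
    using Ux[OF r(1) x] g x o[OF x] unfolding okU_def flag_simps[OF x] good_def by simp
   \<comment> \<open>Both positions have at most \<open>V\<close> bits and the cells of the row
     compare all of them.\<close>
   have p: "in_pos d = ps r"
   proof (rule nbit_inj[of _ V])
    show "in_pos d < 2 ^ V" using I(1) V2 by simp
    have "ps r \<le> length w + 1" by (metis Suc_eq_plus1 add_2_eq_Suc' less_Suc_eq_le mod_less_divisor zero_less_Suc)
    then show "ps r < 2 ^ V" using V2 by (rule le_less_trans)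
   qed (use UU in blast)
   have ap: "applicable M w d i"
    unfolding applicable_def
   proof (intro conjI iM)
    show "src i = state d" "in_read i = scan_input w (in_pos d)" using UU[of 0] V1 p by auto
    show "wk_read i = map (\<lambda>(t, h). t h) (work d)"
    proof (rule nth_equalityI)
     fix j assume "j < length (wk_read i)"
     then have j: "j < n_tapes M" using la by simp
     show "wk_read i ! j = map (\<lambda>(t, h). t h) (work d) ! j"
      using UU[OF I(3)[OF j]] j I(2) by (simp add: case_prod_unfold)
    qed (simp add: la I)
   qed
   define e where "e = execute w i d"
   have "good (Suc r) e" unfolding good_def
   proof (intro allI impI)
    fix x assume x: "x < V"
    note F = flag_simps[OF x, of r]
    note VV = Vx[OF r(1) x r(2), unfolded okV_def o[OF x] option.case F]
    show "cst (z (Suc r * V + x)) = state e \<and> cxb (z (Suc r * V + x)) = nbit (in_pos e) x \<and>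
    (\<forall>j<n_tapes M. csy (z (Suc r * V + x)) j = fst (work e ! j) x \<and> cmk (z (Suc r * V + x)) j = (snd (work e ! j) = x))"
    proof (intro conjI allI impI)
     show "cst (z (Suc r * V + x)) = state e" using VV by (simp add: e_def execute_def)
     have "in_pos e = min (move (in_dir i) (in_pos d)) (length w + 1)" by (simp add: e_def execute_def)
     moreover have "min (in_pos d - 1) (length w + 1) = in_pos d - 1" "min (in_pos d) (length w + 1) = in_pos d"
      using I(1) by auto
     moreover note VV[THEN conjunct2, THEN conjunct1]
     ultimately show "cxb (z (Suc r * V + x)) = nbit (in_pos e) x"
      unfolding p[symmetric] by (cases "in_dir i") simp_all
     fix j assume j: "j < n_tapes M"
     obtain a dr where ad: "wk_act i ! j = (a, dr)" by (cases "wk_act i ! j")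
     obtain t h where th: "work d ! j = (t, h)" by (cases "work d ! j")
     have we: "work e ! j = (t(h := a), move dr h)" using j la I(2) ad th by (simp add: e_def execute_def)
     have gj: "csy (z (r * V + x)) j = t x" "cmk (z (r * V + x)) j = (h = x)" using g x j th unfolding good_def by auto
     note L = lm[OF g r(1) x j I(3)[OF j]] rm[OF g r(1) x j I(3)[OF j]]
     from VV j have v: "csy (z (Suc r * V + x)) j = (if cmk (z (r * V + x)) j then fst (wk_act i ! j) else csy (z (r * V + x)) j)"
      "cmk (z (Suc r * V + x)) j = (case snd (wk_act i ! j) of Stay \<Rightarrow> cmk (z (r * V + x)) j
       | Right \<Rightarrow> clm (z (r * V + x)) j | Left \<Rightarrow> crm (z (r * V + x)) j \<or> (x = 0 \<and> cmk (z (r * V + x)) j))"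
      by blast+
     show "csy (z (Suc r * V + x)) j = fst (work e ! j) x" unfolding v we gj ad by simp
     show "cmk (z (Suc r * V + x)) j = (snd (work e ! j) = x)"
      unfolding v(2) we gj L th ad by (cases dr) auto
    qed
   qed
   moreover have "tick M w (r, d) (Suc r, e)" using ap p by (auto simp: tick_def step_def e_def)
   ultimately show ?thesis using d by auto
  qed
 qed
 from this[of "T - 1"] T obtain d where d: "(tick M w ^^ (T - 1)) (0, init M) (T - 1, d)" "good (T - 1) d" by auto
 have "okU M A (flags w V T ((T - 1) * V + 0)) (z ((T - 1) * V + 0))" by (rule Ux) (use T V1 in auto)
 then have "cst (z ((T - 1) * V + 0)) = A" using flag_simps(2)[of 0 "T - 1"] T V1 unfolding okU_def by simp
 moreover have "cst (z ((T - 1) * V + 0)) = state d" using d(2) V1 unfolding good_def by (metis less_eq_Suc_le One_nat_def)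
 ultimately show ?thesis using d(1) by auto
qed

end

text \<open>Variable \<open>z\<close> of a block says that its cell is \<open>zs ! z\<close>. The
  clause with \<open>p = False\<close> asks for at least one value; the clauses with
  \<open>p = True\<close> forbid values and pairs of values. Several true variables do no harm:
  every choice among them is a tiling. The flags 3 and 1 suppress clauses that would lead out of the
  row or of the table.\<close>

definition tclauses :: "tm \<Rightarrow> nat \<Rightarrow> cell list \<Rightarrow> clause list" where
 "tclauses M A zs = (let n = length zs; ps = List.product [0..<n] [0..<n] in
   concat (map (\<lambda>\<phi>. (\<phi>, False, map (Pair 0) [0..<n]) #
    map (\<lambda>z. (\<phi>, True, [(0, z)])) (filter (\<lambda>z. \<not> okU M A \<phi> (zs ! z)) [0..<n]) @
    (if \<phi> ! 3 then [] else map (\<lambda>y. (\<phi>, True, [(0, fst y), (1, snd y)])) (filter (\<lambda>y. \<not> okH M (zs ! fst y) (zs ! snd y)) ps)) @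
    (if \<phi> ! 1 then [] else map (\<lambda>y. (\<phi>, True, [(0, fst y), (2, snd y)])) (filter (\<lambda>y. \<not> okV M \<phi> (zs ! fst y) (zs ! snd y)) ps)))
   (List.n_lists 9 [True, False])))"

lemma tclauses_mem:
 "(\<phi>, p, ls) \<in> set (tclauses M A zs) \<longleftrightarrow> length \<phi> = 9 \<and>
   ((\<not> p \<and> ls = map (Pair 0) [0..<length zs]) \<or>
   (p \<and> (\<exists>z<length zs. ls = [(0, z)] \<and> \<not> okU M A \<phi> (zs ! z))) \<or>
   (p \<and> \<not> \<phi> ! 3 \<and> (\<exists>y<length zs. \<exists>z<length zs. ls = [(0, y), (1, z)] \<and> \<not> okH M (zs ! y) (zs ! z))) \<or>
   (p \<and> \<not> \<phi> ! 1 \<and> (\<exists>y<length zs. \<exists>z<length zs. ls = [(0, y), (2, z)] \<and> \<not> okV M \<phi> (zs ! y) (zs ! z))))"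
proof -
 define L where "L = List.n_lists 9 [True, False]"
 have L: "\<phi> \<in> set L \<longleftrightarrow> length \<phi> = 9" unfolding L_def set_n_lists by auto
 have P: "y \<in> set (List.product [0..<length zs] [0..<length zs]) \<longleftrightarrow> fst y < length zs \<and> snd y < length zs" for y
  by (cases y) simp
 define F :: "bool list \<Rightarrow> clause list" where "F \<phi>' = (\<phi>', False, map (Pair 0) [0..<length zs]) #
    map (\<lambda>z. (\<phi>', True, [(0, z)])) (filter (\<lambda>z. \<not> okU M A \<phi>' (zs ! z)) [0..<length zs]) @
    (if \<phi>' ! 3 then [] else map (\<lambda>y. (\<phi>', True, [(0, fst y), (1, snd y)]))
     (filter (\<lambda>y. \<not> okH M (zs ! fst y) (zs ! snd y)) (List.product [0..<length zs] [0..<length zs]))) @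
    (if \<phi>' ! 1 then [] else map (\<lambda>y. (\<phi>', True, [(0, fst y), (2, snd y)]))
     (filter (\<lambda>y. \<not> okV M \<phi>' (zs ! fst y) (zs ! snd y)) (List.product [0..<length zs] [0..<length zs])))" for \<phi>'
 have T: "tclauses M A zs = concat (map F L)" unfolding tclauses_def Let_def L_def F_def ..
 have F: "(\<phi>, p, ls) \<in> set (F \<phi>') \<longleftrightarrow> \<phi> = \<phi>' \<and>
   ((\<not> p \<and> ls = map (Pair 0) [0..<length zs]) \<or>
   (p \<and> (\<exists>z<length zs. ls = [(0, z)] \<and> \<not> okU M A \<phi> (zs ! z))) \<or>
   (p \<and> \<not> \<phi> ! 3 \<and> (\<exists>y<length zs. \<exists>z<length zs. ls = [(0, y), (1, z)] \<and> \<not> okH M (zs ! y) (zs ! z))) \<or>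
   (p \<and> \<not> \<phi> ! 1 \<and> (\<exists>y<length zs. \<exists>z<length zs. ls = [(0, y), (2, z)] \<and> \<not> okV M \<phi> (zs ! y) (zs ! z))))" for \<phi>'
  unfolding F_def by (cases p; cases "\<phi>' ! 3"; cases "\<phi>' ! 1") (auto simp: P image_iff)
 have "(\<phi>, p, ls) \<in> set (concat (map F L)) \<longleftrightarrow> (\<exists>\<phi>'\<in>set L. (\<phi>, p, ls) \<in> set (F \<phi>'))"
  unfolding set_concat set_map by blast
 then show ?thesis unfolding T F using L by blast
qed

context tableau
begin

lemma tableau_csp:
 assumes zs: "set zs = cells M A"
 shows "csp (length zs) (length zs + 2) (tclauses M A zs) V (V * T) (flags w V T)"
  and "(\<exists>Y. csp.satisfied (tclauses M A zs) V (V * T) (flags w V T) Y) \<longleftrightarrow> (\<exists>z. tiling M A w V T z)"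
proof -
 let ?CL = "tclauses M A zs" and ?f = "flags w V T" and ?n = "length zs"
 have "(None, 0, True, replicate (n_tapes M) (0, True, True, True)) \<in> cells M A"
  using st by (auto simp: cells_def)
 then have n0: "0 < ?n" using zs by (metis length_pos_if_in_set)
 have fl: "length (?f b) = 9" for b by (simp add: flags_def Let_def)
 have f31: "?f b ! 3 \<longleftrightarrow> Suc (b mod V) = V" "?f b ! 1 \<longleftrightarrow> Suc (b div V) = T" for b
  by (simp_all add: flags_def Let_def eval_nat_numeral)
 have nb_inside: "(b mod V) + 1 \<noteq> V \<Longrightarrow> b + 1 < V * T" "Suc (b div V) \<noteq> T \<Longrightarrow> b + V < V * T" if b: "b < V * T" for b
 proof -
  have r: "b div V < T" using b by (intro less_mult_imp_div_less) (simp add: mult.commute)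
  have c: "b mod V < V" using V1 by simp
  have e: "b = b div V * V + b mod V" by simp
  have "(b div V + 1) * V \<le> T * V" using r by (intro mult_le_mono1) simp
  then have "b div V * V + V \<le> V * T" by (simp add: algebra_simps)
  then show "b mod V + 1 \<noteq> V \<Longrightarrow> b + 1 < V * T" using c e by linarith
  assume "Suc (b div V) \<noteq> T"
  then have "(b div V + 2) * V \<le> T * V" using r by (intro mult_le_mono1) simp
  then have "b div V * V + V + V \<le> V * T" by (simp add: algebra_simps)
  then show "b + V < V * T" using c e by linarith
 qed
 show C: "csp ?n (?n + 2) ?CL V (V * T) ?f"
 proof
  show "1 \<le> V" "V < V * T" using V1 T by auto
  show "ls \<noteq> [] \<and> length ls \<le> ?n + 2 \<and> (\<forall>(k, z)\<in>set ls. k \<le> 2 \<and> z < ?n)" if "(\<phi>, p, ls) \<in> set ?CL" for \<phi> p ls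
   using that n0 unfolding tclauses_mem by auto
  fix b p ls k z assume b: "b < V * T" and m: "(?f b, p, ls) \<in> set ?CL" "(k, z) \<in> set ls"
  have "k = 0 \<or> (k = 1 \<and> Suc (b mod V) \<noteq> V) \<or> (k = 2 \<and> Suc (b div V) \<noteq> T)"
   using m unfolding tclauses_mem f31 by auto
  then show "b + offs V k < V * T" using nb_inside[OF b] b by (auto simp: offs_def)
 qed
 interpret csp ?n "?n + 2" ?CL V "V * T" ?f by (rule C)
 show "(\<exists>Y. satisfied Y) \<longleftrightarrow> (\<exists>z. tiling M A w V T z)"
 proof
  assume "\<exists>Y. satisfied Y"
  then obtain Y where S: "\<And>b p ls. b < V * T \<Longrightarrow> (?f b, p, ls) \<in> set ?CL \<Longrightarrow> \<exists>(k, z)\<in>set ls. Y (b + offs V k) z \<noteq> p"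
   unfolding satisfied_def by blast
  have "\<exists>z<?n. Y b z" if "b < V * T" for b
  proof -
   have "(?f b, False, map (Pair 0) [0..<?n]) \<in> set ?CL" unfolding tclauses_mem using fl by simp
   from S[OF that this] show ?thesis by auto
  qed
  then obtain g where g: "\<And>b. b < V * T \<Longrightarrow> g b < ?n \<and> Y b (g b)" by metis
  have "tiling M A w V T (\<lambda>b. zs ! g b)" unfolding tiling_def
  proof (intro allI impI conjI)
   fix b assume b: "b < V * T"
   show "zs ! g b \<in> cells M A" using g[OF b] zs nth_mem by blast
   show "okU M A (?f b) (zs ! g b)"
   proof (rule ccontr)
    assume "\<not> okU M A (?f b) (zs ! g b)"
    then have "(?f b, True, [(0, g b)]) \<in> set ?CL" unfolding tclauses_mem using fl g[OF b] by simp
    from S[OF b this] g[OF b] show False by simp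
   qed
   show "okH M (zs ! g b) (zs ! g (b + 1))" if "Suc (b mod V) \<noteq> V"
   proof (rule ccontr)
    assume "\<not> okH M (zs ! g b) (zs ! g (b + 1))"
    moreover have b': "b + 1 < V * T" using nb_inside(1)[OF b] that by simp
    ultimately have "(?f b, True, [(0, g b), (1, g (b + 1))]) \<in> set ?CL"
     unfolding tclauses_mem f31 using fl g[OF b] g[OF b'] that by simp
    from S[OF b this] g[OF b] g[OF b'] show False by (simp add: offs_def)
   qed
   show "okV M (?f b) (zs ! g b) (zs ! g (b + V))" if "Suc (b div V) \<noteq> T"
   proof (rule ccontr)
    assume "\<not> okV M (?f b) (zs ! g b) (zs ! g (b + V))"
    moreover have b': "b + V < V * T" using nb_inside(2)[OF b] that by simp
    ultimately have "(?f b, True, [(0, g b), (2, g (b + V))]) \<in> set ?CL"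
     unfolding tclauses_mem f31 using fl g[OF b] g[OF b'] that by simp
    from S[OF b this] g[OF b] g[OF b'] show False by (simp add: offs_def)
   qed
  qed
  then show "\<exists>z. tiling M A w V T z" by blast
 next
  assume "\<exists>z. tiling M A w V T z"
  then obtain z where z: "tiling M A w V T z" by blast
  have "satisfied (\<lambda>b i. zs ! i = z b)" unfolding satisfied_def
  proof (intro allI impI)
   fix b p ls assume b: "b < V * T" and m: "(?f b, p, ls) \<in> set ?CL"
   have Z: "z b \<in> cells M A" "okU M A (?f b) (z b)" "Suc (b mod V) \<noteq> V \<Longrightarrow> okH M (z b) (z (b + 1))"
    "Suc (b div V) \<noteq> T \<Longrightarrow> okV M (?f b) (z b) (z (b + V))"
    using z b unfolding tiling_def by blast+
   from Z(1) zs obtain i where i: "i < ?n" "zs ! i = z b" by (metis in_set_conv_nth)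
   from m[unfolded tclauses_mem f31] show "\<exists>(k, i)\<in>set ls. (zs ! i = z (b + offs V k)) \<noteq> p"
   proof (elim conjE disjE exE)
    assume "\<not> p" "ls = map (Pair 0) [0..<?n]"
    with i show ?thesis by auto
   qed (use Z in \<open>auto simp: offs_def\<close>)
  qed
  then show "\<exists>Y. satisfied Y" by blast
 qed
qed

end

text \<open>The number of rows is one for the start plus a round of \<open>length w + 2\<close> rows
  for each of at most \<open>T + 1\<close> steps of the completed machine. Runs that accept earlier
  idle until the last row, where the state \<open>A\<close> is demanded.\<close>

theorem computation_csp:
 assumes M: "well_formed M" "state_bound M A" and zs: "set zs = cells (complete A M) A"
  and time: "runs_in_time M w (real T)" and space: "runs_in_space M w (real V)"
  and V: "1 \<le> V" "length w + 1 < 2 ^ V" and R: "R = Suc T * (length w + 2) + 1"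
 shows "csp (length zs) (length zs + 2) (tclauses (complete A M) A zs) V (V * R) (flags w V R)"
  and "(\<exists>Y. csp.satisfied (tclauses (complete A M) A zs) V (V * R) (flags w V R) Y) \<longleftrightarrow> accepts M w"
proof -
 let ?C = "complete A M"
 have sb: "sym_bound M A" using M(2) by (simp add: state_bound_def)
 have inv0: "in_pos c \<le> length w + 1 \<and> length (work c) = n_tapes M \<and> state c < A \<and>
   (\<forall>x\<in>set (work c). snd x < V \<and> (\<forall>j. fst x j < A))" if c: "(step M w ^^ n) (init M) c" for n c
 proof -
  have "reachable M w c" using c unfolding reachable_def by (rule relpowp_imp_rtranclp)
  with space have "\<forall>x\<in>set (work c). snd x < V" unfolding runs_in_space_def by force
  then show ?thesis using steps_invariant[OF M(1) sb c] by blast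
 qed
 have cinv: "in_pos c \<le> length w + 1 \<and> length (work c) = n_tapes ?C \<and> state c \<le> A \<and>
   (\<forall>x\<in>set (work c). snd x < V \<and> (\<forall>j. fst x j < A))" if c: "(step ?C w ^^ n) (init ?C) c" for n c
 proof -
  from complete_steps[OF M c[unfolded init_complete]]
  consider "(step M w ^^ n) (init M) c" | m d where "(step M w ^^ m) (init M) d" "c = d\<lparr>state := A\<rparr>" by blast
  then show ?thesis
  proof cases
   case 1
   from inv0[OF this] show ?thesis by (simp add: less_imp_le)
  next
   case 2
   from inv0[OF this(1)] show ?thesis using 2(2) by simp
  qed
 qed
 interpret tableau ?C A w V R
 proof
  show "well_formed ?C" by (rule well_formed_complete[OF M(1)])
  show "src i < A \<and> dst i \<le> A \<and> (\<forall>x\<in>set (wk_act i). fst x < A)" if "i \<in> instrs ?C" for i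
   using complete_bounds[OF M(2) that] by blast
  show "start ?C < A" using sb by (simp add: sym_bound_def)
  show "2 \<le> R" using R by simp
 qed (use V cinv in auto)
 show "csp (length zs) (length zs + 2) (tclauses ?C A zs) V (V * R) (flags w V R)" by (rule tableau_csp(1)[OF zs])
 let ?N = "Suc T * (length w + 2)"
 have RN: "R - 1 = ?N" using R by simp
 have "(\<exists>z. tiling ?C A w V R z) \<longleftrightarrow> (\<exists>c. (tick ?C w ^^ ?N) (0, init ?C) (?N, c) \<and> state c = A)"
  using tiling_if_run run_if_tiling unfolding RN by blast
 also have "\<dots> \<longleftrightarrow> (\<exists>n c. n \<le> Suc T \<and> (step ?C w ^^ n) (init M) c \<and> state c = A)"
 proof
  assume "\<exists>c. (tick ?C w ^^ ?N) (0, init ?C) (?N, c) \<and> state c = A"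
  then obtain c where c: "(tick ?C w ^^ ?N) (0, init ?C) (?N, c)" "state c = A" by blast
  from tick_reach[OF c(1)] obtain m where m: "(step ?C w ^^ m) (init ?C) c" by blast
  with complete_steps[OF M, of m w c] c(2) inv0[of m c] obtain m' d where
   d: "m = Suc m'" "(step M w ^^ m') (init M) d" by auto
  then have "m \<le> Suc T" using time unfolding runs_in_time_def by (metis Suc_le_mono of_nat_le_iff)
  with m c(2) show "\<exists>n c. n \<le> Suc T \<and> (step ?C w ^^ n) (init M) c \<and> state c = A" by auto
 next
  assume "\<exists>n c. n \<le> Suc T \<and> (step ?C w ^^ n) (init M) c \<and> state c = A"
  then obtain n c where c: "n \<le> Suc T" "(step ?C w ^^ n) (init ?C) c" "state c = A" by auto
  have 1: "(tick ?C w ^^ (n * (length w + 2))) (0, init ?C) (n * (length w + 2), c)"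
  proof (rule tick_steps[OF _ c(2)])
   show "in_pos d \<le> length w + 1" if "(step ?C w ^^ m) (init ?C) d" for m d
    using cinv[OF that] by blast
  qed
  have le: "n * (length w + 2) \<le> ?N" using c(1) by (rule mult_le_mono1)
  have 2: "(tick ?C w ^^ (?N - n * (length w + 2))) (n * (length w + 2), c) (n * (length w + 2) + (?N - n * (length w + 2)), c)"
   by (rule tick_idle)
  have "(tick ?C w ^^ (n * (length w + 2) + (?N - n * (length w + 2)))) (0, init ?C) (n * (length w + 2) + (?N - n * (length w + 2)), c)"
   unfolding relpowp_add using 1 2 by blast
  with le c(3) show "\<exists>c. (tick ?C w ^^ ?N) (0, init ?C) (?N, c) \<and> state c = A" by auto
 qed
 also have "\<dots> \<longleftrightarrow> accepts M w" by (rule accepts_complete[OF M time, symmetric])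
 finally show "(\<exists>Y. csp.satisfied (tclauses ?C A zs) V (V * R) (flags w V R) Y) \<longleftrightarrow> accepts M w"
  unfolding tableau_csp(2)[OF zs] .
qed

section \<open>Derived expressions and programs\<close>

text \<open>A bound above all variables that occur in an expression; derived forms take their bound
  variables from there on.\<close>

primrec vb :: "aexp \<Rightarrow> nat" where
 "vb (Con k) = 0"
| "vb (Var x) = x + 1"
| "vb (Ari b d e) = max (vb d) (vb e)"
| "vb (In e) = vb e"
| "vb (Get e) = vb e"
| "vb (Fold x y n d e) = max (vb n) (max (vb d) (vb e))"

lemma ev_cong: "(\<And>x. x < vb e \<Longrightarrow> E x = E' x) \<Longrightarrow> ev w a c e E = ev w a c e E'"
proof (induction e arbitrary: E E')
 case (Fold x y n d e)
 have "ev w a c n E = ev w a c n E'" by (rule Fold.IH(1)) (use Fold.prems in simp)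
 moreover have "ev w a c d (E(x := i)) = ev w a c d (E'(x := i))" for i
  by (rule Fold.IH(2)) (use Fold.prems in simp)
 moreover have "ev w a c e (E(x := i, y := s)) = ev w a c e (E'(x := i, y := s))" for i s
  by (rule Fold.IH(3)) (use Fold.prems in simp)
 ultimately show ?case by simp
next
 case (Ari b d e)
 have "ev w a c d E = ev w a c d E'" "ev w a c e E = ev w a c e E'"
  by (rule Ari.IH; use Ari.prems in simp)+
 then show ?case by simp
next
 case (In e)
 have "ev w a c e E = ev w a c e E'" by (rule In.IH) (use In.prems in simp)
 then show ?case by simp
next
 case (Get e)
 have "ev w a c e E = ev w a c e E'" by (rule Get.IH) (use Get.prems in simp)
 then show ?case by simp
qed simp_all

lemma ev_upd [simp]: "vb e \<le> x \<Longrightarrow> ev w a c e (E(x := i)) = ev w a c e E"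
 by (rule ev_cong) simp

definition aNot where "aNot e = Sub (Con 1) e"
definition aLe where "aLe d e = aNot (Sub d e)"
definition aLt where "aLt d e = aLe (Add d (Con 1)) e"
definition aEq where "aEq d e = aNot (Add (Sub d e) (Sub e d))"
definition aAnd where "aAnd d e = aNot (Add (aNot d) (aNot e))"
definition aOr where "aOr d e = aNot (aNot (Add d e))"
text \<open>The summand itself serves as the permitted increment of \<open>Fold\<close>, so the
  cutoff never takes effect.\<close>

definition aSum where "aSum x n e = Fold x (x + vb e + 1) n e (Add (Var (x + vb e + 1)) e)"
definition aAll where "aAll x n e = aNot (aSum x n (aNot e))"
definition aEx where "aEx x n e = aNot (aNot (aSum x n e))"
definition aMul where "aMul d e = aSum (vb e) d e"
definition aIf where "aIf b d e = Add (aMul (aNot (aNot b)) d) (aMul (aNot b) e)"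
text \<open>The quotient is the number of \<open>i < d\<close> with
  \<open>(i + 1) * e \<le> d\<close>; the conjunct \<open>e\<close> makes it 0 for the divisor
  0.\<close>

definition aDiv where "aDiv d e = aSum (max (vb d) (vb e)) d
 (aAnd e (aLe (aMul (Add (Var (max (vb d) (vb e))) (Con 1)) e) d))"
definition aMod where "aMod d e = Sub d (aMul (aDiv d e) e)"
text \<open>Round 0 replaces the initial 0 by \<open>p\<close>, and each of the following
  \<open>c\<close> rounds halves; hence \<open>c + 1\<close> rounds. Exponentiation is avoided, as
  \<open>2 ^ c\<close> may be too large for a register.\<close>

definition aShr where "aShr p c = Fold (vb p) (vb p + 1) (Add c (Con 1)) p
 (aIf (Var (vb p)) (aDiv (Var (vb p + 1)) (Con 2)) p)"
definition aBit where "aBit p c = aMod (aShr p c) (Con 2)"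
definition aLen where "aLen p = aSum (vb p) p (aLt (Con 0) (aShr p (Var (vb p))))"

primrec aPow where
 "aPow e 0 = Con 1"
| "aPow e (Suc n) = aMul (aPow e n) e"

definition
 "aPoly p e = foldr (\<lambda>i s. Add (aMul (Con (coeff p i)) (aPow e i)) s) [0..<Suc (degree p)] (Con 0)"

lemma ev_aNot [simp]: "ev w a c (aNot e) E = of_bool (ev w a c e E = 0)"
 by (simp add: aNot_def)

lemma ev_aLe [simp]: "ev w a c (aLe d e) E = of_bool (ev w a c d E \<le> ev w a c e E)"
 by (simp add: aLe_def)

lemma ev_aLt [simp]: "ev w a c (aLt d e) E = of_bool (ev w a c d E < ev w a c e E)"
 by (simp add: aLt_def Suc_le_eq)

lemma ev_aEq [simp]: "ev w a c (aEq d e) E = of_bool (ev w a c d E = ev w a c e E)"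
 by (auto simp: aEq_def)

lemma ev_aAnd [simp]: "ev w a c (aAnd d e) E = of_bool (ev w a c d E \<noteq> 0 \<and> ev w a c e E \<noteq> 0)"
 by (simp add: aAnd_def)

lemma ev_aOr [simp]: "ev w a c (aOr d e) E = of_bool (ev w a c d E \<noteq> 0 \<or> ev w a c e E \<noteq> 0)"
 by (simp add: aOr_def)

lemma rec_sum: "rec_nat 0 (\<lambda>i s. s + f i) n = sum f {..<n}"
 by (induction n) simp_all

lemma ev_aSum [simp]: "ev w a c (aSum x n e) E = (\<Sum>i<ev w a c n E. ev w a c e (E(x := i)))"
 by (simp add: aSum_def rec_sum)

lemma ev_aAll [simp]: "ev w a c (aAll x n e) E = of_bool (\<forall>i<ev w a c n E. ev w a c e (E(x := i)) \<noteq> 0)"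
 by (auto simp: aAll_def simp del: sum_of_bool_eq)

lemma ev_aEx [simp]: "ev w a c (aEx x n e) E = of_bool (\<exists>i<ev w a c n E. ev w a c e (E(x := i)) \<noteq> 0)"
 by (auto simp: aEx_def)

lemma ev_aMul [simp]: "ev w a c (aMul d e) E = ev w a c d E * ev w a c e E"
 by (simp add: aMul_def)

lemma ev_aIf [simp]: "ev w a c (aIf b d e) E = (if ev w a c b E \<noteq> 0 then ev w a c d E else ev w a c e E)"
 by (simp add: aIf_def)

lemma sum_of_bool_less: "(\<Sum>i<n. of_bool (i < k)) = min n (k :: nat)"
 by (induction n) auto

lemma ev_aDiv [simp]: "ev w a c (aDiv d e) E = ev w a c d E div ev w a c e E"
proof -
 let ?d = "ev w a c d E" and ?e = "ev w a c e E"
 have *: "(?e \<noteq> 0 \<and> (i + 1) * ?e \<le> ?d) \<longleftrightarrow> i < ?d div ?e" for i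
  using less_eq_div_iff_mult_less_eq[of ?e "Suc i" ?d] by (cases "?e = 0") (simp_all add: Suc_le_eq)
 have "ev w a c (aDiv d e) E = (\<Sum>i<?d. of_bool (?e \<noteq> 0 \<and> (i + 1) * ?e \<le> ?d))"
  by (simp add: aDiv_def)
 also have "\<dots> = ?d div ?e" unfolding * sum_of_bool_less by (rule min_absorb2[OF div_le_dividend])
 finally show ?thesis .
qed

lemma ev_aMod [simp]: "ev w a c (aMod d e) E = ev w a c d E mod ev w a c e E"
 by (simp add: aMod_def modulo_nat_def mult.commute minus_div_mult_eq_mod)

lemma ev_aShr [simp]: "ev w a c (aShr p d) E = ev w a c p E div 2 ^ ev w a c d E"
proof -
 let ?p = "ev w a c p E"
 define r where "r = rec_nat 0 (\<lambda>i s. min (s + ?p) (if i \<noteq> 0 then s div 2 else ?p))"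
 have r: "r (Suc m) = min (r m + ?p) (if m \<noteq> 0 then r m div 2 else ?p)" for m by (simp add: r_def)
 have "r (Suc n) = ?p div 2 ^ n" for n
 proof (induction n)
  case 0
  show ?case by (simp add: r)
 next
  case (Suc n)
  have "?p div 2 ^ n div 2 = ?p div (2 ^ Suc n)" by (simp only: div_mult2_eq[symmetric] power_Suc mult.commute)
  moreover have "?p div 2 ^ Suc n \<le> ?p div 2 ^ n + ?p" using div_le_dividend trans_le_add2 by blast
  ultimately show ?case unfolding r[of "Suc n"] Suc by simp
 qed
 then show ?thesis by (simp add: aShr_def r_def cong: if_cong)
qed

lemma ev_aBit [simp]: "ev w a c (aBit p d) E = of_bool (odd (ev w a c p E div 2 ^ ev w a c d E))"
 by (simp add: aBit_def mod_2_eq_odd)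

lemma less_length_binary: "i < length (binary n) \<longleftrightarrow> 2 ^ i \<le> n"
proof (induction n arbitrary: i rule: less_induct)
 case (less n)
 show ?case
 proof (cases "n = 0")
  case False
  then have "i - 1 < length (binary (n div 2)) \<longleftrightarrow> 2 ^ (i - 1) \<le> n div 2" by (intro less) simp
  with False show ?thesis
   by (cases i) (auto simp: binary.simps[of n] less_eq_div_iff_mult_less_eq mult.commute)
 qed (simp add: binary.simps)
qed

lemma length_binary_le: "length (binary n) \<le> n"
proof (rule ccontr)
 assume "\<not> ?thesis"
 then have "2 ^ n \<le> n" by (simp add: less_length_binary[symmetric])
 moreover have "n < 2 ^ n" by (rule less_exp)
 ultimately show False by simp
qed

lemma less_power_length_binary: "n < 2 ^ length (binary n)"
 using less_length_binary[of "length (binary n)" n] by simp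

lemma nth_binary: "i < length (binary n) \<Longrightarrow> binary n ! i = odd (n div 2 ^ i)"
proof (induction n arbitrary: i rule: less_induct)
 case (less n)
 have n: "n \<noteq> 0"
 proof
  assume "n = 0"
  with less.prems show False by (simp add: binary.simps)
 qed
 show ?case
 proof (cases i)
  case (Suc j)
  have "binary (n div 2) ! j = odd (n div 2 div 2 ^ j)"
   by (rule less.IH) (use less.prems n Suc in \<open>simp_all add: binary.simps[of n]\<close>)
  then show ?thesis using n Suc by (simp add: binary.simps[of n] div_mult2_eq)
 qed (use n in \<open>simp add: binary.simps[of n]\<close>)
qed

lemma binary_eq_map: "binary n = map (\<lambda>i. odd (n div 2 ^ i)) [0..<length (binary n)]"
 by (rule nth_equalityI) (simp_all add: nth_binary)

lemma ev_aLen [simp]: "ev w a c (aLen p) E = length (binary (ev w a c p E))"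
proof -
 let ?p = "ev w a c p E"
 have "(0 < ?p div 2 ^ i) \<longleftrightarrow> i < length (binary ?p)" for i
  by (simp add: less_length_binary div_greater_zero_iff)
 then have "ev w a c (aLen p) E = (\<Sum>i<?p. of_bool (i < length (binary ?p)))"
  by (simp add: aLen_def)
 also have "\<dots> = length (binary ?p)" unfolding sum_of_bool_less by (rule min_absorb2[OF length_binary_le])
 finally show ?thesis .
qed

lemma ev_aPow [simp]: "ev w a c (aPow e n) E = ev w a c e E ^ n"
 by (induction n) simp_all

lemma ev_aPoly [simp]: "ev w a c (aPoly p e) E = poly p (ev w a c e E)"
proof -
 have "ev w a c (foldr (\<lambda>i s. Add (aMul (Con (coeff p i)) (aPow e i)) s) xs (Con 0)) E
   = (\<Sum>i\<leftarrow>xs. coeff p i * ev w a c e E ^ i)" for xs by (induction xs) simp_all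
 then show ?thesis unfolding aPoly_def poly_altdef
  by (simp add: sum_list_distinct_conv_sum_set atLeast0AtMost atLeast0_lessThan_Suc_eq_insert_0 lessThan_Suc_atMost lessThan_atLeast0[symmetric] del: upt_Suc)
qed

section \<open>Statements that print encodings\<close>

definition prints :: "bool list \<Rightarrow> nat \<Rightarrow> stm \<Rightarrow> (nat \<Rightarrow> nat) \<Rightarrow> (nat \<Rightarrow> bool) \<Rightarrow> bool list \<Rightarrow> bool" where
 "prints w c st E a bs \<longleftrightarrow> (\<forall>v r. sem w c st E (a, v, r) = (a, v @ bs, r))"

lemma prints_Emit: "prints w c (Emit bs) E a bs"
 by (simp add: prints_def)

lemma prints_seq: "prints w c s E a bs \<Longrightarrow> prints w c s' E a bs' \<Longrightarrow> prints w c (s ; s') E a (bs @ bs')"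
 by (simp add: prints_def)

lemma prints_For:
 assumes "n = ev w a c e E" "\<And>i. i < n \<Longrightarrow> prints w c b (E(x := i)) a (bs i)"
 shows "prints w c (For x e b) E a (concat (map bs [0..<n]))"
proof -
 define F where "F i = sem w c b (E(x := i))" for i
 have F: "F i (a, u, r) = (a, u @ bs i, r)" if "i < n" for i u r
  using assms(2)[OF that] unfolding prints_def F_def by blast
 have "rec_nat (a, v, r) F k = (a, v @ concat (map bs [0..<k]), r)" if "k \<le> n" for v r k
  using that by (induction k) (simp_all add: F)
 then show ?thesis using assms(1) unfolding prints_def sem.simps fst_conv F_def by simp
qed

definition "pseq xs = foldr SSeq xs (Emit [])"

lemma prints_pseq:
 assumes "\<And>x. x \<in> set xs \<Longrightarrow> prints w c (p x) E a (f x)"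
 shows "prints w c (pseq (map p xs)) E a (concat (map f xs))"
 using assms
proof (induction xs)
 case Nil
 show ?case using prints_Emit[of w c "[]"] by (simp add: pseq_def)
next
 case (Cons x xs)
 then have "prints w c (p x ; pseq (map p xs)) E a (f x @ concat (map f xs))" by (intro prints_seq) auto
 then show ?case by (simp add: pseq_def)
qed

definition "doif x e b = For x (aNot (aNot e)) b"

lemma prints_doif:
 assumes "ev w a c e E \<noteq> 0 \<Longrightarrow> prints w c b (E(x := 0)) a bs"
 shows "prints w c (doif x e b) E a (if ev w a c e E \<noteq> 0 then bs else [])"
proof -
 have "prints w c (doif x e b) E a (concat (map (\<lambda>_. bs) [0..<of_bool (ev w a c e E \<noteq> 0)]))"
  unfolding doif_def
 proof (rule prints_For)
  show "prints w c b (E(x := i)) a bs" if "i < of_bool (ev w a c e E \<noteq> 0)" for i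
   using that assms by (cases "ev w a c e E = 0") simp_all
 qed simp
 then show ?thesis by (cases "ev w a c e E = 0") auto
qed

definition
 "emit_bit e = doif 0 e (Emit [True]) ; doif 0 (aNot e) (Emit [False])"

lemma prints_emit_bit: "prints w c (emit_bit e) E a [ev w a c e E \<noteq> 0]"
proof -
 have "prints w c (emit_bit e) E a ((if ev w a c e E \<noteq> 0 then [True] else []) @
   (if ev w a c (aNot e) E \<noteq> 0 then [False] else []))"
  unfolding emit_bit_def by (intro prints_seq prints_doif prints_Emit)
 then show ?thesis by (cases "ev w a c e E = 0") simp_all
qed

definition
 "emit_nat e = For (vb e) (aLen e) (Emit [True] ; emit_bit (aBit e (Var (vb e)))) ; Emit [False]"

lemma enc_list_conv: "enc_list e xs = concat (map (\<lambda>x. True # e x) xs) @ [False]"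
 by (induction xs) simp_all

lemma prints_emit_nat: "prints w c (emit_nat e) E a (enc_nat (ev w a c e E))"
proof -
 let ?n = "ev w a c e E"
 let ?f = "\<lambda>i. [True] @ [odd (?n div 2 ^ i)]"
 have "prints w c (emit_bit (aBit e (Var (vb e)))) (E(vb e := i)) a [odd (?n div 2 ^ i)]" for i
  using prints_emit_bit[of w c "aBit e (Var (vb e))" "E(vb e := i)" a] by simp
 from prints_seq[OF prints_Emit[where bs = "[True]"] this]
 have "prints w c (emit_nat e) E a (concat (map ?f [0..<length (binary ?n)]) @ [False])"
  unfolding emit_nat_def by (intro prints_seq[OF prints_For prints_Emit]) simp_all
 moreover have "enc_nat ?n = concat (map ?f [0..<length (binary ?n)]) @ [False]"
  unfolding enc_nat_def enc_list_conv by (subst binary_eq_map) (simp add: o_def)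
 ultimately show ?thesis by simp
qed

lemma guessless_pseq [simp]: "guessless (pseq xs) \<longleftrightarrow> (\<forall>x\<in>set xs. guessless x)"
 by (induction xs) (simp_all add: pseq_def)

lemma guessless_emit [simp]: "guessless (emit_nat e)" "guessless (doif x e s) \<longleftrightarrow> guessless s"
 by (simp_all add: emit_nat_def emit_bit_def doif_def)

section \<open>Clocks\<close>

definition clock :: "tm \<Rightarrow> nat \<Rightarrow> (nat \<Rightarrow> nat) \<Rightarrow> bool" where
 "clock F A t \<longleftrightarrow> well_formed F \<and> deterministic F \<and> sym_bound F A \<and>
   (\<forall>k. \<exists>cf. (step F (replicate k True) ^^ t k) (init F) cf \<and> halted F (replicate k True) cf)"

lemma clock_trivial: "clock \<lparr>n_tapes = 0, instrs = {}, start = 0, accepting = {}\<rparr> 5 (\<lambda>_. 0)"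
 by (auto simp: clock_def well_formed_def deterministic_def sym_bound_def halted_def step_def applicable_def)

text \<open>The value \<open>f k\<close> is printed in unary, and one step prints fewer than
  \<open>a\<close> bits, where \<open>a\<close> exceeds the lengths of all \<open>emit\<close>
  fields. So the running time bounds \<open>f k\<close> up to a constant.\<close>

lemma clock_exists:
 assumes "computable f"
 shows "\<exists>F A t a. clock F A t \<and> (\<forall>k. f k \<le> a * t k)"
proof -
 from assms obtain F where F: "well_formed F" "deterministic F"
  and out: "\<And>k. outputs F (replicate k True) (replicate (f k) True)" unfolding computable_def by blast
 from sym_bound_exists[OF F(1)] obtain A where A: "sym_bound F A" by blast
 have "finite ((\<lambda>i. length (emit i)) ` instrs F)" using F(1) by (simp add: well_formed_def)
 then obtain a where a: "\<forall>n\<in>(\<lambda>i. length (emit i)) ` instrs F. n < a" unfolding finite_nat_set_iff_bounded by blast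
 have len: "length (out_word c) \<le> a * n" if "(step F u ^^ n) (init F) c" for u n c
  using that
 proof (induction n arbitrary: c)
  case (Suc n)
  then obtain d where d: "(step F u ^^ n) (init F) d" "step F u d c" by (auto elim: relpowp_Suc_E)
  from d(2) obtain i where i: "i \<in> instrs F" "c = execute u i d" unfolding step_def applicable_def by blast
  from a i(1) have "length (emit i) < a" by blast
  with Suc.IH[OF d(1)] i(2) show ?case by (simp add: execute_def)
 qed (simp add: init_def)
 have "\<exists>n cf. (step F (replicate k True) ^^ n) (init F) cf \<and> halted F (replicate k True) cf \<and> f k \<le> a * n" for k
 proof -
  from out[of k] obtain c where c: "reachable F (replicate k True) c" "halted F (replicate k True) c"
   "out_word c = replicate (f k) True" unfolding outputs_def by blast
  from c(1) obtain n where n: "(step F (replicate k True) ^^ n) (init F) c"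
   unfolding reachable_def by (auto dest: rtranclp_imp_relpowp)
  from len[OF n] c show ?thesis using n by auto
 qed
 then obtain t where "\<And>k. \<exists>cf. (step F (replicate k True) ^^ t k) (init F) cf \<and> halted F (replicate k True) cf \<and> f k \<le> a * t k"
  by metis
 then have "clock F A t \<and> (\<forall>k. f k \<le> a * t k)" unfolding clock_def using F A by blast
 then show ?thesis by blast
qed

lemma computable_ev:
 assumes "clock F A t"
 shows "computable (\<lambda>k. ev (replicate k True) (\<lambda>_. False) 0 e (boot_env (t k) (k + 1)))"
proof -
 let ?st = "For 2 e (Emit [True])" and ?M = "boot_tm F A (Con 0) (For 2 e (Emit [True]))"
 have "outputs ?M (replicate k True) (replicate (ev (replicate k True) (\<lambda>_. False) 0 e (boot_env (t k) (k + 1))) True)" for k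
 proof -
  let ?w = "replicate k True" and ?E = "boot_env (t k) (k + 1)"
  let ?n = "ev ?w (\<lambda>_. False) 0 e ?E"
  from assms obtain cf where F: "well_formed F" "deterministic F" "sym_bound F A"
   "(step F ?w ^^ t k) (init F) cf" "halted F ?w cf" unfolding clock_def by blast
  have "prints ?w 0 ?st ?E (\<lambda>_. False) (concat (map (\<lambda>_. [True]) [0..<?n]))"
   by (rule prints_For) (simp_all add: prints_Emit)
  then have s: "sem ?w 0 ?st ?E ((\<lambda>_. False), [], ch, True) = ((\<lambda>_. False), replicate ?n True, ch, True)" for ch
   unfolding prints_def by (simp add: concat_map_singleton map_replicate_const)
  have "outputs ?M ?w (fst (snd (sem ?w 0 ?st (boot_env (t k) (length ?w + 1)) ((\<lambda>_. False), [], (\<lambda>_. False), True))))"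
   by (rule outputs_boot_tm[where r = "[]", OF F(1-3) _ _ F(4,5) refl less_exp]) simp_all
  then show ?thesis using s by (simp del: sem.simps)
 qed
 moreover have "well_formed ?M" "deterministic ?M" by (simp_all add: well_formed_boot_tm deterministic_boot_tm)
 ultimately show ?thesis unfolding computable_def by blast
qed

section \<open>The reduction\<close>

context
 fixes a :: nat and p :: "nat poly" and D :: nat and TE :: "(bool list option \<times> node \<times> node) list"
begin

text \<open>Variable 0 is the clock and variable 1 is \<open>m = length w + 1\<close>. The factor
  \<open>a * u + 1\<close> bounds \<open>f k\<close>, and the number of binary digits of
  \<open>m\<close> bounds the logarithm of the input size; the summand 1 also ensures that
  \<open>V\<close> bits suffice for an input position. In \<open>eR\<close>,
  \<open>a * u * poly p m\<close> bounds the running time.\<close>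

definition eV where "eV = aMul (Add (aMul (Con a) (Var 0)) (Con 1)) (aLen (Var 1))"
definition eR where "eR = Add (aMul (Add (aMul (aMul (Con a) (Var 0)) (aPoly p (Var 1))) (Con 1)) (Add (Var 1) (Con 1))) (Con 1)"
definition tV where "tV u m = (a * u + 1) * length (binary m)"
definition tR where "tR u m = Suc (a * u * poly p m) * (m + 1) + 1"

lemma ev_eVR [simp]: "ev w b c eV E = tV (E 0) (E 1)" "ev w b c eR E = tR (E 0) (E 1)"
 by (simp_all add: eV_def tV_def eR_def tR_def)

definition
 "flag_exps = (let m = Var 1; r = aDiv (Var 2) eV; c = aMod (Var 2) eV; q = aMod r (Add m (Con 1)); q' = Add q (Con 1)
   in [aEq r (Con 0), aEq (Add r (Con 1)) eR, aEq c (Con 0), aEq (Add c (Con 1)) eV,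
   aBit q c, aBit (aIf (aLe q' m) q' m) c, aBit (Sub q (Con 1)) c, aAnd (aLt (Con 0) q) (aLt q m),
   aOr (aEq q m) (aAnd (aAnd (aLt (Con 0) q) (aLt q m)) (In q))])"

lemma ev_flag_exps:
 assumes "E 1 = length w + 1"
 shows "map (\<lambda>e. ev w b c e E \<noteq> 0) flag_exps = flags w (tV (E 0) (E 1)) (tR (E 0) (E 1)) (E 2)"
 using assms by (auto simp: flag_exps_def Let_def flags_def nbit_def scan_input_def min_def)

definition
 "guard_exp g = (case g of None \<Rightarrow> Con 1 | Some \<phi> \<Rightarrow>
   foldr aAnd (map (\<lambda>(e, v). if v then e else aNot e) (zip flag_exps \<phi>)) (Con (of_bool (length \<phi> = 9))))"

lemma ev_guard_exp:
 assumes "E 1 = length w + 1"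
 shows "ev w b c (guard_exp g) E \<noteq> 0 \<longleftrightarrow> active (flags w (tV (E 0) (E 1)) (tR (E 0) (E 1)) (E 2)) g"
proof (cases g)
 case (Some \<phi>)
 have *: "ev w b c (foldr aAnd (map (\<lambda>(e, v). if v then e else aNot e) (zip es \<phi>)) (Con (of_bool q))) E \<noteq> 0 \<longleftrightarrow>
   q \<and> map (\<lambda>e. ev w b c e E \<noteq> 0) es = \<phi>" if "q \<Longrightarrow> length \<phi> = length es" for es q
  using that
 proof (induction es arbitrary: \<phi>)
  case (Cons e es)
  then show ?case by (cases \<phi>; cases q) auto
 qed auto
 have l: "length flag_exps = 9" by (simp add: flag_exps_def Let_def)
 have lf: "length (flags w (tV (E 0) (E 1)) (tR (E 0) (E 1)) (E 2)) = 9"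
  unfolding ev_flag_exps[where E = E, OF assms, symmetric, of b c] by (simp add: l)
 have "ev w b c (guard_exp g) E \<noteq> 0 \<longleftrightarrow> length \<phi> = 9 \<and> map (\<lambda>e. ev w b c e E \<noteq> 0) flag_exps = \<phi>"
  unfolding guard_exp_def Some option.case by (rule *) (simp add: l)
 then show ?thesis unfolding ev_flag_exps[where E = E, OF assms] Some active_def using lf by auto
qed (simp add: guard_exp_def active_def)

primrec node_exp :: "node \<Rightarrow> aexp" where
 "node_exp (Pal i) = Con i"
| "node_exp (Nd k j) = Add (Add (Con 3) (aMul (Add (Var 2) (if k = 2 then eV else Con k)) (Con D))) (Con j)"

lemma ev_node_exp [simp]: "ev w b c (node_exp x) E = vtx (tV (E 0) (E 1)) D (E 2) x"
 by (cases x) (simp_all add: offs_def)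

definition
 "edge_stm d e = Emit [True] ; emit_nat d ; emit_nat e"

lemma prints_edge: "prints w c (edge_stm d e) E b (True # enc_edge (ev w b c d E, ev w b c e E))"
proof -
 have "prints w c (edge_stm d e) E b ([True] @ enc_nat (ev w b c d E) @ enc_nat (ev w b c e E))"
  unfolding edge_stm_def by (intro prints_seq prints_Emit prints_emit_nat)
 then show ?thesis by (simp add: enc_edge_def)
qed

definition
 "edges_stm = pseq (map (\<lambda>(i, j). edge_stm (Con i) (Con j)) [(0, 1), (0, 2), (1, 2)]) ;
   For 2 (aMul eV eR) (pseq (map (\<lambda>(g, x, y). doif 3 (guard_exp g) (edge_stm (node_exp x) (node_exp y))) TE)) ;
   Emit [False]"

lemma prints_edges:
 assumes "E 1 = length w + 1"
 defines "V \<equiv> tV (E 0) (E 1)" and "R \<equiv> tR (E 0) (E 1)"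
 shows "prints w c edges_stm E b (enc_list enc_edge (csp_edges V D TE (flags w V R) (V * R)))"
proof -
 let ?e = "\<lambda>xs. concat (map (\<lambda>x. True # enc_edge x) xs)"
 let ?bl = "\<lambda>i. block_edges V D TE (flags w V R i) i"
 have 1: "prints w c (pseq (map (\<lambda>(i, j). edge_stm (Con i) (Con j)) [(0, 1), (0, 2), (1, 2)])) E b (?e [(0, 1), (0, 2), (1, 2)])"
 proof (rule prints_pseq)
  show "prints w c (case x of (i, j) \<Rightarrow> edge_stm (Con i) (Con j)) E b (True # enc_edge x)" for x
   using prints_edge[of w c "Con (fst x)" "Con (snd x)" E b] by (simp add: case_prod_unfold)
 qed
 have 2: "prints w c (pseq (map (\<lambda>(g, x, y). doif 3 (guard_exp g) (edge_stm (node_exp x) (node_exp y))) TE)) (E(2 := i)) b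
   (concat (map (\<lambda>(g, x, y). if active (flags w V R i) g then ?e [(vtx V D i x, vtx V D i y)] else []) TE))" for i
 proof (rule prints_pseq)
  fix t assume "t \<in> set TE"
  obtain g x y where t: "t = (g, x, y)" by (cases t)
  have "ev w b c (guard_exp g) (E(2 := i)) \<noteq> 0 \<longleftrightarrow> active (flags w V R i) g"
   using ev_guard_exp[of "E(2 := i)" w b c g] assms(1) by (simp add: V_def R_def)
  moreover have "prints w c (edge_stm (node_exp x) (node_exp y)) (E(2 := i, 3 := 0)) b (?e [(vtx V D i x, vtx V D i y)])"
   using prints_edge[of w c "node_exp x" "node_exp y" "E(2 := i, 3 := 0)" b] by (simp add: V_def)
  ultimately show "prints w c (case t of (g, x, y) \<Rightarrow> doif 3 (guard_exp g) (edge_stm (node_exp x) (node_exp y))) (E(2 := i)) b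
   (case t of (g, x, y) \<Rightarrow> if active (flags w V R i) g then ?e [(vtx V D i x, vtx V D i y)] else [])"
   using prints_doif[of w b c "guard_exp g" "E(2 := i)" "edge_stm (node_exp x) (node_exp y)" 3 "?e [(vtx V D i x, vtx V D i y)]"]
   unfolding t prod.case by simp
 qed
 have 3: "concat (map (\<lambda>(g, x, y). if active (flags w V R i) g then ?e [(vtx V D i x, vtx V D i y)] else []) TE) = ?e (?bl i)" for i
  unfolding block_edges_def by (induction TE) auto
 have "prints w c edges_stm E b (?e [(0, 1), (0, 2), (1, 2)] @ concat (map (\<lambda>i. ?e (?bl i)) [0..<V * R]) @ [False])"
  unfolding edges_stm_def by (intro prints_seq prints_Emit 1 prints_For 2[unfolded 3]) (simp add: V_def R_def)
 moreover have "concat (map (\<lambda>i. ?e (?bl i)) xs) = ?e (concat (map ?bl xs))" for xs by (induction xs) simp_all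
 ultimately show ?thesis unfolding csp_edges_def enc_list_conv by simp
qed

definition
 "bags_stm = For 2 (Sub (aMul eV eR) eV) (Emit [True] ; pseq (map (\<lambda>i. Emit [True] ; emit_nat (Con i)) [0, 1, 2]) ;
   For 3 (aMul (Add eV (Con 1)) (Con D)) (Emit [True] ; emit_nat (Add (Add (Con 3) (aMul (Var 2) (Con D))) (Var 3))) ;
   Emit [False]) ; Emit [False]"

lemma prints_bags:
 fixes E :: "nat \<Rightarrow> nat"
 defines "V \<equiv> tV (E 0) (E 1)" and "R \<equiv> tR (E 0) (E 1)"
 shows "prints w c bags_stm E b (enc_list (enc_list enc_nat) (csp_bags V D (V * R)))"
proof -
 let ?e = "\<lambda>xs. concat (map (\<lambda>x. [True] @ enc_nat x) xs)"
 have 1: "prints w c (pseq (map (\<lambda>i. Emit [True] ; emit_nat (Con i)) xs)) E' b (?e xs)" for xs E'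
  by (intro prints_pseq prints_seq prints_Emit) (use prints_emit_nat[of w c "Con _" E' b] in simp)
 have 2: "prints w c (emit_nat (Add (Add (Con 3) (aMul (Var 2) (Con D))) (Var 3))) (E(2 := i, 3 := j)) b (enc_nat (3 + i * D + j))" for i j
  using prints_emit_nat[of w c "Add (Add (Con 3) (aMul (Var 2) (Con D))) (Var 3)" "E(2 := i, 3 := j)" b] by simp
 have "prints w c bags_stm E b (concat (map (\<lambda>i. [True] @ ?e [0, 1, 2] @
   concat (map (\<lambda>j. [True] @ enc_nat (3 + i * D + j)) [0..<(V + 1) * D]) @ [False]) [0..<V * R - V]) @ [False])"
  unfolding bags_stm_def by (intro prints_seq prints_Emit prints_For 1 2) (simp_all add: V_def R_def)
 moreover have "concat (map (\<lambda>j. [True] @ enc_nat (3 + i * D + j)) [0..<(V + 1) * D]) = ?e [3 + i * D..<3 + (i + V + 1) * D]" for i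
 proof -
  have "[3 + i * D..<3 + (i + V + 1) * D] = map (\<lambda>j. j + (3 + i * D)) [0..<(V + 1) * D]"
   using map_add_upt[of "3 + i * D" "(V + 1) * D"] by (simp add: algebra_simps)
  then show ?thesis by (simp add: o_def add.commute)
 qed
 ultimately show ?thesis unfolding csp_bags_def enc_list_conv by (simp add: o_def)
qed

text \<open>The width is \<open>2 + (V + 1) * D\<close> with \<open>V = (a * u + 1) * L\<close>. For
  instance size \<open>s\<close> there are the estimates \<open>L \<le> 2 * log 2 s\<close> and
  \<open>1 \<le> log 2 s\<close>, which make the width at most this number times
  \<open>log 2 s\<close>.\<close>

definition param_exp where
 "param_exp = Add (aMul (Add (aMul (Con (2 * a)) (Var 0)) (Con 3)) (Con D)) (Con 2)"

definition
 "reduction_stm = For 2 param_exp (Emit [True]) ; Emit [False] ;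
   emit_nat (Add (Con 3) (aMul (Con D) (aMul eV eR))) ; edges_stm ; bags_stm"

lemma guessless_reduction: "guessless reduction_stm"
 by (auto simp: reduction_stm_def edges_stm_def bags_stm_def edge_stm_def)

lemma prints_reduction:
 assumes "E 1 = length w + 1"
 defines "V \<equiv> tV (E 0) (E 1)" and "R \<equiv> tR (E 0) (E 1)"
 shows "prints w c reduction_stm E b (tape_word (enc_graph_pd (3 + D * (V * R))
  (csp_edges V D TE (flags w V R) (V * R)) (csp_bags V D (V * R)), (2 * a * E 0 + 3) * D + 2))"
proof -
 let ?k = "(2 * a * E 0 + 3) * D + 2"
 have "prints w c (For 2 param_exp (Emit [True])) E b (concat (map (\<lambda>_. [True]) [0..<?k]))"
  by (rule prints_For) (simp_all add: prints_Emit param_exp_def)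
 moreover have "concat (map (\<lambda>_. [True]) [0..<?k]) = replicate ?k True"
  by (simp only: concat_map_singleton map_replicate_const) simp
 moreover have "prints w c (emit_nat (Add (Con 3) (aMul (Con D) (aMul eV eR)))) E b (enc_nat (3 + D * (V * R)))"
  using prints_emit_nat[of w c "Add (Con 3) (aMul (Con D) (aMul eV eR))" E b] by (simp add: V_def R_def)
 ultimately have "prints w c reduction_stm E b (replicate ?k True @ [False] @ enc_nat (3 + D * (V * R)) @
   enc_list enc_edge (csp_edges V D TE (flags w V R) (V * R)) @ enc_list (enc_list enc_nat) (csp_bags V D (V * R)))"
  unfolding reduction_stm_def V_def R_def
  by (intro prints_seq prints_Emit prints_edges prints_bags) (use assms(1) in simp_all)
 then show ?thesis by (simp add: enc_graph_pd_def)
qed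

end

section \<open>Size estimates and correctness of the reduction\<close>

lemma length_enc_list_ge: "length xs \<le> length (enc_list e xs)"
 by (induction xs) simp_all

lemma length_binary_le_log:
 assumes "1 \<le> n"
 shows "real (length (binary n)) \<le> 1 + log 2 (real n)"
proof -
 have "0 < length (binary n)" using assms by (simp add: less_length_binary)
 then have "2 ^ (length (binary n) - 1) \<le> n" by (simp add: less_length_binary[symmetric])
 then have "2 ^ (length (binary n) - 1) \<le> real n" by (metis of_nat_le_iff of_nat_numeral of_nat_power)
 then have "real (length (binary n) - 1) \<le> log 2 (real n)" using assms by (simp add: le_log_iff powr_realpow)
 then show ?thesis by simp
qed

text \<open>Separates the parameter from the input size: by
  \<open>s + n \<le> 2 ^ (s + 1) * n\<close> the logarithm of a sum becomes an additive term in
  \<open>s\<close> plus \<open>log 2 n\<close>, as the space bound of a pl-reduction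
  requires.\<close>

lemma length_binary_add:
 assumes "1 \<le> n"
 shows "real (length (binary (s + n))) \<le> real s + 2 + log 2 (real n)"
proof -
 have "s + n \<le> (s + 1) * n" using assms by simp
 moreover have "s + 1 < 2 ^ (s + 1)" by (rule less_exp)
 then have "(s + 1) * n \<le> 2 ^ (s + 1) * n" by (intro mult_le_mono1) simp
 ultimately have "s + n \<le> 2 ^ (s + 1) * n" by (rule le_trans)
 then have "real (s + n) \<le> real (2 ^ (s + 1) * n)" by (simp only: of_nat_le_iff)
 then have "real (s + n) \<le> 2 ^ (s + 1) * real n" by simp
 then have "log 2 (real (s + n)) \<le> log 2 (2 ^ (s + 1) * real n)" using assms by simp
 also have "\<dots> = real (s + 1) + log 2 (real n)" using assms by (simp add: log_mult)
 finally show ?thesis using length_binary_le_log[of "s + n"] assms by simp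
qed

lemma poly_nat_mono: "m \<le> n \<Longrightarrow> poly (p :: nat poly) m \<le> poly p n"
 by (induction p) (auto intro: add_mono mult_mono)

lemma lg_size_pos: "1 \<le> lg_size x"
 unfolding lg_size_def by (subst le_log_iff) auto

text \<open>Every output is the code of a graph with a valid decomposition of permitted width. Since
  encodings are unambiguous, membership of the output is therefore equivalent to 3-colorability, and
  so to acceptance.\<close>

theorem pl_reduces_pw_3Coloring_log:
 assumes "Q \<in> paraNTiSp_fpoly_flog"
 shows "pl_reduces Q pw_3Coloring_log"
proof -
 from assms obtain M f p where M: "well_formed M" "computable f"
  and acc: "\<And>x k. (x, k) \<in> Q \<longleftrightarrow> accepts M (tape_word (x, k))"
  and time: "\<And>x k. runs_in_time M (tape_word (x, k)) (real (f k * poly p (length x)))"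
  and space: "\<And>x k. runs_in_space M (tape_word (x, k)) (real (f k) * lg_size x)"
  unfolding paraNTiSp_fpoly_flog_def by blast
 from state_bound_exists[OF M(1)] obtain A where A: "state_bound M A" by blast
 from clock_exists[OF M(2)] obtain F A' t a where cl: "clock F A' t" and ft: "\<And>k. f k \<le> a * t k" by blast
 obtain zs where zs: "set zs = cells (complete A M) A" using finite_list[OF finite_cells[OF well_formed_complete[OF M(1)]]] by blast
 define CL where "CL = tclauses (complete A M) A zs"
 define D where "D = length zs + 3 * (length zs + 2) * length CL"
 define TE where "TE = template (length zs) (length zs + 2) CL"
 define st where "st = reduction_stm a p D TE"
 define V where "V k x = tV a (t k) (length (tape_word (x, k)) + 1)" for k x
 define R where "R k x = tR a p (t k) (length (tape_word (x, k)) + 1)" for k x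
 define N where "N k x = 3 + D * (V k x * R k x)" for k x
 define es where "es k x = csp_edges (V k x) D TE (flags (tape_word (x, k)) (V k x) (R k x)) (V k x * R k x)" for k x
 define bs where "bs k x = csp_bags (V k x) D (V k x * R k x)" for k x
 define k' where "k' k = (2 * a * t k + 3) * D + 2" for k
 define g where "g = (\<lambda>(x, k). (enc_graph_pd (N k x) (es k x) (bs k x), k' k))"
 define dd where "dd = dg (Con 0) * sd st"
 \<comment> \<open>\<open>3 * dd + 5\<close> accounts for the parameter part of the space, and
   \<open>(2 * a + 3) * D + 2\<close> for the new parameter; both are multiplied by
   \<open>t k + (k + 1)\<close>, so a single computable function bounds both.\<close>
 define C where "C = 3 * dd + 5 + (2 * a + 3) * D + 2"
 have comp: "computable (\<lambda>k. C * (t k + (k + 1)))"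
  using computable_ev[OF cl, of "aMul (Con C) (Add (Var 0) (Var 1))"] by (simp add: boot_env_def)
 have "outputs (boot_tm F A' (Con 0) st) (tape_word (x, k)) (tape_word (g (x, k)))"
  "runs_in_space (boot_tm F A' (Con 0) st) (tape_word (x, k)) (real (C * (t k + (k + 1))) + real dd * lg_size x)" for x k
 proof -
  let ?w = "tape_word (x, k)"
  from cl obtain cf where F: "well_formed F" "deterministic F" "sym_bound F A'"
   "(step F (replicate k True) ^^ t k) (init F) cf" "halted F (replicate k True) cf" unfolding clock_def by blast
  have w: "?w = replicate k True @ (False # x)" "False # x = [] \<or> (\<exists>y. False # x = False # y)" by simp_all
  let ?X = "t k + length ?w + 2" and ?E = "boot_env (t k) (length ?w + 1)"
  have "?X ^ dd < 2 ^ (dd * length (binary ?X))" if "0 < dd"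
   using power_strict_mono[OF less_power_length_binary[of ?X], of dd] that by (simp add: power_mult[symmetric] mult.commute)
  moreover have "0 < dd" by (simp add: dd_def sd_pos)
  ultimately have h: "?X ^ dd < 2 ^ (dd * length (binary ?X))" by blast
  have cap: "0 = ev ?w (\<lambda>_. False) 0 (Con 0) ?E" by simp
  note B = F(1-3) w F(4,5) refl h[unfolded dd_def] cap
  have "prints ?w 0 st ?E (\<lambda>_. False) (tape_word (g (x, k)))"
   using prints_reduction[where E = ?E and w = ?w and a = a and p = p and D = D and TE = TE and c = 0 and b = "\<lambda>_. False"]
   by (simp only: st_def g_def prod.case N_def es_def bs_def V_def R_def k'_def) (simp add: boot_env_def)
  then have "sem ?w 0 st ?E ((\<lambda>_. False), [], ch, True) = ((\<lambda>_. False), tape_word (g (x, k)), ch, True)" for ch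
   unfolding prints_def by simp
  with outputs_boot_tm[OF B, of "\<lambda>_. False"]
  show "outputs (boot_tm F A' (Con 0) st) ?w (tape_word (g (x, k)))" by simp
  have X: "?X = t k + k + 1 + (length x + 2)" by simp
  have "real (dd * length (binary ?X)) \<le> dd * (real (t k + k + 1) + 2 + lg_size x)"
   unfolding X of_nat_mult lg_size_def by (intro mult_left_mono length_binary_add[of "length x + 2"]) auto
  moreover have "dd * (t k + k + 3) + t k + 5 \<le> (3 * dd + 5) * (t k + (k + 1))" by (simp add: algebra_simps)
  then have "dd * (t k + k + 3) + t k + 5 \<le> C * (t k + (k + 1))"
   unfolding C_def by (elim order_trans) (intro mult_le_mono1, simp)
  then have "real (dd * (t k + k + 3) + t k + 5) \<le> real (C * (t k + (k + 1)))" by (simp only: of_nat_le_iff)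
  ultimately have "real (dd * length (binary ?X) + 0 + t k + 5) \<le> real (C * (t k + (k + 1))) + real dd * lg_size x"
   by (simp add: algebra_simps)
  with runs_in_space_boot_tm[OF B]
  show "runs_in_space (boot_tm F A' (Con 0) st) ?w (real (C * (t k + (k + 1))) + real dd * lg_size x)"
   unfolding runs_in_space_def dd_def by (fastforce simp del: of_nat_add of_nat_mult)
 qed
 note red = this
 have eqv: "(x, k) \<in> Q \<longleftrightarrow> g (x, k) \<in> pw_3Coloring_log" for x k
 proof -
  let ?w = "tape_word (x, k)" and ?L = "length (binary (length (tape_word (x, k)) + 1))"
  define T where "T = a * t k * poly p (length ?w + 1)"
  have m2: "length x + 2 \<le> length ?w + 1" by simp
  have "real (f k * poly p (length x)) \<le> real T"
   unfolding T_def of_nat_le_iff by (intro mult_mono ft poly_nat_mono) auto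
  with time[of x k] have T: "runs_in_time M ?w (real T)" unfolding runs_in_time_def by (meson order_trans)
  have L: "length ?w + 1 < 2 ^ ?L" by (rule less_power_length_binary)
  have "real (length x + 2) \<le> real (2 ^ ?L)" using m2 L by (simp only: of_nat_le_iff)
  then have "real (length x + 2) \<le> 2 ^ ?L" by (simp only: of_nat_power of_nat_numeral)
  then have "lg_size x \<le> ?L" unfolding lg_size_def by (subst log_le_iff) (auto simp: powr_realpow)
  moreover have "real (f k) \<le> real (a * t k + 1)" using ft[of k] by (simp only: of_nat_le_iff)
  ultimately have "real (f k) * lg_size x \<le> real (V k x)"
   unfolding V_def tV_def of_nat_mult using lg_size_pos[of x] by (intro mult_mono) auto
  with space[of x k] have S: "runs_in_space M ?w (real (V k x))" unfolding runs_in_space_def by fastforce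
  have L0: "1 \<le> ?L" by (simp add: Suc_le_eq less_length_binary del: length_greater_0_conv)
  have LV: "?L \<le> V k x" unfolding V_def tV_def by simp
  then have V1: "1 \<le> V k x" using L0 by simp
  have V2: "length ?w + 1 < 2 ^ V k x"
   using L LV by (meson less_le_trans one_le_numeral power_increasing)
  have R: "R k x = Suc T * (length ?w + 2) + 1" by (simp add: R_def tR_def T_def)
  note cc = computation_csp[OF M(1) A zs T S V1 V2 R, folded CL_def]
  interpret c: csp "length zs" "length zs + 2" CL "V k x" "V k x * R k x" "flags ?w (V k x) (R k x)" by (rule cc(1))
  have cD: "c.D = D" unfolding c.D_def D_def ..
  note th = c.pair_graph_csp c.path_decomposition_csp c.pd_width_csp c.colorable_iff_satisfied
  have th': "pair_graph (graph_of (N k x) (es k x))" "path_decomposition (graph_of (N k x) (es k x)) (map set (bs k x))"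
   "pd_width (map set (bs k x)) = int (2 + (V k x + 1) * D)"
   "three_colorable (graph_of (N k x) (es k x)) \<longleftrightarrow> accepts M ?w"
   using th cc(2) unfolding cD N_def es_def bs_def TE_def by simp_all
  let ?e = "enc_graph_pd (N k x) (es k x) (bs k x)"
  \<comment> \<open>The output is at least as long as the input word, since it has
    \<open>V * (R - 1)\<close> bags and each of them takes at least one bit. Thus the logarithm of
    the input length may be replaced by that of the output length.\<close>
  have "length ?w + 1 \<le> R k x - 1" unfolding R by simp
  also have "\<dots> \<le> V k x * (R k x - 1)" using V1 by simp
  also have "\<dots> = length (bs k x)" by (simp add: bs_def csp_bags_def diff_mult_distrib2)
  also have "\<dots> \<le> length ?e"
   using length_enc_list_ge[of "bs k x" "enc_list enc_nat"] by (simp add: enc_graph_pd_def)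
  finally have le: "length ?w + 1 \<le> length ?e" .
  have l1: "1 \<le> log 2 (real (length ?e))" using le by (subst le_log_iff) auto
  have "log 2 (real i) \<le> log 2 (real j)" if "1 \<le> i" "i \<le> j" for i j :: nat using that by simp
  from this[OF _ le] have "log 2 (real (length ?w + 1)) \<le> log 2 (real (length ?e))" by simp
  \<comment> \<open>The factor 2 pays for the summand 1 in
    \<open>length_binary_le_log\<close>.\<close>
  then have Lle: "real ?L \<le> 2 * log 2 (real (length ?e))" using length_binary_le_log[of "length ?w + 1"] l1 by simp
  have "real_of_int (pd_width (map set (bs k x))) = 2 + ((a * t k + 1) * real ?L + 1) * real D"
   unfolding th'(3) by (simp add: V_def tV_def algebra_simps)
  also have "\<dots> \<le> 2 * log 2 (real (length ?e)) + ((a * t k + 1) * (2 * log 2 (real (length ?e))) + log 2 (real (length ?e))) * real D"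
   using l1 by (intro add_mono mult_right_mono mult_left_mono Lle) auto
  also have "\<dots> = real (k' k) * log 2 (real (length ?e))" by (simp add: k'_def algebra_simps)
  finally have wd: "real_of_int (pd_width (map set (bs k x))) \<le> real (k' k) * log 2 (real (length ?e))" .
  have "g (x, k) \<in> pw_3Coloring_log \<longleftrightarrow> three_colorable (graph_of (N k x) (es k x))"
  proof
   assume "g (x, k) \<in> pw_3Coloring_log"
   then obtain N' es' bs' where e: "?e = enc_graph_pd N' es' bs'" and tc: "three_colorable (graph_of N' es')"
    unfolding g_def pw_3Coloring_log_def by auto
   from enc_graph_pd_inject[OF e] tc show "three_colorable (graph_of (N k x) (es k x))" by simp
  next
   assume "three_colorable (graph_of (N k x) (es k x))"
   with th'(1,2) wd show "g (x, k) \<in> pw_3Coloring_log"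
    unfolding g_def pw_3Coloring_log_def prod.case mem_Collect_eq by blast
  qed
  then show ?thesis using th'(4) acc by simp
 qed
 have "snd (g (x, k)) \<le> C * (t k + (k + 1))" for x k
  by (simp add: g_def k'_def C_def algebra_simps)
 moreover have "well_formed (boot_tm F A' (Con 0) st)" "deterministic (boot_tm F A' (Con 0) st)"
  by (simp_all add: well_formed_boot_tm deterministic_boot_tm st_def guessless_reduction)
 ultimately show ?thesis unfolding pl_reduces_def using red eqv comp by blast
qed

section \<open>Parsing instances with a finite automaton\<close>

text \<open>
 The codes of the number of vertices, of the two ends of an edge, and of the elements of bags are
 read in the states \<open>3 t\<close> (flag), \<open>3 t + 1\<close> (digit) and \<open>3 t + 2\<close> (flag after the digit 0, which
 must not be the last one) for \<open>t = 0, 1, 2, 3\<close>. The states 12, 13, 14 expect the next flag of the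
 list of edges, of the list of bags, and of the current bag; 15 is final.
\<close>

definition delta :: "nat \<Rightarrow> bool \<Rightarrow> nat" where
 "delta q b = (if q < 12 then
   (if q mod 3 = 0 then (if b then q + 1 else [12, 6, 12, 14] ! (q div 3))
    else if q mod 3 = 1 then (if b then q - 1 else q + 1)
    else (if b then q - 1 else 16))
   else if q = 12 then (if b then 3 else 13)
   else if q = 13 then (if b then 14 else 15)
   else if q = 14 then (if b then 9 else 13) else 16)"

definition run :: "nat \<Rightarrow> bool list \<Rightarrow> bool" where "run q y \<longleftrightarrow> foldl delta q y = 15"

lemma run_simps: "run q [] \<longleftrightarrow> q = 15" "run q (b # y) \<longleftrightarrow> run (delta q b) y"
 by (simp_all add: run_def)

lemma run_dead: "\<not> run 16 y"
 by (induction y) (simp_all add: run_simps delta_def)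

lemma run_15: "run 15 y \<longleftrightarrow> y = []"
 by (cases y) (simp_all add: run_simps delta_def run_dead)

abbreviation "enc_bits \<equiv> enc_list (\<lambda>b :: bool. [b])"

text \<open>Together with \<open>last_binary\<close>: the lists of digits that occur are exactly
  those whose most significant digit is not 0, a condition that one extra state of the automaton can
  check.\<close>

lemma binary_surj:
 assumes "ds = [] \<or> last ds"
 shows "\<exists>v. binary v = ds"
 using assms
proof (induction ds)
 case Nil
 show ?case by (rule exI[of _ 0]) (simp add: binary.simps)
next
 case (Cons b ds)
 then obtain v where v: "binary v = ds" by (auto split: if_splits)
 have "v \<noteq> 0 \<or> b" using Cons.prems v by (cases "v = 0") (auto simp: binary.simps split: if_splits)
 then have "binary (of_bool b + 2 * v) = b # ds" using v by (cases b) (simp_all add: binary.simps[of "Suc (2 * v)"] binary.simps[of "2 * v"])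
 then show ?case ..
qed

lemma last_binary: "binary v \<noteq> [] \<Longrightarrow> last (binary v)"
proof (induction v rule: less_induct)
 case (less v)
 have v: "v \<noteq> 0"
 proof
  assume "v = 0"
  with less.prems show False by (simp add: binary.simps)
 qed
 show ?case
 proof (cases "v div 2 = 0")
  case True
  then have "v = 1" using v by linarith
  then show ?thesis by (simp add: binary.simps)
 next
  case False
  then have "binary (v div 2) \<noteq> []" by (simp add: binary.simps)
  with less.IH[of "v div 2"] v show ?thesis by (simp add: binary.simps[of v])
 qed
qed

text \<open>Where parsing continues after a number: with the list of edges after \<open>N\<close>
  and after the second end of an edge, with the second end (state 6) after the first, and with the
  current bag after an element.\<close>

definition "exit_state t = [12, 6, 12, 14] ! t"

lemma delta_nat:
 assumes "t < 4"
 shows "delta (3 * t) True = 3 * t + 1" "delta (3 * t) False = exit_state t"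
  "delta (3 * t + 1) True = 3 * t" "delta (3 * t + 1) False = 3 * t + 2"
  "delta (3 * t + 2) True = 3 * t + 1" "delta (3 * t + 2) False = 16"
proof -
 from assms have "t = 0 \<or> t = 1 \<or> t = 2 \<or> t = 3" by linarith
 then show "delta (3 * t) True = 3 * t + 1" "delta (3 * t) False = exit_state t"
  "delta (3 * t + 1) True = 3 * t" "delta (3 * t + 1) False = 3 * t + 2"
  "delta (3 * t + 2) True = 3 * t + 1" "delta (3 * t + 2) False = 16"
  by (elim disjE; simp add: delta_def exit_state_def)+
qed

text \<open>Both states are treated in one induction, since state \<open>3 * t + 2\<close>, which
  remembers that the last digit was 0, and state \<open>3 * t\<close> lead to each other.\<close>

lemma run_bits:
 assumes "t < 4"
 shows "(run (3 * t) y \<longrightarrow> (\<exists>ds r. y = enc_bits ds @ r \<and> (ds = [] \<or> last ds) \<and> run (exit_state t) r)) \<and>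
  (run (3 * t + 2) y \<longrightarrow> (\<exists>ds r. y = enc_bits ds @ r \<and> ds \<noteq> [] \<and> last ds \<and> run (exit_state t) r))"
proof (induction y rule: length_induct)
 case (1 y)
 note d = delta_nat[OF assms]
 have two: "\<exists>ds r. y = enc_bits ds @ r \<and> ds \<noteq> [] \<and> last ds \<and> run (exit_state t) r"
  if y: "y = True # z" and z: "run (3 * t + 1) z" for z
 proof (cases z)
  case Nil
  with z show ?thesis using assms by (simp add: run_simps)
 next
  case (Cons b z')
  have l: "length z' < length y" by (simp add: y Cons)
  show ?thesis
  proof (cases b)
   case True
   with z have "run (3 * t) z'" using d(3) by (simp add: Cons run_simps)
   with 1 l obtain ds r where "z' = enc_bits ds @ r" "ds = [] \<or> last ds" "run (exit_state t) r" by blast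
   then show ?thesis by (intro exI[of _ "True # ds"] exI[of _ r]) (auto simp: y Cons True)
  next
   case False
   with z have "run (3 * t + 2) z'" using d(4) by (simp add: Cons run_simps)
   with 1 l obtain ds r where "z' = enc_bits ds @ r" "ds \<noteq> []" "last ds" "run (exit_state t) r" by blast
   then show ?thesis by (intro exI[of _ "False # ds"] exI[of _ r]) (auto simp: y Cons False)
  qed
 qed
 show ?case
 proof (intro conjI impI)
  assume r: "run (3 * t) y"
  show "\<exists>ds r. y = enc_bits ds @ r \<and> (ds = [] \<or> last ds) \<and> run (exit_state t) r"
  proof (cases y)
   case Nil
   with r show ?thesis using assms by (simp add: run_simps)
  next
   case (Cons b z)
   show ?thesis
   proof (cases b)
    case True
    with r Cons have "run (3 * t + 1) z" using d(1) by (simp add: run_simps)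
    from two[OF _ this] Cons True show ?thesis by blast
   next
    case False
    with r Cons have "run (exit_state t) z" using d(2) by (simp add: run_simps)
    then show ?thesis using Cons False by (intro exI[of _ "[]"] exI[of _ z]) simp
   qed
  qed
 next
  assume r: "run (3 * t + 2) y"
  show "\<exists>ds r. y = enc_bits ds @ r \<and> ds \<noteq> [] \<and> last ds \<and> run (exit_state t) r"
  proof (cases y)
   case Nil
   with r show ?thesis using assms by (simp add: run_simps)
  next
   case (Cons b z)
   show ?thesis
   proof (cases b)
    case True
    with r Cons have "run (3 * t + 1) z" using d(5) by (simp add: run_simps)
    from two[OF _ this] Cons True show ?thesis by blast
   next
    case False
    with r Cons have "run 16 z" using d(6) by (simp add: run_simps)
    with run_dead show ?thesis by blast
   qed
  qed
 qed
qed

lemma foldl_delta_bits: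
 assumes "t < 4"
 shows "(ds = [] \<or> last ds \<longrightarrow> foldl delta (3 * t) (enc_bits ds) = exit_state t) \<and>
  (ds \<noteq> [] \<and> last ds \<longrightarrow> foldl delta (3 * t + 2) (enc_bits ds) = exit_state t)"
proof (induction ds)
 case (Cons b ds)
 note d = delta_nat[OF assms]
 have s: "foldl delta (3 * t + 1) (b # enc_bits ds) = exit_state t" if "last (b # ds)"
 proof (cases b)
  case True
  with Cons.IH that show ?thesis using d(3) by (cases "ds = []") simp_all
 next
  case False
  with that have "ds \<noteq> []" "last ds" by (auto split: if_splits)
  with Cons.IH show ?thesis using d(4) False by simp
 qed
 then show ?case using d(1,5) by simp
qed (use delta_nat[OF assms] in simp_all)

lemma run_nat:
 assumes "t < 4"
 shows "run (3 * t) y \<longleftrightarrow> (\<exists>v r. y = enc_nat v @ r \<and> run (exit_state t) r)"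
proof
 assume "run (3 * t) y"
 with run_bits[OF assms, of y] obtain ds r where 1: "y = enc_bits ds @ r" "ds = [] \<or> last ds" "run (exit_state t) r" by blast
 from binary_surj[OF 1(2)] obtain v where "binary v = ds" by blast
 with 1 have "y = enc_nat v @ r \<and> run (exit_state t) r" by (simp add: enc_nat_def)
 then show "\<exists>v r. y = enc_nat v @ r \<and> run (exit_state t) r" by blast
next
 assume "\<exists>v r. y = enc_nat v @ r \<and> run (exit_state t) r"
 then obtain v r where y: "y = enc_nat v @ r" "run (exit_state t) r" by blast
 have "foldl delta (3 * t) (enc_nat v) = exit_state t"
  unfolding enc_nat_def using foldl_delta_bits[OF assms] last_binary by blast
 then show "run (3 * t) y" using y by (simp add: run_def)
qed

text \<open>If flag 1 leads to a part of the automaton that reads one element and returns to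
  \<open>q\<close>, then \<open>q\<close> reads a whole list. The hypothesis
  \<open>q \<noteq> 15\<close> excludes acceptance of the empty rest.\<close>

lemma run_list:
 assumes "\<And>y. run (delta q True) y \<longleftrightarrow> (\<exists>a r. y = e a @ r \<and> run q r)" and "q \<noteq> 15"
 shows "run q y \<longleftrightarrow> (\<exists>as r. y = enc_list e as @ r \<and> run (delta q False) r)"
proof
 show "run q y \<Longrightarrow> \<exists>as r. y = enc_list e as @ r \<and> run (delta q False) r"
 proof (induction y rule: length_induct)
  case (1 y)
  then obtain b z where y: "y = b # z" "run (delta q b) z" using assms(2) by (cases y) (auto simp: run_simps)
  show ?case
  proof (cases b)
   case True
   with y(2) have "run (delta q True) z" by simp
   then obtain a r where z: "z = e a @ r" "run q r" unfolding assms(1) by blast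
   have "length r < length y" by (simp add: y z)
   with 1 z(2) obtain as r' where "r = enc_list e as @ r'" "run (delta q False) r'" by blast
   then show ?thesis using y z True by (intro exI[of _ "a # as"] exI[of _ r']) simp
  next
   case False
   then show ?thesis using y by (intro exI[of _ "[]"] exI[of _ z]) simp
  qed
 qed
 have "run q (enc_list e as @ r)" if "run (delta q False) r" for as r
  using that
 proof (induction as)
  case (Cons a as)
  then show ?case unfolding enc_list.simps append_Cons run_simps assms(1) by auto
 qed (simp add: run_simps)
 then show "\<exists>as r. y = enc_list e as @ r \<and> run (delta q False) r \<Longrightarrow> run q y" by blast
qed

lemma delta_lists: "delta 12 True = 3" "delta 12 False = 13" "delta 13 True = 14" "delta 13 False = 15"
 "delta 14 True = 9" "delta 14 False = 13"
 by (simp_all add: delta_def)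

lemma exit_states [simp]: "exit_state 0 = 12" "exit_state 1 = 6" "exit_state (Suc 0) = 6" "exit_state 2 = 12" "exit_state 3 = 14"
 by (simp_all add: exit_state_def)

lemma run_iff: "run 0 y \<longleftrightarrow> (\<exists>N es bs. y = enc_graph_pd N es bs)"
proof -
 have elems: "run 14 y \<longleftrightarrow> (\<exists>as r. y = enc_list enc_nat as @ r \<and> run 13 r)" for y
  using run_list[of 14 enc_nat y] run_nat[of 3] by (simp add: delta_lists)
 have bags: "run 13 y \<longleftrightarrow> (\<exists>bs. y = enc_list (enc_list enc_nat) bs)" for y
  using run_list[of 13 "enc_list enc_nat" y] elems by (simp add: delta_lists run_15)
 have edge: "run 3 y \<longleftrightarrow> (\<exists>e r. y = enc_edge e @ r \<and> run 12 r)" for y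
  using run_nat[of 1 y] run_nat[of 2] by (simp add: enc_edge_def) blast
 have edges: "run 12 y \<longleftrightarrow> (\<exists>es r. y = enc_list enc_edge es @ r \<and> run 13 r)" for y
  using run_list[of 12 enc_edge y] edge by (simp add: delta_lists)
 show ?thesis using run_nat[of 0 y] by (simp add: edges bags enc_graph_pd_def) blast
qed

text \<open>All positions of a run: state, number of bags opened so far, and remaining suffix.\<close>

primrec scan :: "nat \<Rightarrow> nat \<Rightarrow> bool list \<Rightarrow> (nat \<times> nat \<times> bool list) set" where
 "scan q c [] = {}"
| "scan q c (b # y) = insert (q, c, b # y) (scan (delta q b) (c + of_bool (q = 13 \<and> b)) y)"

definition edge_set :: "nat \<Rightarrow> nat \<Rightarrow> bool list \<Rightarrow> (nat \<times> nat) set" where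
 "edge_set q c y = {(u, v). \<exists>d r. (12, d, True # enc_nat u @ enc_nat v @ r) \<in> scan q c y}"

text \<open>Bags are numbered from 1: the counter has already been raised by the flag that opens the
  bag.\<close>

definition elem_set :: "nat \<Rightarrow> nat \<Rightarrow> bool list \<Rightarrow> (nat \<times> nat) set" where
 "elem_set q c y = {(d, v). \<exists>r. (14, d, True # enc_nat v @ r) \<in> scan q c y}"

primrec bag_count :: "nat \<Rightarrow> bool list \<Rightarrow> nat" where
 "bag_count q [] = 0"
| "bag_count q (b # y) = of_bool (q = 13 \<and> b) + bag_count (delta q b) y"

lemma sets_skip:
 assumes "q < 12"
 shows "edge_set q c (b # y) = edge_set (delta q b) c y" "elem_set q c (b # y) = elem_set (delta q b) c y"
  "bag_count q (b # y) = bag_count (delta q b) y"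
 using assms by (simp_all add: edge_set_def elem_set_def)

lemma sets_bits:
 assumes "t < 4"
 shows "(ds = [] \<or> last ds \<longrightarrow> edge_set (3 * t) c (enc_bits ds @ y) = edge_set (exit_state t) c y \<and>
   elem_set (3 * t) c (enc_bits ds @ y) = elem_set (exit_state t) c y \<and>
   bag_count (3 * t) (enc_bits ds @ y) = bag_count (exit_state t) y) \<and>
  (ds \<noteq> [] \<and> last ds \<longrightarrow> edge_set (3 * t + 2) c (enc_bits ds @ y) = edge_set (exit_state t) c y \<and>
   elem_set (3 * t + 2) c (enc_bits ds @ y) = elem_set (exit_state t) c y \<and>
   bag_count (3 * t + 2) (enc_bits ds @ y) = bag_count (exit_state t) y)"
proof (induction ds)
 case Nil
 have "3 * t < 12" using assms by simp
 from sets_skip(1,2)[OF this, of c False y] sets_skip(3)[OF this, of False y] show ?case by (simp add: delta_nat(2)[OF assms])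
next
 case (Cons b ds)
 note d = delta_nat[OF assms]
 have l: "3 * t < 12" "3 * t + 1 < 12" "3 * t + 2 < 12" using assms by simp_all
 let ?P = "\<lambda>q z. edge_set q c z = edge_set (exit_state t) c y \<and> elem_set q c z = elem_set (exit_state t) c y \<and>
   bag_count q z = bag_count (exit_state t) y"
 have s: "?P (3 * t + 1) (b # enc_bits ds @ y)" if "last (b # ds)"
 proof (cases b)
  case True
  have "?P (3 * t) (enc_bits ds @ y)" using Cons.IH that by (cases "ds = []") auto
  then show ?thesis unfolding sets_skip[OF l(2)] using d(3) True by simp
 next
  case False
  with that have "ds \<noteq> []" "last ds" by (auto split: if_splits)
  with Cons.IH have "?P (3 * t + 2) (enc_bits ds @ y)" by blast
  then show ?thesis unfolding sets_skip[OF l(2)] using d(4) False by simp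
 qed
 have "?P (3 * t + 1) (b # enc_bits ds @ y)" if "last (b # ds)" using s that .
 then show ?case unfolding enc_list.simps append_Cons sets_skip[OF l(1)] sets_skip[OF l(3)] d append_Nil by simp
qed

lemma sets_nat:
 assumes "t < 4"
 shows "edge_set (3 * t) c (enc_nat v @ y) = edge_set (exit_state t) c y"
  "elem_set (3 * t) c (enc_nat v @ y) = elem_set (exit_state t) c y"
  "bag_count (3 * t) (enc_nat v @ y) = bag_count (exit_state t) y"
 using sets_bits[OF assms, where ds = "binary v" and c = c and y = y] last_binary unfolding enc_nat_def by blast+

lemma sets_edge:
 "edge_set 12 c (True # enc_edge e @ y) = insert e (edge_set 12 c y)"
 "elem_set 12 c (True # enc_edge e @ y) = elem_set 12 c y"
 "bag_count 12 (True # enc_edge e @ y) = bag_count 12 y"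
proof -
 obtain u v where e: "e = (u, v)" by (cases e)
 let ?y = "enc_edge e @ y"
 have u: "u' = u \<and> v' = v" if "enc_nat u' @ enc_nat v' @ r = enc_nat u @ enc_nat v @ y" for u' v' r
  using that enc_nat_append_inject by blast
 have "edge_set 12 c (True # ?y) = insert e (edge_set 3 c ?y)"
  by (auto simp: edge_set_def e enc_edge_def delta_lists dest: u)
 moreover have "edge_set 3 c ?y = edge_set 12 c y"
  using sets_nat(1)[of 1 c u "enc_nat v @ y"] sets_nat(1)[of 2 c v y] by (simp add: e enc_edge_def)
 ultimately show "edge_set 12 c (True # ?y) = insert e (edge_set 12 c y)" by simp
 show "elem_set 12 c (True # ?y) = elem_set 12 c y"
  using sets_nat(2)[of 1 c u "enc_nat v @ y"] sets_nat(2)[of 2 c v y]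
  by (simp add: elem_set_def e enc_edge_def delta_lists)
 show "bag_count 12 (True # ?y) = bag_count 12 y"
  using sets_nat(3)[of 1 u "enc_nat v @ y"] sets_nat(3)[of 2 v y]
  by (simp add: e enc_edge_def delta_lists)
qed

lemma sets_elem:
 "edge_set 14 c (True # enc_nat v @ y) = edge_set 14 c y"
 "elem_set 14 c (True # enc_nat v @ y) = insert (c, v) (elem_set 14 c y)"
 "bag_count 14 (True # enc_nat v @ y) = bag_count 14 y"
proof -
 note n = sets_nat[of 3, simplified]
 show "edge_set 14 c (True # enc_nat v @ y) = edge_set 14 c y"
  using n(1)[of c v y] by (simp add: edge_set_def delta_lists)
 show "bag_count 14 (True # enc_nat v @ y) = bag_count 14 y"
  using n(3)[of v y] by (simp add: delta_lists)
 have "elem_set 14 c (True # enc_nat v @ y) = insert (c, v) (elem_set 9 c (enc_nat v @ y))"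
  by (auto simp: elem_set_def delta_lists dest: enc_nat_append_inject)
 then show "elem_set 14 c (True # enc_nat v @ y) = insert (c, v) (elem_set 14 c y)" by (simp add: n(2))
qed

lemma sets_flags:
 "edge_set 12 c (False # y) = edge_set 13 c y" "elem_set 12 c (False # y) = elem_set 13 c y"
 "bag_count 12 (False # y) = bag_count 13 y"
 "edge_set 14 c (False # y) = edge_set 13 c y" "elem_set 14 c (False # y) = elem_set 13 c y"
 "bag_count 14 (False # y) = bag_count 13 y"
 "edge_set 13 c (True # y) = edge_set 14 (c + 1) y" "elem_set 13 c (True # y) = elem_set 14 (c + 1) y"
 "bag_count 13 (True # y) = bag_count 14 y + 1"
 "edge_set 13 c [False] = {}" "elem_set 13 c [False] = {}" "bag_count 13 [False] = 0"
 by (simp_all add: edge_set_def elem_set_def delta_lists)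

declare bag_count.simps [simp del]

lemma sets_edges:
 "edge_set 12 c (enc_list enc_edge es @ y) = set es \<union> edge_set 13 c y"
 "elem_set 12 c (enc_list enc_edge es @ y) = elem_set 13 c y"
 "bag_count 12 (enc_list enc_edge es @ y) = bag_count 13 y"
 by (induction es) (simp_all add: sets_edge sets_flags)

lemma sets_elems:
 "edge_set 14 c (enc_list enc_nat vs @ y) = edge_set 13 c y"
 "elem_set 14 c (enc_list enc_nat vs @ y) = Pair c ` set vs \<union> elem_set 13 c y"
 "bag_count 14 (enc_list enc_nat vs @ y) = bag_count 13 y"
 by (induction vs) (simp_all add: sets_elem sets_flags)

lemma sets_bags:
 "edge_set 13 c (enc_list (enc_list enc_nat) bs) = {}"
 "bag_count 13 (enc_list (enc_list enc_nat) bs) = length bs"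
 "elem_set 13 c (enc_list (enc_list enc_nat) bs) = {(c + j + 1, v) | j v. j < length bs \<and> v \<in> set (bs ! j)}"
proof -
 show "edge_set 13 c (enc_list (enc_list enc_nat) bs) = {}"
  by (induction bs arbitrary: c) (simp_all add: sets_flags sets_elems)
 show "bag_count 13 (enc_list (enc_list enc_nat) bs) = length bs"
  by (induction bs) (simp_all add: sets_flags sets_elems)
 show "elem_set 13 c (enc_list (enc_list enc_nat) bs) = {(c + j + 1, v) | j v. j < length bs \<and> v \<in> set (bs ! j)}"
 proof (induction bs arbitrary: c)
  case (Cons b bs)
  have "elem_set 13 c (enc_list (enc_list enc_nat) (b # bs)) =
    Pair (c + 1) ` set b \<union> {(c + 1 + j + 1, v) | j v. j < length bs \<and> v \<in> set (bs ! j)}"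
   by (simp add: sets_flags sets_elems Cons)
  moreover have "(d, v) \<in> Pair (c + 1) ` set b \<union> {(c + 1 + j + 1, v) | j v. j < length bs \<and> v \<in> set (bs ! j)} \<longleftrightarrow>
    (\<exists>j < Suc (length bs). d = c + j + 1 \<and> v \<in> set ((b # bs) ! j))" for d v
   unfolding Ex_less_Suc2 by auto
  ultimately have M: "(d, v) \<in> elem_set 13 c (enc_list (enc_list enc_nat) (b # bs)) \<longleftrightarrow>
    (\<exists>j < Suc (length bs). d = c + j + 1 \<and> v \<in> set ((b # bs) ! j))" for d v by (simp only:)
  show ?case
  proof (rule set_eqI)
   fix z show "z \<in> elem_set 13 c (enc_list (enc_list enc_nat) (b # bs)) \<longleftrightarrow>
     z \<in> {(c + j + 1, v) | j v. j < length (b # bs) \<and> v \<in> set ((b # bs) ! j)}"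
    by (cases z) (simp only: M mem_Collect_eq Pair_inject length_Cons, blast)
  qed
 qed (simp add: sets_flags)
qed

lemma sets_graph:
 assumes "x = enc_graph_pd N es bs"
 shows "edge_set 0 0 x = set es" "elem_set 0 0 x = {(j + 1, v) | j v. j < length bs \<and> v \<in> set (bs ! j)}"
  "bag_count 0 x = length bs"
 using sets_nat(1,2)[of 0 0 N "enc_list enc_edge es @ enc_list (enc_list enc_nat) bs", simplified]
  sets_nat(3)[of 0 N "enc_list enc_edge es @ enc_list (enc_list enc_nat) bs", simplified]
 by (simp_all add: assms enc_graph_pd_def sets_edges sets_bags)

text \<open>The counter of \<open>scan\<close> as a cardinality, which an arithmetic expression can
  compute as a sum.\<close>

definition bag_no :: "nat \<Rightarrow> bool list \<Rightarrow> nat \<Rightarrow> nat" where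
 "bag_no q y i = card {j. j < i \<and> foldl delta q (take j y) = 13 \<and> y ! j}"

lemma bag_no_Suc: "bag_no q (b # y) (Suc i) = of_bool (q = 13 \<and> b) + bag_no (delta q b) y i"
proof -
 let ?S = "{j. j < i \<and> foldl delta (delta q b) (take j y) = 13 \<and> y ! j}"
 have "{j. j < Suc i \<and> foldl delta q (take j (b # y)) = 13 \<and> (b # y) ! j} = {j. j = 0 \<and> q = 13 \<and> b} \<union> Suc ` ?S"
 proof (intro set_eqI)
  fix j show "j \<in> {j. j < Suc i \<and> foldl delta q (take j (b # y)) = 13 \<and> (b # y) ! j} \<longleftrightarrow>
   j \<in> {j. j = 0 \<and> q = 13 \<and> b} \<union> Suc ` ?S"
   by (cases j) auto
 qed
 moreover have "card ({j. j = 0 \<and> q = 13 \<and> b} \<union> Suc ` ?S) = card {j :: nat. j = 0 \<and> q = 13 \<and> b} + card (Suc ` ?S)"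
  by (rule card_Un_disjoint) auto
 moreover have "card {j :: nat. j = 0 \<and> q = 13 \<and> b} = of_bool (q = 13 \<and> b)"
  by (cases "q = 13 \<and> b") auto
 ultimately show ?thesis unfolding bag_no_def by (simp add: card_image)
qed

lemma scan_iff:
 "(q', d, s) \<in> scan q c y \<longleftrightarrow>
   (\<exists>i<length y. q' = foldl delta q (take i y) \<and> d = c + bag_no q y i \<and> s = drop i y)"
proof (induction y arbitrary: q c)
 case (Cons b y)
 have "bag_no q (b # y) 0 = 0" by (simp add: bag_no_def)
 then show ?case unfolding scan.simps insert_iff Cons.IH length_Cons Ex_less_Suc2 bag_no_Suc
  by (simp add: add.assoc)
qed simp

lemma bag_count_conv: "bag_count q y = bag_no q y (length y)"
 by (induction y arbitrary: q) (simp_all add: bag_count.simps bag_no_Suc, simp add: bag_no_def)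

section \<open>Inspecting instances by expressions\<close>

text \<open>The tape is \<open>1^k 0 x\<close>, so \<open>k\<close> is the number of
  \<open>i\<close> such that positions 1 to \<open>i + 1\<close> all carry a one. Bit
  \<open>j\<close> of \<open>x\<close> is at position \<open>k + 2 + j\<close>.\<close>

definition eK where "eK = aSum 2 (Var 1) (aAll 3 (Add (Var 2) (Con 1)) (aEq (In (Add (Var 3) (Con 1))) (Con 1)))"
definition eN where "eN = Sub (Var 1) (Add eK (Con 2))"
definition eX where "eX e = aEq (In (Add (Add eK (Con 2)) e)) (Con 1)"
text \<open>A run of the automaton: its table is written as a cascade of conditionals. All states
  are below 17, so the permitted increment 17 makes the cutoff of \<open>Fold\<close>
  ineffective.\<close>

definition eS where "eS e = Fold 2 3 e (Con 17) (foldr (\<lambda>q. aIf (aEq (Var 3) (Con q))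
 (aIf (eX (Var 2)) (Con (delta q True)) (Con (delta q False)))) [0..<17] (Con 16))"
definition eP where "eP q e = aAnd (eX e) (aEq (eS e) (Con q))"
definition eC where "eC e = aSum 2 e (eP 13 (Var 2))"
text \<open>Compares \<open>x\<close> from position \<open>s\<close> on with the code of
  \<open>c\<close>: flags 1 at even places, digits at odd places, and the final flag 0 at place
  \<open>L\<close>. The variable \<open>z\<close> is chosen above 1, so that variable 1, which
  determines the input length, is not overwritten.\<close>

definition eM where "eM s c = (let z = Suc (Suc (max (vb s) (vb c))); L = aMul (Con 2) (aLen c); p = Add s (Var z) in
 aAll z (Add L (Con 1)) (aAnd (aLt p eN) (aEq (eX p)
  (aIf (aEq (Var z) L) (Con 0) (aIf (aMod (Var z) (Con 2)) (aBit c (aDiv (Var z) (Con 2))) (Con 1))))))"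
definition eEdge where "eEdge u v = (let z = Suc (Suc (max (vb u) (vb v))) in
 aEx z eN (aAnd (eP 12 (Var z)) (aAnd (eM (Add (Var z) (Con 1)) u)
  (eM (Add (Add (Var z) (Con 2)) (aMul (Con 2) (aLen u))) v))))"
definition eElem where "eElem d v = (let z = Suc (Suc (max (vb d) (vb v))) in
 aEx z eN (aAnd (eP 14 (Var z)) (aAnd (eM (Add (Var z) (Con 1)) v) (aEq (eC (Var z)) d))))"

lemma length_enc_bits: "length (enc_bits ds) = 2 * length ds + 1"
 by (induction ds) simp_all

lemma nth_enc_bits:
 "j \<le> 2 * length ds \<Longrightarrow> enc_bits ds ! j = (if j = 2 * length ds then False else if odd j then ds ! (j div 2) else True)"
proof (induction ds arbitrary: j)
 case (Cons b ds)
 consider "j = 0" | "j = 1" | i where "j = Suc (Suc i)" by (metis One_nat_def not0_implies_Suc)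
 then show ?case
 proof cases
  case 3
  then have "i \<le> 2 * length ds" using Cons.prems by simp
  from Cons.IH[OF this] show ?thesis using 3 by simp
 qed simp_all
qed simp

lemma length_enc_nat: "length (enc_nat c) = 2 * length (binary c) + 1"
 by (simp add: enc_nat_def length_enc_bits)

lemma nth_enc_nat:
 "j \<le> 2 * length (binary c) \<Longrightarrow> enc_nat c ! j =
   (if j = 2 * length (binary c) then False else if odd j then odd (c div 2 ^ (j div 2)) else True)"
 unfolding enc_nat_def by (subst nth_enc_bits) (auto simp: nth_binary)

lemma drop_prefix_iff:
 assumes "y \<noteq> []"
 shows "(\<forall>j<length y. s + j < length x \<and> x ! (s + j) = y ! j) \<longleftrightarrow> (\<exists>r. drop s x = y @ r)"
proof
 assume a: "\<forall>j<length y. s + j < length x \<and> x ! (s + j) = y ! j"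
 from assms have "length y - 1 < length y" by (cases y) auto
 with a have "s + (length y - 1) < length x" by blast
 then have l: "length y \<le> length (drop s x)" using \<open>length y - 1 < length y\<close> by simp
 have s: "s \<le> length x" using a[rule_format, of 0] assms by simp
 have "take (length y) (drop s x) = y"
 proof (rule nth_equalityI)
  show "length (take (length y) (drop s x)) = length y" using l by simp
  show "take (length y) (drop s x) ! j = y ! j" if "j < length (take (length y) (drop s x))" for j
   using that a s by simp
 qed
 then show "\<exists>r. drop s x = y @ r" by (metis append_take_drop_id)
next
 assume "\<exists>r. drop s x = y @ r"
 then obtain r where r: "drop s x = y @ r" ..
 show "\<forall>j<length y. s + j < length x \<and> x ! (s + j) = y ! j"
 proof (intro allI impI)
  fix j assume j: "j < length y"
  have "length y \<le> length (drop s x)" unfolding r by simp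
  then have "s + j < length x" using j by simp
  moreover from this have "x ! (s + j) = drop s x ! j" by simp
  ultimately show "s + j < length x \<and> x ! (s + j) = y ! j" using j by (simp add: r nth_append)
 qed
qed

lemma delta_less: "q < 17 \<Longrightarrow> delta q b < 17"
proof -
 assume "q < 17"
 have "[12, 6, 12, 14] ! (q div 3) < (17 :: nat)" if "q < 12"
 proof -
  have "q div 3 \<in> {0, 1, 2, 3}" using that by auto
  then show ?thesis by auto
 qed
 then show ?thesis by (auto simp: delta_def)
qed

locale instance_env =
 fixes x :: "bool list" and k :: nat and w :: "bool list"
 assumes w: "w = tape_word (x, k)"
begin

abbreviation "n \<equiv> length x"
abbreviation "st i \<equiv> foldl delta 0 (take i x)"

text \<open>Variable 1 holds the length of the tape word, \<open>k + 1 + n\<close>, plus 1; derived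
  expressions obtain \<open>n\<close> from it.\<close>

definition std :: "(nat \<Rightarrow> nat) \<Rightarrow> bool" where "std E \<longleftrightarrow> E 1 = k + n + 2"

lemma std_upd [simp]: "y \<noteq> 1 \<Longrightarrow> std (E(y := i)) = std E"
 by (simp add: std_def)

lemma std_upd0 [simp]: "std (E(Suc (Suc y) := i)) = std E"
 by (simp add: std_def)

lemma ev_eK [simp]: "std E \<Longrightarrow> ev w a c eK E = k"
proof -
 assume E: "std E"
 have in1: "in_code (scan_input w (Suc j)) = 1 \<longleftrightarrow> j < k" if "j \<le> k" for j
  using that by (auto simp: w scan_input_def nth_append)
 have "(\<forall>j<i + 1. in_code (scan_input w (j + 1)) = 1) \<longleftrightarrow> i < k" for i
 proof
  assume a: "\<forall>j<i + 1. in_code (scan_input w (j + 1)) = 1"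
  show "i < k"
  proof (rule ccontr)
   assume "\<not> i < k"
   with a have "in_code (scan_input w (Suc k)) = 1" by simp
   with in1[of k] show False by simp
  qed
 next
  assume "i < k"
  then show "\<forall>j<i + 1. in_code (scan_input w (j + 1)) = 1" using in1 by simp
 qed
 then have "ev w a c eK E = (\<Sum>i<E 1. of_bool (i < k))" by (simp add: eK_def)
 then show ?thesis using E unfolding sum_of_bool_less std_def by simp
qed

lemma ev_eN [simp]: "std E \<Longrightarrow> ev w a c eN E = n"
 by (simp add: eN_def) (simp add: std_def)

lemma ev_eX [simp]: "std E \<Longrightarrow> ev w a c (eX e) E = of_bool (ev w a c e E < n \<and> x ! ev w a c e E)"
proof -
 assume E: "std E"
 have "in_code (scan_input w (k + 2 + p)) = 1 \<longleftrightarrow> p < n \<and> x ! p" for p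
  by (simp add: scan_input_def w nth_append)
 from this[of "ev w a c e E"] E show ?thesis by (simp add: eX_def)
qed

lemma st_less: "st i < 17"
proof (induction i)
 case (Suc i)
 then show ?case using delta_less by (cases "i < n") (auto simp: take_Suc_conv_app_nth)
qed simp

lemma ev_eS [simp]: "std E \<Longrightarrow> ev w a c e E \<le> n \<Longrightarrow> ev w a c (eS e) E = st (ev w a c e E)"
proof -
 assume E: "std E" "ev w a c e E \<le> n"
 let ?d = "foldr (\<lambda>q. aIf (aEq (Var 3) (Con q)) (aIf (eX (Var 2)) (Con (delta q True)) (Con (delta q False)))) [0..<17] (Con 16)"
 define E' where "E' i s = E(2 := i, 3 := s)" for i s
 have E': "std (E' i s)" "E' i s 2 = i" "E' i s 3 = s" for i s using E(1) by (simp_all add: E'_def)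
 have "ev w a c (foldr (\<lambda>q. aIf (aEq (Var 3) (Con q)) (aIf (eX (Var 2)) (Con (delta q True)) (Con (delta q False)))) qs (Con 16)) (E' i s) =
  (if s \<in> set qs then delta s (i < n \<and> x ! i) else 16)" for qs i s
  by (induction qs) (auto simp: E')
 then have d: "ev w a c ?d (E' i s) = (if s < 17 then delta s (i < n \<and> x ! i) else 16)" for i s by simp
 have "rec_nat 0 (\<lambda>i s. min (s + 17) (ev w a c ?d (E' i s))) j = st j" if "j \<le> n" for j
  using that
 proof (induction j)
  case (Suc j)
  have "delta (st j) (x ! j) < 17" by (intro delta_less st_less)
  then show ?case using Suc st_less[of j] unfolding nat.rec(2) d by (simp add: take_Suc_conv_app_nth)
 qed simp
 from this[OF E(2)] show ?thesis by (simp add: eS_def E'_def)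
qed

abbreviation "P q i \<equiv> i < n \<and> x ! i \<and> st i = q"

lemma ev_eP [simp]: "std E \<Longrightarrow> ev w a c (eP q e) E = of_bool (P q (ev w a c e E))"
 by (cases "ev w a c e E < n") (simp_all add: eP_def)

lemma ev_eC [simp]: "std E \<Longrightarrow> ev w a c e E \<le> n \<Longrightarrow> ev w a c (eC e) E = bag_no 0 x (ev w a c e E)"
proof -
 assume E: "std E" and e: "ev w a c e E \<le> n"
 let ?i = "ev w a c e E"
 have "{..<?i} \<inter> {j. P 13 j} = {j. j < ?i \<and> st j = 13 \<and> x ! j}" using e by auto
 then show ?thesis using E by (simp add: eC_def bag_no_def)
qed

definition mt :: "nat \<Rightarrow> nat \<Rightarrow> bool" where "mt s c \<longleftrightarrow> (\<exists>r. drop s x = enc_nat c @ r)"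

lemma mt_unique: "mt s c \<Longrightarrow> mt s c' \<Longrightarrow> c = c'"
 unfolding mt_def by (metis enc_nat_append_inject)

lemma ev_eM [simp]: "std E \<Longrightarrow> ev w a c (eM s d) E = of_bool (mt (ev w a c s E) (ev w a c d E))"
proof -
 assume E: "std E"
 let ?s = "ev w a c s E" and ?d = "ev w a c d E"
 let ?L = "2 * length (binary ?d)"
 define z where "z = Suc (Suc (max (vb s) (vb d)))"
 have z: "std (E(z := j))" "ev w a c s (E(z := j)) = ?s" "ev w a c d (E(z := j)) = ?d" for j
  by (simp_all add: z_def E)
 have b: "ev w a c (aAnd (aLt (Add s (Var z)) eN) (aEq (eX (Add s (Var z)))
   (aIf (aEq (Var z) (aMul (Con 2) (aLen d))) (Con 0) (aIf (aMod (Var z) (Con 2)) (aBit d (aDiv (Var z) (Con 2))) (Con 1)))))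
   (E(z := j)) \<noteq> 0 \<longleftrightarrow> ?s + j < n \<and>
   x ! (?s + j) = (if j = ?L then False else if odd j then odd (?d div 2 ^ (j div 2)) else True)" for j
  by (auto simp: z mod_2_eq_odd)
 have L: "ev w a c (Add (aMul (Con 2) (aLen d)) (Con 1)) E = ?L + 1" by simp
 have "ev w a c (eM s d) E = of_bool (\<forall>j<?L + 1. ?s + j < n \<and>
   x ! (?s + j) = (if j = ?L then False else if odd j then odd (?d div 2 ^ (j div 2)) else True))"
  unfolding eM_def Let_def z_def[symmetric] ev_aAll b L ..
 also have "(\<forall>j<?L + 1. ?s + j < n \<and>
   x ! (?s + j) = (if j = ?L then False else if odd j then odd (?d div 2 ^ (j div 2)) else True)) \<longleftrightarrow>
   (\<forall>j<length (enc_nat ?d). ?s + j < length x \<and> x ! (?s + j) = enc_nat ?d ! j)"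
  unfolding length_enc_nat by (intro all_cong1 imp_cong refl) (simp add: nth_enc_nat)
 also have "\<dots> \<longleftrightarrow> mt ?s ?d" unfolding mt_def by (rule drop_prefix_iff) (use length_enc_nat[of ?d] in auto)
 finally show ?thesis .
qed

lemma drop_Cons_True: "i < n \<Longrightarrow> drop i x = True # z \<longleftrightarrow> x ! i \<and> drop (Suc i) x = z"
proof -
 assume "i < n"
 then have "drop i x = x ! i # drop (Suc i) x" by (simp only: Cons_nth_drop_Suc)
 then show ?thesis by simp
qed

lemma mt_append: "(\<exists>r. drop s x = enc_nat u @ enc_nat v @ r) \<longleftrightarrow> mt s u \<and> mt (s + (2 * length (binary u) + 1)) v"
proof -
 have d: "drop (s + (2 * length (binary u) + 1)) x = drop (length (enc_nat u)) (drop s x)"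
  by (simp add: length_enc_nat add.commute)
 have e: "drop (s + (2 * length (binary u) + 1)) x = r" if "drop s x = enc_nat u @ r" for r
  unfolding d that by simp
 show ?thesis
 proof
  assume "\<exists>r. drop s x = enc_nat u @ enc_nat v @ r"
  then obtain r where r: "drop s x = enc_nat u @ enc_nat v @ r" ..
  from e[OF r] r show "mt s u \<and> mt (s + (2 * length (binary u) + 1)) v" unfolding mt_def by (intro conjI exI)
 next
  assume "mt s u \<and> mt (s + (2 * length (binary u) + 1)) v"
  then obtain r r' where r: "drop s x = enc_nat u @ r" "drop (s + (2 * length (binary u) + 1)) x = enc_nat v @ r'"
   unfolding mt_def by (elim conjE exE)
  from r(2) have "r = enc_nat v @ r'" unfolding e[OF r(1)] .
  with r(1) show "\<exists>r. drop s x = enc_nat u @ enc_nat v @ r" by simp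
 qed
qed

text \<open>The flag is at \<open>i\<close> and the code of \<open>u\<close> occupies the next
  \<open>2 * length (binary u) + 1\<close> places, whence the position of the code of
  \<open>v\<close>.\<close>

lemma edge_set_iff: "(u, v) \<in> edge_set 0 0 x \<longleftrightarrow>
  (\<exists>i<n. P 12 i \<and> mt (i + 1) u \<and> mt (i + 2 + 2 * length (binary u)) v)"
proof -
 have "(u, v) \<in> edge_set 0 0 x \<longleftrightarrow> (\<exists>i<n. st i = 12 \<and> (\<exists>r. drop i x = True # enc_nat u @ enc_nat v @ r))"
  unfolding edge_set_def scan_iff mem_Collect_eq prod.case eq_commute[of "12 :: nat"] eq_commute[of "True # _"] by blast
 also have "\<dots> \<longleftrightarrow> (\<exists>i<n. P 12 i \<and> (\<exists>r. drop (Suc i) x = enc_nat u @ enc_nat v @ r))"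
  by (auto simp: drop_Cons_True)
 finally show ?thesis unfolding mt_append by simp
qed

lemma elem_set_iff: "(d, v) \<in> elem_set 0 0 x \<longleftrightarrow> (\<exists>i<n. P 14 i \<and> mt (i + 1) v \<and> bag_no 0 x i = d)"
proof -
 have "(d, v) \<in> elem_set 0 0 x \<longleftrightarrow> (\<exists>i<n. st i = 14 \<and> d = bag_no 0 x i \<and> (\<exists>r. drop i x = True # enc_nat v @ r))"
  unfolding elem_set_def scan_iff mem_Collect_eq prod.case eq_commute[of "14 :: nat"] eq_commute[of "True # _"] add_0 by blast
 also have "\<dots> \<longleftrightarrow> (\<exists>i<n. P 14 i \<and> d = bag_no 0 x i \<and> (\<exists>r. drop (Suc i) x = enc_nat v @ r))"
  by (auto simp: drop_Cons_True)
 finally show ?thesis unfolding mt_def by auto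
qed

lemma ev_eEdge [simp]: "std E \<Longrightarrow>
 ev w a c (eEdge d e) E = of_bool ((ev w a c d E, ev w a c e E) \<in> edge_set 0 0 x)"
 by (simp add: eEdge_def Let_def edge_set_iff)

lemma ev_eElem [simp]: "std E \<Longrightarrow>
 ev w a c (eElem d e) E = of_bool ((ev w a c d E, ev w a c e E) \<in> elem_set 0 0 x)"
 by (simp add: eElem_def Let_def elem_set_iff cong: conj_cong)

lemma run_drop: "run 0 x \<Longrightarrow> run (st i) (drop i x)"
 unfolding run_def by (metis append_take_drop_id foldl_append)

text \<open>In a well-formed word every set flag of the list of edges is followed by an edge, so
  conditions on all edges can be tested position by position.\<close>

lemma edge_at:
 assumes "run 0 x" "P 12 i"
 shows "\<exists>u v. mt (i + 1) u \<and> mt (i + 2 + 2 * length (binary u)) v"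
proof -
 have "run 12 (True # drop (Suc i) x)" using run_drop[OF assms(1), of i] assms(2) drop_Cons_True[of i] by metis
 then have "run (3 * 1) (drop (Suc i) x)" by (simp add: run_simps delta_lists)
 then obtain u r where u: "drop (Suc i) x = enc_nat u @ r" "run 6 r"
  using run_nat[of 1 "drop (Suc i) x"] by auto
 from u(2) obtain v r' where "r = enc_nat v @ r'" using run_nat[of 2 r] by auto
 with u have "\<exists>r. drop (Suc i) x = enc_nat u @ enc_nat v @ r" by simp
 then show ?thesis unfolding mt_append by auto
qed

lemma elem_at:
 assumes "run 0 x" "P 14 i"
 shows "\<exists>v. mt (i + 1) v"
proof -
 have "run 14 (True # drop (Suc i) x)" using run_drop[OF assms(1), of i] assms(2) drop_Cons_True[of i] by metis
 then have "run (3 * 3) (drop (Suc i) x)" by (simp add: run_simps delta_lists)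
 then show ?thesis using run_nat[of 3 "drop (Suc i) x"] unfolding mt_def by auto
qed

end

section \<open>The verifier\<close>

text \<open>Two bits are guessed for each pair of bag \<open>c\<close> and vertex \<open>v\<close>;
  excluding the combination of two ones leaves three colors. The other conditions compare with
  smaller neighbours in the same bag and with the same vertex in the previous bag.\<close>

abbreviation colors_ok :: "(nat \<Rightarrow> nat \<Rightarrow> bool) \<Rightarrow> (nat \<Rightarrow> nat \<Rightarrow> bool) \<Rightarrow> nat \<Rightarrow> (nat \<Rightarrow> bool) \<Rightarrow> nat \<Rightarrow> nat \<Rightarrow> bool" where
 "colors_ok I G N ch c v \<equiv> I c v \<longrightarrow> \<not> (ch (2 * (c * N + v)) \<and> ch (2 * (c * N + v) + 1)) \<and>
  (\<forall>u<v. I c u \<and> G u v \<longrightarrow> \<not> (ch (2 * (c * N + u)) = ch (2 * (c * N + v)) \<and> ch (2 * (c * N + u) + 1) = ch (2 * (c * N + v) + 1))) \<and>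
  (0 < c \<and> I (c - 1) v \<longrightarrow> ch (2 * ((c - 1) * N + v)) = ch (2 * (c * N + v)) \<and> ch (2 * ((c - 1) * N + v) + 1) = ch (2 * (c * N + v) + 1))"

text \<open>The bags of a vertex form an interval, so agreement between consecutive bags makes its
  color the same in all of them; it is read off in the first one, \<open>m v\<close>. Each edge lies
  in some bag and is tested there.\<close>

lemma bag_coloring:
 fixes I G :: "nat \<Rightarrow> nat \<Rightarrow> bool"
 assumes G: "\<And>u v. G u v \<Longrightarrow> G v u \<and> u \<noteq> v \<and> (\<exists>c. I c u \<and> I c v)"
  and cont: "\<And>a b c v. I a v \<Longrightarrow> I b v \<Longrightarrow> a \<le> c \<Longrightarrow> c \<le> b \<Longrightarrow> I c v"
  and I: "\<And>c v. I c v \<Longrightarrow> c < NB \<and> v < N"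
 shows "(\<exists>ch. \<forall>c<NB. \<forall>v<N. colors_ok I G N ch c v) \<longleftrightarrow>
  (\<exists>col. (\<forall>v<N. col v < (3 :: nat)) \<and> (\<forall>u v. G u v \<longrightarrow> col u \<noteq> col v))" (is "(\<exists>ch. ?A ch) \<longleftrightarrow> ?B")
proof
 assume "\<exists>ch. ?A ch"
 then obtain ch where ch: "?A ch" ..
 define f :: "nat \<Rightarrow> nat \<Rightarrow> nat" where "f c v = of_bool (ch (2 * (c * N + v))) + 2 * of_bool (ch (2 * (c * N + v) + 1))" for c v
 have f: "f c v = f c' v' \<longleftrightarrow> ch (2 * (c * N + v)) = ch (2 * (c' * N + v')) \<and> ch (2 * (c * N + v) + 1) = ch (2 * (c' * N + v') + 1)" for c v c' v'
  by (cases "ch (2 * (c * N + v))"; cases "ch (2 * (c * N + v) + 1)"; cases "ch (2 * (c' * N + v'))"; cases "ch (2 * (c' * N + v') + 1)")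
   (simp_all add: f_def)
 have f3: "f c v < (3 :: nat)" if "I c v" for c v using ch I[OF that] that by (auto simp: f_def)
 have fn: "f c u \<noteq> f c v" if "I c u" "I c v" "G u v" "u < v" for c u v
  using ch I[OF that(2)] that unfolding f by blast
 have fp: "f (c - 1) v = f c v" if "I c v" "I (c - 1) v" "0 < c" for c v
  using ch I[OF that(1)] that unfolding f by blast
 define m where "m v = (LEAST c. I c v)" for v
 have m: "I (m v) v" "m v \<le> c" if "I c v" for c v using that unfolding m_def by (auto intro: LeastI Least_le)
 have fm: "I c v \<Longrightarrow> f c v = f (m v) v" for c v
 proof (induction c)
  case (Suc c)
  show ?case
  proof (cases "m v = Suc c")
   case False
   with m(2)[OF Suc.prems] have "I c v" using cont[OF m(1)[OF Suc.prems] Suc.prems, of c] by simp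
   with Suc.IH fp[of "Suc c" v] Suc.prems show ?thesis by simp
  qed simp
 qed (use m(2) in fastforce)
 let ?col = "\<lambda>v. if I (m v) v then f (m v) v else 0"
 have "?col u \<noteq> ?col v" if "G u v" for u v
 proof -
  from G[OF that] obtain c where c: "I c u" "I c v" "u \<noteq> v" "G v u" by blast
  have "f c u \<noteq> f c v" using fn[OF c(1,2) that] fn[OF c(2,1,4)] c(3) by (cases "u < v") auto
  then show ?thesis using fm[OF c(1)] fm[OF c(2)] m(1)[OF c(1)] m(1)[OF c(2)] by simp
 qed
 moreover have "?col v < 3" for v using f3 by simp
 ultimately have "(\<forall>v<N. ?col v < 3) \<and> (\<forall>u v. G u v \<longrightarrow> ?col u \<noteq> ?col v)" by blast
 then show ?B by (rule exI[of _ ?col])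
next
 assume ?B
 then obtain col where col: "\<And>v. v < N \<Longrightarrow> col v < (3 :: nat)" "\<And>u v. G u v \<Longrightarrow> col u \<noteq> col v" by blast
 \<comment> \<open>The first bit says color 1, the second says color 2; color 0 has neither. The
   index determines the vertex by a remainder, independently of the bag.\<close>
 define ch where "ch i \<longleftrightarrow> col (i div 2 mod N) = (if even i then 1 else 2)" for i
 have ch: "ch (2 * (c * N + v)) \<longleftrightarrow> col v = 1" "ch (2 * (c * N + v) + 1) \<longleftrightarrow> col v = 2" if "v < N" for c v
  using that by (simp_all add: ch_def)
 have e: "(col u = 1 \<longleftrightarrow> col v = 1) \<and> (col u = 2 \<longleftrightarrow> col v = 2) \<Longrightarrow> col u = col v" if "u < N" "v < N" for u v
  using col(1)[OF that(1)] col(1)[OF that(2)] by linarith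
 have "?A ch"
 proof (intro allI impI conjI)
  fix c v assume v: "v < N"
  show "\<not> (ch (2 * (c * N + v)) \<and> ch (2 * (c * N + v) + 1))" unfolding ch[OF v] by simp
  show "\<not> (ch (2 * (c * N + u)) = ch (2 * (c * N + v)) \<and> ch (2 * (c * N + u) + 1) = ch (2 * (c * N + v) + 1))"
   if u: "u < v" "I c u \<and> G u v" for u
  proof -
   have "u < N" using u v by simp
   then show ?thesis unfolding ch[OF v] ch[OF \<open>u < N\<close>] using e[of u v] v col(2)[of u v] u(2) by blast
  qed
  show "ch (2 * ((c - 1) * N + v)) = ch (2 * (c * N + v))" "ch (2 * ((c - 1) * N + v) + 1) = ch (2 * (c * N + v) + 1)"
   unfolding ch[OF v] by simp_all
 qed
 then show "\<exists>ch. ?A ch" by (rule exI[of _ ch])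
qed

definition aImp where "aImp d e = aOr (aNot d) e"

lemma ev_aImp [simp]: "ev w a c (aImp d e) E = of_bool (ev w a c d E \<noteq> 0 \<longrightarrow> ev w a c e E \<noteq> 0)"
 by (simp add: aImp_def imp_conv_disj)

text \<open>\<open>B\<close> is chosen such that \<open>n ^ k < 2 ^ B\<close>; the width test then
  also makes \<open>B\<close> a bound on the size of bags. \<open>eNB\<close> exceeds the number of
  bags by 1 because bag numbers start at 1. \<open>eNv\<close> finds the unique number that the word
  starts with, by searching up to \<open>n\<close> only.\<close>

definition eB where "eB = Add (Con 1) (aMul eK (aLen eN))"
definition eNB where "eNB = Add (eC eN) (Con 1)"
definition eNv where "eNv = aSum 2 (Add eN (Con 1)) (aMul (Var 2) (eM (Con 0) (Var 2)))"

text \<open>The second conjunct restricts the number of vertices to \<open>n\<close>. By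
  \<open>N_le\<close> this loses no instance, and it keeps the search for that number
  polynomial.\<close>

definition
 "static_exp = foldr aAnd
  [aEq (eS eN) (Con 15),
   aEx 2 (Add eN (Con 1)) (eM (Con 0) (Var 2)),
   aAll 2 eN (aImp (eP 12 (Var 2)) (aEx 3 eNv (aEx 4 eNv (aAnd (aNot (aEq (Var 3) (Var 4))) (aAnd
    (eM (Add (Var 2) (Con 1)) (Var 3)) (eM (Add (Add (Var 2) (Con 2)) (aMul (Con 2) (aLen (Var 3)))) (Var 4))))))),
   aAll 2 eN (aImp (eP 14 (Var 2)) (aEx 3 eNv (eM (Add (Var 2) (Con 1)) (Var 3)))),
   eC eN,
   aAll 2 eNv (aEx 3 eNB (eElem (Var 3) (Var 2))),
   aAll 2 eNv (aAll 3 eNv (aImp (eEdge (Var 2) (Var 3)) (aEx 4 eNB (aAnd (eElem (Var 4) (Var 2)) (eElem (Var 4) (Var 3)))))),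
   aAll 2 eNv (aAll 3 eNB (aAll 4 eNB (aAll 5 eNB (aImp (aAnd (aAnd (eElem (Var 3) (Var 2)) (eElem (Var 4) (Var 2)))
    (aAnd (aLe (Var 3) (Var 5)) (aLe (Var 5) (Var 4)))) (eElem (Var 5) (Var 2))))))] (Con 1)"

text \<open>A bag of \<open>m\<close> vertices is small enough iff
  \<open>2 ^ (m - 1) \<le> n ^ k\<close>, that is, iff some bit of \<open>n ^ k\<close> at a place
  \<open>i\<close> with \<open>m \<le> i + 1\<close> is set. This avoids logarithms of
  reals.\<close>

definition
 "width_exp = aAll 2 eNB (aEx 3 eB (aAnd (aLe (aSum 4 eNv (eElem (Var 2) (Var 4))) (Add (Var 3) (Con 1))) (Get (Var 3))))"

text \<open>
 The power \<open>n\<^sup>k\<close>, which is needed for the width test, is kept in binary in the auxiliary array. It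
 is multiplied by \<open>n\<close> in place from the most significant bit downwards: bit \<open>i\<close> of the product
 depends on the bits up to \<open>i\<close> only, through a carry that never exceeds \<open>n\<close>.
\<close>

definition
 "carry_exp i = Fold 4 5 i eN (aDiv (Add (Var 5) (aMul (Get (Var 4)) eN)) (Con 2))"

definition
 "mult_stm = (let i = Sub (Sub eB (Con 1)) (Var 3) in
   For 3 eB (Put i (aMod (Add (carry_exp i) (aMul (Get i) eN)) (Con 2))))"

text \<open>
 The color of vertex \<open>v\<close> in bag \<open>c\<close> is guessed in round \<open>c * N + v\<close> and stored until bag \<open>c + 1\<close>
 has been treated, at a slot that depends on the parity of \<open>c\<close> and on the rank of \<open>v\<close> in the bag.
 Rounds with \<open>v\<close> outside of the bag guess as well, but use a slot that is never read.
\<close>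

definition eIn where "eIn c v = eElem (Add c (Con 1)) v"
definition eSlot where "eSlot c v = aIf (eIn c v) (Add (aMul eB (aMod c (Con 2))) (aSum 3 v (eIn c (Var 3)))) (aMul (Con 2) eB)"
definition eBit where "eBit j c v = Get (Add (aMul (Con 2) (eSlot c v)) (Con j))"
definition eSame where "eSame c v c' v' = aAnd (aEq (eBit 0 c v) (eBit 0 c' v')) (aEq (eBit 1 c v) (eBit 1 c' v'))"
definition eBag where "eBag = aDiv (Var 2) eNv"
definition eVert where "eVert = aMod (Var 2) eNv"

definition
 "color_exp = aImp (eIn eBag eVert) (aAnd (aNot (aAnd (eBit 0 eBag eVert) (eBit 1 eBag eVert))) (aAnd
   (aAll 4 eVert (aImp (aAnd (eIn eBag (Var 4)) (aOr (eEdge (Var 4) eVert) (eEdge eVert (Var 4)))) (aNot (eSame eBag (Var 4) eBag eVert))))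
   (aImp (aAnd eBag (eIn (Sub eBag (Con 1)) eVert)) (eSame (Sub eBag (Con 1)) eVert eBag eVert))))"

definition
 "color_stm = Guess (aMul (Con 2) (eSlot eBag eVert)) ; Guess (Add (aMul (Con 2) (eSlot eBag eVert)) (Con 1)) ; Assert color_exp"

definition
 "verifier_stm = Assert static_exp ; Put (Con 0) (Con 1) ; For 2 eK mult_stm ; Assert width_exp ;
   For 2 (aMul (eC eN) eNv) color_stm"

text \<open>There are slots 0 to \<open>2 * B\<close>, the last one being the dummy, with two bits
  each.\<close>

definition "cap_exp = Add (aMul (Con 4) eB) (Con 1)"

text \<open>The carry into place \<open>i\<close> of the product of \<open>A\<close> and
  \<open>n\<close> is \<open>(A mod 2 ^ i * n) div 2 ^ i\<close>; this is its recursion, one bit of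
  \<open>A\<close> at a time.\<close>

lemma carry_step:
 fixes A n i :: nat
 shows "(A mod 2 ^ Suc i * n) div 2 ^ Suc i = ((A mod 2 ^ i * n) div 2 ^ i + of_bool (odd (A div 2 ^ i)) * n) div 2"
proof -
 have "A mod 2 ^ Suc i = A mod 2 ^ i + 2 ^ i * of_bool (odd (A div 2 ^ i))"
  unfolding power_Suc2 mod_mult2_eq mod_2_eq_odd by simp
 then have "A mod 2 ^ Suc i * n = A mod 2 ^ i * n + 2 ^ i * (of_bool (odd (A div 2 ^ i)) * n)"
  by (simp add: algebra_simps)
 then have "(A mod 2 ^ Suc i * n) div 2 ^ i = (A mod 2 ^ i * n) div 2 ^ i + of_bool (odd (A div 2 ^ i)) * n" by simp
 moreover have "(A mod 2 ^ Suc i * n) div 2 ^ Suc i = (A mod 2 ^ Suc i * n) div 2 ^ i div 2"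
  by (simp only: power_Suc2 div_mult2_eq)
 ultimately show ?thesis by (simp only:)
qed

lemma carry_le: "(A mod 2 ^ i * n) div 2 ^ i \<le> (n :: nat)"
proof -
 have "A mod 2 ^ i * n \<le> 2 ^ i * n" by (intro mult_le_mono1) (simp add: less_imp_le)
 then have "(A mod 2 ^ i * n) div 2 ^ i \<le> (2 ^ i * n) div 2 ^ i" by (rule div_le_mono)
 then show ?thesis by simp
qed

lemma odd_product:
 fixes A n i :: nat
 shows "odd ((A * n) div 2 ^ i) \<longleftrightarrow> odd ((A mod 2 ^ i * n) div 2 ^ i + of_bool (odd (A div 2 ^ i)) * n)"
proof -
 have "A * n = (2 ^ i * (A div 2 ^ i) + A mod 2 ^ i) * n" by (simp only: mult_div_mod_eq)
 also have "\<dots> = A mod 2 ^ i * n + 2 ^ i * (A div 2 ^ i * n)" by (metis add.commute add_mult_distrib mult.assoc)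
 finally have "A * n = A mod 2 ^ i * n + 2 ^ i * (A div 2 ^ i * n)" .
 then have "(A * n) div 2 ^ i = (A mod 2 ^ i * n) div 2 ^ i + A div 2 ^ i * n" by simp
 then show ?thesis by (cases "odd (A div 2 ^ i)") auto
qed

section \<open>Semantics of the verifier\<close>

context instance_env
begin

abbreviation "Ed \<equiv> edge_set 0 0 x"
abbreviation "El \<equiv> elem_set 0 0 x"
abbreviation "NB \<equiv> bag_no 0 x n"

definition B where "B = 1 + k * length (binary n)"
definition NN where "NN = (\<Sum>c<n + 1. c * of_bool (mt 0 c))"
abbreviation "cap \<equiv> 4 * B + 1"

lemma ev_sizes [simp]: "std E \<Longrightarrow> ev w a c eB E = B" "std E \<Longrightarrow> ev w a c eNB E = NB + 1"
 "std E \<Longrightarrow> ev w a c eNv E = NN"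
 by (simp_all add: eB_def B_def eNB_def eNv_def NN_def)

lemma NN_eq: "mt 0 N \<Longrightarrow> N \<le> n \<Longrightarrow> NN = N"
proof -
 assume N: "mt 0 N" "N \<le> n"
 have "c * of_bool (mt 0 c) = (if c = N then N else 0)" for c
  using mt_unique[OF N(1), of c] N(1) by (cases "mt 0 c") (simp, force)
 then have "NN = (\<Sum>c<n + 1. if c = N then N else 0)" by (simp only: NN_def)
 then show ?thesis using N(2) by simp
qed

definition static :: bool where
 "static \<longleftrightarrow> run 0 x \<and> (\<exists>c\<le>n. mt 0 c) \<and>
   (\<forall>i<n. P 12 i \<longrightarrow> (\<exists>u<NN. \<exists>v<NN. u \<noteq> v \<and> mt (i + 1) u \<and> mt (i + 2 + 2 * length (binary u)) v)) \<and>
   (\<forall>i<n. P 14 i \<longrightarrow> (\<exists>v<NN. mt (i + 1) v)) \<and> 0 < NB \<and>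
   (\<forall>v<NN. \<exists>d\<le>NB. (d, v) \<in> El) \<and>
   (\<forall>u<NN. \<forall>v<NN. (u, v) \<in> Ed \<longrightarrow> (\<exists>d\<le>NB. (d, u) \<in> El \<and> (d, v) \<in> El)) \<and>
   (\<forall>v<NN. \<forall>a\<le>NB. \<forall>b\<le>NB. \<forall>c\<le>NB. (a, v) \<in> El \<and> (b, v) \<in> El \<and> a \<le> c \<and> c \<le> b \<longrightarrow> (c, v) \<in> El)"

lemma ev_static:
 assumes E: "std E"
 shows "ev w a c static_exp E \<noteq> 0 \<longleftrightarrow> static"
proof -
 have all: "ev w a c (aAll z m e) E' \<noteq> 0 \<longleftrightarrow> (\<forall>i<ev w a c m E'. ev w a c e (E'(z := i)) \<noteq> 0)" for z m e E' by simp
 have ex: "ev w a c (aEx z m e) E' \<noteq> 0 \<longleftrightarrow> (\<exists>i<ev w a c m E'. ev w a c e (E'(z := i)) \<noteq> 0)" for z m e E' by simp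
 have op: "ev w a c (aAnd d e) E' \<noteq> 0 \<longleftrightarrow> ev w a c d E' \<noteq> 0 \<and> ev w a c e E' \<noteq> 0"
  "ev w a c (aImp d e) E' \<noteq> 0 \<longleftrightarrow> (ev w a c d E' \<noteq> 0 \<longrightarrow> ev w a c e E' \<noteq> 0)"
  "ev w a c (aLe d e) E' \<noteq> 0 \<longleftrightarrow> ev w a c d E' \<le> ev w a c e E'" for d e E' by auto
 have at: "ev w a c (eP q d) E' \<noteq> 0 \<longleftrightarrow> P q (ev w a c d E')" "ev w a c (eM d e) E' \<noteq> 0 \<longleftrightarrow> mt (ev w a c d E') (ev w a c e E')"
  "ev w a c (eEdge d e) E' \<noteq> 0 \<longleftrightarrow> (ev w a c d E', ev w a c e E') \<in> Ed"
  "ev w a c (eElem d e) E' \<noteq> 0 \<longleftrightarrow> (ev w a c d E', ev w a c e E') \<in> El" if "std E'" for q d e E'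
  using that by auto
 have ne: "ev w a c (aNot (aEq (Var 3) (Var 4))) E' \<noteq> 0 \<longleftrightarrow> E' 3 \<noteq> E' 4" for E' by simp
 have s: "ev w a c (aEq (eS eN) (Con 15)) E \<noteq> 0 \<longleftrightarrow> run 0 x" "ev w a c (eC eN) E \<noteq> 0 \<longleftrightarrow> 0 < NB"
  "ev w a c (Add eN (Con 1)) E = Suc n" using E by (simp_all add: run_def)
 have sz: "ev w a c eN E' = n" "ev w a c eNB E' = Suc NB" "ev w a c eNv E' = NN" if "std E'" for E' using that by simp_all
 show ?thesis
  unfolding static_exp_def static_def foldr.simps o_apply id_apply op(1) s all ex
  by (simp only: all ex op ne at sz std_upd E less_Suc_eq_le ev.simps if_True if_False fun_upd_same fun_upd_other ev_aLen ev_aMul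
   num.distinct num.inject numeral_eq_iff numeral_eq_one_iff one_eq_numeral_iff not_False_eq_True simp_thms) simp
qed

definition
 "wide_ok \<longleftrightarrow> (\<forall>d\<le>NB. \<exists>i<B. card ({..<NN} \<inter> {v. (d, v) \<in> El}) \<le> Suc i \<and> odd (n ^ k div 2 ^ i))"

lemma ev_carry:
 assumes E: "std E" and a: "\<And>j. j < ev w a cap i E \<Longrightarrow> a j = odd (A div 2 ^ j)" and i: "ev w a cap i E \<le> cap"
 shows "ev w a cap (carry_exp i) E = (A mod 2 ^ ev w a cap i E * n) div 2 ^ ev w a cap i E"
proof -
 let ?i = "ev w a cap i E"
 define E' where "E' j s = E(4 := j, 5 := s)" for j s
 have E': "std (E' j s)" "E' j s 4 = j" "E' j s 5 = s" for j s using E by (simp_all add: E'_def)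
 have n: "ev w a cap eN (E(4 := j)) = n" for j using E by simp
 have "rec_nat 0 (\<lambda>j s. min (s + n) (ev w a cap (aDiv (Add (Var 5) (aMul (Get (Var 4)) eN)) (Con 2)) (E' j s))) m =
   (A mod 2 ^ m * n) div 2 ^ m" if "m \<le> ?i" for m
  using that
 proof (induction m)
  case (Suc m)
  have g: "a (min m cap) = odd (A div 2 ^ m)" using a[of m] Suc.prems i by (simp add: min_def)
  have "ev w a cap (aDiv (Add (Var 5) (aMul (Get (Var 4)) eN)) (Con 2)) (E' m ((A mod 2 ^ m * n) div 2 ^ m)) =
    (A mod 2 ^ Suc m * n) div 2 ^ Suc m"
   unfolding carry_step by (simp add: E' g[simplified])
  \<comment> \<open>A carry is at most \<open>n\<close>, which is the permitted increment, so the
    cutoff has no effect.\<close>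
  moreover have "min ((A mod 2 ^ m * n) div 2 ^ m + n) ((A mod 2 ^ Suc m * n) div 2 ^ Suc m) = (A mod 2 ^ Suc m * n) div 2 ^ Suc m"
   using carry_le[of A "Suc m" n] by linarith
  ultimately show ?case using Suc by simp
 qed simp
 from this[of ?i] show ?thesis unfolding carry_exp_def ev.simps(6) n E'_def by simp
qed

lemma sem_mult:
 assumes E: "std E" and a: "\<And>i. i < B \<Longrightarrow> a i = odd (A div 2 ^ i)"
 shows "\<exists>a'. sem w cap mult_stm E (a, s) = (a', s) \<and> (\<forall>i<B. a' i = odd (A * n div 2 ^ i))"
proof -
 let ?i = "Sub (Sub eB (Con 1)) (Var 3)"
 let ?e = "aMod (Add (carry_exp ?i) (aMul (Get ?i) eN)) (Con 2)"
 \<comment> \<open>After \<open>j\<close> rounds the top \<open>j\<close> places hold bits of the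
   product, and the places below still hold bits of \<open>A\<close>. These are all that the next
   carry depends on.\<close>
 have "\<exists>a'. rec_nat (a, s) (\<lambda>j. sem w cap (Put ?i ?e) (E(3 := j))) j = (a', s) \<and>
   (\<forall>i<B. a' i = odd ((if B \<le> i + j then A * n else A) div 2 ^ i))" if "j \<le> B" for j
  using that
 proof (induction j)
  case 0
  then show ?case using a by simp
 next
  case (Suc j)
  have "j \<le> B" using Suc.prems by simp
  from Suc.IH[OF this] obtain b where b: "rec_nat (a, s) (\<lambda>j. sem w cap (Put ?i ?e) (E(3 := j))) j = (b, s)"
   "\<And>i. i < B \<Longrightarrow> b i = odd ((if B \<le> i + j then A * n else A) div 2 ^ i)" by blast
  let ?m = "B - 1 - j"
  have mc: "min ?m cap = ?m" by (rule min_absorb1) arith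
  have i: "ev w b' cap ?i (E(3 := j)) = ?m" for b' using E by simp
  have std3: "std (E(3 := j))" using E by simp
  have b': "b m = odd (A div 2 ^ m)" if "m \<le> ?m" for m using b(2)[of m] that Suc.prems by simp
  have c: "ev w b cap (carry_exp ?i) (E(3 := j)) = (A mod 2 ^ ?m * n) div 2 ^ ?m"
   using ev_carry[OF std3, of b ?i A] b' unfolding i by simp
  have "ev w b cap ?e (E(3 := j)) \<noteq> 0 \<longleftrightarrow> odd ((A mod 2 ^ ?m * n) div 2 ^ ?m + of_bool (odd (A div 2 ^ ?m)) * n)"
   unfolding ev_aMod ev.simps(1,5) ev_Add ev_aMul c i mc b'[OF order_refl] ev_eN[OF std3] even_iff_mod_2_eq_zero ..
  then have e: "ev w b cap ?e (E(3 := j)) \<noteq> 0 \<longleftrightarrow> odd (A * n div 2 ^ ?m)" unfolding odd_product[of A n ?m] .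
  have "sem w cap (Put ?i ?e) (E(3 := j)) (b, s) = (b(?m := odd (A * n div 2 ^ ?m)), s)"
   unfolding sem.simps fst_conv snd_conv e i mc ..
  then have "rec_nat (a, s) (\<lambda>j. sem w cap (Put ?i ?e) (E(3 := j))) (Suc j) = (b(?m := odd (A * n div 2 ^ ?m)), s)"
   using b(1) by simp
  moreover have "(b(?m := odd (A * n div 2 ^ ?m))) i = odd ((if B \<le> i + Suc j then A * n else A) div 2 ^ i)" if "i < B" for i
  proof (cases "i = ?m")
   case False
   then have "B \<le> i + j \<longleftrightarrow> B \<le> i + Suc j" using Suc.prems that by linarith
   then show ?thesis using b(2)[OF that] False by simp
  qed (use Suc.prems in simp)
  ultimately show ?case by blast
 qed
 from this[of B] show ?thesis using E unfolding mult_stm_def Let_def sem.simps(3) by simp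
qed

lemma sem_power:
 assumes E: "std E"
 shows "\<exists>a'. sem w cap (Put (Con 0) (Con 1) ; For 2 eK mult_stm) E ((\<lambda>_. False), s) = (a', s) \<and> (\<forall>i<B. a' i = odd (n ^ k div 2 ^ i))"
proof -
 let ?a = "(\<lambda>_. False)(0 := True)"
 have "\<exists>a'. rec_nat (?a, s) (\<lambda>j. sem w cap mult_stm (E(2 := j))) j = (a', s) \<and> (\<forall>i<B. a' i = odd (n ^ j div 2 ^ i))" for j
 proof (induction j)
  case 0
  have "?a i = odd (1 div 2 ^ i :: nat)" for i
  proof (cases i)
   case (Suc m)
   have "(1 :: nat) < 2 ^ Suc m" by (rule one_less_power) simp_all
   then have "(1 :: nat) div 2 ^ i = 0" unfolding Suc by (rule div_less)
   then show ?thesis using Suc by simp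
  qed simp
  then show ?case by simp
 next
  case (Suc j)
  then obtain b where b: "rec_nat (?a, s) (\<lambda>j. sem w cap mult_stm (E(2 := j))) j = (b, s)" "\<And>i. i < B \<Longrightarrow> b i = odd (n ^ j div 2 ^ i)" by blast
  have "std (E(2 := j))" using E by simp
  from sem_mult[OF this b(2)] obtain a' where a': "sem w cap mult_stm (E(2 := j)) (b, s) = (a', s)"
   "\<forall>i<B. a' i = odd (n ^ j * n div 2 ^ i)" by blast
  have "rec_nat (?a, s) (\<lambda>j. sem w cap mult_stm (E(2 := j))) (Suc j) = (a', s)"
   unfolding nat.rec(2) b(1) by (rule a'(1))
  with a'(2) show ?case unfolding power_Suc2 by blast
 qed
 from this[of k] show ?thesis using E by simp
qed

abbreviation "I c v \<equiv> (Suc c, v) \<in> El"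

definition slot where "slot c v = (if I c v then B * (c mod 2) + card ({..<v} \<inter> {u. I c u}) else 2 * B)"

lemma ev_eSlot: "std E \<Longrightarrow> (\<And>i. ev w a q c (E(3 := i)) = ev w a q c E) \<Longrightarrow>
  ev w a q (eSlot c v) E = slot (ev w a q c E) (ev w a q v E)"
 by (simp add: eSlot_def eIn_def slot_def)

definition chk :: "(nat \<Rightarrow> bool) \<Rightarrow> nat \<Rightarrow> nat \<Rightarrow> bool" where
 "chk b c v \<longleftrightarrow> (let g = (\<lambda>c v j. b (min (2 * slot c v + j) cap)) in I c v \<longrightarrow> \<not> (g c v 0 \<and> g c v 1) \<and>
   (\<forall>u<v. I c u \<and> ((u, v) \<in> Ed \<or> (v, u) \<in> Ed) \<longrightarrow> \<not> (g c u 0 = g c v 0 \<and> g c u 1 = g c v 1)) \<and>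
   (c \<noteq> 0 \<and> I (c - 1) v \<longrightarrow> g (c - 1) v 0 = g c v 0 \<and> g (c - 1) v 1 = g c v 1))"

lemma ev_color:
 assumes E: "std E"
 shows "ev w b cap color_exp E \<noteq> 0 \<longleftrightarrow> chk b (E 2 div NN) (E 2 mod NN)"
proof -
 let ?c = "E 2 div NN" and ?v = "E 2 mod NN" and ?g = "\<lambda>c v j. b (min (2 * slot c v + j) cap)"
 let ?p = "Sub eBag (Con 1)"
 have bag: "ev w b cap eBag E' = E' 2 div NN" "ev w b cap eVert E' = E' 2 mod NN"
  "ev w b cap eBag (E'(3 := i)) = ev w b cap eBag E'" "ev w b cap ?p (E'(3 := i)) = ev w b cap ?p E'" if "std E'" for E' i
  using that by (simp_all add: eBag_def eVert_def)
 have all: "ev w b cap (aAll z m e) E' \<noteq> 0 \<longleftrightarrow> (\<forall>i<ev w b cap m E'. ev w b cap e (E'(z := i)) \<noteq> 0)" for z m e E' by simp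
 have op: "ev w b cap (aAnd d e) E' \<noteq> 0 \<longleftrightarrow> ev w b cap d E' \<noteq> 0 \<and> ev w b cap e E' \<noteq> 0"
  "ev w b cap (aOr d e) E' \<noteq> 0 \<longleftrightarrow> ev w b cap d E' \<noteq> 0 \<or> ev w b cap e E' \<noteq> 0"
  "ev w b cap (aNot d) E' \<noteq> 0 \<longleftrightarrow> \<not> ev w b cap d E' \<noteq> 0"
  "ev w b cap (aImp d e) E' \<noteq> 0 \<longleftrightarrow> (ev w b cap d E' \<noteq> 0 \<longrightarrow> ev w b cap e E' \<noteq> 0)" for d e E' by auto
 have at: "ev w b cap (eIn d e) E' \<noteq> 0 \<longleftrightarrow> I (ev w b cap d E') (ev w b cap e E')"
  "ev w b cap (eEdge d e) E' \<noteq> 0 \<longleftrightarrow> (ev w b cap d E', ev w b cap e E') \<in> Ed" if "std E'" for d e E'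
  using that by (simp_all add: eIn_def)
 have sl: "ev w b cap (eBit j eBag v) E' \<noteq> 0 \<longleftrightarrow> ?g (ev w b cap eBag E') (ev w b cap v E') j"
  "ev w b cap (eBit j ?p v) E' \<noteq> 0 \<longleftrightarrow> ?g (ev w b cap ?p E') (ev w b cap v E') j" if "std E'" for j v E'
  using that ev_eSlot[OF that bag(3)[OF that]] ev_eSlot[OF that bag(4)[OF that]] by (simp_all add: eBit_def del: ev_Sub ev.simps(3))
 have same: "ev w b cap (eSame c' v' c v) E' \<noteq> 0 \<longleftrightarrow> (ev w b cap (eBit 0 c' v') E' \<noteq> 0) = (ev w b cap (eBit 0 c v) E' \<noteq> 0) \<and>
   (ev w b cap (eBit 1 c' v') E' \<noteq> 0) = (ev w b cap (eBit 1 c v) E' \<noteq> 0)" for c' v' c v E'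
  by (simp add: eSame_def eBit_def)
 have p: "ev w b cap ?p E = ?c - 1" "std (E(4 := i))" "ev w b cap (Var 4) (E(4 := i)) = i" "(E(4 := i)) 2 = E 2" for i
  using E bag(1)[OF E] by simp_all
 show ?thesis unfolding color_exp_def chk_def Let_def
  by (simp only: op(1,2,4) op(3) all same sl[OF E] sl[OF p(2)] at[OF E] at[OF p(2)] bag(1,2)[OF E] bag(1,2)[OF p(2)] p)
qed

primrec arr :: "(nat \<Rightarrow> bool) \<Rightarrow> (nat \<Rightarrow> bool) \<Rightarrow> nat \<Rightarrow> nat \<Rightarrow> bool" where
 "arr b ch 0 = b"
| "arr b ch (Suc t) = (arr b ch t)(min (2 * slot (t div NN) (t mod NN)) cap := ch (2 * t),
   min (2 * slot (t div NN) (t mod NN) + 1) cap := ch (2 * t + 1))"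

lemma sem_color:
 assumes E: "std E"
 shows "snd (snd (snd (sem w cap (For 2 (aMul (eC eN) eNv) color_stm) E (b, v, ch, ok)))) \<longleftrightarrow>
  ok \<and> (\<forall>t<NB * NN. chk (arr b ch (Suc t)) (t div NN) (t mod NN))"
proof -
 have s: "ev w b' cap (eSlot eBag eVert) (E(2 := t)) = slot (t div NN) (t mod NN)" for b' t
  using E by (subst ev_eSlot) (simp_all add: eBag_def eVert_def)
 have c: "ev w b' cap color_exp (E(2 := t)) \<noteq> 0 \<longleftrightarrow> chk b' (t div NN) (t mod NN)" for b' t
  using ev_color[of "E(2 := t)" b'] E by simp
 have body: "sem w cap color_stm (E(2 := t)) (b', v, ch', ok') =
   (let b'' = b'(min (2 * slot (t div NN) (t mod NN)) cap := ch' 0, min (2 * slot (t div NN) (t mod NN) + 1) cap := ch' (Suc 0))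
    in (b'', v, (\<lambda>i. ch' (Suc (Suc i))), ok' \<and> chk b'' (t div NN) (t mod NN)))" for b' ch' ok' t
  unfolding color_stm_def sem.simps Let_def by (simp only: fst_conv snd_conv c ev_aMul ev.simps(1) ev_Add s)
 have "rec_nat (b, v, ch, ok) (\<lambda>t. sem w cap color_stm (E(2 := t))) m =
  (arr b ch m, v, (\<lambda>i. ch (2 * m + i)), ok \<and> (\<forall>t<m. chk (arr b ch (Suc t)) (t div NN) (t mod NN)))" for m
 proof (induction m)
  case (Suc m)
  have a: "(arr b ch m)(min (2 * slot (m div NN) (m mod NN)) cap := ch (2 * m + 0),
    min (2 * slot (m div NN) (m mod NN) + 1) cap := ch (2 * m + Suc 0)) = arr b ch (Suc m)" by simp
  show ?case unfolding nat.rec(2) Suc body Let_def a by (simp add: All_less_Suc conj_ac del: arr.simps)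
 qed simp
 moreover have "ev w b cap (aMul (eC eN) eNv) E = NB * NN" using E by simp
 ultimately show ?thesis by simp
qed

lemma verifier:
 assumes E: "std E"
 shows "\<exists>b. snd (snd (snd (sem w cap verifier_stm E ((\<lambda>_. False), v, ch, True)))) \<longleftrightarrow>
  static \<and> wide_ok \<and> (\<forall>t<NB * NN. chk (arr b ch (Suc t)) (t div NN) (t mod NN))"
proof -
 let ?s = "(v, ch, static)"
 obtain b where b: "sem w cap (Put (Con 0) (Con 1) ; For 2 eK mult_stm) E ((\<lambda>_. False), ?s) = (b, ?s)"
  "\<And>i. i < B \<Longrightarrow> b i = odd (n ^ k div 2 ^ i)" using sem_power[OF E] by blast
 have wd: "ev w b cap width_exp E \<noteq> 0 \<longleftrightarrow> wide_ok"
 proof -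
  have "ev w b cap width_exp E \<noteq> 0 \<longleftrightarrow> (\<forall>d<Suc NB. \<exists>i<B. card ({..<NN} \<inter> {v. (d, v) \<in> El}) \<le> Suc i \<and> b i)"
   using E by (simp add: width_exp_def)
  also have "\<dots> \<longleftrightarrow> wide_ok" unfolding wide_ok_def by (simp only: less_Suc_eq_le b(2) cong: conj_cong)
  finally show ?thesis .
 qed
 have st: "sem w cap (Assert static_exp) E ((\<lambda>_. False), v, ch, True) = ((\<lambda>_. False), ?s)"
  using ev_static[OF E] by simp
 have sp: "sem w cap (For 2 eK mult_stm) E (sem w cap (Put (Con 0) (Con 1)) E ((\<lambda>_. False), ?s)) = (b, ?s)"
  using b(1) by (simp only: sem.simps(2))
 have "sem w cap (Assert width_exp) E (b, ?s) = (b, v, ch, static \<and> wide_ok)"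
  using wd by simp
 then have "sem w cap verifier_stm E ((\<lambda>_. False), v, ch, True) =
   sem w cap (For 2 (aMul (eC eN) eNv) color_stm) E (b, v, ch, static \<and> wide_ok)"
  unfolding verifier_stm_def sem.simps(2) st sp by (simp only:)
 then show ?thesis using sem_color[OF E, of b v ch "static \<and> wide_ok"] by (intro exI[of _ b]) (simp only: conj_assoc)
qed

abbreviation "linked u v \<equiv> (u, v) \<in> Ed \<or> (v, u) \<in> Ed"

context
 assumes wide: wide_ok and bounded: "\<And>c v. I c v \<Longrightarrow> c < NB \<and> v < NN"
begin

text \<open>The width test gives some \<open>i < B\<close> with bag size at most
  \<open>Suc i\<close>, and the rank of a member is smaller than the bag size.\<close>

lemma rank_less: "I c v \<Longrightarrow> card ({..<v} \<inter> {u. I c u}) < B"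
proof -
 assume I: "I c v"
 then have "Suc c \<le> NB" using bounded by (simp add: Suc_le_eq)
 with wide obtain i where "i < B" "card ({..<NN} \<inter> {u. I c u}) \<le> Suc i" unfolding wide_ok_def by blast
 moreover have "card ({..<v} \<inter> {u. I c u}) < card ({..<NN} \<inter> {u. I c u})"
  using I bounded[OF I] by (intro psubset_card_mono) auto
 ultimately show ?thesis by linarith
qed

text \<open>Members of one bag differ in rank, and consecutive bags differ in parity, with ranks
  below \<open>B\<close> keeping the two halves apart.\<close>

lemma slot_distinct:
 assumes I: "I c v" and I': "I c' v'" and c: "c = c' \<or> c = Suc c'" and ne: "(c, v) \<noteq> (c', v')"
 shows "slot c v \<noteq> slot c' v'"
proof (cases "c = c'")
 case True
 with ne have "v \<noteq> v'" by simp
 have m: "card ({..<a} \<inter> {u. I c u}) < card ({..<b} \<inter> {u. I c u})" if "a < b" "I c a" for a b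
  using that by (intro psubset_card_mono) auto
 from \<open>v \<noteq> v'\<close> have "v < v' \<or> v' < v" by linarith
 then show ?thesis using m[of v v'] m[of v' v] I I' True by (auto simp: slot_def)
next
 case False
 then have "c mod 2 \<noteq> c' mod 2" using c by presburger
 moreover have "c mod 2 < 2" "c' mod 2 < 2" by simp_all
 ultimately have "c mod 2 = 0 \<and> c' mod 2 = 1 \<or> c mod 2 = 1 \<and> c' mod 2 = 0" by linarith
 then show ?thesis using rank_less[OF I] rank_less[OF I'] I I' by (auto simp: slot_def)
qed

lemma slot_le: "slot c v \<le> 2 * B" "I c v \<Longrightarrow> slot c v < 2 * B"
proof -
 show *: "slot c v < 2 * B" if "I c v"
 proof -
  have "c mod 2 \<le> 1" by presburger
  from mult_le_mono2[OF this, of B] have "B * (c mod 2) \<le> B" by simp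
  then show ?thesis using rank_less[OF that] that unfolding slot_def by (simp only: if_True)
 qed
 show "slot c v \<le> 2 * B" using * by (cases "I c v") (auto simp: slot_def)
qed

text \<open>The bits guessed in round \<open>t'\<close> are intact until the end of the next bag:
  later writes up to then come from other members of the same or the next bag, excluded by
  \<open>slot_distinct\<close>, or go to the dummy slot.\<close>

lemma arr_slot:
 assumes "t < NB * NN" "t' \<le> t" "I (t' div NN) (t' mod NN)" "t div NN \<le> Suc (t' div NN)" "j < 2"
 shows "arr b ch (Suc t) (min (2 * slot (t' div NN) (t' mod NN) + j) cap) = ch (2 * t' + j)"
 using assms
proof (induction t)
 case 0
 then have t': "t' = 0" by simp
 have m: "min (2 * slot 0 0 + i) cap = 2 * slot 0 0 + i" if "i < 2" for i
  using slot_le(1)[of 0 0] that by (intro min_absorb1) linarith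
 show ?case using 0(5) m[of 0] m[of 1] m[OF 0(5)] by (cases "j = 0") (auto simp: t' less_2_cases_iff)
next
 case (Suc t)
 let ?s = "slot (t' div NN) (t' mod NN)" and ?r = "slot (Suc t div NN) (Suc t mod NN)"
 have m: "min (2 * slot c v + i) cap = 2 * slot c v + i" if "i < 2" for c v i
  using slot_le(1)[of c v] that by (intro min_absorb1) linarith
 have m0: "min (2 * slot c v) cap = 2 * slot c v" for c v using m[of 0] by simp
 have m1: "min (2 * slot c v + 1) cap = 2 * slot c v + 1" for c v by (rule m) simp
 have e: "arr b ch (Suc (Suc t)) = (arr b ch (Suc t))(2 * ?r := ch (2 * Suc t), 2 * ?r + 1 := ch (2 * Suc t + 1))"
  unfolding arr.simps(2)[of b ch "Suc t"] m0 m1 ..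
 show ?case
 proof (cases "t' = Suc t")
  case True
  have "j = 0 \<or> j = 1" using Suc.prems(5) by linarith
  then show ?thesis unfolding e m[OF Suc.prems(5)] True by auto
 next
  case False
  then have t': "t' \<le> t" using Suc.prems(2) by simp
  have d: "t div NN \<le> Suc t div NN" "t' div NN \<le> Suc t div NN" using t' by (simp_all add: div_le_mono)
  have ih: "arr b ch (Suc t) (min (2 * ?s + j) cap) = ch (2 * t' + j)"
   using Suc.prems(1) by (intro Suc.IH t' Suc.prems(3,5) le_trans[OF d(1) Suc.prems(4)]) simp
  have "?r \<noteq> ?s"
  proof (cases "I (Suc t div NN) (Suc t mod NN)")
   case True
   have "(Suc t div NN, Suc t mod NN) \<noteq> (t' div NN, t' mod NN)"
   proof
    assume "(Suc t div NN, Suc t mod NN) = (t' div NN, t' mod NN)"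
    then have "Suc t = t'" by (metis Pair_inject mult_div_mod_eq)
    with t' show False by simp
   qed
   moreover have "Suc t div NN = t' div NN \<or> Suc t div NN = Suc (t' div NN)" using d(2) Suc.prems(4) by linarith
   ultimately show ?thesis using slot_distinct[OF True Suc.prems(3)] by blast
  next
   case False
   then have "?r = 2 * B" by (simp add: slot_def)
   then show ?thesis using slot_le(2)[OF Suc.prems(3)] by simp
  qed
  then have "2 * ?s + j \<noteq> 2 * ?r" "2 * ?s + j \<noteq> 2 * ?r + 1" using Suc.prems(5) by presburger+
  then show ?thesis using ih unfolding e m[OF Suc.prems(5)] by simp
 qed
qed

text \<open>All reads of the check concern the current bag, up to the current vertex, or the
  previous bag. So \<open>arr_slot\<close> replaces the array by the stream, and the initial content
  \<open>b\<close> disappears.\<close>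

lemma chk_colors:
 "(\<forall>t<NB * NN. chk (arr b ch (Suc t)) (t div NN) (t mod NN)) \<longleftrightarrow> (\<forall>c<NB. \<forall>v<NN. colors_ok I linked NN ch c v)"
  (is "_ \<longleftrightarrow> (\<forall>c<NB. \<forall>v<NN. ?C c v)")
proof -
 have eq: "chk (arr b ch (Suc (c * NN + v))) c v \<longleftrightarrow> ?C c v" if cv: "c < NB" "v < NN" for c v
 proof -
  let ?t = "c * NN + v"
  define g where "g c' u j = arr b ch (Suc ?t) (min (2 * slot c' u + j) cap)" for c' u j
  have "(c + 1) * NN \<le> NB * NN" using cv by (intro mult_le_mono1) simp
  then have t: "?t < NB * NN" using cv by simp
  have dm: "(c' * NN + u) div NN = c'" "(c' * NN + u) mod NN = u" if "u < NN" for c' u using that by simp_all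
  have g: "g c' u j = ch (2 * (c' * NN + u) + j)" if "u \<le> v" "c' \<le> c" "c \<le> Suc c'" "I c' u" "j < 2" for c' u j
  proof -
   have u: "u < NN" using that cv by simp
   have "c' * NN + u \<le> ?t" using that(1,2) by (intro add_le_mono mult_le_mono1)
   from arr_slot[OF t this, of j b ch] show ?thesis unfolding g_def dm[OF u] dm[OF cv(2)] using that by simp
  qed
  note g0 = g[of _ _ 0, simplified] and g1 = g[of _ _ 1, simplified]
  show ?thesis
  proof (cases "I c v")
   case True
   have v: "g c v 0 = ch (2 * ?t)" "g c v 1 = ch (2 * ?t + 1)" using g0[of v c] g1[of v c] True by simp_all
   have u: "g c u 0 = ch (2 * (c * NN + u))" "g c u 1 = ch (2 * (c * NN + u) + 1)" if "u < v" "I c u" for u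
    using g0[of u c] g1[of u c] that by simp_all
   have p: "g (c - 1) v 0 = ch (2 * ((c - 1) * NN + v))" "g (c - 1) v 1 = ch (2 * ((c - 1) * NN + v) + 1)"
    if "0 < c" "I (c - 1) v" using g0[of v "c - 1"] g1[of v "c - 1"] that by simp_all
   show ?thesis unfolding chk_def Let_def g_def[symmetric] v neq0_conv by (simp only: u p cong: conj_cong imp_cong)
  qed (simp add: chk_def)
 qed
 show ?thesis
 proof
  assume L: "\<forall>t<NB * NN. chk (arr b ch (Suc t)) (t div NN) (t mod NN)"
  show "\<forall>c<NB. \<forall>v<NN. ?C c v"
  proof (rule allI, rule impI, rule allI, rule impI)
   fix c v assume cv: "c < NB" "v < NN"
   have "(c + 1) * NN \<le> NB * NN" using cv by (intro mult_le_mono1) simp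
   then have "c * NN + v < NB * NN" using cv by simp
   with L have "chk (arr b ch (Suc (c * NN + v))) ((c * NN + v) div NN) ((c * NN + v) mod NN)" by blast
   moreover have "(c * NN + v) div NN = c" "(c * NN + v) mod NN = v" using cv by simp_all
   ultimately have "chk (arr b ch (Suc (c * NN + v))) c v" by (simp only:)
   with eq[OF cv] show "?C c v" by (rule iffD1)
  qed
 next
  assume R: "\<forall>c<NB. \<forall>v<NN. ?C c v"
  show "\<forall>t<NB * NN. chk (arr b ch (Suc t)) (t div NN) (t mod NN)"
  proof (intro allI impI)
   fix t assume t: "t < NB * NN"
   then have "0 < NN" by (cases "NN = 0") auto
   then have cv: "t div NN < NB" "t mod NN < NN" using t by (simp_all add: less_mult_imp_div_less)
   from R cv have "?C (t div NN) (t mod NN)" by blast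
   with eq[OF cv] have "chk (arr b ch (Suc (t div NN * NN + t mod NN))) (t div NN) (t mod NN)" by (rule iffD2)
   then show "chk (arr b ch (Suc t)) (t div NN) (t mod NN)" unfolding div_mult_mod_eq .
  qed
 qed
qed

end

end

section \<open>Agreement of the tests with the graph-theoretic notions\<close>

lemma length_concat_le: "length (concat bs) \<le> length (enc_list (enc_list enc_nat) bs)"
proof (induction bs)
 case (Cons b bs)
 then show ?case using length_enc_list_ge[of b enc_nat] by simp
qed simp

text \<open>For the converse direction the witness is the leading bit of \<open>M\<close>;
  \<open>M < 2 ^ B\<close> places it below \<open>B\<close>.\<close>

lemma top_bit:
 fixes M :: nat
 assumes "1 \<le> M" "M < 2 ^ B"
 shows "(\<exists>i<B. m \<le> Suc i \<and> odd (M div 2 ^ i)) \<longleftrightarrow> 2 ^ (m - 1) \<le> M"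
proof
 assume "\<exists>i<B. m \<le> Suc i \<and> odd (M div 2 ^ i)"
 then obtain i where i: "m \<le> Suc i" "odd (M div 2 ^ i)" by blast
 then have "M div 2 ^ i \<noteq> 0" by (metis even_zero)
 then have "2 ^ i \<le> M" by (metis div_less not_less)
 moreover have "(2 :: nat) ^ (m - 1) \<le> 2 ^ i" using i(1) by (intro power_increasing) auto
 ultimately show "2 ^ (m - 1) \<le> M" by (rule le_trans[rotated])
next
 assume le: "2 ^ (m - 1) \<le> M"
 let ?l = "length (binary M)"
 have l: "m - 1 < ?l" using le by (simp add: less_length_binary)
 then have b: "binary M \<noteq> []" by auto
 have "binary M ! (?l - 1) = odd (M div 2 ^ (?l - 1))" by (rule nth_binary) (use l in simp)
 then have o: "odd (M div 2 ^ (?l - 1))" using last_binary[OF b] by (simp add: last_conv_nth[OF b])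
 have "2 ^ (?l - 1) \<le> M" using l by (simp add: less_length_binary[symmetric])
 then have "(2 :: nat) ^ (?l - 1) < 2 ^ B" using assms(2) by (rule le_less_trans)
 then have "?l - 1 < B" by simp
 then show "\<exists>i<B. m \<le> Suc i \<and> odd (M div 2 ^ i)" using o l by (intro exI[of _ "?l - 1"]) auto
qed

text \<open>For \<open>m = 0\<close> the truncated and the real difference disagree, but both sides
  hold because \<open>1 \<le> n\<close>.\<close>

lemma power_le_iff_log:
 assumes "1 \<le> n"
 shows "2 ^ (m - 1) \<le> n ^ k \<longleftrightarrow> real m - 1 \<le> real k * log 2 (real n)"
proof (cases m)
 case 0
 have "0 \<le> real k * log 2 (real n)" using assms by simp
 then have "real m - 1 \<le> real k * log 2 (real n)" using 0 by linarith
 moreover have "2 ^ (m - 1) \<le> n ^ k" using 0 assms by simp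
 ultimately show ?thesis by blast
next
 case (Suc i)
 have "real i \<le> log 2 (real (n ^ k)) \<longleftrightarrow> 2 powr real i \<le> real (n ^ k)" using assms by (intro le_log_iff) auto
 also have "\<dots> \<longleftrightarrow> real (2 ^ i) \<le> real (n ^ k)" by (simp add: powr_realpow)
 also have "\<dots> \<longleftrightarrow> 2 ^ i \<le> n ^ k" by (simp only: of_nat_le_iff)
 finally show ?thesis using Suc assms by (simp add: log_nat_power)
qed

lemma ball_map_set: "(\<forall>B\<in>set (map set bs). Q B) \<longleftrightarrow> (\<forall>c<length bs. Q (set (bs ! c)))"
 by (simp add: all_set_conv_all_nth)

lemma bex_map_set: "(\<exists>B\<in>set (map set bs). Q B) \<longleftrightarrow> (\<exists>c<length bs. Q (set (bs ! c)))"
 using ball_map_set[of bs "\<lambda>B. \<not> Q B"] by blast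

locale graph_instance = instance_env +
 fixes N :: nat and es :: "(nat \<times> nat) list" and bs :: "nat list list"
 assumes x: "x = enc_graph_pd N es bs"
begin

lemma run0: "run 0 x"
 unfolding run_iff using x by blast

lemma Ed_eq: "Ed = set es" and NB_eq: "NB = length bs"
 using sets_graph[OF x] bag_count_conv[of 0 x] by simp_all

lemma I_iff: "I c v \<longleftrightarrow> c < length bs \<and> v \<in> set (bs ! c)"
 unfolding sets_graph(2)[OF x] by simp

lemma El_pos: "(d, v) \<in> El \<Longrightarrow> \<exists>c. d = Suc c"
 unfolding sets_graph(2)[OF x] by auto

lemma mt0: "mt 0 N"
 unfolding mt_def drop_0 by (subst x) (simp add: enc_graph_pd_def)

lemma n_pos: "1 \<le> n"
proof -
 have "1 \<le> length (enc_nat N)" by (simp add: length_enc_nat)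
 also have "\<dots> \<le> n" by (simp add: x enc_graph_pd_def)
 finally show ?thesis .
qed

lemma path_decomposition_iff:
 "path_decomposition (graph_of N es) (map set bs) \<longleftrightarrow> 0 < NB \<and> (\<forall>c v. I c v \<longrightarrow> v < N) \<and> (\<forall>v<N. \<exists>c. I c v) \<and>
   (\<forall>(u, v)\<in>set es. \<exists>c. I c u \<and> I c v) \<and> (\<forall>a b c v. I a v \<and> I b v \<and> a \<le> c \<and> c \<le> b \<longrightarrow> I c v)"
proof -
 let ?G = "graph_of N es" and ?P = "map set bs"
 have 1: "?P \<noteq> [] \<longleftrightarrow> 0 < NB" by (simp add: NB_eq)
 have 2: "(\<forall>B\<in>set ?P. B \<subseteq> pverts ?G) \<longleftrightarrow> (\<forall>c v. I c v \<longrightarrow> v < N)"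
  unfolding ball_map_set I_iff by (auto simp: graph_of_def)
 have 3: "(\<forall>v\<in>pverts ?G. \<exists>B\<in>set ?P. v \<in> B) \<longleftrightarrow> (\<forall>v<N. \<exists>c. I c v)"
  unfolding bex_map_set I_iff by (simp add: graph_of_def Ball_def)
 have 4: "(\<forall>(u, v)\<in>parcs ?G. \<exists>B\<in>set ?P. u \<in> B \<and> v \<in> B) \<longleftrightarrow> (\<forall>(u, v)\<in>set es. \<exists>c. I c u \<and> I c v)"
  unfolding bex_map_set I_iff by (auto simp: graph_of_def)
 have 5: "(\<forall>i j l v. i \<le> j \<and> j \<le> l \<and> l < length ?P \<and> v \<in> ?P ! i \<and> v \<in> ?P ! l \<longrightarrow> v \<in> ?P ! j) \<longleftrightarrow>
   (\<forall>a b c v. I a v \<and> I b v \<and> a \<le> c \<and> c \<le> b \<longrightarrow> I c v)" (is "?L \<longleftrightarrow> ?R")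
 proof
  assume L: ?L
  show ?R
  proof (intro allI impI)
   fix a b c v assume a: "I a v \<and> I b v \<and> a \<le> c \<and> c \<le> b"
   with L[rule_format, of a c b v] show "I c v" unfolding I_iff by auto
  qed
 next
  assume R: ?R
  show ?L
  proof (intro allI impI)
   fix i j l v assume a: "i \<le> j \<and> j \<le> l \<and> l < length ?P \<and> v \<in> ?P ! i \<and> v \<in> ?P ! l"
   with R[rule_format, of i v l j] show "v \<in> ?P ! j" unfolding I_iff by auto
  qed
 qed
 show ?thesis unfolding path_decomposition_def 1 2 3 4 5 ..
qed

text \<open>Every vertex occurs in some bag, and every occurrence takes at least one bit of the
  input.\<close>

lemma N_le:
 assumes "path_decomposition (graph_of N es) (map set bs)"
 shows "N \<le> n"
proof -
 have "{..<N} \<subseteq> set (concat bs)"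
 proof
  fix v assume "v \<in> {..<N}"
  with assms obtain c where "I c v" unfolding path_decomposition_iff by blast
  then have "c < length bs" "v \<in> set (bs ! c)" unfolding I_iff by simp_all
  then show "v \<in> set (concat bs)" using nth_mem[of c bs] by auto
 qed
 then have "N \<le> card (set (concat bs))" using card_mono[of "set (concat bs)" "{..<N}"] by simp
 also have "\<dots> \<le> length (concat bs)" by (rule card_length)
 also have "\<dots> \<le> length (enc_list (enc_list enc_nat) bs)" by (rule length_concat_le)
 also have "\<dots> \<le> n" by (simp add: x enc_graph_pd_def)
 finally show ?thesis .
qed

lemma static_iff:
 assumes N: "N \<le> n"
 shows "static \<longleftrightarrow> pair_graph (graph_of N es) \<and> path_decomposition (graph_of N es) (map set bs)"
proof -
 note NN = NN_eq[OF mt0 N]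
 have 1: "\<exists>c\<le>n. mt 0 c" using mt0 N by blast
 have 2: "(\<forall>i<n. P 12 i \<longrightarrow> (\<exists>u<N. \<exists>v<N. u \<noteq> v \<and> mt (i + 1) u \<and> mt (i + 2 + 2 * length (binary u)) v)) \<longleftrightarrow>
   (\<forall>(u, v)\<in>set es. u < N \<and> v < N \<and> u \<noteq> v)" (is "?L \<longleftrightarrow> ?R")
 proof
  assume L: ?L
  have "u < N \<and> v < N \<and> u \<noteq> v" if uv: "(u, v) \<in> set es" for u v
  proof -
   from uv obtain i where i: "P 12 i" "mt (i + 1) u" "mt (i + 2 + 2 * length (binary u)) v"
    unfolding Ed_eq[symmetric] edge_set_iff by blast
   with L obtain u' v' where u': "u' < N" "v' < N" "u' \<noteq> v'" "mt (i + 1) u'" "mt (i + 2 + 2 * length (binary u')) v'" by blast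
   have "u' = u" by (rule mt_unique[OF u'(4) i(2)])
   moreover from this have "v' = v" using mt_unique[OF _ i(3)] u'(5) by blast
   ultimately show ?thesis using u' by simp
  qed
  then show ?R by blast
 next
  assume R: ?R
  show ?L
  proof (intro allI impI)
   fix i assume "P 12 i"
   from edge_at[OF run0 this] obtain u v where uv: "mt (i + 1) u" "mt (i + 2 + 2 * length (binary u)) v" by blast
   then have "(u, v) \<in> set es" unfolding Ed_eq[symmetric] edge_set_iff using \<open>P 12 i\<close> by blast
   with R uv show "\<exists>u<N. \<exists>v<N. u \<noteq> v \<and> mt (i + 1) u \<and> mt (i + 2 + 2 * length (binary u)) v" by blast
  qed
 qed
 have 3: "(\<forall>i<n. P 14 i \<longrightarrow> (\<exists>v<N. mt (i + 1) v)) \<longleftrightarrow> (\<forall>c v. I c v \<longrightarrow> v < N)" (is "?L \<longleftrightarrow> ?R")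
 proof
  assume L: ?L
  show ?R
  proof (intro allI impI)
   fix c v assume "I c v"
   then obtain i where i: "P 14 i" "mt (i + 1) v" unfolding elem_set_iff by blast
   with L obtain v' where "v' < N" "mt (i + 1) v'" by blast
   with mt_unique[OF i(2)] show "v < N" by blast
  qed
 next
  assume R: ?R
  show ?L
  proof (intro allI impI)
   fix i assume i: "P 14 i"
   from elem_at[OF run0 this] obtain v where v: "mt (i + 1) v" by blast
   then have "(bag_no 0 x i, v) \<in> El" unfolding elem_set_iff using i by blast
   with El_pos[OF this] obtain c where "I c v" by auto
   with R have "v < N" by simp
   with v show "\<exists>v<N. mt (i + 1) v" by blast
  qed
 qed
 have le: "Suc c \<le> NB" if "I c v" for c v using that unfolding I_iff NB_eq by simp
 have 5: "(\<exists>d\<le>NB. (d, v) \<in> El) \<longleftrightarrow> (\<exists>c. I c v)" "(\<exists>d\<le>NB. (d, u) \<in> El \<and> (d, v) \<in> El) \<longleftrightarrow> (\<exists>c. I c u \<and> I c v)" for u v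
  by (metis El_pos le)+
 have 7: "(\<forall>v<N. \<forall>a\<le>NB. \<forall>b\<le>NB. \<forall>c\<le>NB. (a, v) \<in> El \<and> (b, v) \<in> El \<and> a \<le> c \<and> c \<le> b \<longrightarrow> (c, v) \<in> El) \<longleftrightarrow>
   (\<forall>a b c v. I a v \<and> I b v \<and> a \<le> c \<and> c \<le> b \<longrightarrow> I c v)" (is "?L \<longleftrightarrow> ?R") if I: "\<forall>c v. I c v \<longrightarrow> v < N"
 proof
  assume L: ?L
  show ?R
  proof (intro allI impI)
   fix a b c v assume a: "I a v \<and> I b v \<and> a \<le> c \<and> c \<le> b"
   moreover from this have "Suc a \<le> NB" "Suc b \<le> NB" using le by blast+
   ultimately show "I c v" using L[rule_format, of v "Suc a" "Suc b" "Suc c"] I by auto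
  qed
 next
  assume R: ?R
  show ?L
  proof (intro allI impI)
   fix v a b c assume a: "(a, v) \<in> El \<and> (b, v) \<in> El \<and> a \<le> c \<and> c \<le> b"
   then obtain a' b' where "a = Suc a'" "b = Suc b'" using El_pos by metis
   with a have ab: "a = Suc a'" "I a' v" "b = Suc b'" "I b' v" by auto
   then obtain c' where "c = Suc c'" using a by (cases c) auto
   with R[rule_format, of a' v b' c'] a ab show "(c, v) \<in> El" by simp
  qed
 qed
 have 6: "(\<forall>u<N. \<forall>v<N. (u, v) \<in> Ed \<longrightarrow> (\<exists>c. I c u \<and> I c v)) \<longleftrightarrow> (\<forall>(u, v)\<in>set es. \<exists>c. I c u \<and> I c v)"
  if "\<forall>(u, v)\<in>set es. u < N \<and> v < N \<and> u \<noteq> v" using that unfolding Ed_eq by blast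
 define Q2 Q3 Q6 Q7 Q6' Q7' where "Q2 \<longleftrightarrow> (\<forall>(u, v)\<in>set es. u < N \<and> v < N \<and> u \<noteq> v)" and "Q3 \<longleftrightarrow> (\<forall>c v. I c v \<longrightarrow> v < N)"
  and "Q6 \<longleftrightarrow> (\<forall>(u, v)\<in>set es. \<exists>c. I c u \<and> I c v)"
  and "Q7 \<longleftrightarrow> (\<forall>a b c v. I a v \<and> I b v \<and> a \<le> c \<and> c \<le> b \<longrightarrow> I c v)"
  and "Q6' \<longleftrightarrow> (\<forall>u<N. \<forall>v<N. (u, v) \<in> Ed \<longrightarrow> (\<exists>c. I c u \<and> I c v))"
  and "Q7' \<longleftrightarrow> (\<forall>v<N. \<forall>a\<le>NB. \<forall>b\<le>NB. \<forall>c\<le>NB. (a, v) \<in> El \<and> (b, v) \<in> El \<and> a \<le> c \<and> c \<le> b \<longrightarrow> (c, v) \<in> El)"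
 note Q = Q2_def[symmetric] Q3_def[symmetric] Q6_def[symmetric] Q7_def[symmetric] Q6'_def[symmetric] Q7'_def[symmetric]
 show ?thesis
  unfolding static_def NN 2 3 5 pair_graph_iff path_decomposition_iff Q using run0 1 6[unfolded Q] 7[unfolded Q] by argo
qed

text \<open>The test also ranges over bag number 0, which is empty and passes. The others pass by
  \<open>top_bit\<close> and \<open>power_le_iff_log\<close> exactly if their size respects the
  bound, and the largest one decides.\<close>

lemma wide_iff:
 assumes NN: "NN = N" and I: "\<And>c v. I c v \<Longrightarrow> v < N" and ne: "0 < NB"
 shows "wide_ok \<longleftrightarrow> real_of_int (pd_width (map set bs)) \<le> real k * log 2 (real n)"
proof -
 have nk: "1 \<le> n ^ k" by (rule one_le_power[OF n_pos])
 have "n ^ k < 2 ^ B"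
 proof -
  have "n ^ k \<le> (2 ^ length (binary n)) ^ k" by (rule power_mono[OF less_imp_le[OF less_power_length_binary]]) simp
  also have "\<dots> = 2 ^ (k * length (binary n))" by (simp add: power_mult[symmetric] mult.commute)
  also have "\<dots> < 2 ^ B" unfolding B_def by (intro power_strict_increasing) simp_all
  finally show ?thesis .
 qed
 note tb = top_bit[OF nk this]
 have "{..<N} \<inter> {v. (Suc c, v) \<in> El} = set (bs ! c)" if "c < NB" for c
  using I that unfolding I_iff NB_eq by auto
 moreover have "{..<N} \<inter> {v. (0, v) \<in> El} = {}" using El_pos by blast
 moreover have "(\<forall>d\<le>NB. Q d) \<longleftrightarrow> Q 0 \<and> (\<forall>c<NB. Q (Suc c))" for Q
  unfolding less_Suc_eq_le[symmetric] All_less_Suc2 ..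
 ultimately have "wide_ok \<longleftrightarrow> (\<forall>c<NB. 2 ^ (card (set (bs ! c)) - 1) \<le> n ^ k)"
  unfolding wide_ok_def NN tb using nk by simp
 also have "\<dots> \<longleftrightarrow> (\<forall>c<NB. real (card (set (bs ! c))) - 1 \<le> real k * log 2 (real n))"
  unfolding power_le_iff_log[OF n_pos] ..
 also have "\<dots> \<longleftrightarrow> (\<forall>m\<in>card ` set (map set bs). real m - 1 \<le> real k * log 2 (real n))"
  unfolding NB_eq ball_simps(9) ball_map_set ..
 also have "\<dots> \<longleftrightarrow> real (Max (card ` set (map set bs))) - 1 \<le> real k * log 2 (real n)" (is "(\<forall>m\<in>?S. _) \<longleftrightarrow> _")
 proof
  have fin: "finite ?S" "?S \<noteq> {}" using ne by (simp_all add: NB_eq)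
  show "\<forall>m\<in>?S. real m - 1 \<le> real k * log 2 (real n) \<Longrightarrow> real (Max ?S) - 1 \<le> real k * log 2 (real n)"
   using Max_in[OF fin] by blast
  assume M: "real (Max ?S) - 1 \<le> real k * log 2 (real n)"
  show "\<forall>m\<in>?S. real m - 1 \<le> real k * log 2 (real n)"
  proof
   fix m assume "m \<in> ?S"
   then have "real m \<le> real (Max ?S)" using Max_ge[OF fin(1)] by (simp only: of_nat_le_iff)
   with M show "real m - 1 \<le> real k * log 2 (real n)" by linarith
  qed
 qed
 finally show ?thesis by (simp add: pd_width_def)
qed

lemma member_iff:
 "(x, k) \<in> pw_3Coloring_log \<longleftrightarrow> pair_graph (graph_of N es) \<and> path_decomposition (graph_of N es) (map set bs) \<and>
   real_of_int (pd_width (map set bs)) \<le> real k * log 2 (real n) \<and> three_colorable (graph_of N es)"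
proof
 assume "(x, k) \<in> pw_3Coloring_log"
 then obtain N' es' bs' where e: "x = enc_graph_pd N' es' bs'" and *: "pair_graph (graph_of N' es')"
  "path_decomposition (graph_of N' es') (map set bs')" "three_colorable (graph_of N' es')"
  "real_of_int (pd_width (map set bs')) \<le> real k * log 2 (real n)"
  unfolding pw_3Coloring_log_def mem_Collect_eq prod.case by blast
 from enc_graph_pd_inject[OF e[unfolded x]] * show "pair_graph (graph_of N es) \<and> path_decomposition (graph_of N es) (map set bs) \<and>
   real_of_int (pd_width (map set bs)) \<le> real k * log 2 (real n) \<and> three_colorable (graph_of N es)" by simp
next
 assume "pair_graph (graph_of N es) \<and> path_decomposition (graph_of N es) (map set bs) \<and>
   real_of_int (pd_width (map set bs)) \<le> real k * log 2 (real n) \<and> three_colorable (graph_of N es)"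
 then show "(x, k) \<in> pw_3Coloring_log"
  unfolding pw_3Coloring_log_def mem_Collect_eq prod.case using x by blast
qed

lemma colors_iff:
 assumes pg: "pair_graph (graph_of N es)" and pd: "path_decomposition (graph_of N es) (map set bs)" and NN: "NN = N" and wide: wide_ok
 shows "(\<exists>ch. \<forall>t<NB * NN. chk (arr (b ch) ch (Suc t)) (t div NN) (t mod NN)) \<longleftrightarrow> three_colorable (graph_of N es)"
proof -
 note q = pd[unfolded path_decomposition_iff, THEN conjunct2]
 note pd' = q[THEN conjunct1] q[THEN conjunct2, THEN conjunct2, THEN conjunct1] q[THEN conjunct2, THEN conjunct2, THEN conjunct2]
 have ne: "u \<noteq> v" if "(u, v) \<in> set es" for u v using that pg unfolding pair_graph_iff by auto
 have cm: "\<exists>c. I c u \<and> I c v" if "(u, v) \<in> set es" for u v using that pd'(2) by auto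
 have bd: "c < NB \<and> v < NN" if "I c v" for c v using that pd'(1) I_iff[of c v] by (simp add: NN NB_eq)
 have lk: "linked v u \<and> u \<noteq> v \<and> (\<exists>c. I c u \<and> I c v)" if "linked u v" for u v
  using that ne[of u v] ne[of v u] cm[of u v] cm[of v u] unfolding Ed_eq by metis
 have ct: "I c v" if "I a v" "I b v" "a \<le> c" "c \<le> b" for a b c v using that pd'(3) by metis
 have "(\<exists>col. (\<forall>v<NN. col v < (3 :: nat)) \<and> (\<forall>u v. linked u v \<longrightarrow> col u \<noteq> col v)) \<longleftrightarrow> three_colorable (graph_of N es)"
  unfolding three_colorable_graph_of NN Ed_eq by (intro iff_exI) fastforce
 note bc = trans[OF bag_coloring[where I = "\<lambda>c v. I c v" and G = linked and NB = NB and N = NN] this]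
 show ?thesis by (rule trans[OF iff_exI[OF chk_colors[OF wide]] bc]) (rule lk ct bd; assumption)+
qed

end

context instance_env
begin

text \<open>Words that are no code fail the test of the automaton. If the code announces more than
  \<open>n\<close> vertices, then the static test fails by uniqueness of the leading number, and
  there is no path decomposition by \<open>N_le\<close>.\<close>

lemma verifier_correct:
 assumes E: "std E"
 shows "(\<exists>ch. snd (snd (snd (sem w cap verifier_stm E ((\<lambda>_. False), v, ch, True))))) \<longleftrightarrow> (x, k) \<in> pw_3Coloring_log"
proof -
 from verifier[OF E, of v] obtain b where "\<And>ch. snd (snd (snd (sem w cap verifier_stm E ((\<lambda>_. False), v, ch, True)))) \<longleftrightarrow>
  static \<and> wide_ok \<and> (\<forall>t<NB * NN. chk (arr (b ch) ch (Suc t)) (t div NN) (t mod NN))" by metis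
 then have V: "(\<exists>ch. snd (snd (snd (sem w cap verifier_stm E ((\<lambda>_. False), v, ch, True))))) \<longleftrightarrow>
  static \<and> wide_ok \<and> (\<exists>ch. \<forall>t<NB * NN. chk (arr (b ch) ch (Suc t)) (t div NN) (t mod NN))" by blast
 show ?thesis
 proof (cases "run 0 x")
  case False
  then have "\<not> static" by (simp add: static_def)
  moreover have "(x, k) \<notin> pw_3Coloring_log" using False unfolding run_iff pw_3Coloring_log_def by blast
  ultimately show ?thesis using V by blast
 next
  case True
  then obtain N es bs where x: "x = enc_graph_pd N es bs" unfolding run_iff by blast
  interpret graph_instance x k w N es bs by unfold_locales (rule x)
  show ?thesis
  proof (cases "N \<le> n")
   case False
   have "\<not> static"
   proof
    assume static
    then have "\<exists>c\<le>n. mt 0 c" unfolding static_def by (elim conjE)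
    then obtain c where "c \<le> n" "mt 0 c" by (elim exE conjE)
    with mt_unique[OF mt0, of c] False show False by simp
   qed
   moreover have "\<not> path_decomposition (graph_of N es) (map set bs)" using False N_le by (rule contrapos_nn)
   ultimately show ?thesis using V member_iff by argo
  next
   case True
   note st = static_iff[OF True] and NN = NN_eq[OF mt0 True]
   have "wide_ok \<longleftrightarrow> real_of_int (pd_width (map set bs)) \<le> real k * log 2 (real n)"
    if "path_decomposition (graph_of N es) (map set bs)"
   proof (rule wide_iff[OF NN])
    show "v < N" if "I c v" for c v
     using \<open>path_decomposition (graph_of N es) (map set bs)\<close>[unfolded path_decomposition_iff, THEN conjunct2, THEN conjunct1] that by simp
    show "0 < NB" using that[unfolded path_decomposition_iff] by (rule conjunct1)
   qed
   then show ?thesis unfolding V st member_iff using colors_iff[OF _ _ NN, of b] by argo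
  qed
 qed
qed

end

text \<open>A clock without steps is used here: \<open>k\<close> enters the bounds only through
  arithmetic on the input word.\<close>

theorem pw_3Coloring_log_in_class: "pw_3Coloring_log \<in> paraNTiSp_fpoly_flog"
proof -
 define F where "F = \<lparr>n_tapes = 0, instrs = {}, start = 0, accepting = {}\<rparr>"
 have cl: "clock F 5 (\<lambda>_. 0)" unfolding F_def by (rule clock_trivial)
 define M where "M = boot_tm F 5 cap_exp verifier_stm"
 define d where "d = dg cap_exp * sd verifier_stm"
 \<comment> \<open>From \<open>9 * (6 * d * X + 22 * X) * X ^ d + X ^ (d + 1)\<close>, as
   \<open>9 * 6 = 54\<close> and \<open>9 * 22 + 1 = 199\<close>. The forms of \<open>f\<close> and
   \<open>p\<close> come from \<open>X = k + n + 3\<close>, which is at most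
   \<open>(k + 3) * (1 + n)\<close>.\<close>
 define C where "C = 54 * d + 199"
 define f where "f k = C * (k + 1 + 2) ^ (d + 1)" for k
 define p :: "nat poly" where "p = [:1, 1:] ^ (d + 1)"
 have comp: "computable f"
  using computable_ev[OF cl, of "aMul (Con C) (aPow (Add (Var 1) (Con 2)) (d + 1))"]
  unfolding f_def[abs_def] by (simp add: boot_env_def del: aPow.simps power_Suc)
 have d0: "0 < d" using dg_pos[of cap_exp] sd_pos[of verifier_stm] by (simp add: d_def)
 have "((x, k) \<in> pw_3Coloring_log \<longleftrightarrow> accepts M (tape_word (x, k))) \<and>
   runs_in_time M (tape_word (x, k)) (real (f k * poly p (length x))) \<and>
   runs_in_space M (tape_word (x, k)) (real (f k) * lg_size x)" for x k
 proof -
  let ?w = "tape_word (x, k)" and ?n = "length x"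
  interpret instance_env x k ?w by unfold_locales (rule refl)
  let ?X = "0 + length ?w + 2" and ?E = "boot_env 0 (length ?w + 1)"
  let ?h = "d * length (binary ?X)"
  have E: "std ?E" by (simp add: std_def boot_env_def)
  from cl obtain cf where F: "well_formed F" "deterministic F" "sym_bound F 5"
   "(step F (replicate k True) ^^ 0) (init F) cf" "halted F (replicate k True) cf" unfolding clock_def by blast
  have w: "?w = replicate k True @ (False # x)" "False # x = [] \<or> (\<exists>y. False # x = False # y)" by simp_all
  have h: "?X ^ d < 2 ^ ?h"
   using power_strict_mono[OF less_power_length_binary[of ?X], of d] d0 by (simp add: power_mult[symmetric] mult.commute)
  have cap: "cap = ev ?w (\<lambda>_. False) 0 cap_exp ?E"
   unfolding cap_exp_def by (simp only: ev.simps if_True ev_aMul ev_sizes(1)[OF E])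
  note bt = F(1-3) w F(4,5) refl h[unfolded d_def] cap
  have "accepts M ?w \<longleftrightarrow> (x, k) \<in> pw_3Coloring_log"
   unfolding M_def accepts_boot_tm[OF bt] by (rule verifier_correct[OF E])
  moreover have "9 * (6 * ?h + 22) * ?X ^ d + 1 \<le> f k * poly p ?n"
  proof -
   have "9 * (6 * ?h + 22) * ?X ^ d + 1 \<le> 9 * (6 * (d * ?X) + 22) * ?X ^ d + 1"
    by (intro add_mono mult_le_mono order_refl length_binary_le)
   also have "\<dots> \<le> 9 * (6 * (d * ?X) + 22 * ?X) * ?X ^ d + ?X ^ (d + 1)"
    by (intro add_mono mult_le_mono order_refl one_le_power) auto
   also have "\<dots> = C * ?X ^ (d + 1)" unfolding C_def by (simp only: power_add power_one_right) algebra
   also have "\<dots> \<le> C * ((k + 1 + 2) * (1 + ?n)) ^ (d + 1)" by (intro mult_le_mono2 power_mono) auto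
   also have "\<dots> = f k * poly p ?n" by (simp only: f_def p_def poly_power power_mult_distrib) simp
   finally show ?thesis .
  qed
  then have "real (9 * (6 * ?h + 22) * ?X ^ d + 1) \<le> real (f k * poly p ?n)" by (simp only: of_nat_le_iff)
  then have "runs_in_time M ?w (real (f k * poly p ?n))"
   using runs_in_time_boot_tm[OF bt] unfolding M_def d_def runs_in_time_def by (meson order_trans)
  moreover have "real (?h + cap + 0 + 5) \<le> real (f k) * lg_size x"
  proof -
   let ?l = "lg_size x"
   have l: "1 \<le> ?l" by (rule lg_size_pos)
   have X: "?X = k + 1 + (?n + 2)" by simp
   have 1: "real (length (binary ?X)) \<le> real (k + 1) + 2 + ?l"
    unfolding X lg_size_def by (rule length_binary_add) simp
   have 2: "real (length (binary ?n)) \<le> 2 * ?l"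
   proof (cases "?n = 0")
    case False
    then have "log 2 (real ?n) \<le> ?l" unfolding lg_size_def by simp
    with length_binary_le_log[of ?n] False l show ?thesis by simp
   qed (use l in \<open>simp add: binary.simps\<close>)
   have "real (?h + cap + 0 + 5) = real d * real (length (binary ?X)) + 4 * real k * real (length (binary ?n)) + 10"
    by (simp add: B_def)
   also have "\<dots> \<le> real d * (real (k + 1) + 2 + ?l) + 4 * real k * (2 * ?l) + 10"
    by (intro add_mono mult_left_mono 1 2) auto
   also have "\<dots> \<le> real d * ((real k + 3) * ?l + ?l) + 4 * real k * (2 * ?l) + 10 * ?l"
   proof -
    have "(real k + 3) * 1 \<le> (real k + 3) * ?l" using l by (intro mult_left_mono) auto
    then have "real (k + 1) + 2 + ?l \<le> (real k + 3) * ?l + ?l" by (simp only: of_nat_add of_nat_1 mult_1_right)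
    then show ?thesis using l by (intro add_mono mult_left_mono) auto
   qed
   also have "\<dots> = real (d * (k + 4) + 8 * k + 10) * ?l" by (simp add: algebra_simps)
   also have "\<dots> \<le> real (f k) * ?l"
   proof -
    have "d * (k + 4) + 8 * k + 10 \<le> (2 * d + 8) * (k + 1 + 2)" by (simp add: algebra_simps)
    also have "\<dots> \<le> C * (k + 1 + 2)" unfolding C_def by (intro mult_le_mono1) simp
    also have "\<dots> \<le> f k" unfolding f_def by (intro mult_le_mono2 self_le_power) auto
    finally show ?thesis using l by (intro mult_right_mono) (auto simp only: of_nat_le_iff)
   qed
   finally show ?thesis .
  qed
  then have "runs_in_space M ?w (real (f k) * lg_size x)"
   using runs_in_space_boot_tm[OF bt] unfolding M_def d_def runs_in_space_def by (fastforce simp del: of_nat_add of_nat_mult)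
  ultimately show ?thesis by blast
 qed
 moreover have "well_formed M" by (simp add: M_def well_formed_boot_tm)
 ultimately show ?thesis unfolding paraNTiSp_fpoly_flog_def using comp by blast
qed

theorem theorem18:
 shows "complete_under_pl_reductions pw_3Coloring_log paraNTiSp_fpoly_flog"
 unfolding complete_under_pl_reductions_def
 using pw_3Coloring_log_in_class pl_reduces_pw_3Coloring_log by blast

end
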